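(* Let $(A,\pi,\psi)$ be a Lie algebroid with a twisted Poisson structure, where $A$ is orientable as a vector bundle, and let $\lambda$ be a volume form on $A$ (a nowhere-vanishing section of $\wedge^NA^*$, $N=\mathrm{rank}\,A$). Then the section $Z_{\pi,\psi,\lambda}=X_{\pi,\lambda}+Y_{\pi,\psi}$ of $A$ is a $d_{\pi,\psi}$-cocycle, i.e. $d_{\pi,\psi}Z_{\pi,\psi,\lambda}=0$, and the $d_{\pi,\psi}$-cohomology class of $Z_{\pi,\psi,\lambda}$ is independent of the choice of $\lambda$.
   Context: Conventions. $A\to M$ is a vector bundle of finite rank with dual $A^*$; sections of $\wedge^pA$ are $p$-vectors, sections of $\wedge^qA^*$ are $q$-forms; $(X\wedge Y)(\alpha,\beta)=\alpha(X)\beta(Y)-\alpha(Y)\beta(X)$. $i_X$ is the interior product of forms by a vector $X$, $i_{X_1\wedge\dots\wedge X_p}=i_{X_1}\circ\dots\circ i_{X_p}$. For a bivector $\pi$, $\pi^\sharp:A^*\to A$ is defined by $\langle\beta,\pi^\sharp\alpha\rangle=\pi(\alpha,\beta)$; thus $i_\pi(\alpha\wedge\beta)=-\pi(\alpha,\beta)$. $\wedge^q\pi^\sharp$ maps $\alpha_1\wedge\dots\wedge\alpha_q$ to $\pi^\sharp\alpha_1\wedge\dots\wedge\pi^\sharp\alpha_q$. Lie algebroids. For a Lie algebroid $A$ with anchor $\rho$, the bracket is extended to the Gerstenhaber bracket on $\Gamma(\wedge^\bullet A)$, a graded biderivation with $[a,f]=\rho(a)\cdot f$ for $a\in\Gamma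 A$, $f\in C^\infty(M)$, and $[a_1\wedge\dots\wedge a_q,b_1\wedge\dots\wedge b_r]=\sum_{k,\ell}(-1)^{k+\ell}[a_k,b_\ell]\wedge a_1\wedge\dots\widehat{a_k}\dots\wedge a_q\wedge b_1\wedge\dots\widehat{b_\ell}\dots\wedge b_r$. $d_A$ is the usual Lie algebroid differential on $\Gamma(\wedge^\bullet A^* )$, ${\mathcal L}^A_X=[i_X,d_A]$ (graded commutator). Twisted Poisson structure. $(A,\pi,\psi)$ is a Lie algebroid with a twisted Poisson structure if $\pi\in\Gamma(\wedge^2A)$, $\psi\in\Gamma(\wedge^3A^* )$, $d_A\psi=0$ and $\frac12[\pi,\pi]=(\wedge^3\pi^\sharp)\psi$. Set $\psi^{(2)}(\xi,\eta)(X)=\psi(\pi^\sharp\xi,\pi^\sharp\eta,X)$; for a vector $X$, $\psi^{(2)}(X)$ denotes the bivector $(\xi,\eta)\mapsto\psi(\pi^\sharp\xi,\pi^\sharp\eta,X)$. Then $A^*$ is a Lie algebroid with anchor $\rho\circ\pi^\sharp$ and bracket $[\alpha,\beta]_{\pi,\psi}={\mathcal L}^A_{\pi^\sharp\alpha}\beta-{\mathcal L}^A_{\pi^\sharp\beta}\alpha-d_A(\pi(\alpha,\beta))+\psi^{(2)}(\alpha,\beta)$; its differential on $\Gamma(\wedge^\bullet A)$ is $d_{\pi,\psi}=[\pi,\cdot\,]+\underline d_{\pi,\psi}$, where $\underline d_{\pi,\psi}$ vanishes on functions and $\underline d_{\pi,\psi}(X_1\wedge\dots\wedge X_p)=\sum_k(-1)^{k+1}\psi^{(2)}(X_k)\wedge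 X_1\wedge\dots\widehat{X_k}\dots\wedge X_p$ (known facts). Sections. $X_{\pi,\lambda}\in\Gamma A$ is defined by $\langle\alpha,X_{\pi,\lambda}\rangle\lambda={\mathcal L}^A_{\pi^\sharp\alpha}\lambda-(i_\pi d_A\alpha)\lambda$ for all $\alpha\in\Gamma(A^* )$. $Y_{\pi,\psi}\in\Gamma A$ is defined by $Y_{\pi,\psi}=\pi^\sharp(i_\pi\psi)$. The class of $Z_{\pi,\psi,\lambda}$ is called the modular class of $(A,\pi,\psi)$.
   Formalization: The sign of ψ in the twisted Poisson condition is changed: ½[π,π](ξ,η,ζ) = ψ(π♯ξ,π♯η,π♯ζ), whereas the stated ∧³π♯ gives −ψ(π♯ξ,π♯η,π♯ζ); with the stated sign X+Y is in general not a d_{π,ψ}-cocycle. *)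

theory Defs
  imports "HOL-Analysis.Analysis" "HOL-Library.Function_Algebras"
begin

instantiation "fun" :: (type, real_vector) real_vector
begin

definition scaleR_fun :: "real \<Rightarrow> ('a \<Rightarrow> 'b) \<Rightarrow> 'a \<Rightarrow> 'b"
  where "scaleR_fun c f = (\<lambda>x. c *\<^sub>R f x)"

instance
  by standard (auto simp: scaleR_fun_def fun_eq_iff scaleR_add_right scaleR_add_left)

end

section \<open>Smooth manifolds\<close>

fun Ck_on :: "nat \<Rightarrow> 'e::real_normed_vector set \<Rightarrow> ('e \<Rightarrow> 'f::real_normed_vector) \<Rightarrow> bool" where
  "Ck_on 0 S f \<longleftrightarrow> continuous_on S f"
| "Ck_on (Suc k) S f \<longleftrightarrow> (\<forall>x\<in>S. f differentiable (at x)) \<and>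
     (\<forall>v. Ck_on k S (\<lambda>x. frechet_derivative f (at x) v))"

definition Cinf_on :: "'e::real_normed_vector set \<Rightarrow> ('e \<Rightarrow> 'f::real_normed_vector) \<Rightarrow> bool" where
  "Cinf_on S f \<longleftrightarrow> (\<forall>k. Ck_on k S f)"

text \<open>The manifold is the whole type \<open>'m\<close>.  The model space is a finite-dimensional inner product
  space and not an instance of \<open>euclidean_space\<close>, since the latter would exclude manifolds of
  dimension 0 (and with them Lie algebras, regarded as Lie algebroids over a point).\<close>

type_synonym ('m, 'e) chart = "'m set \<times> ('m \<Rightarrow> 'e)"

definition smooth_manifold ::
  "('m::{t2_space,second_countable_topology}, 'e::real_inner) chart set \<Rightarrow> bool" where
  "smooth_manifold \<A> \<longleftrightarrow>
     (\<exists>B::'e set. finite B \<and> span B = UNIV) \<and>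
     (\<Union>(fst ` \<A>)) = UNIV \<and>
     (\<forall>(U, \<phi>)\<in>\<A>. open U \<and> open (\<phi> ` U) \<and> (\<exists>\<eta>. homeomorphism U (\<phi> ` U) \<phi> \<eta>)) \<and>
     (\<forall>(U, \<phi>)\<in>\<A>. \<forall>(V, \<eta>)\<in>\<A>. Cinf_on (\<phi> ` (U \<inter> V)) (\<eta> \<circ> inv_into U \<phi>))"

definition smooth_fun ::
  "('m::topological_space, 'e::real_inner) chart set \<Rightarrow> 'm set \<Rightarrow> ('m \<Rightarrow> real) \<Rightarrow> bool" where
  "smooth_fun \<A> W f \<longleftrightarrow> (\<forall>(U, \<phi>)\<in>\<A>. Cinf_on (\<phi> ` (U \<inter> W)) (f \<circ> inv_into U \<phi>))"

section \<open>Vector bundles\<close>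

text \<open>The fibres are linear subspaces of one real vector space \<open>'v\<close> without topology, which may be
  infinite-dimensional.  This is no restriction: any family of vector spaces embeds in its direct sum.
  Local trivialisations are given as local frames \<open>(U, e)\<close>, of which \<open>e i p\<close> matters only for
  \<open>p \<in> U\<close> and \<open>i < vrank\<close>.\<close>

record ('m, 'e, 'v) vbundle =
  atlas :: "('m, 'e) chart set"
  fibre :: "'m \<Rightarrow> 'v set"
  vrank :: nat
  frames :: "('m set \<times> (nat \<Rightarrow> 'm \<Rightarrow> 'v)) set"

definition vector_bundle ::
  "('m::{t2_space,second_countable_topology}, 'e::real_inner, 'v::real_vector, 'z) vbundle_scheme \<Rightarrow> bool"
  where
  "vector_bundle E \<longleftrightarrow>
     smooth_manifold (atlas E) \<and>
     (\<Union>(fst ` frames E)) = UNIV \<and>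
     (\<forall>(U, e)\<in>frames E. open U \<and>
        (\<forall>p\<in>U. inj_on (\<lambda>i. e i p) {..<vrank E} \<and>
               independent ((\<lambda>i. e i p) ` {..<vrank E}) \<and>
               span ((\<lambda>i. e i p) ` {..<vrank E}) = fibre E p)) \<and>
     (\<forall>(U, e)\<in>frames E. \<forall>(V, e')\<in>frames E.
        \<exists>g. (\<forall>i<vrank E. \<forall>j<vrank E. smooth_fun (atlas E) (U \<inter> V) (g i j)) \<and>
            (\<forall>p\<in>U \<inter> V. \<forall>j<vrank E. e' j p = (\<Sum>i<vrank E. g i j p *\<^sub>R e i p)))"

definition smooth_section ::
  "('m::topological_space, 'e::real_inner, 'v::real_vector, 'z) vbundle_scheme \<Rightarrow> ('m \<Rightarrow> 'v) \<Rightarrow> bool"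
  where
  "smooth_section E s \<longleftrightarrow> (\<forall>p. s p \<in> fibre E p) \<and>
     (\<forall>(U, e)\<in>frames E. \<exists>c. (\<forall>i<vrank E. smooth_fun (atlas E) U (c i)) \<and>
        (\<forall>p\<in>U. s p = (\<Sum>i<vrank E. c i p *\<^sub>R e i p)))"

text \<open>Covectors at \<open>p\<close> are linear forms on the fibre, extended by 0 outside the fibre; a dual frame
  consists of the coefficient functions of the given frame.\<close>

definition dual_bundle ::
  "('m, 'e, 'v::real_vector, 'z) vbundle_scheme \<Rightarrow> ('m, 'e, 'v \<Rightarrow> real) vbundle" where
  "dual_bundle E = \<lparr> atlas = atlas E,
     fibre = (\<lambda>p. {\<xi>. (\<forall>u\<in>fibre E p. \<forall>v\<in>fibre E p. \<xi> (u + v) = \<xi> u + \<xi> v) \<and>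
                      (\<forall>c. \<forall>u\<in>fibre E p. \<xi> (c *\<^sub>R u) = c * \<xi> u) \<and>
                      (\<forall>u. u \<notin> fibre E p \<longrightarrow> \<xi> u = 0)}),
     vrank = vrank E,
     frames = (\<lambda>(U, e). (U, \<lambda>i p u. representation ((\<lambda>j. e j p) ` {..<vrank E}) u (e i p))) ` frames E \<rparr>"

section \<open>Forms and multivectors\<close>

text \<open>A \<open>q\<close>-form on \<open>E\<close> is a family of alternating multilinear functions on lists of length \<open>q\<close> of
  fibre elements.  A \<open>q\<close>-vector on \<open>A\<close> is a \<open>q\<close>-form on \<open>dual_bundle A\<close>.  A 0-form \<open>\<omega>\<close> is the
  function \<open>\<lambda>p. \<omega> p []\<close>.\<close>

definition tuples :: "('m, 'e, 'v, 'z) vbundle_scheme \<Rightarrow> nat \<Rightarrow> 'm \<Rightarrow> 'v list set" where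
  "tuples E q p = {us. length us = q \<and> set us \<subseteq> fibre E p}"

definition form ::
  "('m::topological_space, 'e::real_inner, 'v::real_vector, 'z) vbundle_scheme \<Rightarrow> nat \<Rightarrow>
   ('m \<Rightarrow> 'v list \<Rightarrow> real) \<Rightarrow> bool" where
  "form E q \<omega> \<longleftrightarrow>
     (\<forall>p. \<forall>us\<in>tuples E q p.
        (\<forall>i<q. \<forall>u\<in>fibre E p. \<forall>v\<in>fibre E p. \<omega> p (us[i := u + v]) = \<omega> p (us[i := u]) + \<omega> p (us[i := v])) \<and>
        (\<forall>i<q. \<forall>c. \<forall>u\<in>fibre E p. \<omega> p (us[i := c *\<^sub>R u]) = c * \<omega> p (us[i := u])) \<and>
        (\<forall>i<q. \<forall>j<q. i \<noteq> j \<and> us ! i = us ! j \<longrightarrow> \<omega> p us = 0)) \<and>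
     (\<forall>(U, e)\<in>frames E. \<forall>is. length is = q \<and> set is \<subseteq> {..<vrank E} \<longrightarrow>
        smooth_fun (atlas E) U (\<lambda>p. \<omega> p (map (\<lambda>i. e i p) is)))"

definition volume_form ::
  "('m::topological_space, 'e::real_inner, 'v::real_vector, 'z) vbundle_scheme \<Rightarrow>
   ('m \<Rightarrow> 'v list \<Rightarrow> real) \<Rightarrow> bool" where
  "volume_form E \<mu> \<longleftrightarrow> form E (vrank E) \<mu> \<and> (\<forall>p. \<exists>us\<in>tuples E (vrank E) p. \<mu> p us \<noteq> 0)"

definition orientable ::
  "('m::topological_space, 'e::real_inner, 'v::real_vector, 'z) vbundle_scheme \<Rightarrow> bool" where
  "orientable E \<longleftrightarrow> (\<exists>\<mu>. volume_form E \<mu>)"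

text \<open>\<open>wedge us\<close> is \<open>u\<^sub>1 \<and> \<dots> \<and> u\<^sub>q\<close>, normalised by
  \<open>(X \<and> Y)(\<alpha>, \<beta>) = \<alpha>(X) \<beta>(Y) - \<alpha>(Y) \<beta>(X)\<close>.\<close>

definition wedge :: "'v list \<Rightarrow> ('v \<Rightarrow> real) list \<Rightarrow> real" where
  "wedge us \<xi>s = (\<Sum>\<sigma> | \<sigma> permutes {..<length us}.
     of_int (sign \<sigma>) * (\<Prod>i<length us. (\<xi>s ! i) (us ! \<sigma> i)))"

definition remove_nth :: "nat \<Rightarrow> 'a list \<Rightarrow> 'a list" where
  "remove_nth i xs = take i xs @ drop (Suc i) xs"

text \<open>Operators that the mathematics defines on decomposable multivectors are extended through
  decompositions \<open>P = \<Sum> u\<^sub>1 \<and> \<dots> \<and> u\<^sub>q\<close>, at a point (\<open>decomp\<close>), or, for the bracket, by global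
  sections in a neighbourhood of a point (\<open>section_decomp\<close>).  The results do not depend on the
  decomposition.  There are no coefficients, as they can be absorbed into a factor; this needs
  \<open>q \<ge> 1\<close>.\<close>

definition decomp ::
  "('m, 'e, 'v::real_vector, 'z) vbundle_scheme \<Rightarrow> nat \<Rightarrow> 'm \<Rightarrow> (('v \<Rightarrow> real) list \<Rightarrow> real) \<Rightarrow> 'v list list" where
  "decomp A q p P = (SOME D. set D \<subseteq> tuples A q p \<and>
     (\<forall>\<xi>s\<in>tuples (dual_bundle A) q p. P \<xi>s = (\<Sum>us\<leftarrow>D. wedge us \<xi>s)))"

definition section_decomp ::
  "('m::topological_space, 'e::real_inner, 'v::real_vector, 'z) vbundle_scheme \<Rightarrow> nat \<Rightarrow> 'm \<Rightarrow>
   ('m \<Rightarrow> ('v \<Rightarrow> real) list \<Rightarrow> real) \<Rightarrow> ('m \<Rightarrow> 'v) list list" where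
  "section_decomp A q p P = (SOME D.
     (\<forall>as\<in>set D. length as = q \<and> (\<forall>a\<in>set as. smooth_section A a)) \<and>
     (\<exists>W. open W \<and> p \<in> W \<and> (\<forall>x\<in>W. \<forall>\<xi>s\<in>tuples (dual_bundle A) q x.
        P x \<xi>s = (\<Sum>as\<leftarrow>D. wedge (map (\<lambda>a. a x) as) \<xi>s))))"

definition interior_prod :: "('m \<Rightarrow> 'v) \<Rightarrow> ('m \<Rightarrow> 'v list \<Rightarrow> real) \<Rightarrow> 'm \<Rightarrow> 'v list \<Rightarrow> real" where
  "interior_prod X \<omega> = (\<lambda>p us. \<omega> p (X p # us))"

text \<open>\<open>foldr\<close> yields the composition in the order \<open>i\<^bsub>X\<^sub>1\<^esub> \<circ> \<dots> \<circ> i\<^bsub>X\<^sub>q\<^esub>\<close>, in particular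
  \<open>i\<^sub>\<pi> (\<alpha> \<and> \<beta>) = - \<pi>(\<alpha>, \<beta>)\<close>.\<close>

definition interior_mv ::
  "('m, 'e, 'v::real_vector, 'z) vbundle_scheme \<Rightarrow> nat \<Rightarrow> ('m \<Rightarrow> ('v \<Rightarrow> real) list \<Rightarrow> real) \<Rightarrow>
   ('m \<Rightarrow> 'v list \<Rightarrow> real) \<Rightarrow> 'm \<Rightarrow> 'v list \<Rightarrow> real" where
  "interior_mv A q P \<omega> p us =
     (\<Sum>xs\<leftarrow>decomp A q p (P p). foldr (\<lambda>x \<theta>. \<lambda>vs. \<theta> (x # vs)) xs (\<omega> p) us)"

definition form_of_section :: "('m \<Rightarrow> 'v \<Rightarrow> real) \<Rightarrow> 'm \<Rightarrow> 'v list \<Rightarrow> real" where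
  "form_of_section \<alpha> = (\<lambda>p us. \<alpha> p (hd us))"

definition section_of_form ::
  "('m, 'e, 'v, 'z) vbundle_scheme \<Rightarrow> ('m \<Rightarrow> 'v list \<Rightarrow> real) \<Rightarrow> 'm \<Rightarrow> 'v \<Rightarrow> real" where
  "section_of_form A \<theta> = (\<lambda>p u. if u \<in> fibre A p then \<theta> p [u] else 0)"

definition vector_of_section :: "('m \<Rightarrow> 'v) \<Rightarrow> 'm \<Rightarrow> ('v \<Rightarrow> real) list \<Rightarrow> real" where
  "vector_of_section Z = (\<lambda>p \<xi>s. hd \<xi>s (Z p))"

section \<open>Lie algebroids\<close>

text \<open>Tangent vectors at \<open>p\<close> are derivations at \<open>p\<close> of the algebra of smooth functions:
  \<open>anchor A p u f\<close> is the derivative of \<open>f\<close> along \<open>\<rho>(u) \<in> T\<^sub>p M\<close>, and only smooth \<open>f\<close> matter.\<close>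

record ('m, 'e, 'v) algebroid = "('m, 'e, 'v) vbundle" +
  anchor :: "'m \<Rightarrow> 'v \<Rightarrow> ('m \<Rightarrow> real) \<Rightarrow> real"
  bracket :: "('m \<Rightarrow> 'v) \<Rightarrow> ('m \<Rightarrow> 'v) \<Rightarrow> 'm \<Rightarrow> 'v"

definition tangent_vector ::
  "('m::topological_space, 'e::real_inner) chart set \<Rightarrow> 'm \<Rightarrow> (('m \<Rightarrow> real) \<Rightarrow> real) \<Rightarrow> bool" where
  "tangent_vector \<A> p D \<longleftrightarrow> (\<forall>f g. smooth_fun \<A> UNIV f \<and> smooth_fun \<A> UNIV g \<longrightarrow>
     D (\<lambda>x. f x + g x) = D f + D g \<and>
     (\<forall>c. D (\<lambda>x. c * f x) = c * D f) \<and>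
     D (\<lambda>x. f x * g x) = f p * D g + g p * D f)"

definition lie_algebroid ::
  "('m::{t2_space,second_countable_topology}, 'e::real_inner, 'v::real_vector) algebroid \<Rightarrow> bool" where
  "lie_algebroid A \<longleftrightarrow>
     vector_bundle A \<and>
     \<comment> \<open>the anchor is a vector bundle map to the tangent bundle\<close>
     (\<forall>p. \<forall>u\<in>fibre A p. tangent_vector (atlas A) p (anchor A p u)) \<and>
     (\<forall>p f. smooth_fun (atlas A) UNIV f \<longrightarrow>
        (\<forall>u\<in>fibre A p. \<forall>v\<in>fibre A p. anchor A p (u + v) f = anchor A p u f + anchor A p v f) \<and>
        (\<forall>c. \<forall>u\<in>fibre A p. anchor A p (c *\<^sub>R u) f = c * anchor A p u f)) \<and>
     (\<forall>a f. smooth_section A a \<and> smooth_fun (atlas A) UNIV f \<longrightarrow>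
        smooth_fun (atlas A) UNIV (\<lambda>p. anchor A p (a p) f)) \<and>
     \<comment> \<open>the sections form a real Lie algebra\<close>
     (\<forall>a b. smooth_section A a \<and> smooth_section A b \<longrightarrow>
        smooth_section A (bracket A a b) \<and>
        (\<forall>p. bracket A a b p = - bracket A b a p) \<and>
        (\<forall>c p. bracket A (\<lambda>x. c *\<^sub>R a x) b p = c *\<^sub>R bracket A a b p)) \<and>
     (\<forall>a b c. smooth_section A a \<and> smooth_section A b \<and> smooth_section A c \<longrightarrow>
        (\<forall>p. bracket A (\<lambda>x. a x + b x) c p = bracket A a c p + bracket A b c p) \<and>
        (\<forall>p. bracket A a (bracket A b c) p + bracket A b (bracket A c a) p
             + bracket A c (bracket A a b) p = 0)) \<and>
     \<comment> \<open>Leibniz rule, and the anchor preserves brackets\<close>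
     (\<forall>a b f. smooth_section A a \<and> smooth_section A b \<and> smooth_fun (atlas A) UNIV f \<longrightarrow>
        (\<forall>p. bracket A a (\<lambda>x. f x *\<^sub>R b x) p = f p *\<^sub>R bracket A a b p + anchor A p (a p) f *\<^sub>R b p) \<and>
        (\<forall>p. anchor A p (bracket A a b p) f =
             anchor A p (a p) (\<lambda>x. anchor A x (b x) f) - anchor A p (b p) (\<lambda>x. anchor A x (a x) f)))"

definition koszul ::
  "('m, 'e, 'v) algebroid \<Rightarrow> ('m \<Rightarrow> 'v list \<Rightarrow> real) \<Rightarrow> ('m \<Rightarrow> 'v) list \<Rightarrow> 'm \<Rightarrow> real" where
  "koszul A \<omega> Xs p =
     (\<Sum>i<length Xs. (-1) ^ i *
        anchor A p ((Xs ! i) p) (\<lambda>x. \<omega> x (map (\<lambda>X. X x) (remove_nth i Xs)))) +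
     (\<Sum>j<length Xs. \<Sum>i<j. (-1) ^ (i + j) *
        \<omega> p (bracket A (Xs ! i) (Xs ! j) p # map (\<lambda>X. X p) (remove_nth i (remove_nth j Xs))))"

text \<open>The value of \<open>koszul\<close> at \<open>p\<close> depends only on the values of the sections at \<open>p\<close>, so that
  fibre elements can be extended to sections arbitrarily.\<close>

definition extend ::
  "('m::topological_space, 'e::real_inner, 'v::real_vector, 'z) vbundle_scheme \<Rightarrow> 'm \<Rightarrow> 'v \<Rightarrow> 'm \<Rightarrow> 'v"
  where
  "extend A p u = (SOME X. smooth_section A X \<and> X p = u)"

definition la_diff ::
  "('m::topological_space, 'e::real_inner, 'v::real_vector) algebroid \<Rightarrow> ('m \<Rightarrow> 'v list \<Rightarrow> real) \<Rightarrow>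
   'm \<Rightarrow> 'v list \<Rightarrow> real" where
  "la_diff A \<omega> p us = koszul A \<omega> (map (extend A p) us) p"

definition lie_derivative ::
  "('m::topological_space, 'e::real_inner, 'v::real_vector) algebroid \<Rightarrow> ('m \<Rightarrow> 'v) \<Rightarrow>
   ('m \<Rightarrow> 'v list \<Rightarrow> real) \<Rightarrow> 'm \<Rightarrow> 'v list \<Rightarrow> real" where
  "lie_derivative A X \<omega> p us = interior_prod X (la_diff A \<omega>) p us + la_diff A (interior_prod X \<omega>) p us"

text \<open>The Gerstenhaber bracket \<open>[P, Q]\<close> of a \<open>q\<close>-vector and an \<open>r\<close>-vector with \<open>q, r \<ge> 1\<close>, and
  \<open>[P, f]\<close> for a function \<open>f\<close>.  The latter comes from \<open>[a, f] = \<rho>(a) f\<close> and the graded Leibniz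
  rule in the first argument,
  \<open>[a\<^sub>1 \<and> \<dots> \<and> a\<^sub>q, f] = \<Sum>\<^sub>k (-1)\<^bsup>q - k\<^esup> (\<rho>(a\<^sub>k) f) a\<^sub>1 \<and> \<dots> (omit a\<^sub>k) \<dots> \<and> a\<^sub>q\<close>
  (here with indices starting at 0).\<close>

definition gerstenhaber ::
  "('m::topological_space, 'e::real_inner, 'v::real_vector) algebroid \<Rightarrow> nat \<Rightarrow> nat \<Rightarrow>
   ('m \<Rightarrow> ('v \<Rightarrow> real) list \<Rightarrow> real) \<Rightarrow> ('m \<Rightarrow> ('v \<Rightarrow> real) list \<Rightarrow> real) \<Rightarrow>
   'm \<Rightarrow> ('v \<Rightarrow> real) list \<Rightarrow> real" where
  "gerstenhaber A q r P Q p \<xi>s =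
     (\<Sum>as\<leftarrow>section_decomp A q p P. \<Sum>bs\<leftarrow>section_decomp A r p Q. \<Sum>k<q. \<Sum>l<r. (-1) ^ (k + l) *
        wedge (bracket A (as ! k) (bs ! l) p # map (\<lambda>a. a p) (remove_nth k as @ remove_nth l bs)) \<xi>s)"

definition gerstenhaber_fun ::
  "('m::topological_space, 'e::real_inner, 'v::real_vector) algebroid \<Rightarrow> nat \<Rightarrow>
   ('m \<Rightarrow> ('v \<Rightarrow> real) list \<Rightarrow> real) \<Rightarrow> ('m \<Rightarrow> real) \<Rightarrow> 'm \<Rightarrow> ('v \<Rightarrow> real) list \<Rightarrow> real" where
  "gerstenhaber_fun A q P f p \<xi>s =
     (\<Sum>as\<leftarrow>section_decomp A q p P. \<Sum>k<q. (-1) ^ (q - Suc k) *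
        anchor A p ((as ! k) p) f * wedge (map (\<lambda>a. a p) (remove_nth k as)) \<xi>s)"

section \<open>Twisted Poisson structures\<close>

definition sharp ::
  "('m, 'e, 'v::real_vector, 'z) vbundle_scheme \<Rightarrow> ('m \<Rightarrow> ('v \<Rightarrow> real) list \<Rightarrow> real) \<Rightarrow>
   'm \<Rightarrow> ('v \<Rightarrow> real) \<Rightarrow> 'v" where
  "sharp A \<pi> p \<xi> = (THE u. u \<in> fibre A p \<and> (\<forall>\<eta>\<in>fibre (dual_bundle A) p. \<eta> u = \<pi> p [\<xi>, \<eta>]))"

text \<open>\<open>sharp_form\<close> regards \<open>(\<and>\<^sup>q \<pi>\<^sup>\<sharp>) \<omega>\<close> as the \<open>q\<close>-vector
  \<open>(\<xi>\<^sub>1, \<dots>, \<xi>\<^sub>q) \<mapsto> \<omega> (\<pi>\<^sup>\<sharp> \<xi>\<^sub>1, \<dots>, \<pi>\<^sup>\<sharp> \<xi>\<^sub>q)\<close>.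
  Since \<open>\<pi>\<^sup>\<sharp>\<close> is skew, it sends \<open>\<alpha>\<^sub>1 \<and> \<dots> \<and> \<alpha>\<^sub>q\<close> to
  \<open>(-1)\<^sup>q \<pi>\<^sup>\<sharp> \<alpha>\<^sub>1 \<and> \<dots> \<and> \<pi>\<^sup>\<sharp> \<alpha>\<^sub>q\<close>.  For \<open>q = 3\<close> this amounts to replacing \<open>\<psi>\<close> by \<open>-\<psi>\<close>
  in the twisted Poisson condition.  It is the sign for which \<open>twisted_diff\<close> squares to zero and for
  which \<open>X + Y\<close> below is a cocycle.\<close>

definition sharp_form ::
  "('m, 'e, 'v::real_vector, 'z) vbundle_scheme \<Rightarrow> ('m \<Rightarrow> ('v \<Rightarrow> real) list \<Rightarrow> real) \<Rightarrow>
   ('m \<Rightarrow> 'v list \<Rightarrow> real) \<Rightarrow> 'm \<Rightarrow> ('v \<Rightarrow> real) list \<Rightarrow> real" where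
  "sharp_form A \<pi> \<omega> p \<xi>s = \<omega> p (map (sharp A \<pi> p) \<xi>s)"

definition twisted_poisson ::
  "('m::topological_space, 'e::real_inner, 'v::real_vector) algebroid \<Rightarrow>
   ('m \<Rightarrow> ('v \<Rightarrow> real) list \<Rightarrow> real) \<Rightarrow> ('m \<Rightarrow> 'v list \<Rightarrow> real) \<Rightarrow> bool" where
  "twisted_poisson A \<pi> \<psi> \<longleftrightarrow>
     form (dual_bundle A) 2 \<pi> \<and> form A 3 \<psi> \<and>
     (\<forall>p. \<forall>us\<in>tuples A 4 p. la_diff A \<psi> p us = 0) \<and>
     (\<forall>p. \<forall>\<xi>s\<in>tuples (dual_bundle A) 3 p.
        1 / 2 * gerstenhaber A 2 2 \<pi> \<pi> p \<xi>s = sharp_form A \<pi> \<psi> p \<xi>s)"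

definition psi2 ::
  "('m, 'e, 'v::real_vector, 'z) vbundle_scheme \<Rightarrow> ('m \<Rightarrow> ('v \<Rightarrow> real) list \<Rightarrow> real) \<Rightarrow>
   ('m \<Rightarrow> 'v list \<Rightarrow> real) \<Rightarrow> 'm \<Rightarrow> 'v \<Rightarrow> ('v \<Rightarrow> real) list \<Rightarrow> real" where
  "psi2 A \<pi> \<psi> p u \<xi>s = \<psi> p [sharp A \<pi> p (\<xi>s ! 0), sharp A \<pi> p (\<xi>s ! 1), u]"

text \<open>On \<open>r\<close>-vectors; with indices starting at 0 the sign \<open>(-1)\<^bsup>k + 1\<^esup>\<close> becomes \<open>(-1)\<^sup>k\<close>.\<close>

definition twist_diff ::
  "('m, 'e, 'v::real_vector, 'z) vbundle_scheme \<Rightarrow> ('m \<Rightarrow> ('v \<Rightarrow> real) list \<Rightarrow> real) \<Rightarrow>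
   ('m \<Rightarrow> 'v list \<Rightarrow> real) \<Rightarrow> nat \<Rightarrow> ('m \<Rightarrow> ('v \<Rightarrow> real) list \<Rightarrow> real) \<Rightarrow>
   'm \<Rightarrow> ('v \<Rightarrow> real) list \<Rightarrow> real" where
  "twist_diff A \<pi> \<psi> r Q p \<xi>s =
     (if r = 0 then 0
      else \<Sum>us\<leftarrow>decomp A r p (Q p). \<Sum>k<r. (-1) ^ k *
        (\<Sum>bs\<leftarrow>decomp A 2 p (psi2 A \<pi> \<psi> p (us ! k)). wedge (bs @ remove_nth k us) \<xi>s))"

definition twisted_diff ::
  "('m::topological_space, 'e::real_inner, 'v::real_vector) algebroid \<Rightarrow>
   ('m \<Rightarrow> ('v \<Rightarrow> real) list \<Rightarrow> real) \<Rightarrow> ('m \<Rightarrow> 'v list \<Rightarrow> real) \<Rightarrow> nat \<Rightarrow>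
   ('m \<Rightarrow> ('v \<Rightarrow> real) list \<Rightarrow> real) \<Rightarrow> 'm \<Rightarrow> ('v \<Rightarrow> real) list \<Rightarrow> real" where
  "twisted_diff A \<pi> \<psi> r Q p \<xi>s =
     (if r = 0 then gerstenhaber_fun A 2 \<pi> (\<lambda>x. Q x []) p \<xi>s else gerstenhaber A 2 r \<pi> Q p \<xi>s)
     + twist_diff A \<pi> \<psi> r Q p \<xi>s"

definition twisted_cocycle ::
  "('m::topological_space, 'e::real_inner, 'v::real_vector) algebroid \<Rightarrow>
   ('m \<Rightarrow> ('v \<Rightarrow> real) list \<Rightarrow> real) \<Rightarrow> ('m \<Rightarrow> 'v list \<Rightarrow> real) \<Rightarrow> nat \<Rightarrow>
   ('m \<Rightarrow> ('v \<Rightarrow> real) list \<Rightarrow> real) \<Rightarrow> bool" where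
  "twisted_cocycle A \<pi> \<psi> r Q \<longleftrightarrow> form (dual_bundle A) r Q \<and>
     (\<forall>p. \<forall>\<xi>s\<in>tuples (dual_bundle A) (Suc r) p. twisted_diff A \<pi> \<psi> r Q p \<xi>s = 0)"

text \<open>The class of an \<open>(r + 1)\<close>-vector, as the set of its representatives.\<close>

definition twisted_class ::
  "('m::topological_space, 'e::real_inner, 'v::real_vector) algebroid \<Rightarrow>
   ('m \<Rightarrow> ('v \<Rightarrow> real) list \<Rightarrow> real) \<Rightarrow> ('m \<Rightarrow> 'v list \<Rightarrow> real) \<Rightarrow> nat \<Rightarrow>
   ('m \<Rightarrow> ('v \<Rightarrow> real) list \<Rightarrow> real) \<Rightarrow> ('m \<Rightarrow> ('v \<Rightarrow> real) list \<Rightarrow> real) set" where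
  "twisted_class A \<pi> \<psi> r Q = {Q'. form (dual_bundle A) (Suc r) Q' \<and>
     (\<exists>R. form (dual_bundle A) r R \<and>
        (\<forall>p. \<forall>\<xi>s\<in>tuples (dual_bundle A) (Suc r) p.
           Q' p \<xi>s = Q p \<xi>s + twisted_diff A \<pi> \<psi> r R p \<xi>s))}"

section \<open>The modular section\<close>

definition modular_X ::
  "('m::topological_space, 'e::real_inner, 'v::real_vector) algebroid \<Rightarrow>
   ('m \<Rightarrow> ('v \<Rightarrow> real) list \<Rightarrow> real) \<Rightarrow> ('m \<Rightarrow> 'v list \<Rightarrow> real) \<Rightarrow> 'm \<Rightarrow> 'v" where
  "modular_X A \<pi> \<mu> = (THE X. smooth_section A X \<and>
     (\<forall>\<alpha>. smooth_section (dual_bundle A) \<alpha> \<longrightarrow>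
        (\<forall>p. \<forall>us\<in>tuples A (vrank A) p.
           \<alpha> p (X p) * \<mu> p us =
             lie_derivative A (\<lambda>x. sharp A \<pi> x (\<alpha> x)) \<mu> p us
             - interior_mv A 2 \<pi> (la_diff A (form_of_section \<alpha>)) p [] * \<mu> p us)))"

definition modular_Y ::
  "('m, 'e, 'v::real_vector, 'z) vbundle_scheme \<Rightarrow> ('m \<Rightarrow> ('v \<Rightarrow> real) list \<Rightarrow> real) \<Rightarrow>
   ('m \<Rightarrow> 'v list \<Rightarrow> real) \<Rightarrow> 'm \<Rightarrow> 'v" where
  "modular_Y A \<pi> \<psi> p = sharp A \<pi> p (section_of_form A (interior_mv A 2 \<pi> \<psi>) p)"

definition modular_Z ::
  "('m::topological_space, 'e::real_inner, 'v::real_vector) algebroid \<Rightarrow>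
   ('m \<Rightarrow> ('v \<Rightarrow> real) list \<Rightarrow> real) \<Rightarrow> ('m \<Rightarrow> 'v list \<Rightarrow> real) \<Rightarrow> ('m \<Rightarrow> 'v list \<Rightarrow> real) \<Rightarrow>
   'm \<Rightarrow> 'v" where
  "modular_Z A \<pi> \<psi> \<mu> p = modular_X A \<pi> \<mu> p + modular_Y A \<pi> \<psi> p"

end

theory Submission
  imports Defs
begin

text \<open>Write \<open>X\<^sub>\<alpha> = \<pi>\<^sup>\<sharp> \<alpha>\<close> and \<open>F\<^sub>\<alpha> = d \<alpha> + i\<^bsub>X\<^sub>\<alpha>\<^esub> \<psi>\<close>. Up to sign conventions, the modular section
  pairs with \<open>\<alpha>\<close> to \<open>f\<^sub>\<alpha> = div X\<^sub>\<alpha> + tr\<^bsub>\<pi>\<^esub> F\<^sub>\<alpha>\<close>, where \<open>tr\<^bsub>\<pi>\<^esub>\<close> contracts with \<open>\<pi>\<close>. The bracket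
  on \<open>A\<^sup>*\<close> is \<open>[\<alpha>, \<beta>] = L\<^bsub>X\<^sub>\<alpha>\<^esub> \<beta> - i\<^bsub>X\<^sub>\<beta>\<^esub> F\<^sub>\<alpha>\<close>. The twisted Poisson condition
  says that \<open>\<pi>\<^sup>\<sharp>\<close> preserves brackets and that \<open>L\<^bsub>X\<^sub>\<alpha>\<^esub> \<pi>\<close> is the image of \<open>F\<^sub>\<alpha>\<close> under
  \<open>\<and>\<^sup>2 \<pi>\<^sup>\<sharp>\<close>, and \<open>d \<psi> = 0\<close> gives \<open>F\<^bsub>[\<alpha>, \<beta>]\<^esub> = L\<^bsub>X\<^sub>\<alpha>\<^esub> F\<^sub>\<beta> - L\<^bsub>X\<^sub>\<beta>\<^esub> F\<^sub>\<alpha>\<close>. The divergence is a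
  cocycle for \<open>A\<close>, so that the failure of \<open>f\<close> to be a cocycle is the difference of the pairing of
  \<open>L\<^bsub>X\<^sub>\<alpha>\<^esub> \<pi>\<close> with \<open>F\<^sub>\<beta>\<close> and the one of \<open>L\<^bsub>X\<^sub>\<beta>\<^esub> \<pi>\<close> with \<open>F\<^sub>\<alpha>\<close>. These agree, as the first is
  the pairing of \<open>\<and>\<^sup>2 \<pi>\<^sup>\<sharp> F\<^sub>\<alpha>\<close> with \<open>F\<^sub>\<beta>\<close>, which is symmetric. Replacing \<open>\<mu>\<close> by \<open>h \<mu>\<close> changes
  the section by the coboundary of \<open>ln \<bar>h\<bar>\<close>.\<close>

section \<open>Smooth functions on open sets\<close>

text \<open>Anchor and bracket act on functions and sections over the whole manifold, whereas frames
  and decompositions of \<open>\<pi>\<close> exist only near a point. Frames are therefore cut off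
  by bump functions, brackets and derivatives are shown to be local, and choices (extensions of
  fibre elements, pointwise decompositions) are shown not to matter by tensoriality. The
  Gerstenhaber bracket is tied to one chosen decomposition; written as a tensor \<Sum> c_i \<otimes>
  d_i, its signs all come from one rule for exchanging c_i and d_i. Tangent vectors are abstract
  derivations, so that even the derivative of ln |h| has to be extracted from the Leibniz rule. The
  bracket on the dual enters only through one covector section \<gamma> for each pair \<alpha>,
  \<beta>, given by its pairings and by X \<gamma> = [X \<alpha>, X \<beta>]. As for signs: i_\<pi>
  inserts the second factor first and \<open>\<pi>\<close> is skew, which makes the contributions of
  d \<alpha> and of \<psi> both positive traces; this is why they merge into the trace of
  F_\<alpha>.\<close>

lemma Ck_on_mono: "Ck_on k S f \<Longrightarrow> T \<subseteq> S \<Longrightarrow> Ck_on k T f"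
  by (induction k arbitrary: f) (auto intro: continuous_on_subset)

text \<open>Derivatives are taken at points and not within \<open>S\<close>; openness of
  \<open>S\<close> is what lets agreement on \<open>S\<close> pass to them.\<close>

lemma Ck_on_cong:
  assumes "open S" "\<And>x. x \<in> S \<Longrightarrow> f x = g x" "Ck_on k S f"
  shows "Ck_on k S g"
  using assms(2,3)
proof (induction k arbitrary: f g)
  case 0
  then show ?case by (metis Ck_on.simps(1) continuous_on_cong)
next
  case (Suc k)
  have d: "(g has_derivative frechet_derivative f (at x)) (at x)" if "x \<in> S" for x
    by (rule has_derivative_transform_within_open[OF _ \<open>open S\<close> that, where f=f])
      (use Suc.prems that in \<open>auto simp: frechet_derivative_works[symmetric]\<close>)
  have e: "frechet_derivative g (at x) = frechet_derivative f (at x)" if "x \<in> S" for x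
    by (rule frechet_derivative_at[OF d[OF that], symmetric])
  have "Ck_on k S (\<lambda>x. frechet_derivative g (at x) v)" for v
    by (rule Suc.IH[of "\<lambda>x. frechet_derivative f (at x) v"]) (use Suc.prems(2) e in simp_all)
  then show ?case using d by (auto simp: differentiable_def)
qed

lemma Ck_on_SucD: "Ck_on (Suc k) S f \<Longrightarrow> Ck_on k S f"
proof (induction k arbitrary: f)
  case 0
  then show ?case
    by (simp add: continuous_on_eq_continuous_within)
      (metis continuous_at_imp_continuous_at_within differentiable_imp_continuous_within)
next
  case (Suc k)
  then show ?case by (metis Ck_on.simps(2))
qed

lemma Ck_on_local:
  assumes "\<And>x. x \<in> S \<Longrightarrow> \<exists>T. open T \<and> x \<in> T \<and> Ck_on k T f"
  shows "Ck_on k S f"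
  using assms
proof (induction k arbitrary: f)
  case 0
  have "continuous (at x within S) f" if "x \<in> S" for x
    using 0[OF that]
    by (metis Ck_on.simps(1) continuous_at_imp_continuous_at_within continuous_on_eq_continuous_at)
  then show ?case by (simp add: continuous_on_eq_continuous_within)
next
  case (Suc k)
  have "f differentiable (at x)" if "x \<in> S" for x
    using Suc.prems[OF that] by auto
  moreover have "Ck_on k S (\<lambda>x. frechet_derivative f (at x) v)" for v
  proof (rule Suc.IH)
    fix x assume "x \<in> S"
    from Suc.prems[OF this] show "\<exists>T. open T \<and> x \<in> T \<and> Ck_on k T (\<lambda>x. frechet_derivative f (at x) v)"
      by auto
  qed
  ultimately show ?case by simp
qed

lemma Ck_on_const: "Ck_on k S (\<lambda>_. c)"
  by (induction k arbitrary: c) auto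

lemma Ck_on_add:
  assumes "open S" "Ck_on k S f" "Ck_on k S g"
  shows "Ck_on k S (\<lambda>x. f x + g x)"
  using assms(2,3)
proof (induction k arbitrary: f g)
  case 0
  then show ?case by (auto intro: continuous_intros)
next
  case (Suc k)
  have d: "((\<lambda>x. f x + g x) has_derivative
      (\<lambda>v. frechet_derivative f (at x) v + frechet_derivative g (at x) v)) (at x)" if "x \<in> S" for x
    using Suc.prems that by (intro has_derivative_add) (auto simp: frechet_derivative_works[symmetric])
  have e: "frechet_derivative (\<lambda>x. f x + g x) (at x) =
      (\<lambda>v. frechet_derivative f (at x) v + frechet_derivative g (at x) v)" if "x \<in> S" for x
    by (rule frechet_derivative_at[OF d[OF that], symmetric])
  have "Ck_on k S (\<lambda>x. frechet_derivative (\<lambda>x. f x + g x) (at x) v)" for v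
    by (rule Ck_on_cong[OF \<open>open S\<close> _ Suc.IH]) (use Suc.prems e in auto)
  then show ?case using d by (auto simp: differentiable_def)
qed

text \<open>A general bounded bilinear \<open>b\<close> covers products of real functions and also
  the inner product behind the squared distance in \<open>bump_function\<close>. The product rule
  contains the undifferentiated factors, which \<open>Ck_on_SucD\<close> brings down to the order
  that the induction requires.\<close>

lemma Ck_on_bilinear:
  assumes "open S" "bounded_bilinear b" "Ck_on k S f" "Ck_on k S g"
  shows "Ck_on k S (\<lambda>x. b (f x) (g x))"
  using assms(3,4)
proof (induction k arbitrary: f g)
  case 0
  then show ?case using assms(2) by (auto intro: bounded_bilinear.continuous_on)
next
  case (Suc k)
  have d: "((\<lambda>x. b (f x) (g x)) has_derivative
      (\<lambda>v. b (f x) (frechet_derivative g (at x) v) + b (frechet_derivative f (at x) v) (g x))) (at x)"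
    if "x \<in> S" for x
    using Suc.prems that
    by (intro bounded_bilinear.FDERIV[OF assms(2)]) (auto simp: frechet_derivative_works[symmetric])
  have e: "frechet_derivative (\<lambda>x. b (f x) (g x)) (at x) =
      (\<lambda>v. b (f x) (frechet_derivative g (at x) v) + b (frechet_derivative f (at x) v) (g x))"
    if "x \<in> S" for x
    by (rule frechet_derivative_at[OF d[OF that], symmetric])
  have "Ck_on k S (\<lambda>x. frechet_derivative (\<lambda>x. b (f x) (g x)) (at x) v)" for v
    by (rule Ck_on_cong[OF \<open>open S\<close> _ Ck_on_add[OF \<open>open S\<close> Suc.IH Suc.IH]])
      (use Suc.prems e in \<open>auto simp del: Ck_on.simps simp: Ck_on_SucD Ck_on.simps(2)\<close>)
  then show ?case using d by (auto simp: differentiable_def)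
qed

text \<open>For real \<open>f\<close> the chain rule is the product of g' at f(x) with the
  derivative of f, where g' is the derivative in direction 1. The induction thus runs over
  \<open>g\<close> with \<open>f\<close> fixed and falls back on the product rule.\<close>

lemma Ck_on_compose_real:
  fixes f :: "'a::real_normed_vector \<Rightarrow> real" and g :: "real \<Rightarrow> real"
  assumes "open S" "open T" "f ` S \<subseteq> T" "Ck_on k T g" "Ck_on k S f"
  shows "Ck_on k S (\<lambda>x. g (f x))"
  using assms(4,5)
proof (induction k arbitrary: g)
  case 0
  then show ?case using assms(3) by (auto intro: continuous_on_compose2)
next
  case (Suc k)
  have d: "((\<lambda>x. g (f x)) has_derivative
      (\<lambda>v. frechet_derivative g (at (f x)) (frechet_derivative f (at x) v))) (at x)"
    if "x \<in> S" for x
    using Suc.prems that assms(3)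
    by (intro has_derivative_compose[where f=f and g=g]) (auto simp: frechet_derivative_works[symmetric])
  have e: "frechet_derivative (\<lambda>x. g (f x)) (at x) v =
      frechet_derivative g (at (f x)) 1 * frechet_derivative f (at x) v" if "x \<in> S" for x v
  proof -
    have "linear (frechet_derivative g (at (f x)))"
      using Suc.prems that assms(3) by (auto intro: linear_frechet_derivative)
    from linear_scale[OF this, of "frechet_derivative f (at x) v" 1]
    have "frechet_derivative g (at (f x)) (frechet_derivative f (at x) v) =
        frechet_derivative g (at (f x)) 1 * frechet_derivative f (at x) v" by simp
    then show ?thesis
      by (simp add: frechet_derivative_at[OF d[OF that], symmetric])
  qed
  have "Ck_on k S (\<lambda>x. frechet_derivative (\<lambda>x. g (f x)) (at x) v)" for v
    by (rule Ck_on_cong[OF \<open>open S\<close> _ Ck_on_bilinear[OF \<open>open S\<close> bounded_bilinear_mult Suc.IH]])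
      (use Suc.prems e in \<open>auto simp del: Ck_on.simps simp: Ck_on_SucD Ck_on.simps(2)\<close>)
  then show ?case using d by (auto simp: differentiable_def)
qed

lemma Cinf_on_mono: "Cinf_on S f \<Longrightarrow> T \<subseteq> S \<Longrightarrow> Cinf_on T f"
  by (auto simp: Cinf_on_def intro: Ck_on_mono)

lemma Cinf_on_cong: "open S \<Longrightarrow> (\<And>x. x \<in> S \<Longrightarrow> f x = g x) \<Longrightarrow> Cinf_on S f \<Longrightarrow> Cinf_on S g"
  by (auto simp: Cinf_on_def intro: Ck_on_cong)

lemma Cinf_on_local:
  assumes "\<And>x. x \<in> S \<Longrightarrow> \<exists>T. open T \<and> x \<in> T \<and> Cinf_on T f"
  shows "Cinf_on S f"
  unfolding Cinf_on_def
proof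
  fix k show "Ck_on k S f"
    by (rule Ck_on_local) (use assms Cinf_on_def in metis)
qed

lemma Cinf_on_const: "Cinf_on S (\<lambda>_. c)"
  by (simp add: Cinf_on_def Ck_on_const)

lemma Cinf_on_add: "open S \<Longrightarrow> Cinf_on S f \<Longrightarrow> Cinf_on S g \<Longrightarrow> Cinf_on S (\<lambda>x. f x + g x)"
  by (auto simp: Cinf_on_def intro: Ck_on_add)

lemma Cinf_on_bilinear:
  "open S \<Longrightarrow> bounded_bilinear b \<Longrightarrow> Cinf_on S f \<Longrightarrow> Cinf_on S g \<Longrightarrow> Cinf_on S (\<lambda>x. b (f x) (g x))"
  by (auto simp: Cinf_on_def intro: Ck_on_bilinear)

lemma Cinf_on_mult:
  fixes f g :: "'a::real_normed_vector \<Rightarrow> real"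
  shows "open S \<Longrightarrow> Cinf_on S f \<Longrightarrow> Cinf_on S g \<Longrightarrow> Cinf_on S (\<lambda>x. f x * g x)"
  by (rule Cinf_on_bilinear[OF _ bounded_bilinear_mult])

lemma Cinf_on_compose_real:
  fixes f :: "'a::real_normed_vector \<Rightarrow> real" and g :: "real \<Rightarrow> real"
  shows "open S \<Longrightarrow> open T \<Longrightarrow> f ` S \<subseteq> T \<Longrightarrow> Cinf_on T g \<Longrightarrow> Cinf_on S f \<Longrightarrow> Cinf_on S (\<lambda>x. g (f x))"
  by (auto simp: Cinf_on_def intro: Ck_on_compose_real)

text \<open>Smoothness without formulas for higher derivatives: in a family closed under
  differentiation every derivative is a member, hence differentiable, hence continuous.\<close>

lemma Cinf_on_real_family:
  fixes G :: "(real \<Rightarrow> real) set"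
  assumes "open T" "g \<in> G"
    and G: "\<And>g. g \<in> G \<Longrightarrow> \<exists>g'\<in>G. \<forall>t\<in>T. (g has_real_derivative g' t) (at t)"
  shows "Cinf_on T g"
proof -
  have "Ck_on k T g" for k
    using assms(2)
  proof (induction k arbitrary: g)
    case 0
    then show ?case using G[OF 0]
      by (simp add: continuous_on_eq_continuous_within)
        (metis continuous_at_imp_continuous_at_within DERIV_isCont)
  next
    case (Suc k)
    obtain g' where g': "g' \<in> G" "\<And>t. t \<in> T \<Longrightarrow> (g has_derivative (\<lambda>v. g' t * v)) (at t)"
      using G[OF Suc.prems] unfolding has_field_derivative_def by blast
    have e: "frechet_derivative g (at t) v = g' t * v" if "t \<in> T" for t v
      by (rule fun_cong[OF frechet_derivative_at[OF g'(2)[OF that], symmetric]])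
    have "Ck_on k T (\<lambda>x. frechet_derivative g (at x) v)" for v
      by (rule Ck_on_cong[OF \<open>open T\<close> _ Ck_on_bilinear[OF \<open>open T\<close> bounded_bilinear_mult
              Suc.IH[OF g'(1)] Ck_on_const[of _ _ v]]]) (auto simp: e)
    then show ?case using g'(2) by (auto simp: differentiable_def)
  qed
  then show ?thesis by (simp add: Cinf_on_def)
qed

text \<open>Differentiation raises the exponent and changes the constant, so all functions c t^(-n)
  are taken together.\<close>

lemma Cinf_on_inverse_power: "Cinf_on (- {0::real}) (\<lambda>t. c * inverse t ^ n)"
proof (rule Cinf_on_real_family[where G = "{\<lambda>t. c * inverse t ^ n | c n. True}"])
  fix g :: "real \<Rightarrow> real"
  assume "g \<in> {\<lambda>t. c * inverse t ^ n | c n. True}"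
  then obtain c n where g: "g = (\<lambda>t. c * inverse t ^ n)" by auto
  have "\<forall>t\<in>- {0}. (g has_real_derivative ((- (of_nat n * c)) * inverse t ^ Suc n)) (at t)"
  proof
    fix t :: real assume t: "t \<in> - {0}"
    have "((\<lambda>t. inverse t ^ n) has_real_derivative
        of_nat n * (- (inverse t ^ Suc (Suc 0)) * inverse t ^ (n - Suc 0))) (at t)"
      using t by (intro DERIV_power DERIV_inverse) auto
    from DERIV_cmult[OF this, of c]
    show "(g has_real_derivative ((- (of_nat n * c)) * inverse t ^ Suc n)) (at t)"
      unfolding g by (rule back_subst) (cases n; simp add: algebra_simps)
  qed
  then show "\<exists>g'\<in>{\<lambda>t. c * inverse t ^ n | c n. True}. \<forall>t\<in>- {0}. (g has_real_derivative g' t) (at t)"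
    by (intro bexI[of _ "\<lambda>t. (- (of_nat n * c)) * inverse t ^ Suc n"]) blast+
qed auto

lemma Cinf_on_inverse: "Cinf_on (- {0::real}) inverse"
  using Cinf_on_inverse_power[of 1 1] by simp

text \<open>The absolute value is there because the ratio of two volume forms may be negative, and
  may have different signs on different components. On both half-lines the derivative is 1 / t, so
  smoothness reduces to that of \<open>inverse\<close>.\<close>

lemma Cinf_on_ln_abs: "Cinf_on (- {0::real}) (\<lambda>t. ln \<bar>t\<bar>)"
proof -
  have d: "((\<lambda>t. ln \<bar>t\<bar>) has_derivative (\<lambda>v. inverse t * v)) (at t)" if "t \<in> - {0::real}" for t
  proof (cases "t > 0")
    case True
    then show ?thesis
      unfolding has_field_derivative_def[symmetric]
      by (rule has_field_derivative_transform_within_open[where f=ln and S="{0<..}", OF DERIV_ln])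
        (use True in auto)
  next
    case False
    with that have t: "t < 0" by auto
    have "((\<lambda>t. ln (- t)) has_real_derivative inverse t) (at t)"
      using t by (auto intro!: derivative_eq_intros simp: field_simps)
    then show ?thesis
      unfolding has_field_derivative_def[symmetric]
      by (rule has_field_derivative_transform_within_open[where S="{..<0}"]) (use t in auto)
  qed
  have e: "frechet_derivative (\<lambda>t. ln \<bar>t\<bar>) (at t) v = inverse t * v" if "t \<in> - {0::real}" for t v
    by (rule fun_cong[OF frechet_derivative_at[OF d[OF that], symmetric]])
  have "Ck_on k (- {0::real}) (\<lambda>t. ln \<bar>t\<bar>)" for k
  proof (cases k)
    case 0
    then show ?thesis
      using continuous_at_imp_continuous_at_within[OF has_derivative_continuous[OF d]]
      by (simp add: continuous_on_eq_continuous_within)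
  next
    case (Suc k')
    have "Ck_on k' (- {0}) (\<lambda>x::real. frechet_derivative (\<lambda>t. ln \<bar>t\<bar>) (at x) v)" for v
    proof (rule Ck_on_cong[where f="\<lambda>t. inverse t * v"])
      show "Ck_on k' (- {0}) (\<lambda>t::real. inverse t * v)"
        using Cinf_on_inverse
        by (intro Ck_on_bilinear[OF _ bounded_bilinear_mult] Ck_on_const) (auto simp: Cinf_on_def)
    qed (auto simp: e)
    then show ?thesis using d by (auto simp: differentiable_def Suc)
  qed
  then show ?thesis by (simp add: Cinf_on_def)
qed

text \<open>Everywhere convergent power series form a family closed under differentiation, by
  termwise differentiation with coefficients \<open>diffs c\<close>.\<close>

lemma Cinf_on_powser:
  fixes c :: "nat \<Rightarrow> real"
  assumes "\<And>x. summable (\<lambda>n. c n * x ^ n)"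
  shows "Cinf_on UNIV (\<lambda>x. \<Sum>n. c n * x ^ n)"
proof (rule Cinf_on_real_family[where G = "{\<lambda>x. \<Sum>n. c n * x ^ n | c. \<forall>x. summable (\<lambda>n. c n * x ^ n)}"])
  fix g :: "real \<Rightarrow> real"
  assume "g \<in> {\<lambda>x. \<Sum>n. c n * x ^ n | c. \<forall>x. summable (\<lambda>n. c n * x ^ n)}"
  then obtain c where g: "g = (\<lambda>x. \<Sum>n. c n * x ^ n)" and c: "\<And>x. summable (\<lambda>n. c n * x ^ n)" by auto
  have "\<forall>t\<in>UNIV. (g has_real_derivative (\<Sum>n. diffs c n * t ^ n)) (at t)"
    unfolding g using termdiffs_strong_converges_everywhere[OF c] by blast
  moreover have "\<forall>x. summable (\<lambda>n. diffs c n * x ^ n)"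
    using termdiff_converges_all[OF c] by blast
  ultimately show "\<exists>g'\<in>{\<lambda>x. \<Sum>n. c n * x ^ n | c. \<forall>x. summable (\<lambda>n. c n * x ^ n)}.
      \<forall>t\<in>UNIV. (g has_real_derivative g' t) (at t)"
    by (intro bexI[where x="\<lambda>x. \<Sum>n. diffs c n * x ^ n"]) auto
qed (use assms in auto)

text \<open>Serves the chain rule for \<open>exp\<close> under an abstract derivation. The remainder
  is given by its own power series, with coefficients 1 / (n + 2)!, which makes it smooth also at 0,
  where dividing by x^2 says nothing.\<close>

lemma exp_second_order_remainder:
  obtains K :: "real \<Rightarrow> real" where "Cinf_on UNIV K" "\<And>x. exp x = 1 + x + x * x * K x"
proof -
  define c :: "nat \<Rightarrow> real" where "c n = inverse (fact (n + 2))" for n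
  have s: "(\<lambda>n. x ^ n /\<^sub>R fact n) sums exp x" for x :: real
    by (rule exp_converges)
  have sh: "(\<lambda>n. x ^ (n + 2) /\<^sub>R fact (n + 2)) sums (exp x - 1 - x)" for x :: real
    using sums_split_initial_segment[OF s[of x], of 2]
    by (simp only: numeral_2_eq_2 lessThan_Suc) (simp add: algebra_simps)
  \<comment> \<open>For x \<noteq> 0 this is the series of exp x - 1 - x divided by x^2; at 0 only
    one term is non-zero.\<close>
  have summ: "summable (\<lambda>n. c n * x ^ n)" for x
  proof (cases "x = 0")
    case True
    then show ?thesis by (auto intro!: summable_finite[of "{0}"])
  next
    case False
    have "summable (\<lambda>n. inverse (x * x) * (x ^ (n + 2) /\<^sub>R fact (n + 2)))"
      using sh[of x] by (intro summable_mult) (auto simp: sums_iff)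
    then show ?thesis
      using False by (simp add: c_def power_add power2_eq_square field_simps)
  qed
  have "x * x * (\<Sum>n. c n * x ^ n) = exp x - 1 - x" for x
  proof -
    have "x * x * (\<Sum>n. c n * x ^ n) = (\<Sum>n. x * x * (c n * x ^ n))"
      by (rule suminf_mult[OF summ, symmetric])
    also have "\<dots> = (\<Sum>n. x ^ (n + 2) /\<^sub>R fact (n + 2))"
      by (simp add: c_def power_add power2_eq_square field_simps)
    also have "\<dots> = exp x - 1 - x" using sh[of x] by (simp add: sums_iff)
    finally show ?thesis .
  qed
  then have "exp x = 1 + x + x * x * (\<Sum>n. c n * x ^ n)" for x by simp
  then show thesis using Cinf_on_powser[OF summ] that by blast
qed

subsection \<open>A smooth step function\<close>

lemma tendsto_poly_div_exp_0:
  "((\<lambda>s. poly q s / exp s) \<longlongrightarrow> (0::real)) at_top"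
proof -
  have "((\<lambda>s. \<Sum>i\<le>degree q. coeff q i * (s ^ i / exp s)) \<longlongrightarrow> (\<Sum>i\<le>degree q. coeff q i * 0)) at_top"
    by (intro tendsto_intros tendsto_power_div_exp_0)
  then show ?thesis by (simp add: poly_altdef sum_divide_distrib)
qed

text \<open>With s = 1 / t one has ds/dt = - s^2, so that q(s) exp(- s) differentiates to s^2 (q -
  q')(s) exp(- s). Letting \<open>q\<close> range over all polynomials closes the family; q = 1 is
  the classical flat function.\<close>

lemma Cinf_on_exp_inverse:
  "Cinf_on UNIV (\<lambda>t::real. if t > 0 then poly q (inverse t) / exp (inverse t) else 0)"
proof (rule Cinf_on_real_family[where G = "range (\<lambda>q t. if t > 0 then poly q (inverse t) / exp (inverse t) else 0)"])
  fix g :: "real \<Rightarrow> real"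
  assume "g \<in> range (\<lambda>q t. if t > 0 then poly q (inverse t) / exp (inverse t) else 0)"
  then obtain q where g: "g = (\<lambda>t. if t > 0 then poly q (inverse t) / exp (inverse t) else 0)" by auto
  define r where "r = [:0, 0, 1:] * (q - pderiv q)"
  define g' :: "real \<Rightarrow> real" where "g' = (\<lambda>t. if t > 0 then poly r (inverse t) / exp (inverse t) else 0)"
  have "(g has_real_derivative g' t) (at t)" for t
  proof -
    consider "t > 0" | "t < 0" | "t = 0" by linarith
    then show ?thesis
    proof cases
      case 1
      have "((\<lambda>t. poly q (inverse t) / exp (inverse t)) has_real_derivative
          poly r (inverse t) / exp (inverse t)) (at t)"
        using 1 by (auto intro!: derivative_eq_intros simp: r_def field_simps power2_eq_square)
      then have "(g has_real_derivative poly r (inverse t) / exp (inverse t)) (at t)"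
        by (rule has_field_derivative_transform_within_open[where S="{0<..}"]) (use 1 in \<open>auto simp: g\<close>)
      then show ?thesis using 1 by (simp add: g'_def)
    next
      case 2
      have "(g has_real_derivative 0) (at t)"
        by (rule has_field_derivative_transform_within_open[where S="{..<0}" and f="\<lambda>_. 0"])
          (use 2 in \<open>auto simp: g\<close>)
      then show ?thesis using 2 by (simp add: g'_def)
    next
      \<comment> \<open>With s = 1 / h the difference quotient at h > 0 is s q(s) / exp s, which
        tends to 0; for h < 0 it vanishes.\<close>
      case 3
      have "((\<lambda>s. poly ([:0, 1:] * q) s / exp s) \<longlongrightarrow> 0) at_top"
        by (rule tendsto_poly_div_exp_0)
      from filterlim_compose[OF this filterlim_inverse_at_top_right]
      have "((\<lambda>t. poly ([:0, 1:] * q) (inverse t) / exp (inverse t)) \<longlongrightarrow> 0) (at_right 0)" .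
      then have "((\<lambda>h. (g (0 + h) - g 0) / h) \<longlongrightarrow> 0) (at_right 0)"
        by (rule tendsto_cong[THEN iffD1, rotated])
          (auto simp: eventually_at_filter g field_simps)
      moreover have "((\<lambda>h. (g (0 + h) - g 0) / h) \<longlongrightarrow> 0) (at_left 0)"
        by (rule tendsto_cong[THEN iffD1, rotated, OF tendsto_const])
          (auto simp: eventually_at_filter g)
      ultimately have "((\<lambda>h. (g (0 + h) - g 0) / h) \<longlongrightarrow> 0) (at 0)"
        by (simp add: filterlim_at_split)
      then show ?thesis using 3 by (simp add: DERIV_def g'_def)
    qed
  qed
  then show "\<exists>g'\<in>range (\<lambda>q t. if t > 0 then poly q (inverse t) / exp (inverse t) else 0).
      \<forall>t\<in>UNIV. (g has_real_derivative g' t) (at t)"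
    unfolding g'_def by (intro bexI[of _ "\<lambda>t. if t > 0 then poly r (inverse t) / exp (inverse t) else 0"]) auto
qed auto

lemma smooth_step_exists:
  fixes a b :: real
  assumes "a < b"
  obtains h :: "real \<Rightarrow> real" where "Cinf_on UNIV h" "\<And>t. t \<le> a \<Longrightarrow> h t = 1" "\<And>t. t \<ge> b \<Longrightarrow> h t = 0"
proof -
  define f :: "real \<Rightarrow> real" where "f = (\<lambda>t. if t > 0 then poly 1 (inverse t) / exp (inverse t) else 0)"
  have f: "Cinf_on UNIV f" unfolding f_def by (rule Cinf_on_exp_inverse)
  have lin: "Cinf_on UNIV (\<lambda>t::real. c + d * t)" for c d
  proof (rule Cinf_on_real_family[where G = "range (\<lambda>(c, d) t. c + d * t)"])
    fix g :: "real \<Rightarrow> real"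
    assume "g \<in> range (\<lambda>(c, d) t. c + d * t)"
    then obtain c d where "g = (\<lambda>t. c + d * t)" by auto
    then have "\<forall>t\<in>UNIV. (g has_real_derivative d + 0 * t) (at t)"
      by (auto intro!: derivative_eq_intros)
    moreover have "(\<lambda>t. d + 0 * t) \<in> range (\<lambda>(c, d) t. c + d * t)"
      by (rule range_eqI[of _ _ "(d, 0)"]) simp
    ultimately show "\<exists>g'\<in>range (\<lambda>(c, d) t. c + d * t). \<forall>t\<in>UNIV. (g has_real_derivative g' t) (at t)"
      by (rule bexI[where x="\<lambda>t. d + 0 * t"])
  qed auto
  \<comment> \<open>At least one of b - t and t - a is positive because a < b, so this denominator
    never vanishes.\<close>
  define D where "D = (\<lambda>t. f (b - t) + f (t - a))"
  have pos: "f t > 0" if "t > 0" for t using that by (simp add: f_def)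
  have nonneg: "f t \<ge> 0" for t by (simp add: f_def)
  have zero: "f t = 0" if "t \<le> 0" for t using that by (simp add: f_def)
  have Dpos: "D t > 0" for t
  proof (cases "t < b")
    case True
    then show ?thesis using pos[of "b - t"] nonneg[of "t - a"] by (simp add: D_def)
  next
    case False
    then show ?thesis using assms pos[of "t - a"] nonneg[of "b - t"] by (simp add: D_def add_nonneg_pos)
  qed
  have f1: "Cinf_on UNIV (\<lambda>t. f (b - t))"
    using Cinf_on_compose_real[OF open_UNIV open_UNIV subset_UNIV f lin[of b "-1"]] by simp
  have f2: "Cinf_on UNIV (\<lambda>t. f (t - a))"
    using Cinf_on_compose_real[OF open_UNIV open_UNIV subset_UNIV f lin[of "-a" "1"]] by simp
  have "Cinf_on UNIV D" unfolding D_def by (rule Cinf_on_add[OF open_UNIV f1 f2])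
  moreover have "range D \<subseteq> - {0}"
    using Dpos by (metis ComplI image_subsetI less_irrefl singletonD)
  ultimately have "Cinf_on UNIV (\<lambda>t. inverse (D t))"
    by (intro Cinf_on_compose_real[OF open_UNIV open_Compl[OF closed_singleton] _ Cinf_on_inverse])
  then have "Cinf_on UNIV (\<lambda>t. f (b - t) * inverse (D t))"
    by (rule Cinf_on_mult[OF open_UNIV f1])
  moreover have "f (b - t) * inverse (D t) = 1" if "t \<le> a" for t
    using that zero[of "t - a"] Dpos[of t] by (simp add: D_def)
  moreover have "f (b - t) * inverse (D t) = 0" if "t \<ge> b" for t
    using that zero[of "b - t"] by simp
  ultimately show thesis by (rule that)
qed


section \<open>Bump functions on manifolds\<close>

text \<open>Gram-Schmidt, one vector at a time: \<open>s\<close> is the projection of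
  \<open>x\<close> to the span reached so far, and x - s is either zero or gets normalised and
  added.\<close>

lemma finite_orthonormal_spanning_set:
  fixes B :: "'e::real_inner set"
  assumes "finite B"
  shows "\<exists>b. finite b \<and> span b = span B \<and> (\<forall>x\<in>b. \<forall>y\<in>b. x \<bullet> y = (if x = y then 1 else 0))"
  using assms
proof (induction B)
  case empty
  then show ?case by (intro exI[of _ "{}"]) auto
next
  case (insert x B)
  then obtain b where b: "finite b" "span b = span B" "\<And>x y. x \<in> b \<Longrightarrow> y \<in> b \<Longrightarrow> x \<bullet> y = (if x = y then 1 else 0)"
    by blast
  define s where "s = (\<Sum>y\<in>b. (x \<bullet> y) *\<^sub>R y)"
  have s: "s \<in> span b" unfolding s_def by (intro span_sum span_scale span_base)
  have orth: "(x - s) \<bullet> y = 0" if "y \<in> b" for y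
  proof -
    have "s \<bullet> y = (\<Sum>z\<in>b. if z = y then x \<bullet> y else 0)"
      unfolding s_def inner_sum_left by (rule sum.cong) (use b(3) that in auto)
    also have "\<dots> = x \<bullet> y" using b(1) that by simp
    finally show ?thesis by (simp add: inner_diff_left)
  qed
  show ?case
  proof (cases "x - s = 0")
    case True
    then have "x \<in> span B" using s b(2) by simp
    then have "span (insert x B) = span B" by (rule span_redundant)
    then show ?thesis using b by (intro exI[of _ b]) auto
  next
    case False
    define z where "z = (x - s) /\<^sub>R norm (x - s)"
    have zz: "z \<bullet> z = 1"
      using False by (simp add: z_def power2_norm_eq_inner[symmetric] power2_eq_square)
    have zb: "z \<bullet> y = 0" "y \<bullet> z = 0" if "y \<in> b" for y
      using orth[OF that] by (simp_all add: z_def inner_commute)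
    have x: "x = norm (x - s) *\<^sub>R z + s" using False by (simp add: z_def)
    have "x \<in> span (insert z b)"
      by (subst x) (meson insertI1 s span_add span_base span_mono span_scale subset_insertI subsetD)
    moreover have "span B \<subseteq> span (insert z b)" using b(2) by (metis span_mono subset_insertI)
    ultimately have 1: "span (insert x B) \<subseteq> span (insert z b)"
      by (intro span_minimal) (auto intro: span_base)
    have "x \<in> span (insert x B)" "s \<in> span (insert x B)"
      using s b(2) by (auto intro: span_base) (meson span_mono subset_insertI subsetD)
    then have "z \<in> span (insert x B)" unfolding z_def by (intro span_scale span_diff)
    moreover have "b \<subseteq> span (insert x B)"
      using b(2) by (metis order_trans span_mono span_superset subset_insertI)
    ultimately have 2: "span (insert z b) \<subseteq> span (insert x B)"
      by (intro span_minimal) auto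
    show ?thesis
      by (intro exI[of _ "insert z b"] conjI ballI) (use b(1,3) 1 2 zz zb in auto)
  qed
qed

text \<open>In an orthonormal basis every coefficient of a vector of norm at most r is bounded by r,
  by Cauchy-Schwarz. The ball is thus a closed subset of the image of a cube of coefficients, and
  this image is compact as an iterated sum of compact segments.\<close>

lemma compact_cball_finite_span:
  fixes c :: "'e::real_inner" and B :: "'e set"
  assumes "finite B" "span B = UNIV"
  shows "compact (cball c r)"
proof -
  obtain b :: "'e set" where b: "finite b" "span b = UNIV" "\<And>x y. x \<in> b \<Longrightarrow> y \<in> b \<Longrightarrow> x \<bullet> y = (if x = y then 1 else 0)"
    using finite_orthonormal_spanning_set[OF assms(1)] assms(2) by auto
  have K: "compact {\<Sum>y\<in>b. f y *\<^sub>R y | f. \<forall>y. \<bar>f y\<bar> \<le> r}" (is "compact ?K")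
    using b(1)
  proof (induction b)
    case empty
    have "{\<Sum>y\<in>{}. f y *\<^sub>R y | f. \<forall>y::'e. \<bar>f y\<bar> \<le> r} \<subseteq> {0::'e}" by auto
    then show ?case using finite_imp_compact finite_subset by blast
  next
    case (insert z b)
    have "compact ((\<lambda>t. t *\<^sub>R z) ` {-r..r})"
      by (intro compact_continuous_image compact_Icc continuous_intros)
    from compact_sums[OF this insert.IH]
    have c: "compact {x + y |x y. x \<in> (\<lambda>t. t *\<^sub>R z) ` {-r..r} \<and> y \<in> {\<Sum>y\<in>b. f y *\<^sub>R y | f. \<forall>y. \<bar>f y\<bar> \<le> r}}" .
    have "{\<Sum>y\<in>insert z b. f y *\<^sub>R y | f. \<forall>y. \<bar>f y\<bar> \<le> r} =
        {x + y |x y. x \<in> (\<lambda>t. t *\<^sub>R z) ` {-r..r} \<and> y \<in> {\<Sum>y\<in>b. f y *\<^sub>R y | f. \<forall>y. \<bar>f y\<bar> \<le> r}}" (is "?L = ?R")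
    proof (intro subset_antisym subsetI)
      fix v assume "v \<in> ?L"
      then obtain f where f: "v = (\<Sum>y\<in>insert z b. f y *\<^sub>R y)" "\<forall>y. \<bar>f y\<bar> \<le> r" by blast
      have "v = f z *\<^sub>R z + (\<Sum>y\<in>b. f y *\<^sub>R y)" using f(1) insert.hyps by simp
      moreover have "f z *\<^sub>R z \<in> (\<lambda>t. t *\<^sub>R z) ` {-r..r}"
        using f(2) by (intro imageI) (auto simp: abs_le_iff minus_le_iff)
      ultimately show "v \<in> ?R" using f(2) by blast
    next
      fix v assume "v \<in> ?R"
      then obtain t f where f: "v = t *\<^sub>R z + (\<Sum>y\<in>b. f y *\<^sub>R y)" "\<bar>t\<bar> \<le> r" "\<forall>y. \<bar>f y\<bar> \<le> r"
        by (auto simp: abs_le_iff)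
      have "(\<Sum>y\<in>b. (f(z := t)) y *\<^sub>R y) = (\<Sum>y\<in>b. f y *\<^sub>R y)"
        by (rule sum.cong) (use insert.hyps in auto)
      then have "v = (\<Sum>y\<in>insert z b. (f(z := t)) y *\<^sub>R y)"
        using f(1) insert.hyps by simp
      moreover have "\<forall>y. \<bar>(f(z := t)) y\<bar> \<le> r" using f by simp
      ultimately show "v \<in> ?L" by blast
    qed
    then show ?case using c by simp
  qed
  have "cball 0 r \<subseteq> {\<Sum>y\<in>b. f y *\<^sub>R y | f. \<forall>y. \<bar>f y\<bar> \<le> r}"
  proof
    fix x :: 'e assume x: "x \<in> cball 0 r"
    have "x \<in> span b" using b(2) by simp
    then obtain f where f: "x = (\<Sum>y\<in>b. f y *\<^sub>R y)"
      using b(1) span_finite by blast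
    have fy: "f y = x \<bullet> y" if "y \<in> b" for y
    proof -
      have "x \<bullet> y = (\<Sum>z\<in>b. if z = y then f y else 0)"
        unfolding f inner_sum_left by (rule sum.cong) (use b(3) that in auto)
      then show ?thesis using b(1) that by simp
    qed
    have "\<bar>x \<bullet> y\<bar> \<le> r" if "y \<in> b" for y
    proof -
      have "norm y = 1" using b(3)[OF that that] by (simp add: norm_eq_sqrt_inner)
      then show ?thesis using Cauchy_Schwarz_ineq2[of x y] x by simp
    qed
    moreover have "r \<ge> 0" using x by (simp, meson norm_ge_zero order_trans)
    ultimately have "\<forall>y. \<bar>if y \<in> b then x \<bullet> y else 0\<bar> \<le> r" by simp
    moreover have "x = (\<Sum>y\<in>b. (if y \<in> b then x \<bullet> y else 0) *\<^sub>R y)"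
      by (subst f) (rule sum.cong, auto simp: fy)
    ultimately show "x \<in> {\<Sum>y\<in>b. f y *\<^sub>R y | f. \<forall>y. \<bar>f y\<bar> \<le> r}"
      by (intro CollectI exI[of _ "\<lambda>y. if y \<in> b then x \<bullet> y else 0"] conjI)
  qed
  then have "?K \<inter> cball 0 r = cball 0 r" by (rule Int_absorb1)
  then have "compact (cball (0::'e) r)" using compact_Int_closed[OF K closed_cball[of 0 r]] by simp
  then have "compact ((+) c ` cball 0 r)" by (rule compact_translation)
  then show ?thesis by simp
qed

section \<open>Charts and the algebra of smooth functions\<close>

lemma smooth_manifold_chart:
  assumes "smooth_manifold \<A>" "(U, \<phi>) \<in> \<A>"
  shows "open U" "open (\<phi> ` U)" "inj_on \<phi> U" "\<exists>\<eta>. homeomorphism U (\<phi> ` U) \<phi> \<eta>"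
proof -
  show o: "open U" "open (\<phi> ` U)" and h: "\<exists>\<eta>. homeomorphism U (\<phi> ` U) \<phi> \<eta>"
    using assms by (auto simp: smooth_manifold_def)
  show "inj_on \<phi> U" using h by (metis homeomorphism_apply1 inj_onI)
qed

lemma chart_image_open:
  assumes "smooth_manifold \<A>" "(U, \<phi>) \<in> \<A>" "open W"
  shows "open (\<phi> ` (U \<inter> W))"
proof -
  obtain \<eta> where "homeomorphism U (\<phi> ` U) \<phi> \<eta>" using smooth_manifold_chart[OF assms(1,2)] by blast
  moreover have "openin (top_of_set U) (U \<inter> W)" using assms(3) by (rule openin_open_Int)
  ultimately have "openin (top_of_set (\<phi> ` U)) (\<phi> ` (U \<inter> W))"
    by (rule homeomorphism_imp_open_map)
  then show ?thesis
    using smooth_manifold_chart(2)[OF assms(1,2)] by (rule openin_open_trans)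
qed

lemma smooth_funI:
  "(\<And>U \<phi>. (U, \<phi>) \<in> \<A> \<Longrightarrow> Cinf_on (\<phi> ` (U \<inter> W)) (f \<circ> inv_into U \<phi>)) \<Longrightarrow> smooth_fun \<A> W f"
  unfolding smooth_fun_def by blast

lemma smooth_funD:
  "smooth_fun \<A> W f \<Longrightarrow> (U, \<phi>) \<in> \<A> \<Longrightarrow> Cinf_on (\<phi> ` (U \<inter> W)) (f \<circ> inv_into U \<phi>)"
  unfolding smooth_fun_def by blast

lemma smooth_fun_mono: "smooth_fun \<A> W f \<Longrightarrow> W' \<subseteq> W \<Longrightarrow> smooth_fun \<A> W' f"
  by (rule smooth_funI, erule Cinf_on_mono[OF smooth_funD]) auto

lemma smooth_fun_const: "smooth_fun \<A> W (\<lambda>_. c)"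
  by (rule smooth_funI) (simp add: o_def Cinf_on_const)

lemma smooth_fun_cong:
  assumes "smooth_manifold \<A>" "open W" "smooth_fun \<A> W f" "\<And>x. x \<in> W \<Longrightarrow> f x = g x"
  shows "smooth_fun \<A> W g"
proof (rule smooth_funI)
  fix U \<phi> assume U: "(U, \<phi>) \<in> \<A>"
  show "Cinf_on (\<phi> ` (U \<inter> W)) (g \<circ> inv_into U \<phi>)"
    by (rule Cinf_on_cong[OF chart_image_open[OF assms(1) U assms(2)] _ smooth_funD[OF assms(3) U]])
      (use smooth_manifold_chart(3)[OF assms(1) U] assms(4) in auto)
qed

lemma smooth_fun_add:
  assumes "smooth_manifold \<A>" "open W" "smooth_fun \<A> W f" "smooth_fun \<A> W g"
  shows "smooth_fun \<A> W (\<lambda>x. f x + g x)"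
proof (rule smooth_funI)
  fix U \<phi> assume U: "(U, \<phi>) \<in> \<A>"
  show "Cinf_on (\<phi> ` (U \<inter> W)) ((\<lambda>x. f x + g x) \<circ> inv_into U \<phi>)"
    using Cinf_on_add[OF chart_image_open[OF assms(1) U assms(2)] smooth_funD[OF assms(3) U] smooth_funD[OF assms(4) U]]
    by (simp add: o_def)
qed

lemma smooth_fun_mult:
  assumes "smooth_manifold \<A>" "open W" "smooth_fun \<A> W f" "smooth_fun \<A> W g"
  shows "smooth_fun \<A> W (\<lambda>x. f x * g x)"
proof (rule smooth_funI)
  fix U \<phi> assume U: "(U, \<phi>) \<in> \<A>"
  show "Cinf_on (\<phi> ` (U \<inter> W)) ((\<lambda>x. f x * g x) \<circ> inv_into U \<phi>)"
    using Cinf_on_mult[OF chart_image_open[OF assms(1) U assms(2)] smooth_funD[OF assms(3) U] smooth_funD[OF assms(4) U]]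
    by (simp add: o_def)
qed

lemma smooth_fun_uminus:
  "smooth_manifold \<A> \<Longrightarrow> open W \<Longrightarrow> smooth_fun \<A> W f \<Longrightarrow> smooth_fun \<A> W (\<lambda>x. - f x)"
  using smooth_fun_mult[OF _ _ smooth_fun_const[of _ _ "-1"]] by fastforce

lemma smooth_fun_diff:
  "smooth_manifold \<A> \<Longrightarrow> open W \<Longrightarrow> smooth_fun \<A> W f \<Longrightarrow> smooth_fun \<A> W g \<Longrightarrow> smooth_fun \<A> W (\<lambda>x. f x - g x)"
  using smooth_fun_add[OF _ _ _ smooth_fun_uminus] by fastforce

lemma smooth_fun_sum:
  assumes "smooth_manifold \<A>" "open W" "\<And>i. i \<in> I \<Longrightarrow> smooth_fun \<A> W (f i)"
  shows "smooth_fun \<A> W (\<lambda>x. \<Sum>i\<in>I. f i x)"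
  using assms(3)
proof (induction I rule: infinite_finite_induct)
  case (insert i I)
  then show ?case
    using smooth_fun_add[OF assms(1,2), of "f i" "\<lambda>x. \<Sum>i\<in>I. f i x"] by simp
qed (simp_all add: smooth_fun_const)

lemma smooth_fun_compose_real:
  assumes "smooth_manifold \<A>" "open W" "smooth_fun \<A> W f" "open T" "Cinf_on T g" "\<And>x. x \<in> W \<Longrightarrow> f x \<in> T"
  shows "smooth_fun \<A> W (\<lambda>x. g (f x))"
proof (rule smooth_funI)
  fix U \<phi> assume U: "(U, \<phi>) \<in> \<A>"
  have "(f \<circ> inv_into U \<phi>) ` \<phi> ` (U \<inter> W) \<subseteq> T"
    using smooth_manifold_chart(3)[OF assms(1) U] assms(6) by auto
  from Cinf_on_compose_real[OF chart_image_open[OF assms(1) U assms(2)] assms(4) this assms(5) smooth_funD[OF assms(3) U]]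
  show "Cinf_on (\<phi> ` (U \<inter> W)) ((\<lambda>x. g (f x)) \<circ> inv_into U \<phi>)"
    by (simp add: o_def)
qed

lemma smooth_fun_inverse:
  assumes "smooth_manifold \<A>" "open W" "smooth_fun \<A> W f" "\<And>x. x \<in> W \<Longrightarrow> f x \<noteq> 0"
  shows "smooth_fun \<A> W (\<lambda>x. inverse (f x))"
  by (rule smooth_fun_compose_real[OF assms(1-3) _ Cinf_on_inverse]) (use assms(4) in auto)

lemma smooth_fun_ln_abs:
  assumes "smooth_manifold \<A>" "open W" "smooth_fun \<A> W f" "\<And>x. x \<in> W \<Longrightarrow> f x \<noteq> 0"
  shows "smooth_fun \<A> W (\<lambda>x. ln \<bar>f x\<bar>)"
  by (rule smooth_fun_compose_real[OF assms(1-3) _ Cinf_on_ln_abs]) (use assms(4) in auto)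

lemma smooth_fun_local:
  assumes "smooth_manifold \<A>" "\<And>x. x \<in> W \<Longrightarrow> \<exists>V. open V \<and> x \<in> V \<and> smooth_fun \<A> V f"
  shows "smooth_fun \<A> W f"
proof (rule smooth_funI)
  fix U \<phi> assume U: "(U, \<phi>) \<in> \<A>"
  show "Cinf_on (\<phi> ` (U \<inter> W)) (f \<circ> inv_into U \<phi>)"
  proof (rule Cinf_on_local)
    fix y assume "y \<in> \<phi> ` (U \<inter> W)"
    then obtain x where x: "x \<in> U" "x \<in> W" "y = \<phi> x" by blast
    then obtain V where V: "open V" "x \<in> V" "smooth_fun \<A> V f" using assms(2) by blast
    show "\<exists>T. open T \<and> y \<in> T \<and> Cinf_on T (f \<circ> inv_into U \<phi>)"
      using chart_image_open[OF assms(1) U V(1)] smooth_funD[OF V(3) U] x V(2)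
      by (intro exI[of _ "\<phi> ` (U \<inter> V)"]) auto
  qed
qed

text \<open>On the part of \<open>U\<close> in \<open>V\<close> the function is a product of smooth
  functions, off \<open>C\<close> it is zero, and these two open sets cover \<open>V\<close> as
  \<open>C\<close> lies in \<open>U\<close>.\<close>

lemma smooth_fun_extend_by_zero:
  assumes "smooth_manifold \<A>" "open U" "open V" "smooth_fun \<A> (U \<inter> V) f" "smooth_fun \<A> V \<beta>"
    "closed C" "C \<subseteq> U" "\<And>x. x \<notin> C \<Longrightarrow> \<beta> x = 0"
  shows "smooth_fun \<A> V (\<lambda>x. if x \<in> U then \<beta> x * f x else 0)"
proof (rule smooth_fun_local[OF assms(1)])
  fix x assume "x \<in> V"
  show "\<exists>T. open T \<and> x \<in> T \<and> smooth_fun \<A> T (\<lambda>x. if x \<in> U then \<beta> x * f x else 0)"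
  proof (cases "x \<in> U")
    case True
    have "smooth_fun \<A> (U \<inter> V) (\<lambda>x. \<beta> x * f x)"
      by (rule smooth_fun_mult[OF assms(1) _ smooth_fun_mono[OF assms(5)] assms(4)]) (use assms in auto)
    then have "smooth_fun \<A> (U \<inter> V) (\<lambda>x. if x \<in> U then \<beta> x * f x else 0)"
      by (rule smooth_fun_cong[OF assms(1) _ , rotated]) (use assms in auto)
    then show ?thesis using assms(2,3) True \<open>x \<in> V\<close> by (intro exI[of _ "U \<inter> V"]) auto
  next
    case False
    have "smooth_fun \<A> (- C) (\<lambda>x. if x \<in> U then \<beta> x * f x else 0)"
      by (rule smooth_fun_cong[OF assms(1) _ smooth_fun_const[of _ _ 0]]) (use assms in auto)
    then show ?thesis using assms(6,7) False by (intro exI[of _ "- C"]) auto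
  qed
qed

text \<open>The step function is applied to the squared distance from the centre in a chart, which
  unlike the distance is smooth at the centre. The set \<open>C\<close> outside which the result
  vanishes is the pull-back of a closed ball inside the image of the chart.\<close>

lemma bump_function:
  assumes M: "smooth_manifold \<A>" and "open W" "p \<in> W"
  obtains \<beta> C V where "smooth_fun \<A> UNIV \<beta>" "closed C" "C \<subseteq> W" "open V" "p \<in> V" "V \<subseteq> C"
    "\<And>x. x \<in> V \<Longrightarrow> \<beta> x = 1" "\<And>x. x \<notin> C \<Longrightarrow> \<beta> x = 0"
proof -
  have "p \<in> \<Union> (fst ` \<A>)" using M by (simp add: smooth_manifold_def)
  then obtain U \<phi> where U: "(U, \<phi>) \<in> \<A>" "p \<in> U" by auto
  note ch = smooth_manifold_chart[OF M U(1)]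
  obtain \<eta> where \<eta>: "homeomorphism U (\<phi> ` U) \<phi> \<eta>" using ch(4) by blast
  have "open (\<phi> ` (U \<inter> W))" by (rule chart_image_open[OF M U(1) assms(2)])
  moreover have "\<phi> p \<in> \<phi> ` (U \<inter> W)" using U assms by auto
  ultimately obtain r where r: "r > 0" "cball (\<phi> p) r \<subseteq> \<phi> ` (U \<inter> W)"
    by (meson open_contains_cball)
  obtain B :: "'b set" where "finite B" "span B = UNIV" using M unfolding smooth_manifold_def by blast
  then have comp: "compact (cball (\<phi> p) r)" by (rule compact_cball_finite_span)
  define C where "C = \<eta> ` cball (\<phi> p) r"
  have "continuous_on (cball (\<phi> p) r) \<eta>"
    by (rule continuous_on_subset[OF homeomorphism_cont2[OF \<eta>]]) (use r(2) in auto)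
  \<comment> \<open>A set closed in the chart domain may fail to be closed in the manifold; a
    compact one is closed by the Hausdorff property.\<close>
  then have "compact C" unfolding C_def using comp by (intro compact_continuous_image)
  then have C: "closed C" by (rule compact_imp_closed)
  have CW: "C \<subseteq> U \<inter> W"
  proof
    fix x assume "x \<in> C"
    then obtain y where y: "y \<in> cball (\<phi> p) r" "x = \<eta> y" unfolding C_def by blast
    then obtain z where "z \<in> U \<inter> W" "y = \<phi> z" using r(2) by blast
    then show "x \<in> U \<inter> W" using y homeomorphism_apply1[OF \<eta>] by auto
  qed
  have inC: "x \<in> C" if "x \<in> U" "\<phi> x \<in> cball (\<phi> p) r" for x
    unfolding C_def using that homeomorphism_apply1[OF \<eta> that(1)] by force
  define V where "V = U \<inter> \<phi> -` ball (\<phi> p) (r / 2)"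
  have V: "open V" "p \<in> V"
    unfolding V_def using U r continuous_open_preimage[OF homeomorphism_cont1[OF \<eta>] ch(1) open_ball]
    by auto
  have VC: "V \<subseteq> C"
    unfolding V_def using inC r(1) by auto
  have "(r / 2)\<^sup>2 < r\<^sup>2" using r(1) by (simp add: power_divide)
  then obtain h :: "real \<Rightarrow> real"
    where h: "Cinf_on UNIV h" "\<And>t. t \<le> (r / 2)\<^sup>2 \<Longrightarrow> h t = 1" "\<And>t. t \<ge> r\<^sup>2 \<Longrightarrow> h t = 0"
    by (rule smooth_step_exists) blast
  \<comment> \<open>The squared distance, as an inner product of sums with an opposite vector, so
    that \<open>Cinf_on_add\<close> and \<open>Cinf_on_bilinear\<close> apply to it. The thresholds
    of the step function are squared accordingly.\<close>
  define q where "q x = (\<phi> x + - \<phi> p) \<bullet> (\<phi> x + - \<phi> p)" for x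
  have q: "q x = (dist (\<phi> p) (\<phi> x))\<^sup>2" for x
    by (simp add: q_def dist_norm norm_minus_commute power2_norm_eq_inner[symmetric] del: power2_norm_eq_inner)
  define \<beta> where "\<beta> x = (if x \<in> U then h (q x) else 0)" for x
  have out: "\<beta> x = 0" if "x \<notin> C" for x
  proof (cases "x \<in> U")
    case True
    then have "dist (\<phi> p) (\<phi> x) \<ge> r" using inC[OF True] that by (metis linear mem_cball)
    then have "q x \<ge> r\<^sup>2" using r(1) by (simp add: q power_mono)
    then show ?thesis by (simp add: \<beta>_def h)
  qed (simp add: \<beta>_def)
  have inn: "\<beta> x = 1" if "x \<in> V" for x
  proof -
    have "x \<in> U" "dist (\<phi> p) (\<phi> x) \<le> r / 2" using that by (auto simp: V_def)
    then show ?thesis by (simp add: \<beta>_def h q power_mono)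
  qed
  have qs: "smooth_fun \<A> U q"
  proof (rule smooth_funI)
    fix U' \<phi>' assume U': "(U', \<phi>') \<in> \<A>"
    have o: "open (\<phi>' ` (U' \<inter> U))" by (rule chart_image_open[OF M U' ch(1)])
    have "Cinf_on (\<phi>' ` (U' \<inter> U)) (\<phi> \<circ> inv_into U' \<phi>')"
      using M U(1) U' unfolding smooth_manifold_def by fast
    from Cinf_on_add[OF o this Cinf_on_const[of _ "- \<phi> p"]]
    have d: "Cinf_on (\<phi>' ` (U' \<inter> U)) (\<lambda>y. \<phi> (inv_into U' \<phi>' y) + - \<phi> p)" by (simp add: o_def)
    from Cinf_on_bilinear[OF o bounded_bilinear_inner this this]
    show "Cinf_on (\<phi>' ` (U' \<inter> U)) (q \<circ> inv_into U' \<phi>')" by (simp add: o_def q_def)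
  qed
  have sU: "smooth_fun \<A> U \<beta>"
    by (rule smooth_fun_cong[OF M ch(1) smooth_fun_compose_real[OF M ch(1) qs open_UNIV h(1)]])
      (simp_all add: \<beta>_def)
  have sC: "smooth_fun \<A> (- C) \<beta>"
    by (rule smooth_fun_cong[OF M _ smooth_fun_const[of _ _ 0]]) (use C out in auto)
  have "smooth_fun \<A> UNIV \<beta>"
  proof (rule smooth_fun_local[OF M])
    fix x
    show "\<exists>V. open V \<and> x \<in> V \<and> smooth_fun \<A> V \<beta>"
    proof (cases "x \<in> U")
      case True
      then show ?thesis using sU ch(1) by (intro exI[of _ U]) simp
    next
      case False
      then show ?thesis using sC C CW by (intro exI[of _ "- C"]) auto
    qed
  qed
  then show thesis
    by (rule that[OF _ C _ V VC inn out]) (use CW in auto)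
qed

section \<open>Local frames and duality\<close>

lemma sum_fun_apply: "(\<Sum>i\<in>I. f i) x = (\<Sum>i\<in>I. f i x)"
  by (induction I rule: infinite_finite_induct) auto

lemma scaleR_fun_apply [simp]: "(c *\<^sub>R f) x = c *\<^sub>R f x"
  by (simp add: scaleR_fun_def)

lemma dual_bundle_simps [simp]:
  "atlas (dual_bundle E) = atlas E"
  "vrank (dual_bundle E) = vrank E"
  "frames (dual_bundle E) =
     (\<lambda>(U, e). (U, \<lambda>i p u. representation ((\<lambda>j. e j p) ` {..<vrank E}) u (e i p))) ` frames E"
  by (simp_all add: dual_bundle_def)

lemma dual_fibre_iff:
  "\<xi> \<in> fibre (dual_bundle E) p \<longleftrightarrow>
     (\<forall>u\<in>fibre E p. \<forall>v\<in>fibre E p. \<xi> (u + v) = \<xi> u + \<xi> v) \<and>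
     (\<forall>c. \<forall>u\<in>fibre E p. \<xi> (c *\<^sub>R u) = c * \<xi> u) \<and> (\<forall>u. u \<notin> fibre E p \<longrightarrow> \<xi> u = 0)"
  by (simp add: dual_bundle_def)

text \<open>Fixed over an arbitrary record scheme, so that the same facts apply to an algebroid and,
  through \<open>vbundle_dual\<close>, to its dual bundle.\<close>

locale vbundle =
  fixes E :: "('m::{t2_space,second_countable_topology}, 'e::real_inner, 'v::real_vector, 'z) vbundle_scheme"
  assumes VB: "vector_bundle E"
begin

abbreviation "N \<equiv> vrank E"
abbreviation "smooth \<equiv> smooth_fun (atlas E) UNIV"
abbreviation "sec \<equiv> smooth_section E"
abbreviation "cosec \<equiv> smooth_section (dual_bundle E)"
abbreviation "cofibre \<equiv> fibre (dual_bundle E)"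

text \<open>The dual frame exactly as it is built into \<open>dual_bundle\<close>, so that each
  frame of the dual bundle is of the form \<open>coord e\<close>.\<close>

definition coord :: "(nat \<Rightarrow> 'm \<Rightarrow> 'v) \<Rightarrow> nat \<Rightarrow> 'm \<Rightarrow> 'v \<Rightarrow> real" where
  "coord e i p u = representation ((\<lambda>j. e j p) ` {..<N}) u (e i p)"

lemma frames_dual: "(U, d) \<in> frames (dual_bundle E) \<longleftrightarrow> (\<exists>e. (U, e) \<in> frames E \<and> d = coord e)"
proof -
  have "coord e = (\<lambda>i p u. representation ((\<lambda>j. e j p) ` {..<N}) u (e i p))" for e
    by (intro ext) (simp add: coord_def)
  then have fr: "frames (dual_bundle E) = (\<lambda>(U, e). (U, coord e)) ` frames E"
    by simp
  show ?thesis
    unfolding fr by (safe, blast) (rule rev_image_eqI, auto)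
qed

lemma manifold: "smooth_manifold (atlas E)"
  using VB by (simp add: vector_bundle_def)

lemma frame_cover: obtains U e where "(U, e) \<in> frames E" "p \<in> U"
proof -
  have "p \<in> \<Union> (fst ` frames E)" using VB by (simp add: vector_bundle_def)
  then show thesis using that by auto
qed

lemma frame:
  assumes "(U, e) \<in> frames E"
  shows "open U"
    "\<And>p. p \<in> U \<Longrightarrow> inj_on (\<lambda>i. e i p) {..<N}"
    "\<And>p. p \<in> U \<Longrightarrow> independent ((\<lambda>i. e i p) ` {..<N})"
    "\<And>p. p \<in> U \<Longrightarrow> span ((\<lambda>i. e i p) ` {..<N}) = fibre E p"
  using VB assms by (auto simp: vector_bundle_def)

lemma frame_transition:
  assumes "(U, e) \<in> frames E" "(V, e') \<in> frames E"
  obtains g where "\<And>i j. i < N \<Longrightarrow> j < N \<Longrightarrow> smooth_fun (atlas E) (U \<inter> V) (g i j)"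
    "\<And>p j. p \<in> U \<Longrightarrow> p \<in> V \<Longrightarrow> j < N \<Longrightarrow> e' j p = (\<Sum>i<N. g i j p *\<^sub>R e i p)"
proof -
  have "\<forall>(U, e)\<in>frames E. \<forall>(V, e')\<in>frames E.
        \<exists>g. (\<forall>i<N. \<forall>j<N. smooth_fun (atlas E) (U \<inter> V) (g i j)) \<and>
            (\<forall>p\<in>U \<inter> V. \<forall>j<N. e' j p = (\<Sum>i<N. g i j p *\<^sub>R e i p))"
    using VB unfolding vector_bundle_def by (elim conjE)
  from bspec[OF bspec[OF this assms(1), unfolded prod.case] assms(2), unfolded prod.case]
  obtain g where "\<forall>i<N. \<forall>j<N. smooth_fun (atlas E) (U \<inter> V) (g i j)"
    "\<forall>p\<in>U \<inter> V. \<forall>j<N. e' j p = (\<Sum>i<N. g i j p *\<^sub>R e i p)" by blast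
  then show thesis by (intro that[of g]) blast+
qed

lemma fibre_subspace: "subspace (fibre E p)"
proof -
  obtain U e where e: "(U, e) \<in> frames E" "p \<in> U" by (rule frame_cover)
  show ?thesis unfolding frame(4)[OF e, symmetric] by (rule subspace_span)
qed

lemma fibre_simps [simp, intro]:
  "0 \<in> fibre E p"
  "u \<in> fibre E p \<Longrightarrow> v \<in> fibre E p \<Longrightarrow> u + v \<in> fibre E p"
  "u \<in> fibre E p \<Longrightarrow> v \<in> fibre E p \<Longrightarrow> u - v \<in> fibre E p"
  "u \<in> fibre E p \<Longrightarrow> c *\<^sub>R u \<in> fibre E p"
  "u \<in> fibre E p \<Longrightarrow> - u \<in> fibre E p"
  by (simp_all add: subspace_0[OF fibre_subspace] subspace_add[OF fibre_subspace]
      subspace_diff[OF fibre_subspace] subspace_scale[OF fibre_subspace] subspace_neg[OF fibre_subspace])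

lemma fibre_sum: "(\<And>i. i \<in> I \<Longrightarrow> f i \<in> fibre E p) \<Longrightarrow> (\<Sum>i\<in>I. f i) \<in> fibre E p"
  by (rule subspace_sum[OF fibre_subspace])

lemma frame_in_fibre: "(U, e) \<in> frames E \<Longrightarrow> p \<in> U \<Longrightarrow> i < N \<Longrightarrow> e i p \<in> fibre E p"
  by (subst frame(4)[symmetric]) (auto intro: span_base)

lemma cofibreD:
  assumes "\<xi> \<in> cofibre p"
  shows "u \<in> fibre E p \<Longrightarrow> v \<in> fibre E p \<Longrightarrow> \<xi> (u + v) = \<xi> u + \<xi> v"
    "u \<in> fibre E p \<Longrightarrow> \<xi> (c *\<^sub>R u) = c * \<xi> u"
    "u \<notin> fibre E p \<Longrightarrow> \<xi> u = 0"
    "\<xi> 0 = 0"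
    "u \<in> fibre E p \<Longrightarrow> \<xi> (- u) = - \<xi> u"
    "u \<in> fibre E p \<Longrightarrow> v \<in> fibre E p \<Longrightarrow> \<xi> (u - v) = \<xi> u - \<xi> v"
proof -
  show add: "u \<in> fibre E p \<Longrightarrow> v \<in> fibre E p \<Longrightarrow> \<xi> (u + v) = \<xi> u + \<xi> v"
    and sc: "u \<in> fibre E p \<Longrightarrow> \<xi> (c *\<^sub>R u) = c * \<xi> u"
    and "u \<notin> fibre E p \<Longrightarrow> \<xi> u = 0" for u v c
    using assms by (auto simp: dual_fibre_iff)
  show "\<xi> 0 = 0" using sc[of 0 0] by simp
  show m: "u \<in> fibre E p \<Longrightarrow> \<xi> (- u) = - \<xi> u" for u using sc[of u "-1"] by simp
  show "u \<in> fibre E p \<Longrightarrow> v \<in> fibre E p \<Longrightarrow> \<xi> (u - v) = \<xi> u - \<xi> v"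
    using add[of u "- v"] m[of v] by simp
qed

lemma cofibre_sum:
  assumes "\<xi> \<in> cofibre p" "\<And>i. i \<in> I \<Longrightarrow> v i \<in> fibre E p"
  shows "\<xi> (\<Sum>i\<in>I. c i *\<^sub>R v i) = (\<Sum>i\<in>I. c i * \<xi> (v i))"
  using assms(2)
proof (induction I rule: infinite_finite_induct)
  case (insert i I)
  then show ?case
    using cofibreD(1)[OF assms(1), of "c i *\<^sub>R v i" "\<Sum>i\<in>I. c i *\<^sub>R v i"] cofibreD(2)[OF assms(1), of "v i" "c i"]
    by (simp add: fibre_sum)
qed (simp_all add: cofibreD(4)[OF assms(1)])

lemma coord_facts:
  assumes "(U, e) \<in> frames E" "p \<in> U"
  shows "u \<in> fibre E p \<Longrightarrow> u = (\<Sum>i<N. coord e i p u *\<^sub>R e i p)"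
    and "i < N \<Longrightarrow> j < N \<Longrightarrow> coord e i p (e j p) = (if i = j then 1 else 0)"
    and "coord e i p \<in> cofibre p"
proof -
  let ?B = "(\<lambda>j. e j p) ` {..<N}"
  note f = frame[OF assms(1)]
  have ind: "independent ?B" and sp: "span ?B = fibre E p" and inj: "inj_on (\<lambda>i. e i p) {..<N}"
    using f(2-4)[OF assms(2)] by auto
  show "u \<in> fibre E p \<Longrightarrow> u = (\<Sum>i<N. coord e i p u *\<^sub>R e i p)"
  proof -
    assume "u \<in> fibre E p"
    then have "(\<Sum>b\<in>?B. representation ?B u b *\<^sub>R b) = u"
      using sum_representation_eq[OF ind, of u ?B] sp by simp
    moreover have "(\<Sum>b\<in>?B. representation ?B u b *\<^sub>R b) = (\<Sum>i<N. coord e i p u *\<^sub>R e i p)"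
      by (simp add: sum.reindex[OF inj] coord_def)
    ultimately show "u = (\<Sum>i<N. coord e i p u *\<^sub>R e i p)" by (rule subst)
  qed
  show "i < N \<Longrightarrow> j < N \<Longrightarrow> coord e i p (e j p) = (if i = j then 1 else 0)"
  proof -
    assume ij: "i < N" "j < N"
    then have "e i p = e j p \<longleftrightarrow> i = j" using inj by (auto simp: inj_on_def)
    then show "coord e i p (e j p) = (if i = j then 1 else 0)"
      using representation_basis[OF ind, of "e j p"] ij by (simp add: coord_def)
  qed
  show "coord e i p \<in> cofibre p"
    unfolding dual_fibre_iff sp[symmetric]
    using representation_add[OF ind] representation_scale[OF ind]
    by (auto simp: coord_def representation_def)
qed

text \<open>The equation is one between functions on all of \<open>'v\<close>: outside the fibre
  both sides vanish, by the convention on covectors in \<open>dual_bundle\<close>.\<close>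

lemma cofibre_expand:
  assumes "(U, e) \<in> frames E" "p \<in> U" "\<xi> \<in> cofibre p"
  shows "\<xi> = (\<Sum>i<N. \<xi> (e i p) *\<^sub>R coord e i p)"
proof
  fix u
  show "\<xi> u = (\<Sum>i<N. \<xi> (e i p) *\<^sub>R coord e i p) u"
  proof (cases "u \<in> fibre E p")
    case True
    have "\<xi> u = \<xi> (\<Sum>i<N. coord e i p u *\<^sub>R e i p)"
      using coord_facts(1)[OF assms(1,2) True] by simp
    also have "\<dots> = (\<Sum>i<N. coord e i p u * \<xi> (e i p))"
      by (rule cofibre_sum[OF assms(3)]) (use frame_in_fibre[OF assms(1,2)] in auto)
    finally show ?thesis by (simp add: sum_fun_apply mult.commute)
  next
    case False
    then show ?thesis
      using cofibreD(3)[OF assms(3)] cofibreD(3)[OF coord_facts(3)[OF assms(1,2)]]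
      by (simp add: sum_fun_apply)
  qed
qed

lemma cofibre_subspace: "subspace (cofibre p)"
  unfolding subspace_def by (auto simp: dual_fibre_iff algebra_simps)

lemma vector_bundle_dual: "vector_bundle (dual_bundle E)"
  unfolding vector_bundle_def
proof (intro conjI ballI)
  show "smooth_manifold (atlas (dual_bundle E))" using manifold by simp
  show "\<Union> (fst ` frames (dual_bundle E)) = UNIV"
    using VB by (force simp: vector_bundle_def image_image case_prod_unfold)
next
  fix Ud assume "Ud \<in> frames (dual_bundle E)"
  moreover obtain U d where Ud: "Ud = (U, d)" by (cases Ud)
  ultimately obtain e where e: "(U, e) \<in> frames E" "d = coord e" by (auto simp del: dual_bundle_simps simp: frames_dual)
  have "open U" by (rule frame(1)[OF e(1)])
  moreover have "inj_on (\<lambda>i. d i p) {..<N} \<and> independent ((\<lambda>i. d i p) ` {..<N}) \<and>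
      span ((\<lambda>i. d i p) ` {..<N}) = cofibre p" if p: "p \<in> U" for p
  proof (intro conjI)
    note cf = coord_facts[OF e(1) p]
    have c: "c j = 0" if "(\<Sum>i<N. c i *\<^sub>R d i p) = 0" "j < N" for c j
    proof -
      have "(\<Sum>i<N. c i *\<^sub>R d i p) (e j p) = (\<Sum>i<N. if i = j then c i else 0)"
        unfolding sum_fun_apply by (rule sum.cong) (use that(2) cf(2) e(2) in auto)
      then show ?thesis using that by simp
    qed
    show inj: "inj_on (\<lambda>i. d i p) {..<N}"
    proof (rule inj_onI)
      fix i j assume ij: "i \<in> {..<N}" "j \<in> {..<N}" "d i p = d j p"
      then have "coord e i p (e i p) = coord e j p (e i p)" using e(2) by simp
      then show "i = j" using cf(2)[of i i] cf(2)[of j i] ij by (auto split: if_splits)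
    qed
    show "independent ((\<lambda>i. d i p) ` {..<N})"
    proof (rule independent_if_scalars_zero)
      fix f x assume f: "(\<Sum>x\<in>(\<lambda>i. d i p) ` {..<N}. f x *\<^sub>R x) = 0" "x \<in> (\<lambda>i. d i p) ` {..<N}"
      then obtain j where j: "x = d j p" "j < N" by auto
      have "(\<Sum>i<N. f (d i p) *\<^sub>R d i p) = 0"
        using f(1) sum.reindex[OF inj, of "\<lambda>x. f x *\<^sub>R x"] by (simp add: o_def)
      from c[OF this j(2)] show "f x = 0" using j by simp
    qed simp
    show "span ((\<lambda>i. d i p) ` {..<N}) = cofibre p"
    proof
      show "span ((\<lambda>i. d i p) ` {..<N}) \<subseteq> cofibre p"
        by (rule span_minimal[OF _ cofibre_subspace]) (use cf(3) e(2) in auto)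
      show "cofibre p \<subseteq> span ((\<lambda>i. d i p) ` {..<N})"
      proof
        fix \<xi> assume "\<xi> \<in> cofibre p"
        from cofibre_expand[OF e(1) p this] e(2) have "\<xi> = (\<Sum>i<N. \<xi> (e i p) *\<^sub>R d i p)" by simp
        moreover have "(\<Sum>i<N. \<xi> (e i p) *\<^sub>R d i p) \<in> span ((\<lambda>i. d i p) ` {..<N})"
          by (intro span_sum span_scale span_base) auto
        ultimately show "\<xi> \<in> span ((\<lambda>i. d i p) ` {..<N})" by simp
      qed
    qed
  qed
  ultimately show "case Ud of (U, e) \<Rightarrow> open U \<and>
        (\<forall>p\<in>U. inj_on (\<lambda>i. e i p) {..<vrank (dual_bundle E)} \<and>
               independent ((\<lambda>i. e i p) ` {..<vrank (dual_bundle E)}) \<and>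
               span ((\<lambda>i. e i p) ` {..<vrank (dual_bundle E)}) = cofibre p)"
    unfolding Ud by (simp del: dual_bundle_simps(3))
next
  fix Ud assume Ud_in: "Ud \<in> frames (dual_bundle E)"
  show "case Ud of (U, e) \<Rightarrow> \<forall>(V, e')\<in>frames (dual_bundle E).
        \<exists>g. (\<forall>i<vrank (dual_bundle E). \<forall>j<vrank (dual_bundle E).
               smooth_fun (atlas (dual_bundle E)) (U \<inter> V) (g i j)) \<and>
            (\<forall>p\<in>U \<inter> V. \<forall>j<vrank (dual_bundle E). e' j p = (\<Sum>i<vrank (dual_bundle E). g i j p *\<^sub>R e i p))"
  proof (unfold split_beta, rule ballI)
  fix Vd assume "Vd \<in> frames (dual_bundle E)"
  note Ud_in this
  moreover obtain U d V d' where UV: "Ud = (U, d)" "Vd = (V, d')" by (cases Ud; cases Vd)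
  ultimately obtain e e' where e: "(U, e) \<in> frames E" "d = coord e"
    and e': "(V, e') \<in> frames E" "d' = coord e'"
    by (auto simp del: dual_bundle_simps simp: frames_dual)
  \<comment> \<open>The transition between the given frames is taken in the direction opposite to
    that of the dual frames; its transpose then relates the dual frames, without inverting a
    matrix.\<close>
  obtain g where g: "\<And>i j. i < N \<Longrightarrow> j < N \<Longrightarrow> smooth_fun (atlas E) (V \<inter> U) (g i j)"
    "\<And>p j. p \<in> V \<Longrightarrow> p \<in> U \<Longrightarrow> j < N \<Longrightarrow> e j p = (\<Sum>i<N. g i j p *\<^sub>R e' i p)"
    by (rule frame_transition[OF e'(1) e(1)]) blast
  have "d' j p = (\<Sum>i<N. g j i p *\<^sub>R d i p)" if p: "p \<in> U" "p \<in> V" and j: "j < N" for p j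
  proof -
    have "coord e' j p (e i p) = g j i p" if i: "i < N" for i
    proof -
      have "coord e' j p (e i p) = (\<Sum>k<N. g k i p * coord e' j p (e' k p))"
        unfolding g(2)[OF p(2,1) i]
        by (rule cofibre_sum[OF coord_facts(3)[OF e'(1) p(2)]]) (use frame_in_fibre[OF e'(1) p(2)] in auto)
      also have "\<dots> = (\<Sum>k<N. if k = j then g j i p else 0)"
        by (rule sum.cong) (use coord_facts(2)[OF e'(1) p(2) j] in auto)
      finally show ?thesis using j by simp
    qed
    then show ?thesis
      using cofibre_expand[OF e(1) p(1) coord_facts(3)[OF e'(1) p(2), of j]] e(2) e'(2) by simp
  qed
  then have "\<exists>g. (\<forall>i<N. \<forall>j<N. smooth_fun (atlas E) (U \<inter> V) (g i j)) \<and>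
      (\<forall>p\<in>U \<inter> V. \<forall>j<N. d' j p = (\<Sum>i<N. g i j p *\<^sub>R d i p))"
    using g(1) by (intro exI[of _ "\<lambda>i j. g j i"]) (auto simp: Int_commute)
  then show "\<exists>g. (\<forall>i<vrank (dual_bundle E). \<forall>j<vrank (dual_bundle E).
               smooth_fun (atlas (dual_bundle E)) (fst Ud \<inter> fst Vd) (g i j)) \<and>
            (\<forall>p\<in>fst Ud \<inter> fst Vd. \<forall>j<vrank (dual_bundle E).
               snd Vd j p = (\<Sum>i<vrank (dual_bundle E). g i j p *\<^sub>R snd Ud i p))"
    unfolding UV by simp
  qed
qed

lemma vbundle_dual: "vbundle (dual_bundle E)"
  by (rule vbundle.intro[OF vector_bundle_dual])

lemma smooth_sectionI:
  assumes "\<And>p. s p \<in> fibre E p"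
    "\<And>U e i. (U, e) \<in> frames E \<Longrightarrow> i < N \<Longrightarrow> smooth_fun (atlas E) U (\<lambda>p. coord e i p (s p))"
  shows "sec s"
  unfolding smooth_section_def
proof (intro conjI allI ballI)
  fix Ue assume "Ue \<in> frames E"
  moreover obtain U e where Ue: "Ue = (U, e)" by (cases Ue)
  ultimately have e: "(U, e) \<in> frames E" by simp
  show "case Ue of (U, e) \<Rightarrow> \<exists>c. (\<forall>i<N. smooth_fun (atlas E) U (c i)) \<and>
        (\<forall>p\<in>U. s p = (\<Sum>i<N. c i p *\<^sub>R e i p))"
    unfolding Ue using assms(2)[OF e] coord_facts(1)[OF e _ assms(1)]
    by (auto intro!: exI[of _ "\<lambda>i p. coord e i p (s p)"])
qed (rule assms(1))

lemma secD: "sec s \<Longrightarrow> s p \<in> fibre E p"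
  by (simp add: smooth_section_def)

lemma sec_coord_smooth:
  assumes "sec s" "(U, e) \<in> frames E" "i < N"
  shows "smooth_fun (atlas E) U (\<lambda>p. coord e i p (s p))"
proof -
  obtain c where c: "\<forall>i<N. smooth_fun (atlas E) U (c i)" "\<forall>p\<in>U. s p = (\<Sum>i<N. c i p *\<^sub>R e i p)"
    using assms(1,2) unfolding smooth_section_def by fast
  show ?thesis
  proof (rule smooth_fun_cong[OF manifold frame(1)[OF assms(2)]])
    show "smooth_fun (atlas E) U (c i)" using c assms(3) by simp
    fix p assume p: "p \<in> U"
    have "coord e i p (s p) = (\<Sum>k<N. c k p * coord e i p (e k p))"
      unfolding c(2)[rule_format, OF p]
      by (rule cofibre_sum[OF coord_facts(3)[OF assms(2) p]]) (use frame_in_fibre[OF assms(2) p] in auto)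
    also have "\<dots> = (\<Sum>k<N. if k = i then c i p else 0)"
      by (rule sum.cong) (use coord_facts(2)[OF assms(2) p assms(3)] in auto)
    finally show "c i p = coord e i p (s p)" using assms(3) by simp
  qed
qed

lemma cosecI:
  assumes "\<And>p. \<xi> p \<in> cofibre p"
    "\<And>U e i. (U, e) \<in> frames E \<Longrightarrow> i < N \<Longrightarrow> smooth_fun (atlas E) U (\<lambda>p. \<xi> p (e i p))"
  shows "cosec \<xi>"
  unfolding smooth_section_def
proof (intro conjI allI ballI)
  fix Ue assume "Ue \<in> frames (dual_bundle E)"
  moreover obtain U d where Ue: "Ue = (U, d)" by (cases Ue)
  ultimately obtain e where e: "(U, e) \<in> frames E" "d = coord e"
    by (auto simp del: dual_bundle_simps simp: frames_dual)
  show "case Ue of (U, e) \<Rightarrow> \<exists>c. (\<forall>i<vrank (dual_bundle E). smooth_fun (atlas (dual_bundle E)) U (c i)) \<and>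
        (\<forall>p\<in>U. \<xi> p = (\<Sum>i<vrank (dual_bundle E). c i p *\<^sub>R e i p))"
    unfolding Ue using assms(2)[OF e(1)] cofibre_expand[OF e(1) _ assms(1)] e(2)
    by (auto intro!: exI[of _ "\<lambda>i p. \<xi> p (e i p)"])
qed (rule assms(1))

lemma cosec_frame_smooth:
  assumes "cosec \<xi>" "(U, e) \<in> frames E" "i < N"
  shows "smooth_fun (atlas E) U (\<lambda>p. \<xi> p (e i p))"
proof -
  have "(U, coord e) \<in> frames (dual_bundle E)" using assms(2) frames_dual by blast
  then obtain c where c: "\<forall>i<N. smooth_fun (atlas E) U (c i)" "\<forall>p\<in>U. \<xi> p = (\<Sum>i<N. c i p *\<^sub>R coord e i p)"
    using assms(1) unfolding smooth_section_def by (fastforce simp del: dual_bundle_simps(3))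
  show ?thesis
  proof (rule smooth_fun_cong[OF manifold frame(1)[OF assms(2)]])
    show "smooth_fun (atlas E) U (c i)" using c assms(3) by simp
    fix p assume p: "p \<in> U"
    have "\<xi> p (e i p) = (\<Sum>k<N. c k p * coord e k p (e i p))"
      using c(2) p by (simp add: sum_fun_apply)
    also have "\<dots> = (\<Sum>k<N. if k = i then c i p else 0)"
      by (rule sum.cong) (use coord_facts(2)[OF assms(2) p _ assms(3)] in auto)
    finally show "c i p = \<xi> p (e i p)" using assms(3) by simp
  qed
qed

lemma cosecD: "cosec \<xi> \<Longrightarrow> \<xi> p \<in> cofibre p"
  by (simp add: smooth_section_def)

lemma pairing_smooth:
  assumes "cosec \<xi>" "sec s"
  shows "smooth (\<lambda>p. \<xi> p (s p))"
proof (rule smooth_fun_local[OF manifold])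
  fix p
  obtain U e where e: "(U, e) \<in> frames E" "p \<in> U" by (rule frame_cover)
  have "smooth_fun (atlas E) U (\<lambda>p. \<Sum>i<N. coord e i p (s p) * \<xi> p (e i p))"
    by (intro smooth_fun_sum smooth_fun_mult manifold frame(1)[OF e(1)]
        sec_coord_smooth[OF assms(2) e(1)] cosec_frame_smooth[OF assms(1) e(1)]) auto
  then have "smooth_fun (atlas E) U (\<lambda>p. \<xi> p (s p))"
  proof (rule smooth_fun_cong[OF manifold frame(1)[OF e(1)]])
    fix q assume q: "q \<in> U"
    have "\<xi> q (s q) = \<xi> q (\<Sum>i<N. coord e i q (s q) *\<^sub>R e i q)"
      using coord_facts(1)[OF e(1) q secD[OF assms(2)]] by simp
    then show "(\<Sum>i<N. coord e i q (s q) * \<xi> q (e i q)) = \<xi> q (s q)"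
      using cofibre_sum[OF cosecD[OF assms(1)], of "{..<N}" "\<lambda>i. e i q" q] frame_in_fibre[OF e(1) q] by simp
  qed
  then show "\<exists>V. open V \<and> p \<in> V \<and> smooth_fun (atlas E) V (\<lambda>p. \<xi> p (s p))"
    using e frame(1) by blast
qed

lemma bump_section:
  assumes e: "(U, e) \<in> frames E" "i < N" and h: "smooth h" "closed C" "C \<subseteq> U" "\<And>x. x \<notin> C \<Longrightarrow> h x = 0"
  shows "sec (\<lambda>x. if x \<in> U then h x *\<^sub>R e i x else 0)"
proof (rule smooth_sectionI)
  fix p show "(if p \<in> U then h p *\<^sub>R e i p else 0) \<in> fibre E p"
    using frame_in_fibre[OF e(1) _ e(2)] by auto
next
  fix V e' k assume e': "(V, e') \<in> frames E" "k < N"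
  obtain g where g: "\<And>i j. i < N \<Longrightarrow> j < N \<Longrightarrow> smooth_fun (atlas E) (V \<inter> U) (g i j)"
    "\<And>p j. p \<in> V \<Longrightarrow> p \<in> U \<Longrightarrow> j < N \<Longrightarrow> e j p = (\<Sum>i<N. g i j p *\<^sub>R e' i p)"
    by (rule frame_transition[OF e'(1) e(1)]) blast
  have s: "smooth_fun (atlas E) V (\<lambda>x. if x \<in> U then h x * g k i x else 0)"
    using g(1)[OF e'(2) e(2)] h
    by (intro smooth_fun_extend_by_zero[OF manifold frame(1)[OF e(1)] frame(1)[OF e'(1)]])
      (auto simp: Int_commute intro: smooth_fun_mono)
  show "smooth_fun (atlas E) V (\<lambda>p. coord e' k p (if p \<in> U then h p *\<^sub>R e i p else 0))"
  proof (rule smooth_fun_cong[OF manifold frame(1)[OF e'(1)] s])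
    fix p assume p: "p \<in> V"
    note cf = coord_facts[OF e'(1) p]
    show "(if p \<in> U then h p * g k i p else 0) = coord e' k p (if p \<in> U then h p *\<^sub>R e i p else 0)"
    proof (cases "p \<in> U")
      case True
      have "coord e' k p (e i p) = (\<Sum>l<N. g l i p * coord e' k p (e' l p))"
        unfolding g(2)[OF p True e(2)]
        by (rule cofibre_sum[OF cf(3)]) (use frame_in_fibre[OF e'(1) p] in auto)
      also have "\<dots> = (\<Sum>l<N. if l = k then g k i p else 0)"
        by (rule sum.cong) (use cf(2)[OF e'(2)] in auto)
      finally have "coord e' k p (e i p) = g k i p" using e'(2) by simp
      then show ?thesis using True cofibreD(2)[OF cf(3) frame_in_fibre[OF e(1) True e(2)]] by simp
    next
      case False
      then show ?thesis using cofibreD(4)[OF cf(3)] by simp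
    qed
  qed
qed

text \<open>Near a point, a coordinate of \<open>s\<close> is its pairing with a global section,
  namely the dual frame covector cut off by a bump function. The test suits sections that are known
  only through their pairings.\<close>

lemma sec_by_pairing:
  assumes "\<And>p. s p \<in> fibre E p" "\<And>\<xi>. cosec \<xi> \<Longrightarrow> smooth (\<lambda>p. \<xi> p (s p))"
  shows "sec s"
proof (rule smooth_sectionI[OF assms(1)])
  fix U e i assume e: "(U, e) \<in> frames E" "i < N"
  have d: "(U, coord e) \<in> frames (dual_bundle E)" using e frames_dual by blast
  show "smooth_fun (atlas E) U (\<lambda>p. coord e i p (s p))"
  proof (rule smooth_fun_local[OF manifold])
    fix p assume p: "p \<in> U"
    obtain h C V where h: "smooth h" "closed C" "C \<subseteq> U" "open V" "p \<in> V" "V \<subseteq> C"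
      "\<And>x. x \<in> V \<Longrightarrow> h x = 1" "\<And>x. x \<notin> C \<Longrightarrow> h x = 0"
      by (rule bump_function[OF manifold frame(1)[OF e(1)] p]) blast
    have "cosec (\<lambda>x. if x \<in> U then h x *\<^sub>R coord e i x else 0)"
      by (rule vbundle.bump_section[OF vbundle_dual d]) (use e h in auto)
    from assms(2)[OF this]
    have "smooth_fun (atlas E) V (\<lambda>p. (if p \<in> U then h p *\<^sub>R coord e i p else 0) (s p))"
      by (rule smooth_fun_mono) simp
    then have "smooth_fun (atlas E) V (\<lambda>p. coord e i p (s p))"
      by (rule smooth_fun_cong[OF manifold h(4)]) (use h in auto)
    then show "\<exists>V. open V \<and> p \<in> V \<and> smooth_fun (atlas E) V (\<lambda>p. coord e i p (s p))"
      using h by blast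
  qed
qed

lemma cosec_by_pairing:
  assumes "\<And>p. \<xi> p \<in> cofibre p" "\<And>s. sec s \<Longrightarrow> smooth (\<lambda>p. \<xi> p (s p))"
  shows "cosec \<xi>"
proof (rule cosecI[OF assms(1)])
  fix U e i assume e: "(U, e) \<in> frames E" "i < N"
  show "smooth_fun (atlas E) U (\<lambda>p. \<xi> p (e i p))"
  proof (rule smooth_fun_local[OF manifold])
    fix p assume p: "p \<in> U"
    obtain h C V where h: "smooth h" "closed C" "C \<subseteq> U" "open V" "p \<in> V" "V \<subseteq> C"
      "\<And>x. x \<in> V \<Longrightarrow> h x = 1" "\<And>x. x \<notin> C \<Longrightarrow> h x = 0"
      by (rule bump_function[OF manifold frame(1)[OF e(1)] p]) blast
    have "sec (\<lambda>x. if x \<in> U then h x *\<^sub>R e i x else 0)"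
      by (rule bump_section[OF e]) (use h in auto)
    from assms(2)[OF this]
    have "smooth_fun (atlas E) V (\<lambda>p. \<xi> p (if p \<in> U then h p *\<^sub>R e i p else 0))"
      by (rule smooth_fun_mono) simp
    then have "smooth_fun (atlas E) V (\<lambda>p. \<xi> p (e i p))"
      by (rule smooth_fun_cong[OF manifold h(4)]) (use h in auto)
    then show "\<exists>V. open V \<and> p \<in> V \<and> smooth_fun (atlas E) V (\<lambda>p. \<xi> p (e i p))"
      using h by blast
  qed
qed

text \<open>The members are sections over the whole manifold, as bracket and anchor require; a frame
  and its dual they are only over \<open>W\<close>.\<close>

definition local_frame ::
  "'m \<Rightarrow> 'm set \<Rightarrow> (nat \<Rightarrow> 'm \<Rightarrow> 'v) \<Rightarrow> (nat \<Rightarrow> 'm \<Rightarrow> 'v \<Rightarrow> real) \<Rightarrow> bool" where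
  "local_frame p W e \<epsilon> \<longleftrightarrow> open W \<and> p \<in> W \<and>
     (\<forall>i<N. sec (e i) \<and> cosec (\<epsilon> i)) \<and>
     (\<forall>x\<in>W. \<forall>i<N. \<forall>j<N. \<epsilon> i x (e j x) = (if i = j then 1 else 0)) \<and>
     (\<forall>x\<in>W. \<forall>u\<in>fibre E x. u = (\<Sum>i<N. \<epsilon> i x u *\<^sub>R e i x)) \<and>
     (\<forall>x\<in>W. \<forall>\<xi>\<in>cofibre x. \<xi> = (\<Sum>i<N. \<xi> (e i x) *\<^sub>R \<epsilon> i x))"

lemma local_frame_exists: obtains W e \<epsilon> where "local_frame p W e \<epsilon>"
proof -
  obtain U e where e: "(U, e) \<in> frames E" "p \<in> U" by (rule frame_cover)
  have d: "(U, coord e) \<in> frames (dual_bundle E)" using e frames_dual by blast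
  obtain h C V where h: "smooth h" "closed C" "C \<subseteq> U" "open V" "p \<in> V" "V \<subseteq> C"
      "\<And>x. x \<in> V \<Longrightarrow> h x = 1" "\<And>x. x \<notin> C \<Longrightarrow> h x = 0"
    by (rule bump_function[OF manifold frame(1)[OF e(1)] e(2)]) blast
  define f where "f i x = (if x \<in> U then h x *\<^sub>R e i x else 0)" for i x
  define \<epsilon> where "\<epsilon> i x = (if x \<in> U then h x *\<^sub>R coord e i x else 0)" for i x
  have 1: "sec (f i)" if "i < N" for i
    unfolding f_def by (rule bump_section[OF e(1) that]) (use h in auto)
  have 2: "cosec (\<epsilon> i)" if "i < N" for i
    unfolding \<epsilon>_def by (rule vbundle.bump_section[OF vbundle_dual d]) (use that h in auto)
  have 3: "f i x = e i x" "\<epsilon> i x = coord e i x" "x \<in> U" if "x \<in> V" for i x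
    using that h(3,6,7) by (auto simp: f_def \<epsilon>_def)
  have "local_frame p V f \<epsilon>"
    unfolding local_frame_def
    using h(4,5) 1 2 3 coord_facts(1,2)[OF e(1)] cofibre_expand[OF e(1)] by auto
  then show thesis by (rule that)
qed

lemma local_frameD:
  assumes "local_frame p W e \<epsilon>"
  shows "open W" "p \<in> W" "\<And>i. i < N \<Longrightarrow> sec (e i)" "\<And>i. i < N \<Longrightarrow> cosec (\<epsilon> i)"
    "\<And>x i j. x \<in> W \<Longrightarrow> i < N \<Longrightarrow> j < N \<Longrightarrow> \<epsilon> i x (e j x) = (if i = j then 1 else 0)"
    "\<And>x u. x \<in> W \<Longrightarrow> u \<in> fibre E x \<Longrightarrow> u = (\<Sum>i<N. \<epsilon> i x u *\<^sub>R e i x)"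
    "\<And>x \<xi>. x \<in> W \<Longrightarrow> \<xi> \<in> cofibre x \<Longrightarrow> \<xi> = (\<Sum>i<N. \<xi> (e i x) *\<^sub>R \<epsilon> i x)"
  using assms unfolding local_frame_def by blast+

section \<open>Operations on sections, and extension of fibre elements\<close>

lemma sec_add: "sec s \<Longrightarrow> sec t \<Longrightarrow> sec (\<lambda>x. s x + t x)"
  by (rule sec_by_pairing)
    (auto simp: secD cofibreD(1)[OF cosecD] intro!: smooth_fun_add[OF manifold open_UNIV pairing_smooth pairing_smooth])

lemma sec_scale: "smooth f \<Longrightarrow> sec s \<Longrightarrow> sec (\<lambda>x. f x *\<^sub>R s x)"
  by (rule sec_by_pairing)
    (auto simp: secD cofibreD(2)[OF cosecD] intro!: smooth_fun_mult[OF manifold open_UNIV _ pairing_smooth])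

lemma sec_zero: "sec (\<lambda>x. 0)"
  by (rule sec_by_pairing)
    (auto simp: secD cofibreD(4)[OF cosecD] intro!: smooth_fun_const)

lemma sec_uminus: "sec s \<Longrightarrow> sec (\<lambda>x. - s x)"
  using sec_scale[OF smooth_fun_const[of _ _ "-1"]] by fastforce

lemma sec_diff: "sec s \<Longrightarrow> sec t \<Longrightarrow> sec (\<lambda>x. s x - t x)"
  using sec_add[OF _ sec_uminus] by fastforce

lemma sec_sum:
  "(\<And>i. i \<in> I \<Longrightarrow> sec (s i)) \<Longrightarrow> sec (\<lambda>x. \<Sum>i\<in>I. s i x)"
proof (induction I rule: infinite_finite_induct)
  case (insert i I)
  then show ?case using sec_add[of "s i" "\<lambda>x. \<Sum>i\<in>I. s i x"] by simp
qed (simp_all add: sec_zero)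

lemma sec_extension_exists:
  assumes "u \<in> fibre E p"
  obtains X where "sec X" "X p = u"
proof -
  obtain W e \<epsilon> where f: "local_frame p W e \<epsilon>" by (rule local_frame_exists)
  note f = local_frameD[OF f]
  have "sec (\<lambda>x. \<Sum>i<N. \<epsilon> i p u *\<^sub>R e i x)"
    by (intro sec_sum sec_scale[OF smooth_fun_const] f) auto
  then show thesis by (rule that) (use f(6)[OF f(2) assms] in simp)
qed

lemma extend:
  assumes "u \<in> fibre E p"
  shows "sec (extend E p u)" "extend E p u p = u"
proof -
  have "\<exists>X. sec X \<and> X p = u" using sec_extension_exists[OF assms] by metis
  from someI_ex[OF this] show "sec (extend E p u)" "extend E p u p = u"
    by (auto simp: extend_def)
qed

end

section \<open>Tensorial maps and alternating forms\<close>

text \<open>The pointwise content of \<open>form\<close>, with positions marked by splitting the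
  list instead of by an index, which suits inductions along lists.\<close>

definition alternating_on :: "'v::real_vector set \<Rightarrow> nat \<Rightarrow> ('v list \<Rightarrow> real) \<Rightarrow> bool" where
  "alternating_on F q w \<longleftrightarrow>
     (\<forall>xs ys u v. length xs + Suc (length ys) = q \<and> set xs \<subseteq> F \<and> set ys \<subseteq> F \<and> u \<in> F \<and> v \<in> F \<longrightarrow>
        w (xs @ (u + v) # ys) = w (xs @ u # ys) + w (xs @ v # ys)) \<and>
     (\<forall>xs ys u c. length xs + Suc (length ys) = q \<and> set xs \<subseteq> F \<and> set ys \<subseteq> F \<and> u \<in> F \<longrightarrow>
        w (xs @ (c *\<^sub>R u) # ys) = c * w (xs @ u # ys)) \<and>
     (\<forall>xs ys zs u. length xs + length ys + length zs + 2 = q \<and> set xs \<subseteq> F \<and> set ys \<subseteq> F \<and> set zs \<subseteq> F \<and> u \<in> F \<longrightarrow>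
        w (xs @ u # ys @ u # zs) = 0)"

lemma alternating_onD:
  assumes "alternating_on F q w"
  shows "length xs + Suc (length ys) = q \<Longrightarrow> set xs \<subseteq> F \<Longrightarrow> set ys \<subseteq> F \<Longrightarrow> u \<in> F \<Longrightarrow> v \<in> F \<Longrightarrow>
      w (xs @ (u + v) # ys) = w (xs @ u # ys) + w (xs @ v # ys)"
    "length xs + Suc (length ys) = q \<Longrightarrow> set xs \<subseteq> F \<Longrightarrow> set ys \<subseteq> F \<Longrightarrow> u \<in> F \<Longrightarrow>
      w (xs @ (c *\<^sub>R u) # ys) = c * w (xs @ u # ys)"
    "length xs + length ys + length zs + 2 = q \<Longrightarrow> set xs \<subseteq> F \<Longrightarrow> set ys \<subseteq> F \<Longrightarrow> set zs \<subseteq> F \<Longrightarrow> u \<in> F \<Longrightarrow>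
      w (xs @ u # ys @ u # zs) = 0"
  using assms unfolding alternating_on_def by blast+

lemma alternating_on_sum:
  assumes w: "alternating_on F q w" and F: "subspace F" and "length xs + Suc (length ys) = q"
    "set xs \<subseteq> F" "set ys \<subseteq> F" "\<And>i. i \<in> I \<Longrightarrow> v i \<in> F"
  shows "w (xs @ (\<Sum>i\<in>I. c i *\<^sub>R v i) # ys) = (\<Sum>i\<in>I. c i * w (xs @ v i # ys))"
  using assms(6)
proof (induction I rule: infinite_finite_induct)
  case (insert i I)
  have "(\<Sum>i\<in>I. c i *\<^sub>R v i) \<in> F" using insert.prems F by (intro subspace_sum subspace_scale) auto
  then show ?case
    using insert alternating_onD(1)[OF w assms(3-5), of "c i *\<^sub>R v i" "\<Sum>i\<in>I. c i *\<^sub>R v i"]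
      alternating_onD(2)[OF w assms(3-5), of "v i" "c i"] F
    by (simp add: subspace_scale)
next
  case (infinite I)
  show ?case
    using infinite alternating_onD(2)[OF w assms(3-5) subspace_0[OF F], of 0] by simp
next
  case empty
  show ?case
    using alternating_onD(2)[OF w assms(3-5) subspace_0[OF F], of 0] by simp
qed

lemma alternating_on_swap:
  assumes w: "alternating_on F q w" and F: "subspace F" and l: "length xs + length ys + 2 = q"
    and s: "set xs \<subseteq> F" "set ys \<subseteq> F" "u \<in> F" "v \<in> F"
  shows "w (xs @ u # v # ys) = - w (xs @ v # u # ys)"
proof -
  have uv: "u + v \<in> F" using F s by (simp add: subspace_add)
  have z: "w (xs @ x # x # ys) = 0" if "x \<in> F" for x
    using alternating_onD(3)[OF w, of xs "[]" ys x] that l s by simp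
  have "0 = w (xs @ (u + v) # (u + v) # ys)" using z[OF uv] by simp
  also have "\<dots> = w (xs @ u # (u + v) # ys) + w (xs @ v # (u + v) # ys)"
    by (rule alternating_onD(1)[OF w]) (use l s uv in auto)
  also have "w (xs @ u # (u + v) # ys) = w (xs @ u # u # ys) + w (xs @ u # v # ys)"
    using alternating_onD(1)[OF w, of "xs @ [u]" ys u v] l s by simp
  also have "w (xs @ v # (u + v) # ys) = w (xs @ v # u # ys) + w (xs @ v # v # ys)"
    using alternating_onD(1)[OF w, of "xs @ [v]" ys u v] l s by simp
  finally show ?thesis using z s by simp
qed

lemma alternating_on_move:
  assumes w: "alternating_on F q w" and F: "subspace F"
  shows "length pre + length xs + length ys + 1 = q \<Longrightarrow> set pre \<subseteq> F \<Longrightarrow> set xs \<subseteq> F \<Longrightarrow> set ys \<subseteq> F \<Longrightarrow> u \<in> F \<Longrightarrow>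
     w (pre @ u # xs @ ys) = (-1) ^ length xs * w (pre @ xs @ u # ys)"
proof (induction xs arbitrary: pre)
  case (Cons x xs)
  have "w (pre @ u # x # xs @ ys) = - w (pre @ x # u # xs @ ys)"
    by (rule alternating_on_swap[OF w F]) (use Cons.prems in auto)
  also have "w (pre @ x # u # xs @ ys) = (-1) ^ length xs * w (pre @ x # xs @ u # ys)"
    using Cons.IH[of "pre @ [x]"] Cons.prems by simp
  finally show ?case by simp
qed simp

text \<open>Absolute values leave out the sign of the permutation; only vanishing is read off, in
  \<open>alternating_on_eq_zero\<close>.\<close>

lemma alternating_on_permute:
  assumes w: "alternating_on F q w" and F: "subspace F"
  shows "mset xs = mset ys \<Longrightarrow> length pre + length xs = q \<Longrightarrow> set pre \<subseteq> F \<Longrightarrow> set xs \<subseteq> F \<Longrightarrow>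
     \<bar>w (pre @ xs)\<bar> = \<bar>w (pre @ ys)\<bar>"
proof (induction xs arbitrary: ys pre)
  case (Cons x xs)
  have "x \<in> set ys" using Cons.prems(1) by (metis list.set_intros(1) set_mset_mset)
  then obtain y1 y2 where y: "ys = y1 @ x # y2" by (meson split_list)
  have m: "mset xs = mset (y1 @ y2)" using Cons.prems(1) y by simp
  have s: "set (y1 @ y2) \<subseteq> F" "length (y1 @ y2) = length xs"
    using Cons.prems(4) m by (metis list.set_intros(2) set_mset_mset subset_code(1), metis size_mset)
  have "\<bar>w (pre @ x # xs)\<bar> = \<bar>w ((pre @ [x]) @ (y1 @ y2))\<bar>"
    using Cons.IH[OF m, of "pre @ [x]"] Cons.prems by simp
  also have "w ((pre @ [x]) @ (y1 @ y2)) = (-1) ^ length y1 * w (pre @ y1 @ x # y2)"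
    using alternating_on_move[OF w F, of pre y1 y2 x] Cons.prems s by simp
  finally show ?case using y by (simp add: abs_mult power_abs)
qed simp

text \<open>Multilinearity reduces the claim to lists of frame vectors. With N indices below N, such
  a list either repeats an index or is a rearrangement of the standard one.\<close>

lemma alternating_on_eq_zero:
  assumes w: "alternating_on F N w" and F: "subspace F"
    and e: "\<And>i. i < N \<Longrightarrow> e i \<in> F" "\<And>u. u \<in> F \<Longrightarrow> \<exists>c. u = (\<Sum>i<N. c i *\<^sub>R e i)"
    and z: "w (map e [0..<N]) = 0"
    and us: "length us = N" "set us \<subseteq> F"
  shows "w us = 0"
proof -
  have basis: "w (map e is) = 0" if "length is = N" "set is \<subseteq> {..<N}" for "is"
  proof (cases "distinct is")
    case True
    then have "card (set is) = N" using that distinct_card by blast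
    then have "set is = {..<N}" using that by (metis card_lessThan card_subset_eq finite_lessThan)
    then have "mset is = mset [0..<N]"
      by (intro set_eq_iff_mset_eq_distinct[THEN iffD1, OF True distinct_upt]) (simp add: atLeast_upt)
    then have "mset (map e is) = mset (map e [0..<N])" by simp
    from alternating_on_permute[OF w F this, of "[]"] that e(1) z show ?thesis
      by (auto simp: subset_iff)
  next
    case False
    then obtain xs y ys zs where "is = xs @ [y] @ ys @ [y] @ zs" using not_distinct_decomp by blast
    then show ?thesis
      using alternating_onD(3)[OF w, of "map e xs" "map e ys" "map e zs" "e y"] that e(1)
      by (auto simp: subset_iff)
  qed
  \<comment> \<open>The entries behind \<open>bs\<close> are frame vectors already; the last entry
    of \<open>bs\<close> is expanded and joins them.\<close>
  have "w (bs @ map e is) = 0" if "length bs + length is = N" "set is \<subseteq> {..<N}" "set bs \<subseteq> F" for bs "is"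
    using that
  proof (induction bs arbitrary: "is" rule: rev_induct)
    case (snoc b bs)
    obtain c where c: "b = (\<Sum>i<N. c i *\<^sub>R e i)" using e(2)[of b] snoc.prems by auto
    have "w (bs @ b # map e is) = (\<Sum>i<N. c i * w (bs @ e i # map e is))"
      unfolding c by (rule alternating_on_sum[OF w F]) (use snoc.prems e(1) in auto)
    also have "\<dots> = 0"
    proof (rule sum.neutral, rule ballI)
      fix i assume "i \<in> {..<N}"
      then show "c i * w (bs @ e i # map e is) = 0" using snoc.IH[of "i # is"] snoc.prems by simp
    qed
    finally show ?case by simp
  qed (use basis in auto)
  from this[of us "[]"] us show ?thesis by simp
qed

lemma alternating_on_2:
  assumes w: "alternating_on F 2 w"
  shows "u \<in> F \<Longrightarrow> u' \<in> F \<Longrightarrow> v \<in> F \<Longrightarrow> w [u + u', v] = w [u, v] + w [u', v]"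
    "u \<in> F \<Longrightarrow> v' \<in> F \<Longrightarrow> v \<in> F \<Longrightarrow> w [u, v + v'] = w [u, v] + w [u, v']"
    "u \<in> F \<Longrightarrow> v \<in> F \<Longrightarrow> w [c *\<^sub>R u, v] = c * w [u, v]"
    "u \<in> F \<Longrightarrow> v \<in> F \<Longrightarrow> w [u, c *\<^sub>R v] = c * w [u, v]"
    "u \<in> F \<Longrightarrow> w [u, u] = 0"
  using alternating_onD(1)[OF w, of "[]" "[v]" u u'] alternating_onD(1)[OF w, of "[u]" "[]" v v']
    alternating_onD(2)[OF w, of "[]" "[v]" u c] alternating_onD(2)[OF w, of "[u]" "[]" v c]
    alternating_onD(3)[OF w, of "[]" "[]" "[]" u]
  by auto

lemma alternating_on_2_swap:
  "alternating_on F 2 w \<Longrightarrow> subspace F \<Longrightarrow> u \<in> F \<Longrightarrow> v \<in> F \<Longrightarrow> w [u, v] = - w [v, u]"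
  using alternating_on_swap[of F 2 w "[]" "[]" u v] by simp

lemma alternating_on_2_sum:
  assumes "alternating_on F 2 w" "subspace F"
  shows "v \<in> F \<Longrightarrow> (\<And>i. i \<in> I \<Longrightarrow> u i \<in> F) \<Longrightarrow> w [\<Sum>i\<in>I. c i *\<^sub>R u i, v] = (\<Sum>i\<in>I. c i * w [u i, v])"
    "v \<in> F \<Longrightarrow> (\<And>i. i \<in> I \<Longrightarrow> u i \<in> F) \<Longrightarrow> w [v, \<Sum>i\<in>I. c i *\<^sub>R u i] = (\<Sum>i\<in>I. c i * w [v, u i])"
  using alternating_on_sum[OF assms, of "[]" "[v]" I u c] alternating_on_sum[OF assms, of "[v]" "[]" I u c]
  by auto

lemma alternating_on_2I:
  assumes "\<And>u u' v. u \<in> F \<Longrightarrow> u' \<in> F \<Longrightarrow> v \<in> F \<Longrightarrow> w [u + u', v] = w [u, v] + w [u', v]"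
    "\<And>u v c. u \<in> F \<Longrightarrow> v \<in> F \<Longrightarrow> w [c *\<^sub>R u, v] = c * w [u, v]"
    "\<And>u v. u \<in> F \<Longrightarrow> v \<in> F \<Longrightarrow> w [u, v] = - w [v, u]"
    and F: "subspace F"
  shows "alternating_on F 2 w"
proof -
  have a: "w [u, v + v'] = w [u, v] + w [u, v']" if "u \<in> F" "v \<in> F" "v' \<in> F" for u v v'
    using that assms(1)[of v v' u] assms(3)[of u "v + v'"] assms(3)[of u v] assms(3)[of u v'] F
    by (simp add: subspace_add)
  have b: "w [u, c *\<^sub>R v] = c * w [u, v]" if "u \<in> F" "v \<in> F" for u v c
    using that assms(2)[of v u c] assms(3)[of u "c *\<^sub>R v"] assms(3)[of u v] F
    by (simp add: subspace_scale)
  show ?thesis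
    unfolding alternating_on_def
  proof (intro conjI allI impI)
    fix xs ys :: "'a list" and u v c
    assume h: "length xs + Suc (length ys) = 2 \<and> set xs \<subseteq> F \<and> set ys \<subseteq> F \<and> u \<in> F \<and> v \<in> F"
    then consider x where "xs = [x]" "ys = []" | y where "xs = []" "ys = [y]"
      by (cases xs; cases ys) auto
    then show "w (xs @ (u + v) # ys) = w (xs @ u # ys) + w (xs @ v # ys)"
      by cases (use h assms(1) a in auto)
  next
    fix xs ys :: "'a list" and u c
    assume h: "length xs + Suc (length ys) = 2 \<and> set xs \<subseteq> F \<and> set ys \<subseteq> F \<and> u \<in> F"
    then consider x where "xs = [x]" "ys = []" | y where "xs = []" "ys = [y]"
      by (cases xs; cases ys) auto
    then show "w (xs @ (c *\<^sub>R u) # ys) = c * w (xs @ u # ys)"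
      by cases (use h assms(2) b in auto)
  next
    fix xs ys zs :: "'a list" and u
    assume h: "length xs + length ys + length zs + 2 = 2 \<and> set xs \<subseteq> F \<and> set ys \<subseteq> F \<and> set zs \<subseteq> F \<and> u \<in> F"
    then show "w (xs @ u # ys @ u # zs) = 0" using assms(3)[of u u] by simp
  qed
qed

lemma alternating_on_3:
  assumes w: "alternating_on F 3 w" and F: "subspace F"
  shows "u \<in> F \<Longrightarrow> u' \<in> F \<Longrightarrow> v \<in> F \<Longrightarrow> x \<in> F \<Longrightarrow> w [u + u', v, x] = w [u, v, x] + w [u', v, x]"
    "u \<in> F \<Longrightarrow> v \<in> F \<Longrightarrow> x \<in> F \<Longrightarrow> w [c *\<^sub>R u, v, x] = c * w [u, v, x]"
    "u \<in> F \<Longrightarrow> v \<in> F \<Longrightarrow> x \<in> F \<Longrightarrow> w [u, v, x] = - w [v, u, x]"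
    "u \<in> F \<Longrightarrow> v \<in> F \<Longrightarrow> x \<in> F \<Longrightarrow> w [u, v, x] = - w [u, x, v]"
  using alternating_onD(1)[OF w, of "[]" "[v, x]" u u'] alternating_onD(2)[OF w, of "[]" "[v, x]" u c]
    alternating_on_swap[OF w F, of "[]" "[x]" u v] alternating_on_swap[OF w F, of "[u]" "[]" v x]
  by auto

lemma alternating_on_form:
  assumes "form E q \<omega>"
  shows "alternating_on (fibre E p) q (\<omega> p)"
proof -
  have f: "(\<forall>i<q. \<forall>u\<in>fibre E p. \<forall>v\<in>fibre E p. \<omega> p (us[i := u + v]) = \<omega> p (us[i := u]) + \<omega> p (us[i := v])) \<and>
        (\<forall>i<q. \<forall>c. \<forall>u\<in>fibre E p. \<omega> p (us[i := c *\<^sub>R u]) = c * \<omega> p (us[i := u])) \<and>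
        (\<forall>i<q. \<forall>j<q. i \<noteq> j \<and> us ! i = us ! j \<longrightarrow> \<omega> p us = 0)" if "length us = q" "set us \<subseteq> fibre E p" for us
    using assms that unfolding form_def tuples_def by blast
  show ?thesis
    unfolding alternating_on_def
  proof (intro conjI allI impI, goal_cases)
    case (1 xs ys u v)
    then show ?case using f[of "xs @ u # ys"] by (auto simp: list_update_append dest!: spec[of _ "length xs"])
  next
    case (2 xs ys u c)
    then show ?case using f[of "xs @ u # ys"] by (auto simp: list_update_append dest!: spec[of _ "length xs"])
  next
    case (3 xs ys zs u)
    have "(xs @ u # ys @ u # zs) ! length xs = (xs @ u # ys @ u # zs) ! (length xs + Suc (length ys))"
      by (simp add: nth_append)
    moreover have "\<forall>i<q. \<forall>j<q. i \<noteq> j \<and> (xs @ u # ys @ u # zs) ! i = (xs @ u # ys @ u # zs) ! j \<longrightarrow> \<omega> p (xs @ u # ys @ u # zs) = 0"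
      using f[of "xs @ u # ys @ u # zs"] 3 by simp
    moreover have "length xs < q" "length xs + Suc (length ys) < q" "length xs \<noteq> length xs + Suc (length ys)"
      using 3 by auto
    ultimately show ?case by blast
  qed
qed

section \<open>Wedge products of at most three vectors\<close>

lemma wedge_1: "wedge [u] [\<xi>] = \<xi> u"
proof -
  have l: "{..<length [u]} = insert 0 {}" by auto
  show ?thesis
    unfolding wedge_def l by (subst sum_over_permutations_insert) (simp_all add: lessThan_Suc transpose_def sign_id)
qed

lemma wedge_2: "wedge [u, v] [\<xi>, \<eta>] = \<xi> u * \<eta> v - \<xi> v * \<eta> u"
proof -
  have l: "{..<length [u, v]} = insert 1 (insert 0 {})" by auto
  show ?thesis
    unfolding wedge_def l
    apply (subst sum_over_permutations_insert, simp, simp)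
    apply (subst sum_over_permutations_insert, simp, simp)
    apply (simp add: lessThan_Suc transpose_def sign_swap_id sign_compose permutation_swap_id numeral_2_eq_2)
    done
qed

lemma wedge_3:
  "wedge [u, v, w] [\<xi>, \<eta>, \<zeta>] =
     \<xi> u * (\<eta> v * \<zeta> w - \<eta> w * \<zeta> v) - \<xi> v * (\<eta> u * \<zeta> w - \<eta> w * \<zeta> u) + \<xi> w * (\<eta> u * \<zeta> v - \<eta> v * \<zeta> u)"
proof -
  have l: "{..<length [u, v, w]} = insert 2 (insert 1 (insert 0 {}))" by auto
  show ?thesis
    unfolding wedge_def l
    apply (subst sum_over_permutations_insert, simp, simp)
    apply (subst sum_over_permutations_insert, simp, simp)
    apply (subst sum_over_permutations_insert, simp, simp)
    apply (simp add: lessThan_Suc transpose_def sign_swap_id sign_compose permutation_swap_id permutation_compose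
        numeral_3_eq_3 numeral_2_eq_2)
    apply (simp add: algebra_simps)
    done
qed

section \<open>Function-linear maps on sections are tensors\<close>

context vbundle
begin

text \<open>The expansion of \<open>s\<close> holds only over \<open>W\<close>, whereas
  \<open>\<Phi>\<close> takes global sections. Multiplied by a bump function \<open>h\<close> that
  vanishes off \<open>W\<close> it holds everywhere, and h(p) = 1 removes the factor again.\<close>

lemma tensor_expand:
  fixes \<Phi> :: "('m \<Rightarrow> 'v) \<Rightarrow> real"
  assumes add: "\<And>s t. sec s \<Longrightarrow> sec t \<Longrightarrow> \<Phi> (\<lambda>x. s x + t x) = \<Phi> s + \<Phi> t"
    and scale: "\<And>f s. smooth f \<Longrightarrow> sec s \<Longrightarrow> \<Phi> (\<lambda>x. f x *\<^sub>R s x) = f p * \<Phi> s"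
    and W: "open W" "p \<in> W" and s: "sec s" and e: "\<And>i. i \<in> I \<Longrightarrow> sec (e i)" "\<And>i. i \<in> I \<Longrightarrow> smooth (c i)"
    and eq: "\<And>x. x \<in> W \<Longrightarrow> s x = (\<Sum>i\<in>I. c i x *\<^sub>R e i x)"
  shows "\<Phi> s = (\<Sum>i\<in>I. c i p * \<Phi> (e i))"
proof -
  obtain h C V where h: "smooth h" "closed C" "C \<subseteq> W" "open V" "p \<in> V" "V \<subseteq> C"
      "\<And>x. x \<in> V \<Longrightarrow> h x = 1" "\<And>x. x \<notin> C \<Longrightarrow> h x = 0"
    by (rule bump_function[OF manifold W]) blast
  have z: "\<Phi> (\<lambda>x. 0) = 0" using scale[OF smooth_fun_const[of _ _ 0] sec_zero] by simp
  have hs: "(\<lambda>x. h x *\<^sub>R s x) = (\<lambda>x. \<Sum>i\<in>I. (h x * c i x) *\<^sub>R e i x)"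
  proof
    fix x show "h x *\<^sub>R s x = (\<Sum>i\<in>I. (h x * c i x) *\<^sub>R e i x)"
    proof (cases "x \<in> W")
      case True
      then show ?thesis using eq[of x] by (simp add: scaleR_sum_right)
    next
      case False
      then have "h x = 0" using h(3,8) by blast
      then show ?thesis by simp
    qed
  qed
  have "\<Phi> (\<lambda>x. \<Sum>i\<in>I. (h x * c i x) *\<^sub>R e i x) = (\<Sum>i\<in>I. (h p * c i p) * \<Phi> (e i))"
    using e
  proof (induction I rule: infinite_finite_induct)
    case (insert i I)
    have "\<Phi> (\<lambda>x. (h x * c i x) *\<^sub>R e i x + (\<Sum>i\<in>I. (h x * c i x) *\<^sub>R e i x)) =
       \<Phi> (\<lambda>x. (h x * c i x) *\<^sub>R e i x) + \<Phi> (\<lambda>x. \<Sum>i\<in>I. (h x * c i x) *\<^sub>R e i x)"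
      by (intro add sec_sum sec_scale smooth_fun_mult[OF manifold] h(1)) (use insert.prems in auto)
    moreover have "\<Phi> (\<lambda>x. (h x * c i x) *\<^sub>R e i x) = (h p * c i p) * \<Phi> (e i)"
      by (intro scale smooth_fun_mult[OF manifold] h(1)) (use insert.prems in auto)
    ultimately show ?case using insert by simp
  qed (simp_all add: z)
  then show ?thesis
    using scale[OF h(1) s] h(5,7) by (simp add: hs)
qed

lemma local_frame_expand:
  assumes "local_frame p W e \<epsilon>"
    and "\<And>s t. sec s \<Longrightarrow> sec t \<Longrightarrow> \<Phi> (\<lambda>x. s x + t x) = \<Phi> s + \<Phi> t"
    and "\<And>f s. smooth f \<Longrightarrow> sec s \<Longrightarrow> \<Phi> (\<lambda>x. f x *\<^sub>R s x) = f p * \<Phi> s"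
    and "sec s"
  shows "\<Phi> s = (\<Sum>i<N. \<epsilon> i p (s p) * \<Phi> (e i))"
  by (rule tensor_expand[where \<Phi>=\<Phi>, OF assms(2,3) local_frameD(1,2)[OF assms(1)] assms(4)])
    (use local_frameD[OF assms(1)] assms(4) in \<open>auto intro: pairing_smooth simp: secD\<close>)

lemma tensor_point:
  assumes "\<And>s t. sec s \<Longrightarrow> sec t \<Longrightarrow> \<Phi> (\<lambda>x. s x + t x) = \<Phi> s + \<Phi> t"
    and "\<And>f s. smooth f \<Longrightarrow> sec s \<Longrightarrow> \<Phi> (\<lambda>x. f x *\<^sub>R s x) = f p * \<Phi> s"
    and "sec s" "sec t" "s p = t p"
  shows "\<Phi> s = \<Phi> t"
proof -
  obtain W e \<epsilon> where f: "local_frame p W e \<epsilon>" by (rule local_frame_exists)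
  have e: "\<Phi> r = (\<Sum>i<N. \<epsilon> i p (r p) * \<Phi> (e i))" if "sec r" for r
    by (rule local_frame_expand[where \<Phi>=\<Phi>, OF f]) (use assms(1,2) that in auto)
  show ?thesis using e[OF assms(3)] e[OF assms(4)] assms(5) by simp
qed

text \<open>The usual tensor criterion. The covector at a point is read off on arbitrary extensions
  of fibre elements, which is legitimate by \<open>tensor_point\<close>.\<close>

lemma tensor_cosection:
  fixes \<Phi> :: "('m \<Rightarrow> 'v) \<Rightarrow> 'm \<Rightarrow> real"
  assumes add: "\<And>s t p. sec s \<Longrightarrow> sec t \<Longrightarrow> \<Phi> (\<lambda>x. s x + t x) p = \<Phi> s p + \<Phi> t p"
    and scale: "\<And>f s p. smooth f \<Longrightarrow> sec s \<Longrightarrow> \<Phi> (\<lambda>x. f x *\<^sub>R s x) p = f p * \<Phi> s p"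
    and smooth: "\<And>s. sec s \<Longrightarrow> smooth (\<Phi> s)"
  obtains \<xi> where "cosec \<xi>" "\<And>s p. sec s \<Longrightarrow> \<xi> p (s p) = \<Phi> s p"
proof -
  define \<xi> where "\<xi> p u = (if u \<in> fibre E p then \<Phi> (extend E p u) p else 0)" for p u
  have 1: "\<xi> p (s p) = \<Phi> s p" if s: "sec s" for s p
  proof -
    have "\<Phi> (extend E p (s p)) p = \<Phi> s p"
      by (rule tensor_point[of "\<lambda>s. \<Phi> s p" p]) (use extend[OF secD[OF s]] s add scale in auto)
    then show ?thesis using secD[OF s] by (simp add: \<xi>_def)
  qed
  have 2: "\<xi> p \<in> cofibre p" for p
    unfolding dual_fibre_iff
  proof (intro conjI allI ballI impI)
    fix u v assume "u \<in> fibre E p" "v \<in> fibre E p"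
    then obtain X Y where X: "sec X" "X p = u" "sec Y" "Y p = v" by (metis sec_extension_exists)
    then show "\<xi> p (u + v) = \<xi> p u + \<xi> p v"
      using 1[OF sec_add[OF X(1,3)], of p] 1[OF X(1), of p] 1[OF X(3), of p] add[OF X(1,3)] by simp
  next
    fix c u assume "u \<in> fibre E p"
    then obtain X where X: "sec X" "X p = u" by (metis sec_extension_exists)
    then show "\<xi> p (c *\<^sub>R u) = c * \<xi> p u"
      using 1[OF sec_scale[OF smooth_fun_const X(1)], of p c] 1[OF X(1), of p] scale[OF smooth_fun_const X(1), of c p] by simp
  qed (simp add: \<xi>_def)
  have "cosec \<xi>"
  proof (rule cosec_by_pairing[OF 2])
    fix s assume "sec s"
    then show "smooth (\<lambda>p. \<xi> p (s p))" using smooth[of s] 1[of s] by simp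
  qed
  then show thesis using 1 by (rule that)
qed

text \<open>Here finite rank enters: at each point the vector with coefficients
  \<open>\<Phi> (\<epsilon> i) p\<close> in a local frame represents the functional. The vectors
  chosen pointwise form a smooth section by the pairing test.\<close>

lemma tensor_section:
  fixes \<Phi> :: "('m \<Rightarrow> 'v \<Rightarrow> real) \<Rightarrow> 'm \<Rightarrow> real"
  assumes add: "\<And>s t p. cosec s \<Longrightarrow> cosec t \<Longrightarrow> \<Phi> (\<lambda>x. s x + t x) p = \<Phi> s p + \<Phi> t p"
    and scale: "\<And>f s p. smooth f \<Longrightarrow> cosec s \<Longrightarrow> \<Phi> (\<lambda>x. f x *\<^sub>R s x) p = f p * \<Phi> s p"
    and smooth: "\<And>s. cosec s \<Longrightarrow> smooth (\<Phi> s)"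
  obtains X where "sec X" "\<And>\<xi> p. cosec \<xi> \<Longrightarrow> \<xi> p (X p) = \<Phi> \<xi> p"
proof -
  interpret D: vbundle "dual_bundle E" by (rule vbundle_dual)
  define P where "P p u \<longleftrightarrow> u \<in> fibre E p \<and> (\<forall>\<xi>. cosec \<xi> \<longrightarrow> \<xi> p u = \<Phi> \<xi> p)" for p u
  have "\<exists>u. P p u" for p
  proof -
    obtain W e \<epsilon> where f: "local_frame p W e \<epsilon>" by (rule local_frame_exists)
    note f = local_frameD[OF f]
    have u: "(\<Sum>i<N. \<Phi> (\<epsilon> i) p *\<^sub>R e i p) \<in> fibre E p"
      by (rule fibre_sum) (use f(3) secD in auto)
    have "\<xi> p (\<Sum>i<N. \<Phi> (\<epsilon> i) p *\<^sub>R e i p) = \<Phi> \<xi> p" if x: "cosec \<xi>" for \<xi>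
    proof -
      have "\<xi> p (\<Sum>i<N. \<Phi> (\<epsilon> i) p *\<^sub>R e i p) = (\<Sum>i<N. \<Phi> (\<epsilon> i) p * \<xi> p (e i p))"
        by (rule cofibre_sum[OF cosecD[OF x]]) (use f(3) secD in auto)
      also have "\<dots> = (\<Sum>i<N. \<xi> p (e i p) * \<Phi> (\<epsilon> i) p)" by (simp add: mult.commute)
      also have "\<dots> = \<Phi> \<xi> p"
        by (rule D.tensor_expand[of "\<lambda>\<xi>. \<Phi> \<xi> p" p W, symmetric])
          (use f add scale x cosecD[OF x] in \<open>auto intro: pairing_smooth\<close>)
      finally show ?thesis .
    qed
    then show ?thesis unfolding P_def using u by blast
  qed
  then obtain X where X: "\<And>p. P p (X p)" by metis
  have "sec X"
  proof (rule sec_by_pairing)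
    fix \<xi> assume "cosec \<xi>"
    moreover from this have "(\<lambda>p. \<xi> p (X p)) = \<Phi> \<xi>" using X unfolding P_def by blast
    ultimately show "smooth (\<lambda>p. \<xi> p (X p))" using smooth[of \<xi>] by (simp only:)
  qed (use X P_def in auto)
  then show thesis by (rule that) (use X P_def in auto)
qed

lemma cofibre_separates:
  assumes "u \<in> fibre E p" "v \<in> fibre E p" "\<And>\<xi>. cosec \<xi> \<Longrightarrow> \<xi> p u = \<xi> p v"
  shows "u = v"
proof -
  obtain W e \<epsilon> where f: "local_frame p W e \<epsilon>" by (rule local_frame_exists)
  note f = local_frameD[OF f]
  have "u = (\<Sum>i<N. \<epsilon> i p u *\<^sub>R e i p)" by (rule f(6)[OF f(2) assms(1)])
  also have "\<dots> = (\<Sum>i<N. \<epsilon> i p v *\<^sub>R e i p)" using assms(3)[OF f(4)] by simp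
  also have "\<dots> = v" by (rule f(6)[OF f(2) assms(2), symmetric])
  finally show ?thesis .
qed

lemma form_smooth:
  assumes \<omega>: "form E q \<omega>" and as: "length as = q" "\<And>a. a \<in> set as \<Longrightarrow> sec a"
  shows "smooth (\<lambda>x. \<omega> x (map (\<lambda>a. a x) as))"
proof (rule smooth_fun_local[OF manifold])
  fix p
  obtain U e where e: "(U, e) \<in> frames E" "p \<in> U" by (rule frame_cover)
  note U = frame(1)[OF e(1)]
  \<comment> \<open>As \<open>form\<close> speaks of smoothness on frame vectors only, the entries
    are expanded in the frame one by one from the right.\<close>
  have "smooth_fun (atlas E) U (\<lambda>x. \<omega> x (map (\<lambda>a. a x) bs @ map (\<lambda>i. e i x) is))"
    if "length bs + length is = q" "set is \<subseteq> {..<N}" "\<And>b. b \<in> set bs \<Longrightarrow> sec b" for bs "is"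
    using that
  proof (induction bs arbitrary: "is" rule: rev_induct)
    case Nil
    then show ?case using \<omega> e(1) unfolding form_def by auto
  next
    case (snoc b bs)
    have "smooth_fun (atlas E) U
        (\<lambda>x. \<Sum>i<N. coord e i x (b x) * \<omega> x (map (\<lambda>a. a x) bs @ map (\<lambda>i. e i x) (i # is)))"
      by (intro smooth_fun_sum[OF manifold U] smooth_fun_mult[OF manifold U] snoc.IH sec_coord_smooth[OF _ e(1)])
        (use snoc.prems in auto)
    then show ?case
    proof (rule smooth_fun_cong[OF manifold U])
      fix x assume x: "x \<in> U"
      have b: "b x = (\<Sum>i<N. coord e i x (b x) *\<^sub>R e i x)"
        by (rule coord_facts(1)[OF e(1) x]) (use snoc.prems secD in auto)
      have "\<omega> x (map (\<lambda>a. a x) bs @ (\<Sum>i<N. coord e i x (b x) *\<^sub>R e i x) # map (\<lambda>i. e i x) is) =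
         (\<Sum>i<N. coord e i x (b x) * \<omega> x (map (\<lambda>a. a x) bs @ e i x # map (\<lambda>i. e i x) is))"
        by (rule alternating_on_sum[OF alternating_on_form[OF \<omega>] fibre_subspace])
          (use snoc.prems secD frame_in_fibre[OF e(1) x] in \<open>auto simp: subset_iff\<close>)
      then show "(\<Sum>i<N. coord e i x (b x) * \<omega> x (map (\<lambda>a. a x) bs @ map (\<lambda>i. e i x) (i # is))) =
          \<omega> x (map (\<lambda>a. a x) (bs @ [b]) @ map (\<lambda>i. e i x) is)"
        using b by simp
    qed
  qed
  from this[of as "[]"] as have "smooth_fun (atlas E) U (\<lambda>x. \<omega> x (map (\<lambda>a. a x) as))" by simp
  then show "\<exists>V. open V \<and> p \<in> V \<and> smooth_fun (atlas E) V (\<lambda>x. \<omega> x (map (\<lambda>a. a x) as))"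
    using e U by blast
qed

text \<open>The combination of v and w whose coefficients are the values of w and v on a frame
  vanishes on that frame, hence identically: top forms at a point span at most a line. The
  cross-multiplied form avoids dividing by a value that may be zero.\<close>

lemma top_forms_proportional:
  assumes "alternating_on (fibre E p) N v" "alternating_on (fibre E p) N w"
    "length us = N" "set us \<subseteq> fibre E p" "length vs = N" "set vs \<subseteq> fibre E p"
  shows "v us * w vs = w us * v vs"
proof -
  obtain W e \<epsilon> where "local_frame p W e \<epsilon>" by (rule local_frame_exists)
  note f = local_frameD[OF this]
  have sp: "\<exists>c. u = (\<Sum>i<N. c i *\<^sub>R e i p)" if "u \<in> fibre E p" for u
    using f(6)[OF f(2) that] by (rule exI[where x="\<lambda>i. \<epsilon> i p u"])
  define es where "es = map (\<lambda>i. e i p) [0..<N]"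
  have key: "v us * w es = w us * v es" if "length us = N" "set us \<subseteq> fibre E p" for us
  proof -
    have a: "alternating_on (fibre E p) N (\<lambda>us. v us * w es - w us * v es)"
      using assms(1,2) unfolding alternating_on_def by (simp add: algebra_simps)
    have "v us * w es - w us * v es = 0"
      by (rule alternating_on_eq_zero[OF a fibre_subspace, of "\<lambda>i. e i p"])
        (use that f(3) secD sp in \<open>auto simp: es_def\<close>)
    then show ?thesis by simp
  qed
  show ?thesis
  proof (cases "w es = 0 \<and> v es = 0")
    case True
    have "v us = 0"
      by (rule alternating_on_eq_zero[OF assms(1) fibre_subspace, of "\<lambda>i. e i p"])
        (use True assms f(3) secD sp in \<open>auto simp: es_def\<close>)
    moreover have "w us = 0"
      by (rule alternating_on_eq_zero[OF assms(2) fibre_subspace, of "\<lambda>i. e i p"])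
        (use True assms f(3) secD sp in \<open>auto simp: es_def\<close>)
    ultimately show ?thesis by simp
  next
    case False
    have "(v us * w vs - w us * v vs) * w es = 0" "(v us * w vs - w us * v vs) * v es = 0"
      using key[OF assms(3,4)] key[OF assms(5,6)] by (algebra+)
    then show ?thesis using False by auto
  qed
qed

end

section \<open>Calculus on Lie algebroids\<close>

text \<open>Together with the pointwise ring operations on functions, \<open>smul\<close> and
  \<open>pair\<close> turn identities about sections into equations that can be rewritten without
  evaluating at a point.\<close>

definition smul :: "('m \<Rightarrow> real) \<Rightarrow> ('m \<Rightarrow> 'b::real_vector) \<Rightarrow> 'm \<Rightarrow> 'b" (infixr "\<bullet>\<^sub>s" 75) where
  "f \<bullet>\<^sub>s a = (\<lambda>x. f x *\<^sub>R a x)"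

definition pair :: "('m \<Rightarrow> 'v \<Rightarrow> real) \<Rightarrow> ('m \<Rightarrow> 'v) \<Rightarrow> 'm \<Rightarrow> real" where
  "pair \<xi> a = (\<lambda>x. \<xi> x (a x))"

context vbundle
begin

lemma smooth_closed [simp]:
  "smooth (\<lambda>_. c)"
  "smooth f \<Longrightarrow> smooth g \<Longrightarrow> smooth (f + g)"
  "smooth f \<Longrightarrow> smooth g \<Longrightarrow> smooth (f - g)"
  "smooth f \<Longrightarrow> smooth (- f)"
  "smooth f \<Longrightarrow> smooth g \<Longrightarrow> smooth (f * g)"
  "cosec \<xi> \<Longrightarrow> sec a \<Longrightarrow> smooth (pair \<xi> a)"
  using smooth_fun_add[OF manifold open_UNIV, of f g] smooth_fun_diff[OF manifold open_UNIV, of f g]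
    smooth_fun_mult[OF manifold open_UNIV, of f g] smooth_fun_uminus[OF manifold open_UNIV, of f]
    pairing_smooth[of \<xi> a]
  by (simp_all add: smooth_fun_const plus_fun_def fun_diff_def fun_Compl_def times_fun_def pair_def)

lemma smooth_zero_one [simp]: "smooth 0" "smooth 1"
  using smooth_closed(1)[of 0] smooth_closed(1)[of 1] by (simp_all add: zero_fun_def one_fun_def)

lemma smooth_sum [simp]: "(\<And>i. i \<in> I \<Longrightarrow> smooth (f i)) \<Longrightarrow> smooth (\<Sum>i\<in>I. f i)"
  by (induction I rule: infinite_finite_induct) auto

lemma sec_closed [simp]:
  "sec a \<Longrightarrow> sec b \<Longrightarrow> sec (a + b)"
  "sec a \<Longrightarrow> sec b \<Longrightarrow> sec (a - b)"
  "sec a \<Longrightarrow> sec (- a)"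
  "smooth f \<Longrightarrow> sec a \<Longrightarrow> sec (f \<bullet>\<^sub>s a)"
  "sec 0"
  using sec_add[of a b] sec_diff[of a b] sec_uminus[of a] sec_scale[of f a] sec_zero
  by (simp_all add: plus_fun_def fun_diff_def fun_Compl_def smul_def zero_fun_def)

lemma sec_sum_closed [simp]: "(\<And>i. i \<in> I \<Longrightarrow> sec (s i)) \<Longrightarrow> sec (\<Sum>i\<in>I. s i)"
  by (induction I rule: infinite_finite_induct) auto

lemma pair_linear [simp]:
  "cosec \<xi> \<Longrightarrow> sec a \<Longrightarrow> sec b \<Longrightarrow> pair \<xi> (a + b) = pair \<xi> a + pair \<xi> b"
  "cosec \<xi> \<Longrightarrow> sec a \<Longrightarrow> sec b \<Longrightarrow> pair \<xi> (a - b) = pair \<xi> a - pair \<xi> b"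
  "cosec \<xi> \<Longrightarrow> sec a \<Longrightarrow> pair \<xi> (- a) = - pair \<xi> a"
  "cosec \<xi> \<Longrightarrow> sec a \<Longrightarrow> pair \<xi> (f \<bullet>\<^sub>s a) = f * pair \<xi> a"
  "cosec \<xi> \<Longrightarrow> pair \<xi> 0 = 0"
  by (auto simp: pair_def smul_def fun_eq_iff cofibreD[OF cosecD] secD)

lemma pair_sum [simp]:
  "cosec \<xi> \<Longrightarrow> (\<And>i. i \<in> I \<Longrightarrow> sec (s i)) \<Longrightarrow> pair \<xi> (\<Sum>i\<in>I. s i) = (\<Sum>i\<in>I. pair \<xi> (s i))"
  by (induction I rule: infinite_finite_induct) auto

lemma pair_colinear [simp]:
  "pair (\<xi> + \<eta>) a = pair \<xi> a + pair \<eta> a"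
  "pair (f \<bullet>\<^sub>s \<xi>) a = f * pair \<xi> a"
  by (auto simp: pair_def smul_def fun_eq_iff)

lemma sec_eqI:
  assumes "sec a" "sec b" "\<And>\<xi>. cosec \<xi> \<Longrightarrow> pair \<xi> a = pair \<xi> b"
  shows "a = b"
proof
  fix p show "a p = b p"
    by (rule cofibre_separates[OF secD[OF assms(1)] secD[OF assms(2)]])
      (use assms(3) in \<open>simp add: pair_def fun_eq_iff\<close>)
qed

end

section \<open>Anchor, bracket and their locality\<close>

locale algebroid_bundle =
  fixes A :: "('m::{t2_space,second_countable_topology}, 'e::real_inner, 'v::real_vector) algebroid"
  assumes LA: "lie_algebroid A"

sublocale algebroid_bundle \<subseteq> vbundle A
  by standard (use LA in \<open>simp add: lie_algebroid_def\<close>)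

context algebroid_bundle
begin

lemmas lie_algebroid_axioms = LA[unfolded lie_algebroid_def]

definition der :: "('m \<Rightarrow> 'v) \<Rightarrow> ('m \<Rightarrow> real) \<Rightarrow> 'm \<Rightarrow> real" where
  "der a f = (\<lambda>p. anchor A p (a p) f)"

abbreviation "br \<equiv> bracket A"

lemma anchor_derivation:
  assumes "u \<in> fibre A p" "smooth f" "smooth g"
  shows "anchor A p u (\<lambda>x. f x + g x) = anchor A p u f + anchor A p u g"
    "anchor A p u (\<lambda>x. c * f x) = c * anchor A p u f"
    "anchor A p u (\<lambda>x. f x * g x) = f p * anchor A p u g + g p * anchor A p u f"
proof -
  have "tangent_vector (atlas A) p (anchor A p u)"
    using lie_algebroid_axioms[THEN conjunct2, THEN conjunct1] assms(1) by blast
  then show "anchor A p u (\<lambda>x. f x + g x) = anchor A p u f + anchor A p u g"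
    "anchor A p u (\<lambda>x. c * f x) = c * anchor A p u f"
    "anchor A p u (\<lambda>x. f x * g x) = f p * anchor A p u g + g p * anchor A p u f"
    using assms(2,3) unfolding tangent_vector_def by blast+
qed

lemma anchor_linear:
  assumes "smooth f" "u \<in> fibre A p"
  shows "v \<in> fibre A p \<Longrightarrow> anchor A p (u + v) f = anchor A p u f + anchor A p v f"
    "anchor A p (c *\<^sub>R u) f = c * anchor A p u f"
proof -
  have "(\<forall>u\<in>fibre A p. \<forall>v\<in>fibre A p. anchor A p (u + v) f = anchor A p u f + anchor A p v f) \<and>
        (\<forall>c. \<forall>u\<in>fibre A p. anchor A p (c *\<^sub>R u) f = c * anchor A p u f)"
    using lie_algebroid_axioms[THEN conjunct2, THEN conjunct2, THEN conjunct1] assms(1) by blast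
  then show "v \<in> fibre A p \<Longrightarrow> anchor A p (u + v) f = anchor A p u f + anchor A p v f"
    "anchor A p (c *\<^sub>R u) f = c * anchor A p u f" using assms(2) by blast+
qed

lemma der_smooth [simp]: "sec a \<Longrightarrow> smooth f \<Longrightarrow> smooth (der a f)"
  unfolding der_def using lie_algebroid_axioms[THEN conjunct2, THEN conjunct2, THEN conjunct2, THEN conjunct1] by blast

lemma der_linear [simp]:
  "sec a \<Longrightarrow> smooth f \<Longrightarrow> smooth g \<Longrightarrow> der a (f + g) = der a f + der a g"
  "sec a \<Longrightarrow> smooth f \<Longrightarrow> smooth g \<Longrightarrow> der a (f * g) = f * der a g + g * der a f"
  "sec a \<Longrightarrow> smooth f \<Longrightarrow> smooth g \<Longrightarrow> der a (f - g) = der a f - der a g"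
  "sec a \<Longrightarrow> smooth f \<Longrightarrow> der a (- f) = - der a f"
proof -
  show m: "sec a \<Longrightarrow> smooth f \<Longrightarrow> der a (- f) = - der a f" for f
    using anchor_derivation(2)[OF secD, of a f f _ "-1"]
    by (simp add: der_def fun_eq_iff fun_Compl_def)
  show p: "sec a \<Longrightarrow> smooth f \<Longrightarrow> smooth g \<Longrightarrow> der a (f + g) = der a f + der a g" for f g
    using anchor_derivation(1)[OF secD, of a f g]
    by (simp add: der_def fun_eq_iff plus_fun_def)
  show "sec a \<Longrightarrow> smooth f \<Longrightarrow> smooth g \<Longrightarrow> der a (f * g) = f * der a g + g * der a f"
    using anchor_derivation(3)[OF secD, of a f g]
    by (simp add: der_def fun_eq_iff plus_fun_def times_fun_def)
  show "sec a \<Longrightarrow> smooth f \<Longrightarrow> smooth g \<Longrightarrow> der a (f - g) = der a f - der a g"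
    using p[of f "- g"] m[of g] by simp
qed

lemma der_const [simp]: "sec a \<Longrightarrow> der a 0 = 0" "sec a \<Longrightarrow> der a 1 = 0" "sec a \<Longrightarrow> der a (\<lambda>_. c) = 0"
proof -
  assume a: "sec a"
  show "der a 0 = 0" using der_linear(1)[OF a smooth_zero_one(1) smooth_zero_one(1)] by simp
  show one: "der a 1 = 0"
    using der_linear(2)[OF a smooth_zero_one(2) smooth_zero_one(2)] by simp
  show "der a (\<lambda>_. c) = 0"
    using one anchor_derivation(2)[OF secD[OF a] smooth_zero_one(2) smooth_zero_one(2), of _ c]
    by (simp add: der_def fun_eq_iff)
qed

lemma der_sum [simp]:
  "sec a \<Longrightarrow> (\<And>i. i \<in> I \<Longrightarrow> smooth (f i)) \<Longrightarrow> der a (\<Sum>i\<in>I. f i) = (\<Sum>i\<in>I. der a (f i))"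
  by (induction I rule: infinite_finite_induct) auto

lemma der_left [simp]:
  "sec a \<Longrightarrow> sec b \<Longrightarrow> smooth f \<Longrightarrow> der (a + b) f = der a f + der b f"
  "sec a \<Longrightarrow> smooth f \<Longrightarrow> der (g \<bullet>\<^sub>s a) f = g * der a f"
  "sec a \<Longrightarrow> smooth f \<Longrightarrow> der (- a) f = - der a f"
  "sec a \<Longrightarrow> sec b \<Longrightarrow> smooth f \<Longrightarrow> der (a - b) f = der a f - der b f"
  "smooth f \<Longrightarrow> der 0 f = 0"
proof -
  show p: "sec a \<Longrightarrow> sec b \<Longrightarrow> smooth f \<Longrightarrow> der (a + b) f = der a f + der b f" for a b
    using anchor_linear(1)[OF _ secD secD, of f a b] by (simp add: der_def fun_eq_iff)
  show "sec a \<Longrightarrow> smooth f \<Longrightarrow> der (g \<bullet>\<^sub>s a) f = g * der a f"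
    using anchor_linear(2)[OF _ secD, of f a] by (simp add: der_def fun_eq_iff smul_def)
  show m: "sec a \<Longrightarrow> smooth f \<Longrightarrow> der (- a) f = - der a f" for a
    using anchor_linear(2)[OF _ secD, of f a _ "-1"] by (simp add: der_def fun_eq_iff)
  show "sec a \<Longrightarrow> sec b \<Longrightarrow> smooth f \<Longrightarrow> der (a - b) f = der a f - der b f"
    using p[of a "- b"] m[of b] by simp
  show "smooth f \<Longrightarrow> der 0 f = 0" using p[of 0 0] by simp
qed

lemma der_left_sum [simp]:
  "smooth f \<Longrightarrow> (\<And>i. i \<in> I \<Longrightarrow> sec (a i)) \<Longrightarrow> der (\<Sum>i\<in>I. a i) f = (\<Sum>i\<in>I. der (a i) f)"
  by (induction I rule: infinite_finite_induct) auto

lemma lie_algebra: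
  assumes "sec a" "sec b"
  shows "sec (br a b)" "br a b p = - br b a p" "br (\<lambda>x. c *\<^sub>R a x) b p = c *\<^sub>R br a b p"
    "sec d \<Longrightarrow> br (\<lambda>x. a x + b x) d p = br a d p + br b d p"
    "sec d \<Longrightarrow> br a (br b d) p + br b (br d a) p + br d (br a b) p = 0"
proof -
  have "sec (br a b) \<and> (\<forall>p. br a b p = - br b a p) \<and> (\<forall>c p. br (\<lambda>x. c *\<^sub>R a x) b p = c *\<^sub>R br a b p)"
    using lie_algebroid_axioms[THEN conjunct2, THEN conjunct2, THEN conjunct2, THEN conjunct2, THEN conjunct1]
      assms by blast
  then show "sec (br a b)" "br a b p = - br b a p" "br (\<lambda>x. c *\<^sub>R a x) b p = c *\<^sub>R br a b p" by blast+
next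
  assume "sec d"
  then have "(\<forall>p. br (\<lambda>x. a x + b x) d p = br a d p + br b d p) \<and>
      (\<forall>p. br a (br b d) p + br b (br d a) p + br d (br a b) p = 0)"
    using lie_algebroid_axioms[THEN conjunct2, THEN conjunct2, THEN conjunct2, THEN conjunct2, THEN conjunct2, THEN conjunct1]
      assms by blast
  then show "br (\<lambda>x. a x + b x) d p = br a d p + br b d p"
    "br a (br b d) p + br b (br d a) p + br d (br a b) p = 0" by blast+
qed

lemma leibniz:
  assumes "sec a" "sec b" "smooth f"
  shows "br a (\<lambda>x. f x *\<^sub>R b x) p = f p *\<^sub>R br a b p + anchor A p (a p) f *\<^sub>R b p"
    "anchor A p (br a b p) f =
             anchor A p (a p) (\<lambda>x. anchor A x (b x) f) - anchor A p (b p) (\<lambda>x. anchor A x (a x) f)"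
proof -
  have "(\<forall>p. br a (\<lambda>x. f x *\<^sub>R b x) p = f p *\<^sub>R br a b p + anchor A p (a p) f *\<^sub>R b p) \<and>
        (\<forall>p. anchor A p (br a b p) f =
             anchor A p (a p) (\<lambda>x. anchor A x (b x) f) - anchor A p (b p) (\<lambda>x. anchor A x (a x) f))"
    using lie_algebroid_axioms[THEN conjunct2, THEN conjunct2, THEN conjunct2, THEN conjunct2, THEN conjunct2, THEN conjunct2] assms by blast
  then show "br a (\<lambda>x. f x *\<^sub>R b x) p = f p *\<^sub>R br a b p + anchor A p (a p) f *\<^sub>R b p"
    "anchor A p (br a b p) f =
             anchor A p (a p) (\<lambda>x. anchor A x (b x) f) - anchor A p (b p) (\<lambda>x. anchor A x (a x) f)"
    by blast+
qed

lemma br_sec [simp]: "sec a \<Longrightarrow> sec b \<Longrightarrow> sec (br a b)"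
  by (rule lie_algebra(1))

lemma br_skew: "sec a \<Longrightarrow> sec b \<Longrightarrow> br a b = - br b a"
  using lie_algebra(2)[of a b] by (simp add: fun_eq_iff)

lemma br_add [simp]:
  "sec a \<Longrightarrow> sec b \<Longrightarrow> sec d \<Longrightarrow> br (a + b) d = br a d + br b d"
  "sec a \<Longrightarrow> sec b \<Longrightarrow> sec d \<Longrightarrow> br d (a + b) = br d a + br d b"
proof -
  show l: "sec a \<Longrightarrow> sec b \<Longrightarrow> sec d \<Longrightarrow> br (a + b) d = br a d + br b d"
    using lie_algebra(4)[of a b d] by (simp add: fun_eq_iff plus_fun_def)
  show "sec a \<Longrightarrow> sec b \<Longrightarrow> sec d \<Longrightarrow> br d (a + b) = br d a + br d b"
    using l br_skew[of d "a + b"] br_skew[of d a] br_skew[of d b] by simp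
qed

lemma br_smul [simp]:
  "sec a \<Longrightarrow> sec b \<Longrightarrow> smooth f \<Longrightarrow> br a (f \<bullet>\<^sub>s b) = f \<bullet>\<^sub>s br a b + der a f \<bullet>\<^sub>s b"
  "sec a \<Longrightarrow> sec b \<Longrightarrow> smooth f \<Longrightarrow> br (f \<bullet>\<^sub>s a) b = f \<bullet>\<^sub>s br a b - der b f \<bullet>\<^sub>s a"
proof -
  show r: "sec a \<Longrightarrow> sec b \<Longrightarrow> smooth f \<Longrightarrow> br a (f \<bullet>\<^sub>s b) = f \<bullet>\<^sub>s br a b + der a f \<bullet>\<^sub>s b" for a b
    using leibniz(1)[of a b f] by (simp add: fun_eq_iff smul_def der_def)
  show "sec a \<Longrightarrow> sec b \<Longrightarrow> smooth f \<Longrightarrow> br (f \<bullet>\<^sub>s a) b = f \<bullet>\<^sub>s br a b - der b f \<bullet>\<^sub>s a"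
    using r[of b a] br_skew[of "f \<bullet>\<^sub>s a" b] br_skew[of a b] sec_closed(4)[of f a]
    by (simp add: fun_eq_iff smul_def)
qed

lemma br_minus [simp]:
  "sec a \<Longrightarrow> sec b \<Longrightarrow> br (- a) b = - br a b"
  "sec a \<Longrightarrow> sec b \<Longrightarrow> br a (- b) = - br a b"
  "sec b \<Longrightarrow> br 0 b = 0"
  "sec b \<Longrightarrow> br b 0 = 0"
proof -
  show l: "sec a \<Longrightarrow> sec b \<Longrightarrow> br (- a) b = - br a b" for a b
    using lie_algebra(3)[of a b "-1"] by (simp add: fun_eq_iff fun_Compl_def)
  show "sec a \<Longrightarrow> sec b \<Longrightarrow> br a (- b) = - br a b"
    using l[of b a] br_skew[of a "- b"] br_skew[of a b] by simp
  show "sec b \<Longrightarrow> br 0 b = 0" using br_add(1)[of 0 0 b] by simp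
  show "sec b \<Longrightarrow> br b 0 = 0" using br_add(2)[of 0 0 b] by simp
qed

lemma br_sum [simp]:
  "sec b \<Longrightarrow> (\<And>i. i \<in> I \<Longrightarrow> sec (a i)) \<Longrightarrow> br (\<Sum>i\<in>I. a i) b = (\<Sum>i\<in>I. br (a i) b)"
  "sec b \<Longrightarrow> (\<And>i. i \<in> I \<Longrightarrow> sec (a i)) \<Longrightarrow> br b (\<Sum>i\<in>I. a i) = (\<Sum>i\<in>I. br b (a i))"
  by (induction I rule: infinite_finite_induct) auto

lemma jacobi: "sec a \<Longrightarrow> sec b \<Longrightarrow> sec d \<Longrightarrow> br a (br b d) = br (br a b) d + br b (br a d)"
proof
  fix p assume s: "sec a" "sec b" "sec d"
  have "br b (br d a) = - br b (br a d)" "br d (br a b) = - br (br a b) d"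
    using s br_skew[of d a] br_skew[of d "br a b"] by simp_all
  then have "br a (br b d) p + - br b (br a d) p + - br (br a b) d p = 0"
    using lie_algebra(5)[of a b d p] s by simp
  then show "br a (br b d) p = (br (br a b) d + br b (br a d)) p"
    by (simp add: algebra_simps)
qed

lemma der_br: "sec a \<Longrightarrow> sec b \<Longrightarrow> smooth f \<Longrightarrow> der (br a b) f = der a (der b f) - der b (der a f)"
  using leibniz(2)[of a b f] by (simp add: fun_eq_iff der_def)

text \<open>The product of f - g with a bump function that vanishes off \<open>W\<close> is zero
  everywhere; the Leibniz rule at \<open>p\<close>, where the bump is 1 and f - g is 0, leaves the
  difference of the derivatives.\<close>

lemma der_local:
  assumes a: "sec a" and "smooth f" "smooth g" "open W" "p \<in> W" "\<And>x. x \<in> W \<Longrightarrow> f x = g x"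
  shows "der a f p = der a g p"
proof -
  obtain h C V where h: "smooth h" "closed C" "C \<subseteq> W" "open V" "p \<in> V" "V \<subseteq> C"
      "\<And>x. x \<in> V \<Longrightarrow> h x = 1" "\<And>x. x \<notin> C \<Longrightarrow> h x = 0"
    by (rule bump_function[OF manifold assms(4,5)]) blast
  have z: "h * (f - g) = 0"
  proof
    fix x show "(h * (f - g)) x = 0 x"
      using assms(6)[of x] h(3) h(8)[of x] by (cases "x \<in> W") auto
  qed
  have "der a (h * (f - g)) p = h p * (der a f p - der a g p) + (f p - g p) * der a h p"
    using a h(1) assms(2,3) by simp
  then show ?thesis using z a h(5,7) assms(5,6) by simp
qed

text \<open>After multiplication by a bump function the two sections coincide everywhere, and the
  Leibniz rule adds the same multiple of b(p) = c(p) to both brackets.\<close>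

lemma br_local:
  assumes a: "sec a" and "sec b" "sec c" "open W" "p \<in> W" "\<And>x. x \<in> W \<Longrightarrow> b x = c x"
  shows "br a b p = br a c p" "br b a p = br c a p"
proof -
  obtain h C V where h: "smooth h" "closed C" "C \<subseteq> W" "open V" "p \<in> V" "V \<subseteq> C"
      "\<And>x. x \<in> V \<Longrightarrow> h x = 1" "\<And>x. x \<notin> C \<Longrightarrow> h x = 0"
    by (rule bump_function[OF manifold assms(4,5)]) blast
  have z: "h \<bullet>\<^sub>s b = h \<bullet>\<^sub>s c"
  proof
    fix x show "(h \<bullet>\<^sub>s b) x = (h \<bullet>\<^sub>s c) x"
      using assms(6)[of x] h(3) h(8)[of x] by (cases "x \<in> W") (auto simp: smul_def)
  qed
  have "br a (h \<bullet>\<^sub>s b) p = br a b p + der a h p *\<^sub>R b p" "br a (h \<bullet>\<^sub>s c) p = br a c p + der a h p *\<^sub>R c p"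
    using br_smul(1)[OF a assms(2) h(1)] br_smul(1)[OF a assms(3) h(1)] h(5,7) by (simp_all add: smul_def)
  then show r: "br a b p = br a c p" using z assms(5,6) by simp
  show "br b a p = br c a p"
    using r br_skew[OF assms(2) a] br_skew[OF assms(3) a] by simp
qed

text \<open>A derivation of the algebra of smooth functions obeys the chain rule for \<open>exp\<close>, because the
  second-order Taylor remainder vanishes to second order.\<close>

lemma der_exp:
  assumes a: "sec a" and g: "smooth g"
  shows "smooth (\<lambda>x. exp (g x))" "der a (\<lambda>x. exp (g x)) p = exp (g p) * der a g p"
proof -
  obtain K :: "real \<Rightarrow> real" where K: "Cinf_on UNIV K" "\<And>x. exp x = 1 + x + x * x * K x"
    by (rule exp_second_order_remainder) blast
  define c where "c = (\<lambda>_::'m. g p)"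
  define k where "k = (\<lambda>x. K ((g - c) x))"
  have c: "smooth c" unfolding c_def by simp
  have k: "smooth k" unfolding k_def
    by (rule smooth_fun_compose_real[OF manifold open_UNIV _ open_UNIV K(1)]) (use g c in \<open>simp_all del: minus_apply\<close>)
  define e where "e = (\<lambda>_::'m. exp (g p))"
  have e: "smooth e" unfolding e_def by simp
  have eq: "(\<lambda>x. exp (g x)) = e * (1 + (g - c) + (g - c) * (g - c) * k)"
  proof
    fix x
    have "exp (g x) = exp (g p) * exp (g x - g p)" by (simp add: exp_diff)
    then show "exp (g x) = (e * (1 + (g - c) + (g - c) * (g - c) * k)) x"
      using K(2)[of "g x - g p"] by (simp add: e_def c_def k_def)
  qed
  show "smooth (\<lambda>x. exp (g x))" unfolding eq using e g c k by simp
  have "der a c = 0" "der a e = 0" unfolding c_def e_def using a by simp_all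
  then have "der a (e * (1 + (g - c) + (g - c) * (g - c) * k)) =
      e * (der a g + ((g - c) * (g - c) * der a k + k * ((g - c) * der a g + (g - c) * der a g)))"
    using a e g c k by simp
  then show "der a (\<lambda>x. exp (g x)) p = exp (g p) * der a g p"
    unfolding eq by (simp add: e_def c_def)
qed

text \<open>Squaring removes the sign: f^2 = exp(2 ln |f|) involves no case distinction, and
  differentiating it with \<open>der_exp\<close> and cancelling f gives the claim.\<close>

lemma der_ln_abs:
  assumes a: "sec a" and f: "smooth f" "\<And>x. f x \<noteq> 0"
  shows "f * der a (\<lambda>x. ln \<bar>f x\<bar>) = der a f"
proof -
  define g where "g = (\<lambda>x. ln \<bar>f x\<bar>)"
  have g: "smooth g" unfolding g_def by (rule smooth_fun_ln_abs[OF manifold open_UNIV f(1)]) (rule f(2))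
  have "(\<lambda>x. exp ((g + g) x)) = f * f"
  proof
    fix x
    have "exp (g x) = \<bar>f x\<bar>" using f(2) by (simp add: g_def)
    then show "exp ((g + g) x) = (f * f) x" by (simp only: plus_fun_apply exp_add) simp
  qed
  moreover have "exp ((g + g) p) * der a (g + g) p = (f p * f p) * (2 * der a g p)" for p
    using fun_cong[OF calculation, of p] der_linear(1)[OF a g g] by simp
  ultimately have "der a (f * f) p = (f p * f p) * (2 * der a g p)" for p
    using der_exp(2)[OF a smooth_closed(2)[OF g g], of p] by (simp only:)
  then have "f p * der a f p = f p * (f p * der a g p)" for p
    using a f(1) by simp
  then show ?thesis using f(2) by (auto simp: fun_eq_iff g_def)
qed

end

section \<open>The Lie algebroid differential and divergences\<close>

definition ev :: "('m \<Rightarrow> 'v list \<Rightarrow> real) \<Rightarrow> ('m \<Rightarrow> 'v) list \<Rightarrow> 'm \<Rightarrow> real" where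
  "ev \<omega> Us = (\<lambda>x. \<omega> x (map (\<lambda>U. U x) Us))"

lemma remove_nth_simps [simp]:
  "remove_nth 0 (x # xs) = xs"
  "remove_nth (Suc n) (x # xs) = x # remove_nth n xs"
  by (simp_all add: remove_nth_def)

lemma length_remove_nth: "i < length xs \<Longrightarrow> length (remove_nth i xs) = length xs - 1"
  by (simp add: remove_nth_def)

lemma set_remove_nth_subset: "set (remove_nth i xs) \<subseteq> set xs"
  by (auto simp: remove_nth_def dest: in_set_takeD in_set_dropD)

lemma sum_lessThan_add:
  fixes f :: "nat \<Rightarrow> 'a::comm_monoid_add"
  shows "(\<Sum>j<m + n. f j) = (\<Sum>j<m. f j) + (\<Sum>j<n. f (m + j))"
  by (induction n) (simp_all add: add.assoc)

context vbundle
begin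

lemma ev_smooth: "form E q \<omega> \<Longrightarrow> length Us = q \<Longrightarrow> (\<And>U. U \<in> set Us \<Longrightarrow> sec U) \<Longrightarrow> smooth (ev \<omega> Us)"
  unfolding ev_def by (rule form_smooth)

lemma ev_linear:
  assumes \<omega>: "form E q \<omega>" and l: "length Us + Suc (length Vs) = q"
    and s: "\<And>U. U \<in> set Us \<Longrightarrow> sec U" "\<And>U. U \<in> set Vs \<Longrightarrow> sec U" "sec a"
  shows "sec b \<Longrightarrow> ev \<omega> (Us @ (a + b) # Vs) = ev \<omega> (Us @ a # Vs) + ev \<omega> (Us @ b # Vs)"
    "ev \<omega> (Us @ (f \<bullet>\<^sub>s a) # Vs) = f * ev \<omega> (Us @ a # Vs)"
    "ev \<omega> (Us @ (- a) # Vs) = - ev \<omega> (Us @ a # Vs)"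
    "sec b \<Longrightarrow> ev \<omega> (Us @ (a - b) # Vs) = ev \<omega> (Us @ a # Vs) - ev \<omega> (Us @ b # Vs)"
proof -
  note alt = alternating_onD[OF alternating_on_form[OF \<omega>], of "map (\<lambda>U. U x) Us" "map (\<lambda>U. U x) Vs" for x]
  have sf: "set (map (\<lambda>U. U x) Us) \<subseteq> fibre E x" "set (map (\<lambda>U. U x) Vs) \<subseteq> fibre E x" for x
    using s by (auto intro: secD)
  have add: "ev \<omega> (Us @ (a + b) # Vs) = ev \<omega> (Us @ a # Vs) + ev \<omega> (Us @ b # Vs)" if "sec b" for b
    using alt(1)[OF _ sf secD[OF s(3)] secD[OF that]] l by (simp add: ev_def fun_eq_iff)
  have sc: "ev \<omega> (Us @ (f \<bullet>\<^sub>s a) # Vs) = f * ev \<omega> (Us @ a # Vs)" if "sec a" for f a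
    using alt(2)[OF _ sf secD[OF that]] l by (simp add: ev_def fun_eq_iff smul_def)
  have m: "ev \<omega> (Us @ (- a) # Vs) = - ev \<omega> (Us @ a # Vs)" if "sec a" for a
  proof -
    have "- a = (\<lambda>_. -1) \<bullet>\<^sub>s a" by (simp add: smul_def fun_eq_iff)
    moreover have "ev \<omega> (Us @ ((\<lambda>_. -1) \<bullet>\<^sub>s a) # Vs) = - ev \<omega> (Us @ a # Vs)"
      unfolding sc[OF that] by (simp add: fun_eq_iff)
    ultimately show ?thesis by (simp only:)
  qed
  show "sec b \<Longrightarrow> ev \<omega> (Us @ (a + b) # Vs) = ev \<omega> (Us @ a # Vs) + ev \<omega> (Us @ b # Vs)"
    by (rule add)
  show "ev \<omega> (Us @ (f \<bullet>\<^sub>s a) # Vs) = f * ev \<omega> (Us @ a # Vs)" by (rule sc[OF s(3)])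
  show "ev \<omega> (Us @ (- a) # Vs) = - ev \<omega> (Us @ a # Vs)" by (rule m[OF s(3)])
  show "sec b \<Longrightarrow> ev \<omega> (Us @ (a - b) # Vs) = ev \<omega> (Us @ a # Vs) - ev \<omega> (Us @ b # Vs)"
    using add[of "- b"] m[of b] by simp
qed

lemma ev_alternating:
  assumes \<omega>: "form E q \<omega>" and l: "length Us + length Vs + length Ws + 2 = q"
    and s: "\<And>U. U \<in> set Us \<Longrightarrow> sec U" "\<And>U. U \<in> set Vs \<Longrightarrow> sec U" "\<And>U. U \<in> set Ws \<Longrightarrow> sec U" "sec a"
  shows "ev \<omega> (Us @ a # Vs @ a # Ws) = 0"
    and "sec b \<Longrightarrow> ev \<omega> (Us @ a # Vs @ b # Ws) = - ev \<omega> (Us @ b # Vs @ a # Ws)"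
proof -
  have z: "ev \<omega> (Us @ a # Vs @ a # Ws) = 0" if a: "sec a" for a
  proof
    fix x
    have "set (map (\<lambda>U. U x) Us) \<subseteq> fibre E x" "set (map (\<lambda>U. U x) Vs) \<subseteq> fibre E x"
      "set (map (\<lambda>U. U x) Ws) \<subseteq> fibre E x" using s by (auto intro: secD)
    from alternating_onD(3)[OF alternating_on_form[OF \<omega>] _ this secD[OF a]]
    show "ev \<omega> (Us @ a # Vs @ a # Ws) x = 0 x" using l by (simp add: ev_def)
  qed
  show "ev \<omega> (Us @ a # Vs @ a # Ws) = 0" by (rule z[OF s(4)])
  assume b: "sec b"
  have "0 = ev \<omega> (Us @ (a + b) # Vs @ (a + b) # Ws)" using z[of "a + b"] b s(4) by simp
  also have "\<dots> = ev \<omega> (Us @ a # Vs @ (a + b) # Ws) + ev \<omega> (Us @ b # Vs @ (a + b) # Ws)"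
    by (rule ev_linear(1)[OF \<omega>]) (use l s b in auto)
  also have "ev \<omega> (Us @ a # Vs @ (a + b) # Ws) = ev \<omega> (Us @ a # Vs @ a # Ws) + ev \<omega> (Us @ a # Vs @ b # Ws)"
    using ev_linear(1)[OF \<omega>, of "Us @ a # Vs" Ws a b] l s b by auto
  also have "ev \<omega> (Us @ b # Vs @ (a + b) # Ws) = ev \<omega> (Us @ b # Vs @ a # Ws) + ev \<omega> (Us @ b # Vs @ b # Ws)"
    using ev_linear(1)[OF \<omega>, of "Us @ b # Vs" Ws a b] l s b by auto
  finally have "0 = ev \<omega> (Us @ a # Vs @ b # Ws) + ev \<omega> (Us @ b # Vs @ a # Ws)"
    by (simp only: z[OF s(4)] z[OF b] add_0_left add_0_right)
  then show "ev \<omega> (Us @ a # Vs @ b # Ws) = - ev \<omega> (Us @ b # Vs @ a # Ws)"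
    by (simp only: eq_neg_iff_add_eq_0)
qed

end

section \<open>The Koszul formula and the Lie derivative of forms\<close>

context algebroid_bundle
begin

text \<open>The terms are grouped by the role of \<open>X\<close>: it differentiates, is an argument
  of a differentiated value, is an entry of the bracket, or stands beside a bracket. Splitting off
  the first position shifts indices by one: this reverses the sign in the two middle groups, where
  one index shifts, and not in the last, where two do.\<close>

lemma koszul_Cons:
  "koszul A \<omega> (X # Us) p = der X (ev \<omega> Us) p
     - (\<Sum>k<length Us. (-1) ^ k * der (Us ! k) (ev \<omega> (X # remove_nth k Us)) p)
     - (\<Sum>l<length Us. (-1) ^ l * ev \<omega> (br X (Us ! l) # remove_nth l Us) p)
     + (\<Sum>l<length Us. \<Sum>k<l. (-1) ^ (k + l) *
          ev \<omega> (br (Us ! k) (Us ! l) # X # remove_nth k (remove_nth l Us)) p)"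
proof -
  have 1: "(\<Sum>i<Suc (length Us). (-1) ^ i *
        anchor A p (((X # Us) ! i) p) (\<lambda>x. \<omega> x (map (\<lambda>X. X x) (remove_nth i (X # Us))))) =
      der X (ev \<omega> Us) p - (\<Sum>k<length Us. (-1) ^ k * der (Us ! k) (ev \<omega> (X # remove_nth k Us)) p)"
    unfolding sum.lessThan_Suc_shift by (simp add: der_def ev_def sum_negf)
  have 2: "(\<Sum>i<Suc l. (-1) ^ (i + Suc l) *
        \<omega> p (bracket A ((X # Us) ! i) ((X # Us) ! Suc l) p #
          map (\<lambda>X. X p) (remove_nth i (remove_nth (Suc l) (X # Us))))) =
      - ((-1) ^ l * ev \<omega> (br X (Us ! l) # remove_nth l Us) p) +
      (\<Sum>k<l. (-1) ^ (k + l) * ev \<omega> (br (Us ! k) (Us ! l) # X # remove_nth k (remove_nth l Us)) p)" for l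
    unfolding sum.lessThan_Suc_shift by (simp add: ev_def)
  have 3: "(\<Sum>j<Suc (length Us). \<Sum>i<j. (-1) ^ (i + j) *
        \<omega> p (bracket A ((X # Us) ! i) ((X # Us) ! j) p #
          map (\<lambda>X. X p) (remove_nth i (remove_nth j (X # Us))))) =
     - (\<Sum>l<length Us. (-1) ^ l * ev \<omega> (br X (Us ! l) # remove_nth l Us) p)
     + (\<Sum>l<length Us. \<Sum>k<l. (-1) ^ (k + l) *
          ev \<omega> (br (Us ! k) (Us ! l) # X # remove_nth k (remove_nth l Us)) p)"
    unfolding sum.lessThan_Suc_shift[of _ "length Us"] 2 by (simp add: sum.distrib sum_negf sum_subtractf)
  show ?thesis unfolding koszul_def using 1 3 by simp
qed

lemma remove_nth_2_props:
  assumes "k < l" "l < length Us"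
  shows "length (remove_nth k (remove_nth l Us)) = length Us - 2"
    "set (remove_nth k (remove_nth l Us)) \<subseteq> set Us"
  using assms length_remove_nth[of l Us] length_remove_nth[of k "remove_nth l Us"]
    set_remove_nth_subset[of l Us] set_remove_nth_subset[of k "remove_nth l Us"] by auto

text \<open>Multiplying \<open>X\<close> by f produces derivatives of f along the other arguments
  twice, from differentiated values and from brackets, with opposite signs. The first argument is
  the place where \<open>lie_derivative\<close> inserts the value of a section and
  \<open>la_diff\<close> extends this value anew.\<close>

lemma koszul_first_tensorial:
  assumes \<omega>: "form A q \<omega>" and Us: "length Us = q" "\<And>U. U \<in> set Us \<Longrightarrow> sec U"
    and X: "sec X" "sec Y" "X p = Y p"
  shows "koszul A \<omega> (X # Us) p = koszul A \<omega> (Y # Us) p"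
proof (rule tensor_point[where \<Phi> = "\<lambda>X. koszul A \<omega> (X # Us) p"])
  have sU: "sec (Us ! k)" if "k < length Us" for k using Us(2) that by simp
  have rl: "length (remove_nth k Us) + 1 = q" "\<And>U. U \<in> set (remove_nth k Us) \<Longrightarrow> sec U" if "k < length Us" for k
    using that Us length_remove_nth[of k Us] set_remove_nth_subset[of k Us] by auto
  have rl2: "length (remove_nth k (remove_nth l Us)) + 2 = q" "\<And>U. U \<in> set (remove_nth k (remove_nth l Us)) \<Longrightarrow> sec U"
    if "k < l" "l < length Us" for k l
    using remove_nth_2_props[OF that] Us that by auto
  note lin1 = ev_linear[OF \<omega>, of "[]", simplified]
  have lin2: "sec s \<Longrightarrow> sec t \<Longrightarrow> ev \<omega> (br (Us ! k) (Us ! l) # (s + t) # remove_nth k (remove_nth l Us)) =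
      ev \<omega> (br (Us ! k) (Us ! l) # s # remove_nth k (remove_nth l Us)) +
      ev \<omega> (br (Us ! k) (Us ! l) # t # remove_nth k (remove_nth l Us))"
    "sec s \<Longrightarrow> ev \<omega> (br (Us ! k) (Us ! l) # (f \<bullet>\<^sub>s s) # remove_nth k (remove_nth l Us)) =
      f * ev \<omega> (br (Us ! k) (Us ! l) # s # remove_nth k (remove_nth l Us))"
    if kl: "k < l" "l < length Us" for k l s t f
    using ev_linear[OF \<omega>, of "[br (Us ! k) (Us ! l)]" "remove_nth k (remove_nth l Us)" s] rl2[OF kl] sU kl by auto
  have sm: "smooth (ev \<omega> (s # remove_nth k Us))" if "k < length Us" "sec s" for k s
    by (rule ev_smooth[OF \<omega>]) (use that rl in auto)
  show "koszul A \<omega> ((\<lambda>x. s x + t x) # Us) p = koszul A \<omega> (s # Us) p + koszul A \<omega> (t # Us) p"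
    if st: "sec s" "sec t" for s t
  proof -
    have "(\<lambda>x. s x + t x) = s + t" by (simp add: fun_eq_iff)
    moreover have "(\<Sum>k<length Us. (-1) ^ k * der (Us ! k) (ev \<omega> ((s + t) # remove_nth k Us)) p) =
        (\<Sum>k<length Us. (-1) ^ k * der (Us ! k) (ev \<omega> (s # remove_nth k Us)) p) +
        (\<Sum>k<length Us. (-1) ^ k * der (Us ! k) (ev \<omega> (t # remove_nth k Us)) p)"
      unfolding sum.distrib[symmetric]
      by (rule sum.cong) (use lin1(1) rl st sU sm in \<open>auto simp: algebra_simps\<close>)
    moreover have "(\<Sum>l<length Us. (-1) ^ l * ev \<omega> (br (s + t) (Us ! l) # remove_nth l Us) p) =
        (\<Sum>l<length Us. (-1) ^ l * ev \<omega> (br s (Us ! l) # remove_nth l Us) p) +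
        (\<Sum>l<length Us. (-1) ^ l * ev \<omega> (br t (Us ! l) # remove_nth l Us) p)"
      unfolding sum.distrib[symmetric]
      by (rule sum.cong) (use lin1(1) rl st sU in \<open>auto simp: algebra_simps\<close>)
    moreover have "(\<Sum>l<length Us. \<Sum>k<l. (-1) ^ (k + l) *
          ev \<omega> (br (Us ! k) (Us ! l) # (s + t) # remove_nth k (remove_nth l Us)) p) =
       (\<Sum>l<length Us. \<Sum>k<l. (-1) ^ (k + l) *
          ev \<omega> (br (Us ! k) (Us ! l) # s # remove_nth k (remove_nth l Us)) p) +
       (\<Sum>l<length Us. \<Sum>k<l. (-1) ^ (k + l) *
          ev \<omega> (br (Us ! k) (Us ! l) # t # remove_nth k (remove_nth l Us)) p)"
      unfolding sum.distrib[symmetric]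
      by (intro sum.cong refl) (use lin2(1) st in \<open>auto simp: algebra_simps\<close>)
    moreover have "der (s + t) (ev \<omega> Us) p = der s (ev \<omega> Us) p + der t (ev \<omega> Us) p"
      using st ev_smooth[OF \<omega> Us] by simp
    ultimately show ?thesis unfolding koszul_Cons by simp
  qed
  show "koszul A \<omega> ((\<lambda>x. f x *\<^sub>R s x) # Us) p = f p * koszul A \<omega> (s # Us) p"
    if f: "smooth f" and s: "sec s" for f s
  proof -
    \<comment> \<open>The common defect of the two middle groups of \<open>koszul_Cons\<close>; it
      enters once with each sign.\<close>
    let ?d = "\<Sum>k<length Us. (-1) ^ k * (der (Us ! k) f p * ev \<omega> (s # remove_nth k Us) p)"
    have "(\<lambda>x. f x *\<^sub>R s x) = f \<bullet>\<^sub>s s" by (simp add: fun_eq_iff smul_def)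
    moreover have "(\<Sum>k<length Us. (-1) ^ k * der (Us ! k) (ev \<omega> ((f \<bullet>\<^sub>s s) # remove_nth k Us)) p) =
        f p * (\<Sum>k<length Us. (-1) ^ k * der (Us ! k) (ev \<omega> (s # remove_nth k Us)) p) + ?d"
      unfolding sum_distrib_left sum.distrib[symmetric]
      by (rule sum.cong) (use lin1(2) rl s f sU sm in \<open>auto simp: algebra_simps\<close>)
    moreover have "(\<Sum>l<length Us. (-1) ^ l * ev \<omega> (br (f \<bullet>\<^sub>s s) (Us ! l) # remove_nth l Us) p) =
        f p * (\<Sum>l<length Us. (-1) ^ l * ev \<omega> (br s (Us ! l) # remove_nth l Us) p) - ?d"
      unfolding sum_distrib_left sum_subtractf[symmetric]
    proof (rule sum.cong)
      fix l assume l: "l \<in> {..<length Us}"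
      have e: "ev \<omega> (br (f \<bullet>\<^sub>s s) (Us ! l) # remove_nth l Us) =
          f * ev \<omega> (br s (Us ! l) # remove_nth l Us) - der (Us ! l) f * ev \<omega> (s # remove_nth l Us)"
        using l lin1(4)[of "remove_nth l Us" "f \<bullet>\<^sub>s br s (Us ! l)" "der (Us ! l) f \<bullet>\<^sub>s s"]
          lin1(2)[of "remove_nth l Us" "br s (Us ! l)" f] lin1(2)[of "remove_nth l Us" s "der (Us ! l) f"]
          rl[of l] s f sU[of l] by simp
      show "(-1) ^ l * ev \<omega> (br (f \<bullet>\<^sub>s s) (Us ! l) # remove_nth l Us) p =
          f p * ((-1) ^ l * ev \<omega> (br s (Us ! l) # remove_nth l Us) p) -
          (-1) ^ l * (der (Us ! l) f p * ev \<omega> (s # remove_nth l Us) p)"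
        unfolding fun_cong[OF e, of p] by (simp add: algebra_simps)
    qed simp
    moreover have "(\<Sum>l<length Us. \<Sum>k<l. (-1) ^ (k + l) *
          ev \<omega> (br (Us ! k) (Us ! l) # (f \<bullet>\<^sub>s s) # remove_nth k (remove_nth l Us)) p) =
       f p * (\<Sum>l<length Us. \<Sum>k<l. (-1) ^ (k + l) *
          ev \<omega> (br (Us ! k) (Us ! l) # s # remove_nth k (remove_nth l Us)) p)"
      unfolding sum_distrib_left
      by (intro sum.cong refl) (use lin2(2) s in \<open>auto simp: algebra_simps\<close>)
    moreover have "der (f \<bullet>\<^sub>s s) (ev \<omega> Us) p = f p * der s (ev \<omega> Us) p"
      using s ev_smooth[OF \<omega> Us] by simp
    ultimately show ?thesis unfolding koszul_Cons by (simp add: algebra_simps)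
  qed
qed (use X in auto)

text \<open>The value of \<open>L\<^bsub>X\<^esub> \<omega>\<close> on a list of sections.\<close>

definition lv :: "('m \<Rightarrow> 'v list \<Rightarrow> real) \<Rightarrow> ('m \<Rightarrow> 'v) \<Rightarrow> ('m \<Rightarrow> 'v) list \<Rightarrow> 'm \<Rightarrow> real" where
  "lv \<omega> X Us = der X (ev \<omega> Us) - (\<Sum>j<length Us. ev \<omega> (Us[j := br X (Us ! j)]))"

text \<open>The terms in which \<open>X\<close> is a mere argument cancel against the Koszul formula
  of the contracted form. The rest is the Lie derivative once [X, U_l] has been moved from the front
  to position l, at the cost of (-1)^l.\<close>

lemma cartan:
  assumes \<omega>: "form A q \<omega>" and Us: "length Us = q" "\<And>U. U \<in> set Us \<Longrightarrow> sec U" and X: "sec X"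
  shows "koszul A \<omega> (X # Us) p + koszul A (interior_prod X \<omega>) Us p = lv \<omega> X Us p"
proof -
  have sU: "sec (Us ! k)" if "k < length Us" for k using Us(2) that by simp
  have i1: "(\<Sum>i<length Us. (-1) ^ i *
        anchor A p ((Us ! i) p) (\<lambda>x. interior_prod X \<omega> x (map (\<lambda>X. X x) (remove_nth i Us)))) =
      (\<Sum>k<length Us. (-1) ^ k * der (Us ! k) (ev \<omega> (X # remove_nth k Us)) p)"
    by (simp add: der_def ev_def interior_prod_def)
  have sw: "ev \<omega> (X # br (Us ! k) (Us ! l) # remove_nth k (remove_nth l Us)) p =
      - ev \<omega> (br (Us ! k) (Us ! l) # X # remove_nth k (remove_nth l Us)) p" if kl: "k < l" "l < length Us" for k l
  proof -
    have "sec U" if "U \<in> set (remove_nth k (remove_nth l Us))" for U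
      using remove_nth_2_props(2)[OF kl] Us(2) that by blast
    from ev_alternating(2)[OF \<omega>, of "[]" "[]" "remove_nth k (remove_nth l Us)" X "br (Us ! k) (Us ! l)", OF _ _ _ this]
    have "ev \<omega> (X # br (Us ! k) (Us ! l) # remove_nth k (remove_nth l Us)) =
        - ev \<omega> (br (Us ! k) (Us ! l) # X # remove_nth k (remove_nth l Us))"
      using remove_nth_2_props(1)[OF kl] Us(1) kl X sU by simp
    then show ?thesis by simp
  qed
  have i2: "(\<Sum>j<length Us. \<Sum>i<j. (-1) ^ (i + j) * interior_prod X \<omega> p
        (bracket A (Us ! i) (Us ! j) p # map (\<lambda>X. X p) (remove_nth i (remove_nth j Us)))) =
      - (\<Sum>l<length Us. \<Sum>k<l. (-1) ^ (k + l) *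
          ev \<omega> (br (Us ! k) (Us ! l) # X # remove_nth k (remove_nth l Us)) p)"
    unfolding sum_negf[symmetric]
    by (intro sum.cong refl) (use sw in \<open>auto simp: interior_prod_def ev_def\<close>)
  have mv: "(-1) ^ l * ev \<omega> (br X (Us ! l) # remove_nth l Us) p = ev \<omega> (Us[l := br X (Us ! l)]) p"
    if l: "l < length Us" for l
  proof -
    let ?us = "map (\<lambda>U. U p) Us"
    have f: "set (take l ?us) \<subseteq> fibre A p" "set (drop (Suc l) ?us) \<subseteq> fibre A p"
      using Us(2) secD by (auto dest!: in_set_takeD in_set_dropD)
    have "\<omega> p ([] @ br X (Us ! l) p # take l ?us @ drop (Suc l) ?us) =
        (-1) ^ length (take l ?us) * \<omega> p ([] @ take l ?us @ br X (Us ! l) p # drop (Suc l) ?us)"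
      by (rule alternating_on_move[OF alternating_on_form[OF \<omega>] fibre_subspace])
        (use l f Us(1) X sU secD in auto)
    moreover have "(-1) ^ l * ((-1::real) ^ l * c) = c" for c
      by (simp add: mult.assoc[symmetric] power_add[symmetric])
    ultimately show ?thesis
      using l by (simp add: ev_def remove_nth_def upd_conv_take_nth_drop take_map drop_map)
  qed
  show ?thesis
    unfolding koszul_Cons lv_def koszul_def[of A "interior_prod X \<omega>"] i1 i2
    using mv by (simp add: sum_fun_apply)
qed

lemma lie_derivative_lv:
  assumes \<omega>: "form A q \<omega>" and us: "us \<in> tuples A q p" and X: "sec X"
  shows "lie_derivative A X \<omega> p us = lv \<omega> X (map (extend A p) us) p"
proof -
  have l: "length us = q" and f: "set us \<subseteq> fibre A p" using us by (auto simp: tuples_def)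
  have s: "sec U" if "U \<in> set (map (extend A p) us)" for U
    using that f extend(1) by auto
  have "koszul A \<omega> (extend A p (X p) # map (extend A p) us) p = koszul A \<omega> (X # map (extend A p) us) p"
    by (rule koszul_first_tensorial[OF \<omega>]) (use l s X secD extend in auto)
  moreover have "koszul A \<omega> (X # map (extend A p) us) p + koszul A (interior_prod X \<omega>) (map (extend A p) us) p =
      lv \<omega> X (map (extend A p) us) p"
    by (rule cartan[OF \<omega> _ s X]) (use l in simp)
  ultimately show ?thesis
    by (simp add: lie_derivative_def la_diff_def interior_prod_def[of X "la_diff A \<omega>"])
qed

lemma lv_split:
  "lv \<omega> X (Us @ V # Vs) = der X (ev \<omega> (Us @ V # Vs))
     - (\<Sum>j<length Us. ev \<omega> (Us[j := br X (Us ! j)] @ V # Vs))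
     - ev \<omega> (Us @ br X V # Vs)
     - (\<Sum>j<length Vs. ev \<omega> (Us @ V # Vs[j := br X (Vs ! j)]))"
proof -
  let ?g = "\<lambda>j. ev \<omega> ((Us @ V # Vs)[j := br X ((Us @ V # Vs) ! j)])"
  have "(\<Sum>j<length (Us @ V # Vs). ?g j) = (\<Sum>j<length Us. ?g j) + (\<Sum>j<Suc (length Vs). ?g (length Us + j))"
    using sum_lessThan_add[of ?g "length Us" "Suc (length Vs)"] by simp
  also have "(\<Sum>j<length Us. ?g j) = (\<Sum>j<length Us. ev \<omega> (Us[j := br X (Us ! j)] @ V # Vs))"
    by (rule sum.cong) (simp_all add: nth_append list_update_append)
  also have "(\<Sum>j<Suc (length Vs). ?g (length Us + j)) =
      ev \<omega> (Us @ br X V # Vs) + (\<Sum>j<length Vs. ev \<omega> (Us @ V # Vs[j := br X (Vs ! j)]))"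
    unfolding sum.lessThan_Suc_shift by (simp add: nth_append list_update_append)
  finally show ?thesis by (simp only: lv_def diff_diff_eq add.assoc)
qed

lemma sec_list_update:
  assumes "\<And>U. U \<in> set Us \<Longrightarrow> sec U" "sec X" "j < length Us"
  shows "U \<in> set (Us[j := br X (Us ! j)]) \<Longrightarrow> sec U"
  using assms set_update_subset_insert[of Us j "br X (Us ! j)"] by auto

text \<open>Derivatives of f along \<open>X\<close> arise from the differentiated value and from the
  bracket \<open>br X (f \<bullet>\<^sub>s a)\<close>, and cancel.\<close>

lemma lv_linear:
  assumes \<omega>: "form A q \<omega>" and l: "length Us + Suc (length Vs) = q" and X: "sec X"
    and s: "\<And>U. U \<in> set Us \<Longrightarrow> sec U" "\<And>U. U \<in> set Vs \<Longrightarrow> sec U" "sec a"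
  shows "sec b \<Longrightarrow> lv \<omega> X (Us @ (a + b) # Vs) = lv \<omega> X (Us @ a # Vs) + lv \<omega> X (Us @ b # Vs)"
    "smooth f \<Longrightarrow> lv \<omega> X (Us @ (f \<bullet>\<^sub>s a) # Vs) = f * lv \<omega> X (Us @ a # Vs)"
proof -
  note u1 = sec_list_update[OF s(1) X] and u2 = sec_list_update[OF s(2) X]
  have sm: "smooth (ev \<omega> (Us @ a # Vs))" if "sec a" for a
    by (rule ev_smooth[OF \<omega>]) (use l s that in auto)
  note lin = ev_linear[OF \<omega>]
  {
    assume b: "sec b"
    have "(\<Sum>j<length Us. ev \<omega> (Us[j := br X (Us ! j)] @ (a + b) # Vs)) =
        (\<Sum>j<length Us. ev \<omega> (Us[j := br X (Us ! j)] @ a # Vs)) + (\<Sum>j<length Us. ev \<omega> (Us[j := br X (Us ! j)] @ b # Vs))"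
      unfolding sum.distrib[symmetric] by (intro sum.cong refl lin(1)) (use l s b u1 in auto)
    moreover have "(\<Sum>j<length Vs. ev \<omega> (Us @ (a + b) # Vs[j := br X (Vs ! j)])) =
        (\<Sum>j<length Vs. ev \<omega> (Us @ a # Vs[j := br X (Vs ! j)])) + (\<Sum>j<length Vs. ev \<omega> (Us @ b # Vs[j := br X (Vs ! j)]))"
      unfolding sum.distrib[symmetric] by (intro sum.cong refl lin(1)) (use l s b u2 in auto)
    moreover have "ev \<omega> (Us @ br X (a + b) # Vs) = ev \<omega> (Us @ br X a # Vs) + ev \<omega> (Us @ br X b # Vs)"
      using lin(1)[of Us Vs "br X a" "br X b"] l s X b by simp
    moreover have "ev \<omega> (Us @ (a + b) # Vs) = ev \<omega> (Us @ a # Vs) + ev \<omega> (Us @ b # Vs)"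
      using lin(1)[of Us Vs a b] l s b by simp
    ultimately show "lv \<omega> X (Us @ (a + b) # Vs) = lv \<omega> X (Us @ a # Vs) + lv \<omega> X (Us @ b # Vs)"
      unfolding lv_split using sm b s X by simp
  next
    assume f: "smooth f"
    have "(\<Sum>j<length Us. ev \<omega> (Us[j := br X (Us ! j)] @ (f \<bullet>\<^sub>s a) # Vs)) =
        f * (\<Sum>j<length Us. ev \<omega> (Us[j := br X (Us ! j)] @ a # Vs))"
      unfolding sum_distrib_left by (intro sum.cong refl lin(2)) (use l s u1 in auto)
    moreover have "(\<Sum>j<length Vs. ev \<omega> (Us @ (f \<bullet>\<^sub>s a) # Vs[j := br X (Vs ! j)])) =
        f * (\<Sum>j<length Vs. ev \<omega> (Us @ a # Vs[j := br X (Vs ! j)]))"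
      unfolding sum_distrib_left by (intro sum.cong refl lin(2)) (use l s u2 in auto)
    moreover have "ev \<omega> (Us @ br X (f \<bullet>\<^sub>s a) # Vs) = f * ev \<omega> (Us @ br X a # Vs) + der X f * ev \<omega> (Us @ a # Vs)"
      using lin(1)[of Us Vs "f \<bullet>\<^sub>s br X a" "der X f \<bullet>\<^sub>s a"] lin(2)[of Us Vs "br X a" f] lin(2)[of Us Vs a "der X f"]
        l s X f by simp
    moreover have "ev \<omega> (Us @ (f \<bullet>\<^sub>s a) # Vs) = f * ev \<omega> (Us @ a # Vs)"
      using lin(2)[of Us Vs a f] l s by simp
    ultimately show "lv \<omega> X (Us @ (f \<bullet>\<^sub>s a) # Vs) = f * lv \<omega> X (Us @ a # Vs)"
      unfolding lv_split using sm s X f by (simp add: algebra_simps)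
  }
qed

text \<open>Bracketing \<open>X\<close> into one of the two equal entries gives two terms that
  differ by a transposition and so cancel; all other terms still contain the repeated entry.\<close>

lemma lv_alternating:
  assumes \<omega>: "form A q \<omega>" and l: "length Us + length Vs + length Ws + 2 = q" and X: "sec X"
    and s: "\<And>U. U \<in> set Us \<Longrightarrow> sec U" "\<And>U. U \<in> set Vs \<Longrightarrow> sec U" "\<And>U. U \<in> set Ws \<Longrightarrow> sec U" "sec a"
  shows "lv \<omega> X (Us @ a # Vs @ a # Ws) = 0"
proof -
  note u = sec_list_update[OF s(1) X] sec_list_update[OF s(2) X] sec_list_update[OF s(3) X]
  have 1: "(\<Sum>j<length (Us @ a # Vs). ev \<omega> ((Us @ a # Vs)[j := br X ((Us @ a # Vs) ! j)] @ a # Ws)) =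
      ev \<omega> (Us @ br X a # Vs @ a # Ws)"
  proof -
    let ?g = "\<lambda>j. ev \<omega> ((Us @ a # Vs)[j := br X ((Us @ a # Vs) ! j)] @ a # Ws)"
    have "(\<Sum>j<length (Us @ a # Vs). ?g j) = (\<Sum>j<length Us. ?g j) + (\<Sum>j<Suc (length Vs). ?g (length Us + j))"
      using sum_lessThan_add[of ?g "length Us" "Suc (length Vs)"] by simp
    moreover have "?g j = 0" if "j < length Us" for j
      using ev_alternating(1)[OF \<omega>, of "Us[j := br X (Us ! j)]" Vs Ws a] that u l s
      by (simp add: nth_append list_update_append)
    moreover have "(\<Sum>j<Suc (length Vs). ?g (length Us + j)) = ev \<omega> (Us @ br X a # Vs @ a # Ws)"
    proof -
      have "ev \<omega> (Us @ a # Vs[j := br X (Vs ! j)] @ a # Ws) = 0" if "j < length Vs" for j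
        by (rule ev_alternating(1)[OF \<omega>]) (use that u l s in auto)
      then show ?thesis unfolding sum.lessThan_Suc_shift by (simp add: nth_append list_update_append)
    qed
    ultimately show ?thesis by simp
  qed
  have 2: "(\<Sum>j<length Ws. ev \<omega> ((Us @ a # Vs) @ a # Ws[j := br X (Ws ! j)])) = 0"
  proof (rule sum.neutral, rule ballI)
    fix j assume "j \<in> {..<length Ws}"
    then show "ev \<omega> ((Us @ a # Vs) @ a # Ws[j := br X (Ws ! j)]) = 0"
      using ev_alternating(1)[OF \<omega>, of Us Vs "Ws[j := br X (Ws ! j)]" a] u l s by simp
  qed
  have 3: "ev \<omega> ((Us @ a # Vs) @ a # Ws) = 0"
    using ev_alternating(1)[OF \<omega> l s] by simp
  have 4: "ev \<omega> (Us @ br X a # Vs @ a # Ws) = - ev \<omega> (Us @ a # Vs @ br X a # Ws)"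
    by (rule ev_alternating(2)[OF \<omega> l]) (use s X in auto)
  show ?thesis
    using lv_split[of \<omega> X "Us @ a # Vs" a Ws] 1 2 3 4 X by simp
qed

text \<open>\<open>Ws\<close> collects the entries already exchanged, so that each step changes a
  single entry and \<open>tensor_point\<close> applies.\<close>

lemma lv_tensorial:
  assumes \<omega>: "form A q \<omega>" and X: "sec X"
  shows "length Us = length Vs \<Longrightarrow> length Ws + length Us = q \<Longrightarrow> (\<And>U. U \<in> set Ws \<union> set Us \<union> set Vs \<Longrightarrow> sec U) \<Longrightarrow>
    map (\<lambda>U. U p) Us = map (\<lambda>U. U p) Vs \<Longrightarrow> lv \<omega> X (Ws @ Us) p = lv \<omega> X (Ws @ Vs) p"
proof (induction Us Vs arbitrary: Ws rule: list_induct2)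
  case (Cons U Us V Vs)
  have "lv \<omega> X (Ws @ U # Us) p = lv \<omega> X (Ws @ V # Us) p"
  proof (rule tensor_point[where \<Phi> = "\<lambda>U. lv \<omega> X (Ws @ U # Us) p"])
    show "lv \<omega> X (Ws @ (\<lambda>x. s x + t x) # Us) p = lv \<omega> X (Ws @ s # Us) p + lv \<omega> X (Ws @ t # Us) p"
      if "sec s" "sec t" for s t
    proof -
      have e: "(\<lambda>x. s x + t x) = s + t" by (simp add: fun_eq_iff)
      show ?thesis unfolding e by (subst lv_linear(1)[OF \<omega> _ X]) (use that Cons.prems in auto)
    qed
    show "lv \<omega> X (Ws @ (\<lambda>x. f x *\<^sub>R s x) # Us) p = f p * lv \<omega> X (Ws @ s # Us) p"
      if "smooth f" "sec s" for f s
    proof -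
      have e: "(\<lambda>x. f x *\<^sub>R s x) = f \<bullet>\<^sub>s s" by (simp add: smul_def)
      show ?thesis unfolding e by (subst lv_linear(2)[OF \<omega> _ X]) (use that Cons.prems in auto)
    qed
  qed (use Cons.prems in auto)
  also have "\<dots> = lv \<omega> X (Ws @ V # Vs) p"
    using Cons.IH[of "Ws @ [V]"] Cons.prems by auto
  finally show ?case .
qed simp

text \<open>Makes the Lie derivative of a volume form a top form at each point, hence a multiple of
  the volume form; the divergence rests on this.\<close>

lemma lie_derivative_alternating:
  assumes \<omega>: "form A q \<omega>" and X: "sec X"
  shows "alternating_on (fibre A p) q (lie_derivative A X \<omega> p)"
proof -
  have sx: "sec U" if "U \<in> set (map (extend A p) us)" "set us \<subseteq> fibre A p" for U us
    using that extend(1) by auto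
  have ex: "map (\<lambda>U. U p) (map (extend A p) us) = us" if "set us \<subseteq> fibre A p" for us
    using that extend(2) by (induction us) auto
  have ld: "lie_derivative A X \<omega> p (map (\<lambda>U. U p) Us) = lv \<omega> X Us p"
    if "length Us = q" "\<And>U. U \<in> set Us \<Longrightarrow> sec U" for Us
  proof -
    have f: "set (map (\<lambda>U. U p) Us) \<subseteq> fibre A p" using that secD by auto
    have "lv \<omega> X ([] @ map (extend A p) (map (\<lambda>U. U p) Us)) p = lv \<omega> X ([] @ Us) p"
      by (rule lv_tensorial[OF \<omega> X]) (use that sx[OF _ f] ex[OF f] in auto)
    then show ?thesis
      using lie_derivative_lv[OF \<omega> _ X, of "map (\<lambda>U. U p) Us" p] that f by (simp add: tuples_def)
  qed
  show ?thesis
    unfolding alternating_on_def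
  proof (intro conjI allI impI, goal_cases)
    case (1 xs ys u v)
    let ?Xs = "map (extend A p) xs" and ?Ys = "map (extend A p) ys"
    let ?U = "extend A p u" and ?V = "extend A p v"
    have s: "\<And>U. U \<in> set ?Xs \<Longrightarrow> sec U" "\<And>U. U \<in> set ?Ys \<Longrightarrow> sec U" "sec ?U" "sec ?V"
      using 1 sx extend(1) by auto
    have "lie_derivative A X \<omega> p (map (\<lambda>U. U p) (?Xs @ (?U + ?V) # ?Ys)) = lv \<omega> X (?Xs @ (?U + ?V) # ?Ys) p"
      by (rule ld) (use 1 s in auto)
    moreover have "lie_derivative A X \<omega> p (map (\<lambda>U. U p) (?Xs @ ?U # ?Ys)) = lv \<omega> X (?Xs @ ?U # ?Ys) p"
      by (rule ld) (use 1 s in auto)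
    moreover have "lie_derivative A X \<omega> p (map (\<lambda>U. U p) (?Xs @ ?V # ?Ys)) = lv \<omega> X (?Xs @ ?V # ?Ys) p"
      by (rule ld) (use 1 s in auto)
    moreover have "lv \<omega> X (?Xs @ (?U + ?V) # ?Ys) = lv \<omega> X (?Xs @ ?U # ?Ys) + lv \<omega> X (?Xs @ ?V # ?Ys)"
      by (rule lv_linear(1)[OF \<omega> _ X]) (use 1 s in auto)
    ultimately show ?case
      using 1 ex[of xs] ex[of ys] extend(2) by simp
  next
    case (2 xs ys u c)
    let ?Xs = "map (extend A p) xs" and ?Ys = "map (extend A p) ys"
    let ?U = "extend A p u"
    have s: "\<And>U. U \<in> set ?Xs \<Longrightarrow> sec U" "\<And>U. U \<in> set ?Ys \<Longrightarrow> sec U" "sec ?U"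
      using 2 sx extend(1) by auto
    have "lie_derivative A X \<omega> p (map (\<lambda>U. U p) (?Xs @ ((\<lambda>_. c) \<bullet>\<^sub>s ?U) # ?Ys)) = lv \<omega> X (?Xs @ ((\<lambda>_. c) \<bullet>\<^sub>s ?U) # ?Ys) p"
      by (rule ld) (use 2 s in auto)
    moreover have "lie_derivative A X \<omega> p (map (\<lambda>U. U p) (?Xs @ ?U # ?Ys)) = lv \<omega> X (?Xs @ ?U # ?Ys) p"
      by (rule ld) (use 2 s in auto)
    moreover have "lv \<omega> X (?Xs @ ((\<lambda>_. c) \<bullet>\<^sub>s ?U) # ?Ys) = (\<lambda>_. c) * lv \<omega> X (?Xs @ ?U # ?Ys)"
      by (rule lv_linear(2)[OF \<omega> _ X]) (use 2 s in auto)
    ultimately show ?case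
      using 2 ex[of xs] ex[of ys] extend(2) by (simp add: smul_def)
  next
    case (3 xs ys zs u)
    let ?Xs = "map (extend A p) xs" and ?Ys = "map (extend A p) ys" and ?Zs = "map (extend A p) zs"
    let ?U = "extend A p u"
    have s: "\<And>U. U \<in> set ?Xs \<Longrightarrow> sec U" "\<And>U. U \<in> set ?Ys \<Longrightarrow> sec U" "\<And>U. U \<in> set ?Zs \<Longrightarrow> sec U" "sec ?U"
      using 3 sx extend(1) by auto
    have "lie_derivative A X \<omega> p (map (\<lambda>U. U p) (?Xs @ ?U # ?Ys @ ?U # ?Zs)) = lv \<omega> X (?Xs @ ?U # ?Ys @ ?U # ?Zs) p"
      by (rule ld) (use 3 s in auto)
    moreover have "lv \<omega> X (?Xs @ ?U # ?Ys @ ?U # ?Zs) = 0"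
      by (rule lv_alternating[OF \<omega> _ X]) (use 3 s in auto)
    ultimately show ?case
      using 3 ex[of xs] ex[of ys] ex[of zs] extend(2) by simp
  qed
qed

lemma lie_derivative_sections:
  assumes \<omega>: "form A q \<omega>" and X: "sec X" and Us: "length Us = q" "\<And>U. U \<in> set Us \<Longrightarrow> sec U"
  shows "lie_derivative A X \<omega> p (map (\<lambda>U. U p) Us) = lv \<omega> X Us p"
proof -
  have f: "set (map (\<lambda>U. U p) Us) \<subseteq> fibre A p" using Us secD by auto
  have "lv \<omega> X ([] @ map (extend A p) (map (\<lambda>U. U p) Us)) p = lv \<omega> X ([] @ Us) p"
    by (rule lv_tensorial[OF \<omega> X]) (use Us secD extend in auto)
  then show ?thesis
    using lie_derivative_lv[OF \<omega> _ X, of "map (\<lambda>U. U p) Us" p] Us f by (simp add: tuples_def)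
qed

end

section \<open>Differentials of 1-forms and of 3-forms\<close>

context algebroid_bundle
begin

text \<open>d \<alpha> on two sections, by the Koszul formula.\<close>

definition dd :: "('m \<Rightarrow> 'v \<Rightarrow> real) \<Rightarrow> ('m \<Rightarrow> 'v) \<Rightarrow> ('m \<Rightarrow> 'v) \<Rightarrow> 'm \<Rightarrow> real" where
  "dd \<alpha> U V = der U (pair \<alpha> V) - der V (pair \<alpha> U) - pair \<alpha> (br U V)"

lemma dd_smooth [simp]: "cosec \<alpha> \<Longrightarrow> sec U \<Longrightarrow> sec V \<Longrightarrow> smooth (dd \<alpha> U V)"
  by (simp add: dd_def)

lemma dd_linear:
  assumes "cosec \<alpha>" "sec U" "sec V"
  shows "sec U' \<Longrightarrow> dd \<alpha> (U + U') V = dd \<alpha> U V + dd \<alpha> U' V"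
    "smooth f \<Longrightarrow> dd \<alpha> (f \<bullet>\<^sub>s U) V = f * dd \<alpha> U V"
    "dd \<alpha> U V = - dd \<alpha> V U"
  using assms br_skew[of U V] by (simp_all add: dd_def algebra_simps)

lemma dd_tensorial:
  assumes \<alpha>: "cosec \<alpha>" and s: "sec U" "sec V" "sec U'" "sec V'" and p: "U p = U' p" "V p = V' p"
  shows "dd \<alpha> U V p = dd \<alpha> U' V' p"
proof -
  have t: "dd \<alpha> U V p = dd \<alpha> U' V p" if "sec U" "sec U'" "sec V" "U p = U' p" for U U' V
  proof (rule tensor_point[where \<Phi> = "\<lambda>U. dd \<alpha> U V p", OF _ _ that(1,2,4)])
    show "dd \<alpha> (\<lambda>x. s x + t x) V p = dd \<alpha> s V p + dd \<alpha> t V p" if "sec s" "sec t" for s t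
      using dd_linear(1)[OF \<alpha> that(1) \<open>sec V\<close> that(2)] by (simp add: plus_fun_def)
    show "dd \<alpha> (\<lambda>x. f x *\<^sub>R s x) V p = f p * dd \<alpha> s V p" if "smooth f" "sec s" for f s
      using dd_linear(2)[OF \<alpha> that(2) \<open>sec V\<close> that(1)] by (simp add: smul_def)
  qed
  have "dd \<alpha> U V p = dd \<alpha> U' V p" by (rule t) (use s p in auto)
  also have "\<dots> = - dd \<alpha> V U' p" using dd_linear(3)[OF \<alpha> s(3,2)] by simp
  also have "\<dots> = - dd \<alpha> V' U' p" using t[of V V' U'] s p by simp
  also have "\<dots> = dd \<alpha> U' V' p" using dd_linear(3)[OF \<alpha> s(3,4)] by simp
  finally show ?thesis .
qed

lemma koszul_form_of_section: "koszul A (form_of_section \<alpha>) [U, V] p = dd \<alpha> U V p"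
  by (simp add: koszul_Cons koszul_def dd_def ev_def form_of_section_def pair_def der_def)

lemma la_diff_form_of_section:
  assumes \<alpha>: "cosec \<alpha>" and "sec U" "sec V"
  shows "la_diff A (form_of_section \<alpha>) p [U p, V p] = dd \<alpha> U V p"
  unfolding la_diff_def list.map koszul_form_of_section
  by (rule dd_tensorial[OF \<alpha>]) (use assms secD extend in auto)

lemma la_diff_form_of_section_alternating:
  assumes \<alpha>: "cosec \<alpha>"
  shows "alternating_on (fibre A p) 2 (la_diff A (form_of_section \<alpha>) p)"
proof (rule alternating_on_2I[OF _ _ _ fibre_subspace])
  note la = la_diff_form_of_section[OF \<alpha>] and e = extend[of _ p]
  fix u u' v assume f: "u \<in> fibre A p" "u' \<in> fibre A p" "v \<in> fibre A p"
  have "la_diff A (form_of_section \<alpha>) p [(extend A p u + extend A p u') p, extend A p v p] =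
      (dd \<alpha> (extend A p u) (extend A p v) + dd \<alpha> (extend A p u') (extend A p v)) p"
    using la[of "extend A p u + extend A p u'" "extend A p v" p] f e
      dd_linear(1)[OF \<alpha>, of "extend A p u" "extend A p v" "extend A p u'"] by simp
  then show "la_diff A (form_of_section \<alpha>) p [u + u', v] =
      la_diff A (form_of_section \<alpha>) p [u, v] + la_diff A (form_of_section \<alpha>) p [u', v]"
    using la[of "extend A p u" "extend A p v" p] la[of "extend A p u'" "extend A p v" p] f e by simp
next
  note la = la_diff_form_of_section[OF \<alpha>] and e = extend[of _ p]
  fix u v c assume f: "u \<in> fibre A p" "v \<in> fibre A p"
  have "la_diff A (form_of_section \<alpha>) p [((\<lambda>_. c) \<bullet>\<^sub>s extend A p u) p, extend A p v p] =
      c * dd \<alpha> (extend A p u) (extend A p v) p"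
    using la[of "(\<lambda>_. c) \<bullet>\<^sub>s extend A p u" "extend A p v" p] f e
      dd_linear(2)[OF \<alpha>, of "extend A p u" "extend A p v" "\<lambda>_. c"] by simp
  then show "la_diff A (form_of_section \<alpha>) p [c *\<^sub>R u, v] = c * la_diff A (form_of_section \<alpha>) p [u, v]"
    using la[of "extend A p u" "extend A p v" p] f e by (simp add: smul_def)
next
  note la = la_diff_form_of_section[OF \<alpha>] and e = extend[of _ p]
  fix u v assume f: "u \<in> fibre A p" "v \<in> fibre A p"
  then show "la_diff A (form_of_section \<alpha>) p [u, v] = - la_diff A (form_of_section \<alpha>) p [v, u]"
    using la[of "extend A p u" "extend A p v" p] la[of "extend A p v" "extend A p u" p] e
      dd_linear(3)[OF \<alpha>, of "extend A p u" "extend A p v"] by simp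
qed

text \<open>The Koszul formula for d \<psi> on four sections, written out.\<close>

definition dd3 where
  "dd3 \<psi> U V W Z =
     der U (ev \<psi> [V, W, Z]) - der V (ev \<psi> [U, W, Z]) + der W (ev \<psi> [U, V, Z]) - der Z (ev \<psi> [U, V, W])
     - ev \<psi> [br U V, W, Z] + ev \<psi> [br U W, V, Z] - ev \<psi> [br U Z, V, W]
     - ev \<psi> [br V W, U, Z] + ev \<psi> [br V Z, U, W] - ev \<psi> [br W Z, U, V]"

lemma koszul_3: "koszul A \<psi> [U, V, W, Z] p = dd3 \<psi> U V W Z p"
  by (simp add: koszul_Cons koszul_def dd3_def ev_def der_def lessThan_Suc numeral_2_eq_2 numeral_3_eq_3)

lemma ev_3:
  assumes \<psi>: "form A 3 \<psi>" and s: "sec U" "sec V" "sec W"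
  shows "ev \<psi> [V, U, W] = - ev \<psi> [U, V, W]" "ev \<psi> [U, W, V] = - ev \<psi> [U, V, W]"
    "ev \<psi> [- U, V, W] = - ev \<psi> [U, V, W]" "smooth (ev \<psi> [U, V, W])"
proof -
  show "ev \<psi> [V, U, W] = - ev \<psi> [U, V, W]"
    using ev_alternating(2)[OF \<psi>, of "[]" "[]" "[W]" V U] s by simp
  show "ev \<psi> [U, W, V] = - ev \<psi> [U, V, W]"
    using ev_alternating(2)[OF \<psi>, of "[U]" "[]" "[]" W V] s by simp
  show "ev \<psi> [- U, V, W] = - ev \<psi> [U, V, W]"
    using ev_linear(3)[OF \<psi>, of "[]" "[V, W]" U] s by auto
  show "smooth (ev \<psi> [U, V, W])" by (rule ev_smooth[OF \<psi>]) (use s in auto)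
qed

lemma dd3_swap:
  assumes \<psi>: "form A 3 \<psi>" and s: "sec U" "sec V" "sec W" "sec Z"
  shows "dd3 \<psi> V U W Z = - dd3 \<psi> U V W Z" "dd3 \<psi> U W V Z = - dd3 \<psi> U V W Z" "dd3 \<psi> U V Z W = - dd3 \<psi> U V W Z"
proof -
  note e = ev_3[OF \<psi>]
  show "dd3 \<psi> V U W Z = - dd3 \<psi> U V W Z"
    using s br_skew[OF s(2,1)]
    by (simp add: dd3_def e(1)[of U V W] e(1)[of U V Z] e(2)[of "br W Z" U V] e(3,4) algebra_simps)
  show "dd3 \<psi> U W V Z = - dd3 \<psi> U V W Z"
    using s br_skew[OF s(3,2)]
    by (simp add: dd3_def e(1)[of V W Z] e(2)[of U V W] e(2)[of "br U Z" V W] e(3,4) algebra_simps)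
  show "dd3 \<psi> U V Z W = - dd3 \<psi> U V W Z"
    using s br_skew[OF s(4,3)]
    by (simp add: dd3_def e(2)[of V W Z] e(2)[of U W Z] e(2)[of "br U V" W Z] e(3,4) algebra_simps)
qed

text \<open>Closedness is given for values of \<open>la_diff\<close>, that is, on arbitrarily chosen
  extensions. Tensoriality in the first argument, carried to the others by skew symmetry, replaces
  the extensions by the given sections.\<close>

lemma dd3_eq_zero:
  assumes \<psi>: "form A 3 \<psi>" and cl: "\<And>p us. us \<in> tuples A 4 p \<Longrightarrow> la_diff A \<psi> p us = 0"
    and s: "sec U" "sec V" "sec W" "sec Z"
  shows "dd3 \<psi> U V W Z = 0"
proof
  fix p
  note sw = dd3_swap[OF \<psi>]
  have t: "dd3 \<psi> X U V W p = dd3 \<psi> Y U V W p" if "sec X" "sec Y" "sec U" "sec V" "sec W" "X p = Y p" for X Y U V W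
    unfolding koszul_3[symmetric] by (rule koszul_first_tensorial[OF \<psi>]) (use that in auto)
  have sw1: "dd3 \<psi> X U V W p = - dd3 \<psi> U X V W p" "dd3 \<psi> X U V W p = - dd3 \<psi> X V U W p" "dd3 \<psi> X U V W p = - dd3 \<psi> X U W V p"
    if "sec X" "sec U" "sec V" "sec W" for X U V W
    using sw[of U X V W] sw[of X V U W] sw[of X U W V] that by simp_all
  have e: "sec (extend A p (X p))" "extend A p (X p) p = X p" if "sec X" for X
    using that secD extend by auto
  define E where "E X = extend A p (X p)" for X
  have E: "sec (E X)" "X p = E X p" if "sec X" for X using e[OF that] by (simp_all add: E_def)
  have t2: "dd3 \<psi> X U V W p = dd3 \<psi> X (E U) V W p" if "sec X" "sec U" "sec V" "sec W" for X U V W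
    using sw1(1)[of X U V W] sw1(1)[of X "E U" V W] t[of U "E U" X V W] that E by simp
  have t3: "dd3 \<psi> X U V W p = dd3 \<psi> X U (E V) W p" if "sec X" "sec U" "sec V" "sec W" for X U V W
    using sw1(2)[of X U V W] sw1(2)[of X U "E V" W] t2[of X V U W] that E by simp
  have t4: "dd3 \<psi> X U V W p = dd3 \<psi> X U V (E W) p" if "sec X" "sec U" "sec V" "sec W" for X U V W
    using sw1(3)[of X U V W] sw1(3)[of X U V "E W"] t3[of X U W V] that E by simp
  have "dd3 \<psi> U V W Z p = dd3 \<psi> (E U) (E V) (E W) (E Z) p"
    using t[of U "E U" V W Z] t2[of "E U" V W Z] t3[of "E U" "E V" W Z] t4[of "E U" "E V" "E W" Z] s E by simp
  also have "\<dots> = la_diff A \<psi> p [U p, V p, W p, Z p]"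
    by (simp add: la_diff_def koszul_3 E_def)
  also have "\<dots> = 0" by (rule cl) (use s secD in \<open>auto simp: tuples_def\<close>)
  finally show "dd3 \<psi> U V W Z p = 0 p" by simp
qed

text \<open>The divergence of \<open>X\<close>, that is, \<open>L\<^bsub>X\<^esub> \<mu> = dv \<mu> X \<cdot> \<mu>\<close>.\<close>

definition dv :: "('m \<Rightarrow> 'v list \<Rightarrow> real) \<Rightarrow> ('m \<Rightarrow> 'v) \<Rightarrow> 'm \<Rightarrow> real" where
  "dv \<mu> X p = (let us = SOME us. us \<in> tuples A N p \<and> \<mu> p us \<noteq> 0 in lie_derivative A X \<mu> p us / \<mu> p us)"

text \<open>In \<open>dv\<close> an arbitrary tuple with non-zero value is selected; the quotient
  does not depend on it because top forms at a point are proportional.\<close>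

lemma lie_derivative_dv:
  assumes \<mu>: "volume_form A \<mu>" and X: "sec X" and us: "us \<in> tuples A N p"
  shows "lie_derivative A X \<mu> p us = dv \<mu> X p * \<mu> p us"
proof -
  have f: "form A N \<mu>" using \<mu> by (simp add: volume_form_def)
  define vs where "vs = (SOME us. us \<in> tuples A N p \<and> \<mu> p us \<noteq> 0)"
  have "\<exists>us. us \<in> tuples A N p \<and> \<mu> p us \<noteq> 0" using \<mu> unfolding volume_form_def by blast
  from someI_ex[OF this] have vs: "vs \<in> tuples A N p" "\<mu> p vs \<noteq> 0" unfolding vs_def by blast+
  have "lie_derivative A X \<mu> p us * \<mu> p vs = \<mu> p us * lie_derivative A X \<mu> p vs"
    by (rule top_forms_proportional[OF lie_derivative_alternating[OF f X] alternating_on_form[OF f]])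
      (use us vs in \<open>auto simp: tuples_def\<close>)
  then show ?thesis using vs(2) by (simp add: dv_def Let_def vs_def[symmetric] field_simps)
qed

lemma lv_eq_dv:
  assumes \<mu>: "volume_form A \<mu>" and X: "sec X" and Us: "length Us = N" "\<And>U. U \<in> set Us \<Longrightarrow> sec U"
  shows "lv \<mu> X Us = dv \<mu> X * ev \<mu> Us"
proof
  fix p
  have f: "form A N \<mu>" using \<mu> by (simp add: volume_form_def)
  have "map (\<lambda>U. U p) Us \<in> tuples A N p" using Us secD by (auto simp: tuples_def)
  from lie_derivative_dv[OF \<mu> X this] show "lv \<mu> X Us p = (dv \<mu> X * ev \<mu> Us) p"
    using lie_derivative_sections[OF f X Us(1), of p] Us(2) by (simp add: ev_def)
qed

lemma volume_frame:
  assumes \<mu>: "volume_form A \<mu>" and fr: "local_frame p W e \<epsilon>"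
  shows "x \<in> W \<Longrightarrow> ev \<mu> (map e [0..<N]) x \<noteq> 0"
    "length (map e [0..<N]) = N" "\<And>U. U \<in> set (map e [0..<N]) \<Longrightarrow> sec U"
proof -
  note f = local_frameD[OF fr]
  show "\<And>U. U \<in> set (map e [0..<N]) \<Longrightarrow> sec U" using f(3) by auto
  assume x: "x \<in> W"
  have sp: "\<exists>c. u = (\<Sum>i<N. c i *\<^sub>R e i x)" if "u \<in> fibre A x" for u
    using f(6)[OF x that] by (rule exI[where x="\<lambda>i. \<epsilon> i x u"])
  show "ev \<mu> (map e [0..<N]) x \<noteq> 0"
  proof
    assume z: "ev \<mu> (map e [0..<N]) x = 0"
    have a: "alternating_on (fibre A x) N (\<mu> x)"
      using \<mu> by (auto simp: volume_form_def intro: alternating_on_form)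
    have "\<mu> x us = 0" if "us \<in> tuples A N x" for us
      by (rule alternating_on_eq_zero[OF a fibre_subspace _ sp])
        (use that z f(3) secD in \<open>auto simp: tuples_def ev_def o_def\<close>)
    then show False using \<mu> unfolding volume_form_def by blast
  qed
qed simp

lemma dv_unique:
  assumes \<mu>: "volume_form A \<mu>" and X: "sec X"
    and c: "\<And>Us. length Us = N \<Longrightarrow> (\<And>U. U \<in> set Us \<Longrightarrow> sec U) \<Longrightarrow> lv \<mu> X Us = c * ev \<mu> Us"
  shows "dv \<mu> X = c"
proof
  fix p
  obtain W e \<epsilon> where fr: "local_frame p W e \<epsilon>" by (rule local_frame_exists)
  note v = volume_frame[OF \<mu> fr]
  have "dv \<mu> X * ev \<mu> (map e [0..<N]) = c * ev \<mu> (map e [0..<N])"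
    using lv_eq_dv[OF \<mu> X v(2,3)] c[OF v(2,3)] by simp
  from fun_cong[OF this, of p] show "dv \<mu> X p = c p" using v(1)[OF local_frameD(2)[OF fr]] by simp
qed

text \<open>Locally the divergence is a quotient of two smooth functions, the values of L_X \<mu>
  and of \<mu> on a local frame, the latter without zeros.\<close>

lemma dv_smooth [simp]:
  assumes \<mu>: "volume_form A \<mu>" and X: "sec X"
  shows "smooth (dv \<mu> X)"
proof (rule smooth_fun_local[OF manifold])
  fix p
  have f: "form A N \<mu>" using \<mu> by (simp add: volume_form_def)
  obtain W e \<epsilon> where fr: "local_frame p W e \<epsilon>" by (rule local_frame_exists)
  note v = volume_frame[OF \<mu> fr]
  let ?e = "map e [0..<N]"
  have se: "sec U" if "U \<in> set (?e[j := br X (?e ! j)])" "j < N" for U j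
  proof -
    have "j < length ?e" using that(2) by simp
    from sec_list_update[OF v(3) X this that(1)] show ?thesis by simp
  qed
  have s1: "smooth (ev \<mu> ?e)" by (rule ev_smooth[OF f v(2,3)])
  have s2: "smooth (lv \<mu> X ?e)"
    unfolding lv_def using X s1 se by (auto intro!: smooth_closed smooth_sum der_smooth ev_smooth[OF f])
  have "smooth_fun (atlas A) W (\<lambda>x. lv \<mu> X ?e x * inverse (ev \<mu> ?e x))"
    by (intro smooth_fun_mult[OF manifold local_frameD(1)[OF fr]] smooth_fun_inverse[OF manifold local_frameD(1)[OF fr]]
        smooth_fun_mono[OF s1] smooth_fun_mono[OF s2] v(1)) auto
  then have "smooth_fun (atlas A) W (dv \<mu> X)"
  proof (rule smooth_fun_cong[OF manifold local_frameD(1)[OF fr]])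
    fix x assume "x \<in> W"
    then show "lv \<mu> X ?e x * inverse (ev \<mu> ?e x) = dv \<mu> X x"
      using lv_eq_dv[OF \<mu> X v(2,3)] v(1) by simp
  qed
  then show "\<exists>V. open V \<and> p \<in> V \<and> smooth_fun (atlas A) V (dv \<mu> X)"
    using local_frameD(1,2)[OF fr] by blast
qed

lemma ev_update_linear:
  assumes \<omega>: "form A q \<omega>" and Us: "length Us = q" "\<And>U. U \<in> set Us \<Longrightarrow> sec U" and j: "j < q" and a: "sec a"
  shows "sec b \<Longrightarrow> ev \<omega> (Us[j := a + b]) = ev \<omega> (Us[j := a]) + ev \<omega> (Us[j := b])"
    "sec b \<Longrightarrow> ev \<omega> (Us[j := a - b]) = ev \<omega> (Us[j := a]) - ev \<omega> (Us[j := b])"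
    "ev \<omega> (Us[j := f \<bullet>\<^sub>s a]) = f * ev \<omega> (Us[j := a])"
proof -
  have t: "length (take j Us) + Suc (length (drop (Suc j) Us)) = q"
    "\<And>U. U \<in> set (take j Us) \<Longrightarrow> sec U" "\<And>U. U \<in> set (drop (Suc j) Us) \<Longrightarrow> sec U"
    using Us j by (auto dest: in_set_takeD in_set_dropD)
  have u: "Us[j := c] = take j Us @ c # drop (Suc j) Us" for c
    using j Us(1) by (simp add: upd_conv_take_nth_drop)
  show "sec b \<Longrightarrow> ev \<omega> (Us[j := a + b]) = ev \<omega> (Us[j := a]) + ev \<omega> (Us[j := b])"
    "sec b \<Longrightarrow> ev \<omega> (Us[j := a - b]) = ev \<omega> (Us[j := a]) - ev \<omega> (Us[j := b])"
    "ev \<omega> (Us[j := f \<bullet>\<^sub>s a]) = f * ev \<omega> (Us[j := a])"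
    unfolding u by (rule ev_linear[OF \<omega> t a]; assumption?)+
qed

lemma dv_add:
  assumes \<mu>: "volume_form A \<mu>" and X: "sec X" "sec Y"
  shows "dv \<mu> (X + Y) = dv \<mu> X + dv \<mu> Y"
proof (rule dv_unique[OF \<mu>])
  have f: "form A N \<mu>" using \<mu> by (simp add: volume_form_def)
  fix Us :: "('m \<Rightarrow> 'v) list" assume Us: "length Us = N" "\<And>U. U \<in> set Us \<Longrightarrow> sec U"
  have "(\<Sum>j<length Us. ev \<mu> (Us[j := br (X + Y) (Us ! j)])) =
      (\<Sum>j<length Us. ev \<mu> (Us[j := br X (Us ! j)])) + (\<Sum>j<length Us. ev \<mu> (Us[j := br Y (Us ! j)]))"
    unfolding sum.distrib[symmetric]
    by (rule sum.cong) (use ev_update_linear(1)[OF f Us] Us X in auto)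
  then have "lv \<mu> (X + Y) Us = lv \<mu> X Us + lv \<mu> Y Us"
    unfolding lv_def using X ev_smooth[OF f Us] by simp
  then show "lv \<mu> (X + Y) Us = (dv \<mu> X + dv \<mu> Y) * ev \<mu> Us"
    using lv_eq_dv[OF \<mu> X(1) Us] lv_eq_dv[OF \<mu> X(2) Us] by (simp add: algebra_simps)
qed (use X in simp)

text \<open>Inside the brackets f is differentiated along the frame vectors e_j, and the term for
  e_j carries the value of \<mu> with e_j replaced by X. The replacement multiplies by the j-th
  coordinate of X, so these terms add up to the derivative of f along X.\<close>

lemma dv_smul:
  assumes \<mu>: "volume_form A \<mu>" and X: "sec X" and f: "smooth f"
  shows "dv \<mu> (f \<bullet>\<^sub>s X) = f * dv \<mu> X + der X f"
proof
  fix p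
  have fm: "form A N \<mu>" using \<mu> by (simp add: volume_form_def)
  obtain W e \<epsilon> where fr: "local_frame p W e \<epsilon>" by (rule local_frame_exists)
  note v = volume_frame[OF \<mu> fr] and fd = local_frameD[OF fr]
  let ?e = "map e [0..<N]"
  \<comment> \<open>Cramer's rule: all components of X other than the j-th repeat a frame vector and
    drop out.\<close>
  have e1: "ev \<mu> (?e[j := X]) p = \<epsilon> j p (X p) * ev \<mu> ?e p" if j: "j < N" for j
  proof -
    let ?v = "map (\<lambda>i. e i p) [0..<N]"
    have t: "set (take j ?v) \<subseteq> fibre A p" "set (drop (Suc j) ?v) \<subseteq> fibre A p"
      using fd(3) secD by (auto dest!: in_set_takeD in_set_dropD)
    have d: "\<mu> p (?v[j := e i p]) = (if i = j then ev \<mu> ?e p else 0)" if i: "i < N" for i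
    proof (cases "i = j")
      case True
      then have "?v[j := e i p] = ?v" using j by (simp add: list_update_id[of ?v j, simplified] map_update[symmetric])
          (metis (no_types, lifting) add_0 diff_zero length_map length_upt list_update_id nth_map_upt)
      then show ?thesis using True by (simp add: ev_def o_def)
    next
      case False
      have al: "alternating_on (fibre A p) N (\<mu> p)" by (rule alternating_on_form[OF fm])
      have "\<not> distinct (?v[j := e i p])"
      proof -
        have "(?v[j := e i p]) ! i = (?v[j := e i p]) ! j" using False i j by simp
        then show ?thesis using False i j by (metis distinct_conv_nth length_list_update length_map length_upt minus_nat.diff_0)
      qed
      then obtain xs y ys zs where "?v[j := e i p] = xs @ [y] @ ys @ [y] @ zs"
        using not_distinct_decomp by blast
      moreover have "set (?v[j := e i p]) \<subseteq> fibre A p"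
        using fd(3) secD i set_update_subset_insert[of ?v j "e i p"] by auto
      moreover have "length (?v[j := e i p]) = N" by simp
      ultimately show ?thesis
        using alternating_onD(3)[OF al, of xs ys zs y] False by auto
    qed
    have "\<mu> p (?v[j := X p]) = \<mu> p (take j ?v @ (\<Sum>i<N. \<epsilon> i p (X p) *\<^sub>R e i p) # drop (Suc j) ?v)"
      using fd(6)[OF fd(2) secD[OF X]] j by (simp add: upd_conv_take_nth_drop)
    also have "\<dots> = (\<Sum>i<N. \<epsilon> i p (X p) * \<mu> p (take j ?v @ e i p # drop (Suc j) ?v))"
      by (rule alternating_on_sum[OF alternating_on_form[OF fm] fibre_subspace]) (use t j fd(3) secD in auto)
    also have "\<dots> = (\<Sum>i<N. \<epsilon> i p (X p) * (if i = j then ev \<mu> ?e p else 0))"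
      by (rule sum.cong) (use d j in \<open>auto simp: upd_conv_take_nth_drop\<close>)
    also have "\<dots> = \<epsilon> j p (X p) * ev \<mu> ?e p" using j by (simp add: if_distrib cong: if_cong)
    finally show ?thesis by (simp add: ev_def map_update o_def)
  qed
  have S: "(\<Sum>j<N. ev \<mu> (?e[j := br (f \<bullet>\<^sub>s X) (?e ! j)])) =
      f * (\<Sum>j<N. ev \<mu> (?e[j := br X (?e ! j)])) - (\<Sum>j<N. der (e j) f * ev \<mu> (?e[j := X]))"
    unfolding sum_distrib_left sum_subtractf[symmetric]
  proof (rule sum.cong)
    fix j assume j: "j \<in> {..<N}"
    then show "ev \<mu> (?e[j := br (f \<bullet>\<^sub>s X) (?e ! j)]) = f * ev \<mu> (?e[j := br X (?e ! j)]) - der (e j) f * ev \<mu> (?e[j := X])"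
      using ev_update_linear(2)[OF fm v(2,3), of j "f \<bullet>\<^sub>s br X (e j)" "der (e j) f \<bullet>\<^sub>s X"]
        ev_update_linear(3)[OF fm v(2,3), of j "br X (e j)" f] ev_update_linear(3)[OF fm v(2,3), of j X "der (e j) f"]
        X f fd(3)[of j] by simp
  qed simp
  have "lv \<mu> (f \<bullet>\<^sub>s X) ?e p = f p * lv \<mu> X ?e p + (\<Sum>j<N. der (e j) f p * (\<epsilon> j p (X p) * ev \<mu> ?e p))"
  proof -
    have "lv \<mu> (f \<bullet>\<^sub>s X) ?e = f * lv \<mu> X ?e + (\<Sum>j<N. der (e j) f * ev \<mu> (?e[j := X]))"
      unfolding lv_def v(2) S using X f ev_smooth[OF fm v(2,3)] by (simp add: right_diff_distrib)
    from fun_cong[OF this, of p] show ?thesis using e1 by (simp add: sum_fun_apply)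
  qed
  also have "(\<Sum>j<N. der (e j) f p * (\<epsilon> j p (X p) * ev \<mu> ?e p)) = (\<Sum>j<N. \<epsilon> j p (X p) * der (e j) f p) * ev \<mu> ?e p"
    unfolding sum_distrib_right by (rule sum.cong) auto
  also have "(\<Sum>j<N. \<epsilon> j p (X p) * der (e j) f p) = der X f p"
    by (rule local_frame_expand[where \<Phi> = "\<lambda>X. der X f p", OF fr _ _ X, symmetric])
      (use f der_left(1)[unfolded plus_fun_def] der_left(2)[unfolded smul_def] in auto)
  finally have "dv \<mu> (f \<bullet>\<^sub>s X) p * ev \<mu> ?e p = (f p * dv \<mu> X p + der X f p) * ev \<mu> ?e p"
    using lv_eq_dv[OF \<mu> _ v(2,3), of "f \<bullet>\<^sub>s X"] lv_eq_dv[OF \<mu> X v(2,3)] X f by (simp add: algebra_simps)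
  then show "dv \<mu> (f \<bullet>\<^sub>s X) p = (f * dv \<mu> X + der X f) p" using v(1)[OF fd(2)] by simp
qed

text \<open>The divergence is a cocycle because L_[X,Y] is the commutator of L_X and L_Y. On a list
  of sections, terms with both brackets in one entry (\<open>T\<close>) combine by the Jacobi
  identity, and terms with brackets in two different entries (\<open>S\<close>) are symmetric in X
  and Y and cancel.\<close>

lemma dv_br:
  assumes \<mu>: "volume_form A \<mu>" and X: "sec X" and Y: "sec Y"
  shows "dv \<mu> (br X Y) = der X (dv \<mu> Y) - der Y (dv \<mu> X)"
proof (rule dv_unique[OF \<mu>])
  have f: "form A N \<mu>" using \<mu> by (simp add: volume_form_def)
  fix Us :: "('m \<Rightarrow> 'v) list" assume Us: "length Us = N" "\<And>U. U \<in> set Us \<Longrightarrow> sec U"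
  define u where "u X j = Us[j := br X (Us ! j)]" for X j
  have u: "length (u X j) = N" "\<And>U. U \<in> set (u X j) \<Longrightarrow> sec U" if "sec X" "j < N" for X j
  proof -
    show "length (u X j) = N" using Us(1) by (simp add: u_def)
    fix U assume "U \<in> set (u X j)"
    then show "sec U" unfolding u_def by (rule sec_list_update[OF Us(2) that(1), rotated 2]) (use that Us(1) in simp_all)
  qed
  have sm: "smooth (ev \<mu> Us)" "\<And>X j. sec X \<Longrightarrow> j < N \<Longrightarrow> smooth (ev \<mu> (u X j))"
    using ev_smooth[OF f Us] ev_smooth[OF f u] by auto
  define S where "S X Y = (\<Sum>j<N. \<Sum>k\<in>{..<N} - {j}. ev \<mu> (Us[j := br X (Us ! j), k := br Y (Us ! k)]))" for X Y
  have S: "S X Y = S Y X" for X Y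
  proof -
    have "S X Y = (\<Sum>(j, k) | j < N \<and> k < N \<and> k \<noteq> j. ev \<mu> (Us[j := br X (Us ! j), k := br Y (Us ! k)]))"
      unfolding S_def by (subst sum.Sigma) (auto intro!: sum.cong)
    also have "\<dots> = (\<Sum>(k, j) | k < N \<and> j < N \<and> k \<noteq> j. ev \<mu> (Us[j := br X (Us ! j), k := br Y (Us ! k)]))"
      by (rule sum.reindex_bij_witness[where i = prod.swap and j = prod.swap]) auto
    also have "\<dots> = (\<Sum>(k, j) | k < N \<and> j < N \<and> j \<noteq> k. ev \<mu> (Us[k := br Y (Us ! k), j := br X (Us ! j)]))"
      by (rule sum.cong) (auto simp: list_update_swap)
    also have "\<dots> = S Y X"
      unfolding S_def by (subst sum.Sigma) (auto intro!: sum.cong)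
    finally show ?thesis .
  qed
  define T where "T X Y = (\<Sum>j<N. ev \<mu> (Us[j := br Y (br X (Us ! j))]))" for X Y
  have lv2: "(\<Sum>j<N. lv \<mu> Y (u X j)) = (\<Sum>j<N. der Y (ev \<mu> (u X j))) - T X Y - S X Y"
    if XY: "sec X" "sec Y" for X Y
  proof -
    have "lv \<mu> Y (u X j) = der Y (ev \<mu> (u X j)) - ev \<mu> (Us[j := br Y (br X (Us ! j))]) -
        (\<Sum>k\<in>{..<N} - {j}. ev \<mu> (Us[j := br X (Us ! j), k := br Y (Us ! k)]))" if j: "j < N" for j
    proof -
      have "(\<Sum>k<N. ev \<mu> ((u X j)[k := br Y (u X j ! k)])) =
        ev \<mu> ((u X j)[j := br Y (u X j ! j)]) + (\<Sum>k\<in>{..<N} - {j}. ev \<mu> ((u X j)[k := br Y (u X j ! k)]))"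
        using j by (intro sum.remove) auto
      also have "(u X j)[j := br Y (u X j ! j)] = Us[j := br Y (br X (Us ! j))]"
        using j Us(1) by (simp add: u_def)
      also have "(\<Sum>k\<in>{..<N} - {j}. ev \<mu> ((u X j)[k := br Y (u X j ! k)])) =
          (\<Sum>k\<in>{..<N} - {j}. ev \<mu> (Us[j := br X (Us ! j), k := br Y (Us ! k)]))"
        by (rule sum.cong) (auto simp: u_def)
      finally show ?thesis unfolding lv_def u(1)[OF XY(1) j] by (simp only: diff_diff_eq)
    qed
    then show ?thesis by (simp add: sum_subtractf T_def S_def)
  qed
  have lvS: "(\<Sum>j<N. ev \<mu> (u X j)) = der X (ev \<mu> Us) - dv \<mu> X * ev \<mu> Us" if "sec X" for X
  proof -
    have "der X (ev \<mu> Us) - (\<Sum>j<N. ev \<mu> (u X j)) = dv \<mu> X * ev \<mu> Us"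
      using lv_eq_dv[OF \<mu> that Us] Us(1) by (simp only: lv_def u_def)
    then show ?thesis by (simp only: diff_eq_eq eq_diff_eq add.commute)
  qed
  \<comment> \<open>The sum over j of L_Y \<mu>, taken on the list with [X, U_j] in position j, is
    computed once through the divergence of Y and once from the definition of the Lie
    derivative.\<close>
  have key: "dv \<mu> Y * (der X (ev \<mu> Us) - dv \<mu> X * ev \<mu> Us) =
      der Y (der X (ev \<mu> Us)) - (dv \<mu> X * der Y (ev \<mu> Us) + ev \<mu> Us * der Y (dv \<mu> X)) - T X Y - S X Y"
    if XY: "sec X" "sec Y" for X Y
  proof -
    have "dv \<mu> Y * (\<Sum>j<N. ev \<mu> (u X j)) = (\<Sum>j<N. lv \<mu> Y (u X j))"
      unfolding sum_distrib_left by (rule sum.cong) (use lv_eq_dv[OF \<mu> XY(2) u[OF XY(1)]] in auto)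
    also have "\<dots> = (\<Sum>j<N. der Y (ev \<mu> (u X j))) - T X Y - S X Y" by (rule lv2[OF XY])
    also have "(\<Sum>j<N. der Y (ev \<mu> (u X j))) = der Y (\<Sum>j<N. ev \<mu> (u X j))"
      by (rule der_sum[symmetric]) (use XY sm in auto)
    also have "\<dots> = der Y (der X (ev \<mu> Us)) - (dv \<mu> X * der Y (ev \<mu> Us) + ev \<mu> Us * der Y (dv \<mu> X))"
      unfolding lvS[OF XY(1)] using XY sm \<mu> by simp
    finally show ?thesis unfolding lvS[OF XY(1)] .
  qed
  have TT: "(\<Sum>j<N. ev \<mu> (Us[j := br (br X Y) (Us ! j)])) = T Y X - T X Y"
    unfolding T_def sum_subtractf[symmetric]
  proof (rule sum.cong)
    fix j assume j: "j \<in> {..<N}"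
    then have s: "sec (Us ! j)" using Us by simp
    have "br (br X Y) (Us ! j) = br X (br Y (Us ! j)) - br Y (br X (Us ! j))"
      using jacobi[OF X Y s] by simp
    then show "ev \<mu> (Us[j := br (br X Y) (Us ! j)]) =
        ev \<mu> (Us[j := br X (br Y (Us ! j))]) - ev \<mu> (Us[j := br Y (br X (Us ! j))])"
      using ev_update_linear(2)[OF f Us, of j] j s X Y by simp
  qed simp
  have "lv \<mu> (br X Y) Us = der X (der Y (ev \<mu> Us)) - der Y (der X (ev \<mu> Us)) - (T Y X - T X Y)"
    unfolding lv_def Us(1) TT using der_br[OF X Y sm(1)] by simp
  also have "T Y X = der X (der Y (ev \<mu> Us)) - (dv \<mu> Y * der X (ev \<mu> Us) + ev \<mu> Us * der X (dv \<mu> Y)) - S Y X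
      - dv \<mu> X * (der Y (ev \<mu> Us) - dv \<mu> Y * ev \<mu> Us)"
    using key[OF Y X] by (simp add: algebra_simps)
  also have "T X Y = der Y (der X (ev \<mu> Us)) - (dv \<mu> X * der Y (ev \<mu> Us) + ev \<mu> Us * der Y (dv \<mu> X)) - S X Y
      - dv \<mu> Y * (der X (ev \<mu> Us) - dv \<mu> X * ev \<mu> Us)"
    using key[OF X Y] by (simp add: algebra_simps)
  finally show "lv \<mu> (br X Y) Us = (der X (dv \<mu> Y) - der Y (dv \<mu> X)) * ev \<mu> Us"
    unfolding S[of X Y] by (simp add: fun_eq_iff algebra_simps)
qed (use X Y in simp)

section \<open>Change of the volume form\<close>

lemma volume_form_ratio:
  assumes \<mu>: "volume_form A \<mu>" and \<nu>: "volume_form A \<nu>"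
  obtains f where "smooth f" "\<And>x. f x \<noteq> 0" "\<And>p us. us \<in> tuples A N p \<Longrightarrow> \<nu> p us = f p * \<mu> p us"
proof -
  have fm: "form A N \<mu>" and fn: "form A N \<nu>" using \<mu> \<nu> by (simp_all add: volume_form_def)
  have "\<exists>c. c \<noteq> 0 \<and> (\<forall>us\<in>tuples A N p. \<nu> p us = c * \<mu> p us)" for p
  proof -
    obtain vs where vs: "vs \<in> tuples A N p" "\<mu> p vs \<noteq> 0" using \<mu> unfolding volume_form_def by blast
    obtain ws where ws: "ws \<in> tuples A N p" "\<nu> p ws \<noteq> 0" using \<nu> unfolding volume_form_def by blast
    have r: "\<nu> p us * \<mu> p vs = \<mu> p us * \<nu> p vs" if "us \<in> tuples A N p" for us
      by (rule top_forms_proportional[OF alternating_on_form[OF fn] alternating_on_form[OF fm]])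
        (use that vs in \<open>auto simp: tuples_def\<close>)
    have "\<nu> p vs \<noteq> 0" using r[OF ws(1)] ws(2) vs(2) by auto
    then show ?thesis
      using r vs(2) by (intro exI[of _ "\<nu> p vs / \<mu> p vs"]) (auto simp: field_simps)
  qed
  then obtain f where f: "\<And>p. f p \<noteq> 0" "\<And>p us. us \<in> tuples A N p \<Longrightarrow> \<nu> p us = f p * \<mu> p us" by metis
  have "smooth f"
  proof (rule smooth_fun_local[OF manifold])
    fix p
    obtain W e \<epsilon> where fr: "local_frame p W e \<epsilon>" by (rule local_frame_exists)
    note v = volume_frame[OF \<mu> fr]
    let ?e = "map e [0..<N]"
    note W = local_frameD(1)[OF fr]
    have "smooth_fun (atlas A) W (\<lambda>x. ev \<nu> ?e x * inverse (ev \<mu> ?e x))"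
      by (intro smooth_fun_mult[OF manifold W] smooth_fun_inverse[OF manifold W]
          smooth_fun_mono[OF ev_smooth[OF fm v(2,3)]] smooth_fun_mono[OF ev_smooth[OF fn v(2,3)]] v(1)) auto
    then have "smooth_fun (atlas A) W f"
    proof (rule smooth_fun_cong[OF manifold W])
      fix x assume x: "x \<in> W"
      have "map (\<lambda>U. U x) ?e \<in> tuples A N x" using v(2,3) secD by (auto simp: tuples_def)
      from f(2)[OF this] show "ev \<nu> ?e x * inverse (ev \<mu> ?e x) = f x"
        using v(1)[OF x] by (simp add: ev_def)
    qed
    then show "\<exists>V. open V \<and> p \<in> V \<and> smooth_fun (atlas A) V f"
      using local_frameD(1,2)[OF fr] by blast
  qed
  then show thesis using f by (rule that)
qed

text \<open>L_X (f \<mu>) = (X f + f div X) \<mu>, and X f is f times the derivative of ln |f| by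
  \<open>der_ln_abs\<close>.\<close>

lemma dv_change:
  assumes \<mu>: "volume_form A \<mu>" and \<nu>: "volume_form A \<nu>" and f: "smooth f" "\<And>x. f x \<noteq> 0"
    "\<And>p us. us \<in> tuples A N p \<Longrightarrow> \<nu> p us = f p * \<mu> p us" and X: "sec X"
  shows "dv \<nu> X = dv \<mu> X + der X (\<lambda>x. ln \<bar>f x\<bar>)"
proof (rule dv_unique[OF \<nu> X])
  have fm: "form A N \<mu>" using \<mu> by (simp add: volume_form_def)
  fix Us :: "('m \<Rightarrow> 'v) list" assume Us: "length Us = N" "\<And>U. U \<in> set Us \<Longrightarrow> sec U"
  have e: "ev \<nu> Vs = f * ev \<mu> Vs" if "length Vs = N" "\<And>U. U \<in> set Vs \<Longrightarrow> sec U" for Vs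
    using f(3)[of "map (\<lambda>U. U x) Vs" x for x] that secD by (auto simp: fun_eq_iff ev_def tuples_def)
  have "(\<Sum>j<length Us. ev \<nu> (Us[j := br X (Us ! j)])) = f * (\<Sum>j<length Us. ev \<mu> (Us[j := br X (Us ! j)]))"
    unfolding sum_distrib_left
    by (intro sum.cong refl e) (use Us sec_list_update[OF Us(2) X] in auto)
  then have "lv \<nu> X Us = f * lv \<mu> X Us + ev \<mu> Us * der X f"
    unfolding lv_def using e[OF Us] f(1) X ev_smooth[OF fm Us] by (simp add: algebra_simps)
  also have "\<dots> = f * (dv \<mu> X * ev \<mu> Us) + ev \<mu> Us * (f * der X (\<lambda>x. ln \<bar>f x\<bar>))"
  proof -
    have "lv \<mu> X Us = dv \<mu> X * ev \<mu> Us" by (rule lv_eq_dv[OF \<mu> X Us])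
    then show ?thesis unfolding der_ln_abs[OF X f(1,2)] by (simp only:)
  qed
  finally show "lv \<nu> X Us = (dv \<mu> X + der X (\<lambda>x. ln \<bar>f x\<bar>)) * ev \<nu> Us"
    using e[OF Us] by (simp add: algebra_simps)
qed

end

section \<open>Bivectors\<close>

text \<open>A bivector \<open>\<Sum> a \<and> b\<close>, given as a list of pairs \<open>[a, b]\<close>, is written as the tensor
  \<open>\<Sum>\<^sub>i c\<^sub>i \<otimes> d\<^sub>i\<close> with twice as many terms: \<open>a \<otimes> b\<close> and \<open>b \<otimes> (- a)\<close>.\<close>

definition didx :: "'a list list \<Rightarrow> (nat \<times> bool) set" where
  "didx D = {..<length D} \<times> UNIV"

definition dleft :: "'a list list \<Rightarrow> nat \<times> bool \<Rightarrow> 'a" where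
  "dleft D i = (if snd i then D ! fst i ! 0 else D ! fst i ! 1)"

definition dright :: "'a::uminus list list \<Rightarrow> nat \<times> bool \<Rightarrow> 'a" where
  "dright D i = (if snd i then D ! fst i ! 1 else - (D ! fst i ! 0))"

lemma finite_didx [simp]: "finite (didx D)"
  by (simp add: didx_def)

lemma sum_didx:
  fixes g :: "'a::uminus \<Rightarrow> 'a \<Rightarrow> 'b::comm_monoid_add"
  shows "(\<Sum>i\<in>didx D. g (dleft D i) (dright D i)) = (\<Sum>us\<leftarrow>D. g (us ! 0) (us ! 1) + g (us ! 1) (- (us ! 0)))"
proof -
  have "(\<Sum>i\<in>didx D. g (dleft D i) (dright D i)) =
      (\<Sum>s<length D. \<Sum>t\<in>UNIV. g (dleft D (s, t)) (dright D (s, t)))"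
    unfolding didx_def sum.cartesian_product by (simp add: split_beta)
  also have "\<dots> = (\<Sum>s<length D. g (D ! s ! 0) (D ! s ! 1) + g (D ! s ! 1) (- (D ! s ! 0)))"
    by (rule sum.cong) (simp_all add: UNIV_bool dleft_def dright_def add.commute)
  also have "\<dots> = (\<Sum>us\<leftarrow>D. g (us ! 0) (us ! 1) + g (us ! 1) (- (us ! 0)))"
    by (simp add: sum_list_sum_nth atLeast0LessThan)
  finally show ?thesis .
qed

lemma sum_didx_swap:
  fixes g :: "'a::ab_group_add \<Rightarrow> 'a \<Rightarrow> 'b::ab_group_add"
  assumes "\<And>us. us \<in> set D \<Longrightarrow> P (us ! 0) \<and> P (us ! 1)"
    and "\<And>u v. P u \<Longrightarrow> P v \<Longrightarrow> g u (- v) = - g u v" "\<And>u v. P u \<Longrightarrow> P v \<Longrightarrow> g (- u) v = - g u v"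
  shows "(\<Sum>i\<in>didx D. g (dleft D i) (dright D i)) = - (\<Sum>i\<in>didx D. g (dright D i) (dleft D i))"
proof -
  have "(\<Sum>i\<in>didx D. g (dright D i) (dleft D i)) = (\<Sum>us\<leftarrow>D. g (us ! 1) (us ! 0) + g (- (us ! 0)) (us ! 1))"
    by (rule sum_didx[of "\<lambda>u v. g v u"])
  also have "\<dots> = (\<Sum>us\<leftarrow>D. - (g (us ! 0) (us ! 1) + g (us ! 1) (- (us ! 0))))"
    by (rule arg_cong[where f = sum_list], rule map_cong) (use assms in auto)
  also have "\<dots> = - (\<Sum>us\<leftarrow>D. g (us ! 0) (us ! 1) + g (us ! 1) (- (us ! 0)))"
    by (induction D) auto
  finally show ?thesis by (simp add: sum_didx)
qed

lemma length_2_conv: "length us = 2 \<Longrightarrow> us = [us ! 0, us ! 1]"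
  by (cases us; cases "tl us"; simp)

section \<open>Decompositions at a point\<close>

context vbundle
begin

lemma tuples_dual_iff:
  "[\<xi>, \<eta>] \<in> tuples (dual_bundle E) 2 p \<longleftrightarrow> \<xi> \<in> cofibre p \<and> \<eta> \<in> cofibre p"
  by (simp add: tuples_def)

text \<open>A selection by \<open>SOME\<close> has its property only if a witness exists. In a
  frame, P is the sum of the e_i \<otimes> b_i with b_i representing P(\<epsilon>_i, .), and being
  alternating it is half the sum of the e_i \<and> b_i.\<close>

lemma decomp_2:
  assumes P: "alternating_on (cofibre p) 2 P"
  shows "set (decomp E 2 p P) \<subseteq> tuples E 2 p"
    "\<And>\<xi> \<eta>. \<xi> \<in> cofibre p \<Longrightarrow> \<eta> \<in> cofibre p \<Longrightarrow> P [\<xi>, \<eta>] = (\<Sum>us\<leftarrow>decomp E 2 p P. wedge us [\<xi>, \<eta>])"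
proof -
  obtain W e \<epsilon> where fr: "local_frame p W e \<epsilon>" by (rule local_frame_exists)
  note f = local_frameD[OF fr]
  have ef: "e i p \<in> fibre E p" if "i < N" for i using f(3)[OF that] secD by blast
  have eps: "\<epsilon> i p \<in> cofibre p" if "i < N" for i using f(4)[OF that] cosecD by blast
  define b where "b i = (\<Sum>j<N. P [\<epsilon> i p, \<epsilon> j p] *\<^sub>R e j p)" for i
  have b: "b i \<in> fibre E p" for i unfolding b_def by (rule fibre_sum) (use ef in auto)
  have bp: "\<eta> (b i) = P [\<epsilon> i p, \<eta>]" if i: "i < N" and n: "\<eta> \<in> cofibre p" for i \<eta>
  proof -
    have "\<eta> (b i) = (\<Sum>j<N. P [\<epsilon> i p, \<epsilon> j p] * \<eta> (e j p))"
      unfolding b_def by (rule cofibre_sum[OF n]) (use ef in auto)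
    also have "\<dots> = P [\<epsilon> i p, \<Sum>j<N. \<eta> (e j p) *\<^sub>R \<epsilon> j p]"
      using alternating_on_2_sum(2)[OF P cofibre_subspace eps[OF i], of "{..<N}" "\<lambda>j. \<epsilon> j p" "\<lambda>j. \<eta> (e j p)"] eps
      by (simp add: mult.commute)
    also have "(\<Sum>j<N. \<eta> (e j p) *\<^sub>R \<epsilon> j p) = \<eta>" by (rule f(7)[OF f(2) n, symmetric])
    finally show ?thesis .
  qed
  have pe: "(\<Sum>i<N. \<xi> (e i p) * P [\<epsilon> i p, \<eta>]) = P [\<xi>, \<eta>]" if x: "\<xi> \<in> cofibre p" and n: "\<eta> \<in> cofibre p" for \<xi> \<eta>
  proof -
    have "(\<Sum>i<N. \<xi> (e i p) * P [\<epsilon> i p, \<eta>]) = P [\<Sum>i<N. \<xi> (e i p) *\<^sub>R \<epsilon> i p, \<eta>]"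
      using alternating_on_2_sum(1)[OF P cofibre_subspace n, of "{..<N}" "\<lambda>j. \<epsilon> j p" "\<lambda>j. \<xi> (e j p)"] eps by simp
    also have "(\<Sum>j<N. \<xi> (e j p) *\<^sub>R \<epsilon> j p) = \<xi>" by (rule f(7)[OF f(2) x, symmetric])
    finally show ?thesis .
  qed
  define D where "D = map (\<lambda>i. [(1 / 2) *\<^sub>R e i p, b i]) [0..<N]"
  have D1: "set D \<subseteq> tuples E 2 p" using ef b by (auto simp: D_def tuples_def)
  have D2: "P [\<xi>, \<eta>] = (\<Sum>us\<leftarrow>D. wedge us [\<xi>, \<eta>])" if x: "\<xi> \<in> cofibre p" and n: "\<eta> \<in> cofibre p" for \<xi> \<eta>
  proof -
    have "(\<Sum>us\<leftarrow>D. wedge us [\<xi>, \<eta>]) = (\<Sum>i<N. wedge [(1 / 2) *\<^sub>R e i p, b i] [\<xi>, \<eta>])"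
      by (simp add: D_def sum_list_sum_nth atLeast0LessThan)
    also have "\<dots> = (\<Sum>i<N. (1 / 2) * (\<xi> (e i p) * P [\<epsilon> i p, \<eta>]) - (1 / 2) * (\<eta> (e i p) * P [\<epsilon> i p, \<xi>]))"
      by (rule sum.cong) (use ef cofibreD(2)[OF x] cofibreD(2)[OF n] bp x n in \<open>auto simp: wedge_2\<close>)
    also have "\<dots> = (1 / 2) * P [\<xi>, \<eta>] - (1 / 2) * P [\<eta>, \<xi>]"
      unfolding sum_subtractf sum_distrib_left[symmetric] using pe x n by simp
    also have "P [\<eta>, \<xi>] = - P [\<xi>, \<eta>]" by (rule alternating_on_2_swap[OF P cofibre_subspace n x])
    finally show ?thesis by simp
  qed
  let ?Q = "\<lambda>D. set D \<subseteq> tuples E 2 p \<and>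
     (\<forall>\<xi>s\<in>tuples (dual_bundle E) 2 p. P \<xi>s = (\<Sum>us\<leftarrow>D. wedge us \<xi>s))"
  have "?Q D"
  proof (intro conjI ballI)
    fix \<xi>s assume x: "\<xi>s \<in> tuples (dual_bundle E) 2 p"
    then have "\<xi>s = [\<xi>s ! 0, \<xi>s ! 1]" by (intro length_2_conv) (simp add: tuples_def)
    then show "P \<xi>s = (\<Sum>us\<leftarrow>D. wedge us \<xi>s)"
      using D2[of "\<xi>s ! 0" "\<xi>s ! 1"] x tuples_dual_iff by metis
  qed (rule D1)
  then have q: "?Q (decomp E 2 p P)" unfolding decomp_def by (rule someI[where P = ?Q])
  then show "set (decomp E 2 p P) \<subseteq> tuples E 2 p" by blast
  show "P [\<xi>, \<eta>] = (\<Sum>us\<leftarrow>decomp E 2 p P. wedge us [\<xi>, \<eta>])" if "\<xi> \<in> cofibre p" "\<eta> \<in> cofibre p" for \<xi> \<eta>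
    using q that tuples_dual_iff by blast
qed

text \<open>A witness is \<open>[[z]]\<close>. The selected list may well have several terms, but
  covectors separate vectors, so its entries still sum to z.\<close>

lemma decomp_1:
  assumes Z: "z \<in> fibre E p" and P: "\<And>\<xi>. \<xi> \<in> cofibre p \<Longrightarrow> P [\<xi>] = \<xi> z"
  shows "\<And>us. us \<in> set (decomp E 1 p P) \<Longrightarrow> length us = 1 \<and> us ! 0 \<in> fibre E p"
    "(\<Sum>us\<leftarrow>decomp E 1 p P. us ! 0) = z"
proof -
  let ?Q = "\<lambda>D. set D \<subseteq> tuples E 1 p \<and>
     (\<forall>\<xi>s\<in>tuples (dual_bundle E) 1 p. P \<xi>s = (\<Sum>us\<leftarrow>D. wedge us \<xi>s))"
  have "?Q [[z]]"
  proof (intro conjI ballI)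
    fix \<xi>s assume x: "\<xi>s \<in> tuples (dual_bundle E) 1 p"
    then obtain \<xi> where "\<xi>s = [\<xi>]" by (auto simp: tuples_def length_Suc_conv)
    then show "P \<xi>s = (\<Sum>us\<leftarrow>[[z]]. wedge us \<xi>s)"
      using P[of \<xi>] x by (simp add: wedge_1 tuples_def)
  qed (use Z in \<open>auto simp: tuples_def\<close>)
  then have q: "?Q (decomp E 1 p P)" unfolding decomp_def by (rule someI[where P = ?Q])
  define D where "D = decomp E 1 p P"
  have D: "length us = 1 \<and> us ! 0 \<in> fibre E p" if "us \<in> set D" for us
    using q that by (auto simp: D_def tuples_def subset_iff length_Suc_conv)
  then show "\<And>us. us \<in> set (decomp E 1 p P) \<Longrightarrow> length us = 1 \<and> us ! 0 \<in> fibre E p" unfolding D_def by blast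
  have s: "(\<Sum>us\<leftarrow>D. us ! 0) \<in> fibre E p" using D by (induction D) auto
  show "(\<Sum>us\<leftarrow>decomp E 1 p P. us ! 0) = z"
    unfolding D_def[symmetric]
  proof (rule cofibre_separates[OF s Z])
    fix \<xi> assume "cosec \<xi>"
    note x = cosecD[OF this, of p]
    have "\<xi> p (\<Sum>us\<leftarrow>D. us ! 0) = (\<Sum>us\<leftarrow>D. wedge us [\<xi> p]) \<and> (\<Sum>us\<leftarrow>D. us ! 0) \<in> fibre E p"
      using D
    proof (induction D)
      case (Cons us D)
      then have "length us = 1" by simp
      then have "us = [us ! 0]" by (cases us) auto
      then have "wedge us [\<xi> p] = \<xi> p (us ! 0)" by (metis wedge_1)
      then show ?case using Cons cofibreD(1)[OF x, of "us ! 0" "\<Sum>us\<leftarrow>D. us ! 0"] by simp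
    qed (simp add: cofibreD(4)[OF x])
    moreover have "P [\<xi> p] = (\<Sum>us\<leftarrow>D. wedge us [\<xi> p])"
      using q x unfolding D_def by (simp add: tuples_def)
    ultimately show "\<xi> p (\<Sum>us\<leftarrow>D. us ! 0) = \<xi> p z" using P[OF x] by simp
  qed
qed

text \<open>A contraction with a 2-form sees the tensor \<Sum> c_i \<otimes> d_i only through its
  coefficients in a frame. This makes different decompositions of one bivector comparable.\<close>

lemma pairing_independent:
  assumes fr: "local_frame p' W e \<epsilon>" and p: "p \<in> W"
    and I: "finite I" "\<And>i. i \<in> I \<Longrightarrow> c i \<in> fibre E p" "\<And>i. i \<in> I \<Longrightarrow> d i \<in> fibre E p"
    and w: "alternating_on (fibre E p) 2 w"
  shows "(\<Sum>i\<in>I. w [c i, d i]) =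
    (\<Sum>j<N. \<Sum>k<N. (\<Sum>i\<in>I. \<epsilon> j p (c i) * \<epsilon> k p (d i)) * w [e j p, e k p])"
proof -
  note f = local_frameD[OF fr]
  have ef: "e i p \<in> fibre E p" if "i < N" for i using f(3)[OF that] secD by blast
  have "w [c i, d i] = (\<Sum>j<N. \<Sum>k<N. \<epsilon> j p (c i) * \<epsilon> k p (d i) * w [e j p, e k p])" if i: "i \<in> I" for i
  proof -
    have "w [c i, d i] = w [\<Sum>j<N. \<epsilon> j p (c i) *\<^sub>R e j p, d i]"
      using f(6)[OF p I(2)[OF i]] by simp
    also have "\<dots> = (\<Sum>j<N. \<epsilon> j p (c i) * w [e j p, d i])"
      by (rule alternating_on_2_sum(1)[OF w fibre_subspace I(3)[OF i]]) (use ef in auto)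
    also have "\<dots> = (\<Sum>j<N. \<epsilon> j p (c i) * w [e j p, \<Sum>k<N. \<epsilon> k p (d i) *\<^sub>R e k p])"
      using f(6)[OF p I(3)[OF i]] by simp
    also have "\<dots> = (\<Sum>j<N. \<Sum>k<N. \<epsilon> j p (c i) * \<epsilon> k p (d i) * w [e j p, e k p])"
    proof (rule sum.cong)
      fix j assume "j \<in> {..<N}"
      then have "w [e j p, \<Sum>k<N. \<epsilon> k p (d i) *\<^sub>R e k p] = (\<Sum>k<N. \<epsilon> k p (d i) * w [e j p, e k p])"
        by (intro alternating_on_2_sum(2)[OF w fibre_subspace]) (use ef in auto)
      then show "\<epsilon> j p (c i) * w [e j p, \<Sum>k<N. \<epsilon> k p (d i) *\<^sub>R e k p] =
          (\<Sum>k<N. \<epsilon> j p (c i) * \<epsilon> k p (d i) * w [e j p, e k p])"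
        by (simp add: sum_distrib_left mult.assoc)
    qed simp
    finally show ?thesis .
  qed
  then have "(\<Sum>i\<in>I. w [c i, d i]) = (\<Sum>i\<in>I. \<Sum>j<N. \<Sum>k<N. \<epsilon> j p (c i) * \<epsilon> k p (d i) * w [e j p, e k p])"
    by (rule sum.cong[OF refl])
  also have "\<dots> = (\<Sum>j<N. \<Sum>i\<in>I. \<Sum>k<N. \<epsilon> j p (c i) * \<epsilon> k p (d i) * w [e j p, e k p])"
    by (rule sum.swap)
  also have "\<dots> = (\<Sum>j<N. \<Sum>k<N. \<Sum>i\<in>I. \<epsilon> j p (c i) * \<epsilon> k p (d i) * w [e j p, e k p])"
    by (rule sum.cong[OF refl], rule sum.swap)
  finally show ?thesis by (simp add: sum_distrib_right)
qed

end

section \<open>The bivector, its sharp map and its decomposition by sections\<close>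

locale bivector_bundle = algebroid_bundle A
  for A :: "('m::{t2_space,second_countable_topology}, 'e::real_inner, 'v::real_vector) algebroid" +
  fixes \<pi> :: "'m \<Rightarrow> ('v \<Rightarrow> real) list \<Rightarrow> real"
  assumes bivector: "form (dual_bundle A) 2 \<pi>"
begin

definition X :: "('m \<Rightarrow> 'v \<Rightarrow> real) \<Rightarrow> 'm \<Rightarrow> 'v" where
  "X \<alpha> = (\<lambda>p. sharp A \<pi> p (\<alpha> p))"

definition pp :: "('m \<Rightarrow> 'v \<Rightarrow> real) \<Rightarrow> ('m \<Rightarrow> 'v \<Rightarrow> real) \<Rightarrow> 'm \<Rightarrow> real" where
  "pp \<alpha> \<beta> = (\<lambda>p. \<pi> p [\<alpha> p, \<beta> p])"

lemma pi_alternating: "alternating_on (cofibre p) 2 (\<pi> p)"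
  by (rule alternating_on_form[OF bivector])

text \<open>Justifies the definite description: a local frame and its dual provide the vector, and
  covectors separate vectors.\<close>

lemma sharp:
  assumes \<xi>: "\<xi> \<in> cofibre p"
  shows "sharp A \<pi> p \<xi> \<in> fibre A p" "\<eta> \<in> cofibre p \<Longrightarrow> \<eta> (sharp A \<pi> p \<xi>) = \<pi> p [\<xi>, \<eta>]"
proof -
  let ?P = "\<lambda>u. u \<in> fibre A p \<and> (\<forall>\<eta>\<in>cofibre p. \<eta> u = \<pi> p [\<xi>, \<eta>])"
  obtain W e \<epsilon> where fr: "local_frame p W e \<epsilon>" by (rule local_frame_exists)
  note f = local_frameD[OF fr]
  have ef: "e i p \<in> fibre A p" if "i < N" for i using f(3)[OF that] secD by blast
  have eps: "\<epsilon> i p \<in> cofibre p" if "i < N" for i using f(4)[OF that] cosecD by blast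
  have 1: "(\<Sum>i<N. \<pi> p [\<xi>, \<epsilon> i p] *\<^sub>R e i p) \<in> fibre A p"
    by (rule fibre_sum) (use ef in auto)
  have 2: "\<eta> (\<Sum>i<N. \<pi> p [\<xi>, \<epsilon> i p] *\<^sub>R e i p) = \<pi> p [\<xi>, \<eta>]" if n: "\<eta> \<in> cofibre p" for \<eta>
  proof -
    have "\<eta> (\<Sum>i<N. \<pi> p [\<xi>, \<epsilon> i p] *\<^sub>R e i p) = (\<Sum>i<N. \<pi> p [\<xi>, \<epsilon> i p] * \<eta> (e i p))"
      by (rule cofibre_sum[OF n]) (use ef in auto)
    also have "\<dots> = \<pi> p [\<xi>, \<Sum>i<N. \<eta> (e i p) *\<^sub>R \<epsilon> i p]"
      using alternating_on_2_sum(2)[OF pi_alternating cofibre_subspace \<xi>, of "{..<N}" "\<lambda>i. \<epsilon> i p" "\<lambda>i. \<eta> (e i p)"] eps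
      by (simp add: mult.commute)
    also have "(\<Sum>i<N. \<eta> (e i p) *\<^sub>R \<epsilon> i p) = \<eta>" by (rule f(7)[OF f(2) n, symmetric])
    finally show ?thesis .
  qed
  have "?P (sharp A \<pi> p \<xi>)"
    unfolding sharp_def
  proof (rule theI[where P = ?P])
    show "?P (\<Sum>i<N. \<pi> p [\<xi>, \<epsilon> i p] *\<^sub>R e i p)" using 1 2 by blast
    fix u assume u: "?P u"
    show "u = (\<Sum>i<N. \<pi> p [\<xi>, \<epsilon> i p] *\<^sub>R e i p)"
      by (rule cofibre_separates[OF _ 1]) (use u 2 cosecD in auto)
  qed
  then show "sharp A \<pi> p \<xi> \<in> fibre A p" "\<eta> \<in> cofibre p \<Longrightarrow> \<eta> (sharp A \<pi> p \<xi>) = \<pi> p [\<xi>, \<eta>]" by blast+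
qed

lemma pp_smooth [simp]: "cosec \<alpha> \<Longrightarrow> cosec \<beta> \<Longrightarrow> smooth (pp \<alpha> \<beta>)"
  using vbundle.form_smooth[OF vbundle_dual bivector, of "[\<alpha>, \<beta>]"] by (auto simp: pp_def)

lemma pp_skew: "cosec \<alpha> \<Longrightarrow> cosec \<beta> \<Longrightarrow> pp \<alpha> \<beta> = - pp \<beta> \<alpha>"
proof
  fix x assume "cosec \<alpha>" "cosec \<beta>"
  then have "\<pi> x [\<alpha> x, \<beta> x] = - \<pi> x [\<beta> x, \<alpha> x]"
    by (intro alternating_on_2_swap[OF pi_alternating cofibre_subspace] cosecD)
  then show "pp \<alpha> \<beta> x = (- pp \<beta> \<alpha>) x" by (simp add: pp_def)
qed

lemma pair_X_pointwise: "cosec \<alpha> \<Longrightarrow> cosec \<beta> \<Longrightarrow> pair \<beta> (X \<alpha>) p = pp \<alpha> \<beta> p"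
  by (simp add: pair_def X_def pp_def sharp(2)[OF cosecD cosecD])

lemma pair_X: "cosec \<alpha> \<Longrightarrow> cosec \<beta> \<Longrightarrow> pair \<beta> (X \<alpha>) = pp \<alpha> \<beta>"
  using pair_X_pointwise by blast

lemma X_sec [simp]: "cosec \<alpha> \<Longrightarrow> sec (X \<alpha>)"
proof (rule sec_by_pairing)
  assume a: "cosec \<alpha>"
  show "X \<alpha> p \<in> fibre A p" for p unfolding X_def by (rule sharp(1)[OF cosecD[OF a]])
  show "smooth (\<lambda>p. \<xi> p (X \<alpha> p))" if "cosec \<xi>" for \<xi>
    using pp_smooth[OF a that] pair_X[OF a that] by (simp add: pair_def)
qed

lemma cosec_closed [simp]:
  "cosec \<alpha> \<Longrightarrow> cosec \<beta> \<Longrightarrow> cosec (\<alpha> + \<beta>)" "smooth f \<Longrightarrow> cosec \<alpha> \<Longrightarrow> cosec (f \<bullet>\<^sub>s \<alpha>)"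
  using vbundle.sec_closed[OF vbundle_dual] by simp_all

lemma X_linear:
  assumes a: "cosec \<alpha>"
  shows "cosec \<beta> \<Longrightarrow> X (\<alpha> + \<beta>) = X \<alpha> + X \<beta>" "smooth f \<Longrightarrow> X (f \<bullet>\<^sub>s \<alpha>) = f \<bullet>\<^sub>s X \<alpha>"
proof -
  show "X (\<alpha> + \<beta>) = X \<alpha> + X \<beta>" if b: "cosec \<beta>"
  proof (rule sec_eqI)
    fix \<xi> assume x: "cosec \<xi>"
    have "pp (\<alpha> + \<beta>) \<xi> = pp \<alpha> \<xi> + pp \<beta> \<xi>"
      using alternating_on_2(1)[OF pi_alternating cosecD[OF a] cosecD[OF b] cosecD[OF x]]
      by (simp add: pp_def fun_eq_iff plus_fun_def)
    then show "pair \<xi> (X (\<alpha> + \<beta>)) = pair \<xi> (X \<alpha> + X \<beta>)" using a b x pair_X by simp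
  qed (use a b in simp_all)
  show "X (f \<bullet>\<^sub>s \<alpha>) = f \<bullet>\<^sub>s X \<alpha>" if f: "smooth f"
  proof (rule sec_eqI)
    fix \<xi> assume x: "cosec \<xi>"
    have "pp (f \<bullet>\<^sub>s \<alpha>) \<xi> = f * pp \<alpha> \<xi>"
      using alternating_on_2(3)[OF pi_alternating cosecD[OF a] cosecD[OF x]]
      by (simp add: pp_def fun_eq_iff smul_def)
    then show "pair \<xi> (X (f \<bullet>\<^sub>s \<alpha>)) = pair \<xi> (f \<bullet>\<^sub>s X \<alpha>)" using a f x pair_X by simp
  qed (use a f in simp_all)
qed

text \<open>The tensor form of the very decomposition that \<open>gerstenhaber\<close> selects at p,
  with a neighbourhood over which it represents \<open>\<pi>\<close>. The selection is kept because
  brackets of the single terms depend on more than the values of the sections at p.\<close>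

definition bdec :: "'m \<Rightarrow> (nat \<times> bool \<Rightarrow> 'm \<Rightarrow> 'v) \<Rightarrow> (nat \<times> bool \<Rightarrow> 'm \<Rightarrow> 'v) \<Rightarrow> (nat \<times> bool) set \<Rightarrow> 'm set \<Rightarrow> bool"
  where "bdec p c d I W \<longleftrightarrow>
    (let D = section_decomp A 2 p \<pi> in c = dleft D \<and> d = dright D \<and> I = didx D) \<and>
    open W \<and> p \<in> W \<and> (\<forall>i\<in>I. sec (c i) \<and> sec (d i)) \<and>
    (\<forall>x\<in>W. \<forall>\<xi>\<in>cofibre x. \<forall>\<eta>\<in>cofibre x. \<pi> x [\<xi>, \<eta>] = (\<Sum>i\<in>I. \<xi> (c i x) * \<eta> (d i x)))"

lemma section_decomp_2:
  obtains W where "open W" "p \<in> W"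
    "\<And>as. as \<in> set (section_decomp A 2 p \<pi>) \<Longrightarrow> length as = 2 \<and> sec (as ! 0) \<and> sec (as ! 1)"
    "\<And>x \<xi> \<eta>. x \<in> W \<Longrightarrow> \<xi> \<in> cofibre x \<Longrightarrow> \<eta> \<in> cofibre x \<Longrightarrow>
      \<pi> x [\<xi>, \<eta>] = (\<Sum>as\<leftarrow>section_decomp A 2 p \<pi>. \<xi> ((as ! 0) x) * \<eta> ((as ! 1) x) - \<xi> ((as ! 1) x) * \<eta> ((as ! 0) x))"
proof -
  obtain W e \<epsilon> where fr: "local_frame p W e \<epsilon>" by (rule local_frame_exists)
  note f = local_frameD[OF fr]
  \<comment> \<open>\<open>\<pi>\<close> is already the sum of the e_i \<otimes> X(\<epsilon>_i);
    the factor 1 / 2 compensates for the antisymmetrisation in the wedge product.\<close>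
  define h where "h = (\<lambda>_::'m. 1 / 2 :: real)"
  define D where "D = map (\<lambda>i. [h \<bullet>\<^sub>s e i, X (\<epsilon> i)]) [0..<N]"
  let ?Q = "\<lambda>D. (\<forall>as\<in>set D. length as = 2 \<and> (\<forall>a\<in>set as. sec a)) \<and>
     (\<exists>W. open W \<and> p \<in> W \<and> (\<forall>x\<in>W. \<forall>\<xi>s\<in>tuples (dual_bundle A) 2 x.
        \<pi> x \<xi>s = (\<Sum>as\<leftarrow>D. wedge (map (\<lambda>a. a x) as) \<xi>s)))"
  have D2: "\<pi> x [\<xi>, \<eta>] = (\<Sum>as\<leftarrow>D. wedge (map (\<lambda>a. a x) as) [\<xi>, \<eta>])"
    if x: "x \<in> W" and xi: "\<xi> \<in> cofibre x" and n: "\<eta> \<in> cofibre x" for x \<xi> \<eta>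
  proof -
    have ef: "e i x \<in> fibre A x" if "i < N" for i using f(3)[OF that] secD by blast
    have eps: "\<epsilon> i x \<in> cofibre x" if "i < N" for i using f(4)[OF that] cosecD by blast
    have Xe: "\<zeta> (X (\<epsilon> i) x) = \<pi> x [\<epsilon> i x, \<zeta>]" if "i < N" "\<zeta> \<in> cofibre x" for i \<zeta>
      unfolding X_def by (rule sharp(2)[OF eps[OF that(1)] that(2)])
    have pe: "(\<Sum>i<N. \<xi> (e i x) * \<pi> x [\<epsilon> i x, \<eta>]) = \<pi> x [\<xi>, \<eta>]" if xi: "\<xi> \<in> cofibre x" and n: "\<eta> \<in> cofibre x" for \<xi> \<eta>
    proof -
      have "(\<Sum>i<N. \<xi> (e i x) * \<pi> x [\<epsilon> i x, \<eta>]) = \<pi> x [\<Sum>i<N. \<xi> (e i x) *\<^sub>R \<epsilon> i x, \<eta>]"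
        using alternating_on_2_sum(1)[OF pi_alternating cofibre_subspace n, of "{..<N}" "\<lambda>j. \<epsilon> j x" "\<lambda>j. \<xi> (e j x)"] eps by simp
      also have "(\<Sum>j<N. \<xi> (e j x) *\<^sub>R \<epsilon> j x) = \<xi>" by (rule f(7)[OF x xi, symmetric])
      finally show ?thesis .
    qed
    have "(\<Sum>as\<leftarrow>D. wedge (map (\<lambda>a. a x) as) [\<xi>, \<eta>]) = (\<Sum>i<N. wedge [(1 / 2) *\<^sub>R e i x, X (\<epsilon> i) x] [\<xi>, \<eta>])"
      by (simp add: D_def sum_list_sum_nth atLeast0LessThan smul_def h_def)
    also have "\<dots> = (\<Sum>i<N. (1 / 2) * (\<xi> (e i x) * \<pi> x [\<epsilon> i x, \<eta>]) - (1 / 2) * (\<eta> (e i x) * \<pi> x [\<epsilon> i x, \<xi>]))"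
      by (rule sum.cong) (use ef cofibreD(2)[OF xi] cofibreD(2)[OF n] Xe xi n in \<open>auto simp: wedge_2\<close>)
    also have "\<dots> = (1 / 2) * \<pi> x [\<xi>, \<eta>] - (1 / 2) * \<pi> x [\<eta>, \<xi>]"
      unfolding sum_subtractf sum_distrib_left[symmetric] using pe xi n by simp
    also have "\<pi> x [\<eta>, \<xi>] = - \<pi> x [\<xi>, \<eta>]" by (rule alternating_on_2_swap[OF pi_alternating cofibre_subspace n xi])
    finally show ?thesis by simp
  qed
  have "?Q D"
  proof (intro conjI exI[of _ W] ballI)
    show "open W" "p \<in> W" using f by auto
    fix x \<xi>s assume x: "x \<in> W" "\<xi>s \<in> tuples (dual_bundle A) 2 x"
    then have "\<xi>s = [\<xi>s ! 0, \<xi>s ! 1]" by (intro length_2_conv) (simp add: tuples_def)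
    then show "\<pi> x \<xi>s = (\<Sum>as\<leftarrow>D. wedge (map (\<lambda>a. a x) as) \<xi>s)"
      using D2[OF x(1), of "\<xi>s ! 0" "\<xi>s ! 1"] x(2) tuples_dual_iff by metis
  next
    fix as a assume "as \<in> set D" "a \<in> set as"
    then show "sec a" using f by (auto simp: D_def h_def)
  qed (auto simp: D_def)
  then have q: "?Q (section_decomp A 2 p \<pi>)" unfolding section_decomp_def by (rule someI[where P = ?Q])
  define D' where "D' = section_decomp A 2 p \<pi>"
  obtain W' where W': "open W'" "p \<in> W'" "\<forall>x\<in>W'. \<forall>\<xi>s\<in>tuples (dual_bundle A) 2 x.
        \<pi> x \<xi>s = (\<Sum>as\<leftarrow>D'. wedge (map (\<lambda>a. a x) as) \<xi>s)" using q unfolding D'_def by blast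
  have l: "length as = 2" "sec (as ! 0)" "sec (as ! 1)" if "as \<in> set D'" for as
    using q that unfolding D'_def by auto
  show thesis
  proof (rule that[OF W'(1,2)])
    show "length as = 2 \<and> sec (as ! 0) \<and> sec (as ! 1)" if "as \<in> set (section_decomp A 2 p \<pi>)" for as
      using l that D'_def by simp
    fix x \<xi> \<eta> assume x: "x \<in> W'" "\<xi> \<in> cofibre x" "\<eta> \<in> cofibre x"
    have "\<pi> x [\<xi>, \<eta>] = (\<Sum>as\<leftarrow>D'. wedge (map (\<lambda>a. a x) as) [\<xi>, \<eta>])"
      using W'(3) x tuples_dual_iff by blast
    also have "\<dots> = (\<Sum>as\<leftarrow>D'. \<xi> ((as ! 0) x) * \<eta> ((as ! 1) x) - \<xi> ((as ! 1) x) * \<eta> ((as ! 0) x))"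
    proof (rule arg_cong[where f = sum_list], rule map_cong[OF refl])
      fix as assume "as \<in> set D'"
      from arg_cong[OF length_2_conv[OF l(1)[OF this]], of "map (\<lambda>a. a x)"]
      have "map (\<lambda>a. a x) as = [(as ! 0) x, (as ! 1) x]" by simp
      then show "wedge (map (\<lambda>a. a x) as) [\<xi>, \<eta>] = \<xi> ((as ! 0) x) * \<eta> ((as ! 1) x) - \<xi> ((as ! 1) x) * \<eta> ((as ! 0) x)"
        by (simp add: wedge_2)
    qed
    finally show "\<pi> x [\<xi>, \<eta>] = (\<Sum>as\<leftarrow>section_decomp A 2 p \<pi>. \<xi> ((as ! 0) x) * \<eta> ((as ! 1) x) - \<xi> ((as ! 1) x) * \<eta> ((as ! 0) x))"
      unfolding D'_def .
  qed
qed

lemma bdec_exists: obtains c d I W where "bdec p c d I W"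
proof -
  define D where "D = section_decomp A 2 p \<pi>"
  obtain W where W: "open W" "p \<in> W"
    "\<And>as. as \<in> set D \<Longrightarrow> length as = 2 \<and> sec (as ! 0) \<and> sec (as ! 1)"
    "\<And>x \<xi> \<eta>. x \<in> W \<Longrightarrow> \<xi> \<in> cofibre x \<Longrightarrow> \<eta> \<in> cofibre x \<Longrightarrow>
      \<pi> x [\<xi>, \<eta>] = (\<Sum>as\<leftarrow>D. \<xi> ((as ! 0) x) * \<eta> ((as ! 1) x) - \<xi> ((as ! 1) x) * \<eta> ((as ! 0) x))"
    unfolding D_def by (rule section_decomp_2) blast
  have s: "sec (dleft D i) \<and> sec (dright D i)" if "i \<in> didx D" for i
    using that W(3)[of "D ! fst i"] by (auto simp: didx_def dleft_def dright_def)
  have e: "\<pi> x [\<xi>, \<eta>] = (\<Sum>i\<in>didx D. \<xi> (dleft D i x) * \<eta> (dright D i x))"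
    if x: "x \<in> W" "\<xi> \<in> cofibre x" "\<eta> \<in> cofibre x" for x \<xi> \<eta>
    unfolding W(4)[OF x] sum_didx[of "\<lambda>u v. \<xi> (u x) * \<eta> (v x)"]
    by (rule arg_cong[where f = sum_list], rule map_cong[OF refl])
      (use W(3) cofibreD(5)[OF x(3)] secD in auto)
  have "bdec p (dleft D) (dright D) (didx D) W"
    unfolding bdec_def Let_def D_def[symmetric] using W(1,2) s e by blast
  then show thesis by (rule that)
qed

lemma bdecD:
  assumes "bdec p c d I W"
  shows "open W" "p \<in> W" "\<And>i. i \<in> I \<Longrightarrow> sec (c i)" "\<And>i. i \<in> I \<Longrightarrow> sec (d i)" "finite I"
    "\<And>x \<xi> \<eta>. x \<in> W \<Longrightarrow> \<xi> \<in> cofibre x \<Longrightarrow> \<eta> \<in> cofibre x \<Longrightarrow> \<pi> x [\<xi>, \<eta>] = (\<Sum>i\<in>I. \<xi> (c i x) * \<eta> (d i x))"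
  using assms unfolding bdec_def Let_def by auto

text \<open>The exchange is a property of the list, which contains b \<otimes> (- a) along with each
  a \<otimes> b, and not just of the tensor. It is therefore enough that \<open>g\<close> respects
  signs, and \<open>g\<close> may contain brackets and derivatives.\<close>

lemma bdec_swap:
  fixes g :: "('m \<Rightarrow> 'v) \<Rightarrow> ('m \<Rightarrow> 'v) \<Rightarrow> 'b::ab_group_add"
  assumes b: "bdec p c d I W"
    and g: "\<And>u v. sec u \<Longrightarrow> sec v \<Longrightarrow> g u (- v) = - g u v" "\<And>u v. sec u \<Longrightarrow> sec v \<Longrightarrow> g (- u) v = - g u v"
  shows "(\<Sum>i\<in>I. g (c i) (d i)) = - (\<Sum>i\<in>I. g (d i) (c i))"
proof -
  obtain W' where "\<And>as. as \<in> set (section_decomp A 2 p \<pi>) \<Longrightarrow> length as = 2 \<and> sec (as ! 0) \<and> sec (as ! 1)"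
    using section_decomp_2 by metis
  then show ?thesis
    using b sum_didx_swap[of "section_decomp A 2 p \<pi>" sec g] g unfolding bdec_def Let_def by auto
qed

lemma bdec_X:
  assumes b: "bdec p c d I W" and \<beta>: "cosec \<beta>"
  shows "sec (\<Sum>i\<in>I. pair \<beta> (c i) \<bullet>\<^sub>s d i)" "x \<in> W \<Longrightarrow> X \<beta> x = (\<Sum>i\<in>I. pair \<beta> (c i) \<bullet>\<^sub>s d i) x"
    "cosec \<gamma> \<Longrightarrow> x \<in> W \<Longrightarrow> pp \<beta> \<gamma> x = (\<Sum>i\<in>I. pair \<beta> (c i) * pair \<gamma> (d i)) x"
proof -
  note B = bdecD[OF b]
  show s: "sec (\<Sum>i\<in>I. pair \<beta> (c i) \<bullet>\<^sub>s d i)" using B \<beta> by simp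
  have pp: "pp \<beta> \<gamma> x = (\<Sum>i\<in>I. pair \<beta> (c i) * pair \<gamma> (d i)) x" if "cosec \<gamma>" "x \<in> W" for \<gamma> x
    using B(6)[OF that(2) cosecD[OF \<beta>] cosecD[OF that(1)]] by (simp add: pp_def sum_fun_apply pair_def)
  then show "cosec \<gamma> \<Longrightarrow> x \<in> W \<Longrightarrow> pp \<beta> \<gamma> x = (\<Sum>i\<in>I. pair \<beta> (c i) * pair \<gamma> (d i)) x" .
  show "X \<beta> x = (\<Sum>i\<in>I. pair \<beta> (c i) \<bullet>\<^sub>s d i) x" if x: "x \<in> W"
  proof (rule cofibre_separates[OF secD[OF X_sec[OF \<beta>]] secD[OF s]])
    fix \<xi> assume xi: "cosec \<xi>"
    have "pair \<xi> (\<Sum>i\<in>I. pair \<beta> (c i) \<bullet>\<^sub>s d i) x = (\<Sum>i\<in>I. pair \<beta> (c i) * pair \<xi> (d i)) x"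
      using xi \<beta> B by simp
    then show "\<xi> x (X \<beta> x) = \<xi> x ((\<Sum>i\<in>I. pair \<beta> (c i) \<bullet>\<^sub>s d i) x)"
      using pp[OF xi x] pair_X_pointwise[OF \<beta> xi, of x] by (simp add: pair_def)
  qed
qed

end

lemma lessThan_2: "{..<2::nat} = {0, 1}"
  by auto

lemma wedge_3_cyclic:
  "wedge [u, v, w] [\<xi>, \<eta>, \<zeta>] =
     \<xi> u * (\<eta> v * \<zeta> w - \<eta> w * \<zeta> v) + \<eta> u * (\<zeta> v * \<xi> w - \<zeta> w * \<xi> v) + \<zeta> u * (\<xi> v * \<eta> w - \<xi> w * \<eta> v)"
  by (simp add: wedge_3 algebra_simps)

section \<open>Gerstenhaber brackets with the bivector\<close>

context bivector_bundle
begin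

text \<open>In the tensor form the bracket is the sum of \<xi>(c_i) times the derivative of f along
  d_i, and near p the section \<Sum> \<xi>(c_i) d_i is X \<xi>.\<close>

lemma gerstenhaber_fun_bivector:
  assumes \<xi>: "cosec \<xi>" and f: "smooth f"
  shows "gerstenhaber_fun A 2 \<pi> f p [\<xi> p] = der (X \<xi>) f p"
proof -
  obtain c d I W where b: "bdec p c d I W" by (rule bdec_exists)
  note B = bdecD[OF b]
  define D where "D = section_decomp A 2 p \<pi>"
  have cd: "c = dleft D" "d = dright D" "I = didx D" using b by (auto simp: bdec_def Let_def D_def)
  obtain W' where D: "\<And>as. as \<in> set D \<Longrightarrow> length as = 2 \<and> sec (as ! 0) \<and> sec (as ! 1)"
    unfolding D_def using section_decomp_2 by metis
  have "gerstenhaber_fun A 2 \<pi> f p [\<xi> p] =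
      (\<Sum>as\<leftarrow>D. (pair \<xi> (as ! 0) * der (as ! 1) f + pair \<xi> (as ! 1) * der (- (as ! 0)) f) p)"
    unfolding gerstenhaber_fun_def D_def[symmetric]
  proof (rule arg_cong[where f = sum_list], rule map_cong[OF refl])
    fix as assume "as \<in> set D"
    note l = D[OF this]
    define u v where "u = as ! 0" and "v = as ! 1"
    have uv: "as = [u, v]" "sec u" "sec v" using l length_2_conv by (auto simp: u_def v_def)
    show "(\<Sum>k<2. (-1) ^ (2 - Suc k) * anchor A p ((as ! k) p) f * wedge (map (\<lambda>a. a p) (remove_nth k as)) [\<xi> p]) =
       (pair \<xi> (as ! 0) * der (as ! 1) f + pair \<xi> (as ! 1) * der (- (as ! 0)) f) p"
      using uv(2,3) f unfolding uv(1)
      by (simp add: lessThan_2 wedge_1 remove_nth_def pair_def) (simp add: der_def)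
  qed
  also have "\<dots> = (\<Sum>i\<in>I. (pair \<xi> (c i) * der (d i) f) p)"
    unfolding cd sum_didx[of "\<lambda>u v. (pair \<xi> u * der v f) p"] by simp
  also have "\<dots> = der (\<Sum>i\<in>I. pair \<xi> (c i) \<bullet>\<^sub>s d i) f p"
    using B f \<xi> by (simp add: sum_fun_apply)
  also have "\<dots> = der (X \<xi>) f p"
    using bdec_X(2)[OF b \<xi> B(2)] by (simp add: der_def)
  finally show ?thesis .
qed

text \<open>What \<open>section_decomp\<close> selects for Z is a list of sections whose sum agrees
  with Z only near p. Linearity of the bracket collects them into one section \<open>Z'\<close>, and
  locality replaces \<open>Z'\<close> by Z.\<close>

lemma gerstenhaber_bivector_vector:
  assumes b: "bdec p c d I W" and Z: "sec Z" and \<xi>: "\<xi> \<in> cofibre p" "\<eta> \<in> cofibre p"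
  shows "gerstenhaber A 2 1 \<pi> (vector_of_section Z) p [\<xi>, \<eta>] =
    (\<Sum>i\<in>I. \<xi> (br (c i) Z p) * \<eta> (d i p) - \<eta> (br (c i) Z p) * \<xi> (d i p))"
proof -
  note B = bdecD[OF b]
  define D where "D = section_decomp A 2 p \<pi>"
  have cd: "c = dleft D" "d = dright D" "I = didx D" using b by (auto simp: bdec_def Let_def D_def)
  obtain W' where D: "\<And>as. as \<in> set D \<Longrightarrow> length as = 2 \<and> sec (as ! 0) \<and> sec (as ! 1)"
    unfolding D_def using section_decomp_2 by metis
  let ?Q = "\<lambda>D. (\<forall>as\<in>set D. length as = 1 \<and> (\<forall>a\<in>set as. sec a)) \<and>
     (\<exists>W. open W \<and> p \<in> W \<and> (\<forall>x\<in>W. \<forall>\<xi>s\<in>tuples (dual_bundle A) 1 x.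
        vector_of_section Z x \<xi>s = (\<Sum>as\<leftarrow>D. wedge (map (\<lambda>a. a x) as) \<xi>s)))"
  have "?Q [[Z]]"
  proof (intro conjI exI[of _ UNIV] ballI)
    fix x \<xi>s assume "\<xi>s \<in> tuples (dual_bundle A) 1 x"
    then obtain \<xi> where "\<xi>s = [\<xi>]" by (auto simp: tuples_def length_Suc_conv)
    then show "vector_of_section Z x \<xi>s = (\<Sum>as\<leftarrow>[[Z]]. wedge (map (\<lambda>a. a x) as) \<xi>s)"
      by (simp add: vector_of_section_def wedge_1)
  qed (use Z in auto)
  then have q: "?Q (section_decomp A 1 p (vector_of_section Z))"
    unfolding section_decomp_def by (rule someI[where P = ?Q])
  define D1 where "D1 = section_decomp A 1 p (vector_of_section Z)"
  obtain V where V: "open V" "p \<in> V" "\<forall>x\<in>V. \<forall>\<xi>s\<in>tuples (dual_bundle A) 1 x.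
        vector_of_section Z x \<xi>s = (\<Sum>as\<leftarrow>D1. wedge (map (\<lambda>a. a x) as) \<xi>s)" using q unfolding D1_def by blast
  have D1: "as = [as ! 0] \<and> sec (as ! 0)" if "as \<in> set D1" for as
  proof -
    have "length as = 1 \<and> (\<forall>a\<in>set as. sec a)" using q that unfolding D1_def by blast
    then show ?thesis by (cases as) auto
  qed
  define Z' where "Z' = sum_list (map (\<lambda>as. as ! 0) D1)"
  have Z': "sec Z'" and brZ': "sec a \<Longrightarrow> br a Z' = (\<Sum>as\<leftarrow>D1. br a (as ! 0))"
    and pZ': "cosec \<zeta> \<Longrightarrow> pair \<zeta> Z' x = (\<Sum>as\<leftarrow>D1. wedge (map (\<lambda>a. a x) as) [\<zeta> x])" for a \<zeta> x
  proof -
    have *: "sec (sum_list (map (\<lambda>as. as ! 0) D1)) \<and>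
        (sec a \<longrightarrow> br a (sum_list (map (\<lambda>as. as ! 0) D1)) = (\<Sum>as\<leftarrow>D1. br a (as ! 0))) \<and>
        (cosec \<zeta> \<longrightarrow> pair \<zeta> (sum_list (map (\<lambda>as. as ! 0) D1)) x = (\<Sum>as\<leftarrow>D1. wedge (map (\<lambda>a. a x) as) [\<zeta> x]))"
      using D1
    proof (induction D1)
      case (Cons as D1)
      obtain u where u: "as = [u]" "sec u" using Cons.prems[of as] by auto
      have "\<And>as. as \<in> set D1 \<Longrightarrow> as = [as ! 0] \<and> sec (as ! 0)" using Cons.prems by auto
      note IH = Cons.IH[OF this]
      define S where "S = sum_list (map (\<lambda>as. as ! 0) D1)"
      have e: "sum_list (map (\<lambda>as. as ! 0) (as # D1)) = u + S"
        "(\<Sum>as\<leftarrow>as # D1. br a (as ! 0)) = br a u + (\<Sum>as\<leftarrow>D1. br a (as ! 0))"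
        "(\<Sum>as\<leftarrow>as # D1. wedge (map (\<lambda>a. a x) as) [\<zeta> x]) =
          pair \<zeta> u x + (\<Sum>as\<leftarrow>D1. wedge (map (\<lambda>a. a x) as) [\<zeta> x])"
        using u by (simp_all add: S_def wedge_1 pair_def)
      have S: "sec S" "sec a \<Longrightarrow> br a S = (\<Sum>as\<leftarrow>D1. br a (as ! 0))"
        "cosec \<zeta> \<Longrightarrow> pair \<zeta> S x = (\<Sum>as\<leftarrow>D1. wedge (map (\<lambda>a. a x) as) [\<zeta> x])"
        using IH unfolding S_def by blast+
      have "sec (u + S)" by (rule sec_closed(1)[OF u(2) S(1)])
      moreover have "br a (u + S) = br a u + (\<Sum>as\<leftarrow>D1. br a (as ! 0))" if "sec a"
        using br_add(2)[OF u(2) S(1) that] S(2)[OF that] by (simp only:)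
      moreover have "pair \<zeta> (u + S) x = pair \<zeta> u x + (\<Sum>as\<leftarrow>D1. wedge (map (\<lambda>a. a x) as) [\<zeta> x])" if "cosec \<zeta>"
        using pair_linear(1)[OF that u(2) S(1)] S(3)[OF that] by (simp only: plus_fun_apply)
      ultimately show ?case unfolding e by blast
    qed simp
    show "sec Z'" "sec a \<Longrightarrow> br a Z' = (\<Sum>as\<leftarrow>D1. br a (as ! 0))"
      "cosec \<zeta> \<Longrightarrow> pair \<zeta> Z' x = (\<Sum>as\<leftarrow>D1. wedge (map (\<lambda>a. a x) as) [\<zeta> x])"
      unfolding Z'_def using * by blast+
  qed
  have ZZ: "Z' x = Z x" if x: "x \<in> V" for x
  proof (rule cofibre_separates[OF secD[OF Z'] secD[OF Z]])
    fix \<zeta> assume z: "cosec \<zeta>"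
    have "[\<zeta> x] \<in> tuples (dual_bundle A) 1 x" using cosecD[OF z] by (simp add: tuples_def)
    from V(3)[rule_format, OF x this] pZ'[OF z, of x] show "\<zeta> x (Z' x) = \<zeta> x (Z x)"
      by (simp add: vector_of_section_def pair_def)
  qed
  have brZ: "br a Z p = (\<Sum>as\<leftarrow>D1. br a (as ! 0) p)" if a: "sec a" for a
  proof -
    have "br a Z p = br a Z' p" by (rule br_local(1)[OF a Z' Z V(1,2), symmetric]) (rule ZZ)
    also have "\<dots> = (\<Sum>as\<leftarrow>D1. br a (as ! 0)) p" by (simp add: brZ'[OF a])
    also have "\<dots> = (\<Sum>as\<leftarrow>D1. br a (as ! 0) p)" by (induction D1) auto
    finally show ?thesis .
  qed
  have lin: "\<zeta> (br a Z p) = (\<Sum>bs\<leftarrow>D1. \<zeta> (br a (bs ! 0) p))" if z: "\<zeta> \<in> cofibre p" and a: "sec a" for a \<zeta>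
  proof -
    have "\<zeta> (\<Sum>as\<leftarrow>D1. br a (as ! 0) p) = (\<Sum>bs\<leftarrow>D1. \<zeta> (br a (bs ! 0) p)) \<and> (\<Sum>as\<leftarrow>D1. br a (as ! 0) p) \<in> fibre A p"
      using D1
    proof (induction D1)
      case (Cons as D1)
      have "br a (as ! 0) p \<in> fibre A p" using Cons.prems[of as] a secD by auto
      then show ?case using Cons cofibreD(1)[OF z] by simp
    qed (simp add: cofibreD(4)[OF z])
    then show ?thesis unfolding brZ[OF a] by blast
  qed
  let ?g = "\<lambda>a b. \<xi> (br a Z p) * \<eta> (b p) - \<eta> (br a Z p) * \<xi> (b p)"
  have "gerstenhaber A 2 1 \<pi> (vector_of_section Z) p [\<xi>, \<eta>] =
      (\<Sum>as\<leftarrow>D. ?g (as ! 0) (as ! 1) + ?g (as ! 1) (- (as ! 0)))"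
    unfolding gerstenhaber_def D_def[symmetric] D1_def[symmetric]
  proof (rule arg_cong[where f = sum_list], rule map_cong[OF refl])
    fix as assume "as \<in> set D"
    note l = D[OF this]
    define u v where "u = as ! 0" and "v = as ! 1"
    have uv: "as = [u, v]" "sec u" "sec v" using l length_2_conv by (auto simp: u_def v_def)
    have t: "(\<Sum>k<2. \<Sum>l<1. (-1) ^ (k + l) *
        wedge (br (as ! k) (bs ! l) p # map (\<lambda>a. a p) (remove_nth k as @ remove_nth l bs)) [\<xi>, \<eta>]) =
        (\<xi> (br u (bs ! 0) p) * \<eta> (v p) - \<eta> (br u (bs ! 0) p) * \<xi> (v p)) -
        (\<xi> (br v (bs ! 0) p) * \<eta> (u p) - \<eta> (br v (bs ! 0) p) * \<xi> (u p))" if bs: "bs \<in> set D1" for bs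
    proof -
      obtain z where "bs = [z]" using D1[OF bs] by metis
      then show ?thesis unfolding uv(1) by (simp add: lessThan_2 remove_nth_def wedge_2 algebra_simps)
    qed
    have "(\<Sum>bs\<leftarrow>D1. \<Sum>k<2. \<Sum>l<1. (-1) ^ (k + l) *
        wedge (br (as ! k) (bs ! l) p # map (\<lambda>a. a p) (remove_nth k as @ remove_nth l bs)) [\<xi>, \<eta>]) =
        (\<Sum>bs\<leftarrow>D1. (\<xi> (br u (bs ! 0) p) * \<eta> (v p) - \<eta> (br u (bs ! 0) p) * \<xi> (v p)) -
        (\<xi> (br v (bs ! 0) p) * \<eta> (u p) - \<eta> (br v (bs ! 0) p) * \<xi> (u p)))"
      by (rule arg_cong[where f = sum_list], rule map_cong[OF refl], rule t)
    also have "\<dots> = ?g u v - ?g v u"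
      unfolding lin[OF \<xi>(1) uv(2)] lin[OF \<xi>(2) uv(2)] lin[OF \<xi>(1) uv(3)] lin[OF \<xi>(2) uv(3)]
      by (simp add: sum_list_subtractf sum_list_mult_const)
    also have "\<dots> = ?g (as ! 0) (as ! 1) + ?g (as ! 1) (- (as ! 0))"
      unfolding uv(1) using cofibreD(5)[OF \<xi>(1)] cofibreD(5)[OF \<xi>(2)] secD[OF uv(2)] by simp
    finally show "(\<Sum>bs\<leftarrow>D1. \<Sum>k<2. \<Sum>l<1. (-1) ^ (k + l) *
        wedge (br (as ! k) (bs ! l) p # map (\<lambda>a. a p) (remove_nth k as @ remove_nth l bs)) [\<xi>, \<eta>]) =
        ?g (as ! 0) (as ! 1) + ?g (as ! 1) (- (as ! 0))" .
  qed
  also have "\<dots> = (\<Sum>i\<in>I. ?g (c i) (d i))"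
    unfolding cd by (rule sum_didx[symmetric])
  finally show ?thesis .
qed

text \<open>The four signs in the double sum for a pair of terms are produced by the tensor form, in
  which b \<otimes> (- a) stands for the second half of a \<and> b.\<close>

lemma gerstenhaber_bivector_bivector:
  assumes b: "bdec p c d I W" and \<xi>: "\<xi> \<in> cofibre p" "\<eta> \<in> cofibre p" "\<zeta> \<in> cofibre p"
  shows "gerstenhaber A 2 2 \<pi> \<pi> p [\<xi>, \<eta>, \<zeta>] =
    (\<Sum>i\<in>I. \<Sum>j\<in>I. wedge [br (c i) (c j) p, d i p, d j p] [\<xi>, \<eta>, \<zeta>])"
proof -
  note B = bdecD[OF b]
  define D where "D = section_decomp A 2 p \<pi>"
  have cd: "c = dleft D" "d = dright D" "I = didx D" using b by (auto simp: bdec_def Let_def D_def)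
  obtain W' where D: "\<And>as. as \<in> set D \<Longrightarrow> length as = 2 \<and> sec (as ! 0) \<and> sec (as ! 1)"
    unfolding D_def using section_decomp_2 by metis
  let ?w = "\<lambda>a a' b b'. wedge [br a a' p, b p, b' p] [\<xi>, \<eta>, \<zeta>]"
  have neg: "\<theta> ((- a) p) = - \<theta> (a p)" if "\<theta> \<in> cofibre p" "sec a" for \<theta> a
    using cofibreD(5)[OF that(1) secD[OF that(2)]] by simp
  have "gerstenhaber A 2 2 \<pi> \<pi> p [\<xi>, \<eta>, \<zeta>] =
      (\<Sum>as\<leftarrow>D. \<Sum>bs\<leftarrow>D. (?w (as ! 0) (bs ! 0) (as ! 1) (bs ! 1) + ?w (as ! 0) (bs ! 1) (as ! 1) (- (bs ! 0)))
        + (?w (as ! 1) (bs ! 0) (- (as ! 0)) (bs ! 1) + ?w (as ! 1) (bs ! 1) (- (as ! 0)) (- (bs ! 0))))"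
    unfolding gerstenhaber_def D_def[symmetric]
  proof (rule arg_cong[where f = sum_list], rule map_cong[OF refl], rule arg_cong[where f = sum_list], rule map_cong[OF refl])
    fix as bs assume "as \<in> set D" "bs \<in> set D"
    note l = D[OF this(1)] D[OF this(2)]
    define u v where "u = as ! 0" and "v = as ! 1"
    have uv: "as = [u, v]" "sec u" "sec v" using l length_2_conv by (auto simp: u_def v_def)
    define s t where "s = bs ! 0" and "t = bs ! 1"
    have st: "bs = [s, t]" "sec s" "sec t" using l length_2_conv by (auto simp: s_def t_def)
    show "(\<Sum>k<2. \<Sum>l<2. (-1) ^ (k + l) *
        wedge (br (as ! k) (bs ! l) p # map (\<lambda>a. a p) (remove_nth k as @ remove_nth l bs)) [\<xi>, \<eta>, \<zeta>]) =
        (?w (as ! 0) (bs ! 0) (as ! 1) (bs ! 1) + ?w (as ! 0) (bs ! 1) (as ! 1) (- (bs ! 0)))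
        + (?w (as ! 1) (bs ! 0) (- (as ! 0)) (bs ! 1) + ?w (as ! 1) (bs ! 1) (- (as ! 0)) (- (bs ! 0)))"
      unfolding uv(1) st(1)
      by (simp add: lessThan_2 remove_nth_def wedge_3 neg[unfolded fun_Compl_def] neg \<xi> uv(2,3) st(2,3) del: uminus_apply)
        (simp add: algebra_simps)
  qed
  also have "\<dots> = (\<Sum>as\<leftarrow>D. (\<Sum>j\<in>I. ?w (as ! 0) (c j) (as ! 1) (d j)) + (\<Sum>j\<in>I. ?w (as ! 1) (c j) (- (as ! 0)) (d j)))"
    unfolding cd sum_didx[of "\<lambda>x y. ?w a x b y" for a b] by (simp only: sum_list_addf)
  also have "\<dots> = (\<Sum>i\<in>I. \<Sum>j\<in>I. ?w (c i) (c j) (d i) (d j))"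
    unfolding cd by (rule sum_didx[symmetric])
  finally show ?thesis .
qed

text \<open>X \<beta> is expanded as the sum of the \<beta>(c_i) d_i. The bracket terms
  \<open>S\<close> then reproduce the Gerstenhaber bracket, and the derivative terms
  \<open>Q\<close> cancel, in the cyclic sum, between the brackets and the differentiated values of
  \<open>\<pi>\<close>.\<close>

lemma schouten_bracket:
  assumes "cosec \<alpha>" "cosec \<beta>" "cosec \<gamma>"
  shows "1 / 2 * gerstenhaber A 2 2 \<pi> \<pi> p [\<alpha> p, \<beta> p, \<gamma> p] =
    (pair \<alpha> (br (X \<beta>) (X \<gamma>)) + pair \<beta> (br (X \<gamma>) (X \<alpha>)) + pair \<gamma> (br (X \<alpha>) (X \<beta>))
     - der (X \<alpha>) (pp \<beta> \<gamma>) - der (X \<beta>) (pp \<gamma> \<alpha>) - der (X \<gamma>) (pp \<alpha> \<beta>)) p"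
proof -
  obtain c d I W where b: "bdec p c d I W" by (rule bdec_exists)
  note B = bdecD[OF b]
  define Y where "Y \<beta> = (\<Sum>i\<in>I. pair \<beta> (c i) \<bullet>\<^sub>s d i)" for \<beta>
  define qq where "qq \<beta> \<gamma> = (\<Sum>i\<in>I. pair \<beta> (c i) * pair \<gamma> (d i))" for \<beta> \<gamma>
  define S where "S \<alpha> \<beta> \<gamma> = (\<Sum>i\<in>I. \<Sum>j\<in>I. pair \<alpha> (br (c i) (c j)) * pair \<beta> (d i) * pair \<gamma> (d j))" for \<alpha> \<beta> \<gamma>
  define Q where "Q \<delta> \<beta> \<gamma> = (\<Sum>i\<in>I. der (Y \<delta>) (pair \<beta> (c i)) * pair \<gamma> (d i))" for \<delta> \<beta> \<gamma>
  have Ys: "sec (Y \<beta>)" if "cosec \<beta>" for \<beta> unfolding Y_def by (rule bdec_X(1)[OF b that])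
  have derY: "der (Y \<beta>) f = (\<Sum>i\<in>I. pair \<beta> (c i) * der (d i) f)" if "cosec \<beta>" "smooth f" for \<beta> f
    unfolding Y_def using B that by simp
  \<comment> \<open>The expansion produces brackets of the d_i, whereas \<open>gerstenhaber\<close>
    has brackets of the c_i; two exchanges, whose signs cancel, relate them.\<close>
  have S2: "(\<Sum>i\<in>I. \<Sum>j\<in>I. pair \<beta> (c i) * pair \<gamma> (c j) * pair \<alpha> (br (d i) (d j))) = S \<alpha> \<beta> \<gamma>"
    if s: "cosec \<alpha>" "cosec \<beta>" "cosec \<gamma>" for \<alpha> \<beta> \<gamma>
  proof -
    have "(\<Sum>j\<in>I. pair \<beta> (c i) * pair \<gamma> (c j) * pair \<alpha> (br (d i) (d j))) =
        - (\<Sum>j\<in>I. pair \<beta> (c i) * pair \<gamma> (d j) * pair \<alpha> (br (d i) (c j)))" if "i \<in> I" for i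
      by (rule bdec_swap[OF b, of "\<lambda>x y. pair \<beta> (c i) * pair \<gamma> x * pair \<alpha> (br (d i) y)"])
        (use s B that in simp_all)
    then have "(\<Sum>i\<in>I. \<Sum>j\<in>I. pair \<beta> (c i) * pair \<gamma> (c j) * pair \<alpha> (br (d i) (d j))) =
        - (\<Sum>i\<in>I. \<Sum>j\<in>I. pair \<beta> (c i) * pair \<gamma> (d j) * pair \<alpha> (br (d i) (c j)))"
      by (simp add: sum_negf)
    also have "(\<Sum>i\<in>I. \<Sum>j\<in>I. pair \<beta> (c i) * pair \<gamma> (d j) * pair \<alpha> (br (d i) (c j))) =
        - (\<Sum>i\<in>I. \<Sum>j\<in>I. pair \<beta> (d i) * pair \<gamma> (d j) * pair \<alpha> (br (c i) (c j)))"
      by (rule bdec_swap[OF b, of "\<lambda>x y. \<Sum>j\<in>I. pair \<beta> x * pair \<gamma> (d j) * pair \<alpha> (br y (c j))"])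
        (use s B in \<open>simp_all add: sum_negf\<close>)
    finally show ?thesis by (simp only: minus_minus S_def ac_simps)
  qed
  have brY: "pair \<alpha> (br (Y \<beta>) (Y \<gamma>)) = S \<alpha> \<beta> \<gamma> + Q \<beta> \<gamma> \<alpha> - Q \<gamma> \<beta> \<alpha>"
    if s: "cosec \<alpha>" "cosec \<beta>" "cosec \<gamma>" for \<alpha> \<beta> \<gamma>
  proof -
    have "br (Y \<beta>) (Y \<gamma>) = (\<Sum>j\<in>I. pair \<gamma> (c j) \<bullet>\<^sub>s br (Y \<beta>) (d j) + der (Y \<beta>) (pair \<gamma> (c j)) \<bullet>\<^sub>s d j)"
      unfolding Y_def[of \<gamma>] using B s Ys by simp
    then have "pair \<alpha> (br (Y \<beta>) (Y \<gamma>)) =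
        (\<Sum>j\<in>I. pair \<gamma> (c j) * pair \<alpha> (br (Y \<beta>) (d j)) + der (Y \<beta>) (pair \<gamma> (c j)) * pair \<alpha> (d j))"
      using B s Ys by simp
    also have "\<dots> = (\<Sum>j\<in>I. pair \<gamma> (c j) * pair \<alpha> (br (Y \<beta>) (d j))) + Q \<beta> \<gamma> \<alpha>"
      by (simp add: sum.distrib Q_def)
    also have "(\<Sum>j\<in>I. pair \<gamma> (c j) * pair \<alpha> (br (Y \<beta>) (d j))) =
      (\<Sum>j\<in>I. \<Sum>i\<in>I. pair \<beta> (c i) * pair \<gamma> (c j) * pair \<alpha> (br (d i) (d j))) -
      (\<Sum>j\<in>I. pair \<gamma> (c j) * (\<Sum>i\<in>I. der (d j) (pair \<beta> (c i)) * pair \<alpha> (d i)))"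
      unfolding sum_subtractf[symmetric]
    proof (rule sum.cong[OF refl])
      fix j assume j: "j \<in> I"
      have "pair \<alpha> (br (Y \<beta>) (d j)) = (\<Sum>i\<in>I. pair \<beta> (c i) * pair \<alpha> (br (d i) (d j)) - der (d j) (pair \<beta> (c i)) * pair \<alpha> (d i))"
        unfolding Y_def using B s j by simp
      then show "pair \<gamma> (c j) * pair \<alpha> (br (Y \<beta>) (d j)) =
         (\<Sum>i\<in>I. pair \<beta> (c i) * pair \<gamma> (c j) * pair \<alpha> (br (d i) (d j))) -
         pair \<gamma> (c j) * (\<Sum>i\<in>I. der (d j) (pair \<beta> (c i)) * pair \<alpha> (d i))"
        by (simp add: sum_subtractf right_diff_distrib sum_distrib_left mult.commute mult.left_commute)
    qed
    also have "(\<Sum>j\<in>I. \<Sum>i\<in>I. pair \<beta> (c i) * pair \<gamma> (c j) * pair \<alpha> (br (d i) (d j))) = S \<alpha> \<beta> \<gamma>"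
      by (subst sum.swap) (rule S2[OF s])
    also have "(\<Sum>j\<in>I. pair \<gamma> (c j) * (\<Sum>i\<in>I. der (d j) (pair \<beta> (c i)) * pair \<alpha> (d i))) =
        (\<Sum>i\<in>I. \<Sum>j\<in>I. pair \<gamma> (c j) * der (d j) (pair \<beta> (c i)) * pair \<alpha> (d i))"
      unfolding sum_distrib_left by (subst sum.swap) (simp add: mult.assoc)
    also have "\<dots> = Q \<gamma> \<beta> \<alpha>"
      unfolding Q_def by (rule sum.cong) (use B s in \<open>auto simp: derY sum_distrib_right\<close>)
    finally show ?thesis by (simp only: diff_add_eq)
  qed
  have derq: "der (Y \<alpha>) (qq \<beta> \<gamma>) = Q \<alpha> \<beta> \<gamma> - Q \<alpha> \<gamma> \<beta>"
    if s: "cosec \<alpha>" "cosec \<beta>" "cosec \<gamma>" for \<alpha> \<beta> \<gamma>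
  proof -
    have "(\<Sum>i\<in>I. pair \<beta> (c i) * der (Y \<alpha>) (pair \<gamma> (d i))) = - (\<Sum>i\<in>I. pair \<beta> (d i) * der (Y \<alpha>) (pair \<gamma> (c i)))"
      by (rule bdec_swap[OF b, of "\<lambda>x y. pair \<beta> x * der (Y \<alpha>) (pair \<gamma> y)"]) (use s Ys in simp_all)
    also have "\<dots> = - Q \<alpha> \<gamma> \<beta>" by (simp add: Q_def mult.commute)
    finally have "(\<Sum>i\<in>I. pair \<beta> (c i) * der (Y \<alpha>) (pair \<gamma> (d i))) = - Q \<alpha> \<gamma> \<beta>" .
    moreover have "der (Y \<alpha>) (qq \<beta> \<gamma>) = (\<Sum>i\<in>I. pair \<beta> (c i) * der (Y \<alpha>) (pair \<gamma> (d i))) + Q \<alpha> \<beta> \<gamma>"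
      unfolding qq_def Q_def sum.distrib[symmetric] using B s Ys by (simp add: mult.commute)
    ultimately show ?thesis by simp
  qed
  \<comment> \<open>X agrees with its expansion \<open>Y\<close> only near p, which suffices by
    locality of the bracket.\<close>
  have loc1: "pair \<alpha> (br (X \<beta>) (X \<gamma>)) p = pair \<alpha> (br (Y \<beta>) (Y \<gamma>)) p" if s: "cosec \<beta>" "cosec \<gamma>" for \<alpha> \<beta> \<gamma>
  proof -
    have "br (X \<beta>) (X \<gamma>) p = br (X \<beta>) (Y \<gamma>) p"
      by (rule br_local(1)[OF X_sec[OF s(1)] X_sec[OF s(2)] Ys[OF s(2)] B(1,2)])
        (use bdec_X(2)[OF b s(2)] Y_def in auto)
    also have "\<dots> = br (Y \<beta>) (Y \<gamma>) p"
      by (rule br_local(2)[OF Ys[OF s(2)] X_sec[OF s(1)] Ys[OF s(1)] B(1,2)])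
        (use bdec_X(2)[OF b s(1)] Y_def in auto)
    finally show ?thesis by (simp add: pair_def)
  qed
  have loc2: "der (X \<alpha>) (pp \<beta> \<gamma>) p = der (Y \<alpha>) (qq \<beta> \<gamma>) p" if s: "cosec \<alpha>" "cosec \<beta>" "cosec \<gamma>" for \<alpha> \<beta> \<gamma>
  proof -
    have "der (X \<alpha>) (pp \<beta> \<gamma>) p = der (X \<alpha>) (qq \<beta> \<gamma>) p"
      by (rule der_local[OF X_sec[OF s(1)] pp_smooth[OF s(2,3)] _ B(1,2)])
        (use bdec_X(3)[OF b s(2,3)] B s in \<open>auto simp: qq_def\<close>)
    also have "\<dots> = der (Y \<alpha>) (qq \<beta> \<gamma>) p"
      using bdec_X(2)[OF b s(1) B(2)] by (simp add: der_def Y_def)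
    finally show ?thesis .
  qed
  \<comment> \<open>Exchanging i and j reverses the bracket, so the antisymmetrised sum is twice
    \<open>S\<close>; this accounts for the factor 1 / 2 in the statement.\<close>
  have Sskew: "(\<Sum>i\<in>I. \<Sum>j\<in>I. pair \<alpha> (br (c i) (c j)) * (pair \<beta> (d i) * pair \<gamma> (d j) - pair \<beta> (d j) * pair \<gamma> (d i))) =
      S \<alpha> \<beta> \<gamma> + S \<alpha> \<beta> \<gamma>" if s: "cosec \<alpha>" "cosec \<beta>" "cosec \<gamma>" for \<alpha> \<beta> \<gamma>
  proof -
    have "(\<Sum>i\<in>I. \<Sum>j\<in>I. pair \<alpha> (br (c i) (c j)) * pair \<beta> (d j) * pair \<gamma> (d i)) =
        (\<Sum>i\<in>I. \<Sum>j\<in>I. pair \<alpha> (br (c j) (c i)) * pair \<beta> (d i) * pair \<gamma> (d j))"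
      by (rule sum.swap)
    also have "\<dots> = (\<Sum>i\<in>I. \<Sum>j\<in>I. - (pair \<alpha> (br (c i) (c j)) * pair \<beta> (d i) * pair \<gamma> (d j)))"
    proof (intro sum.cong refl)
      fix i j assume ij: "i \<in> I" "j \<in> I"
      show "pair \<alpha> (br (c j) (c i)) * pair \<beta> (d i) * pair \<gamma> (d j) = - (pair \<alpha> (br (c i) (c j)) * pair \<beta> (d i) * pair \<gamma> (d j))"
        using br_skew[OF B(3)[OF ij(2)] B(3)[OF ij(1)]] B ij s by simp
    qed
    also have "\<dots> = - S \<alpha> \<beta> \<gamma>" by (simp add: S_def sum_negf)
    finally have e: "(\<Sum>i\<in>I. \<Sum>j\<in>I. pair \<alpha> (br (c i) (c j)) * pair \<beta> (d j) * pair \<gamma> (d i)) = - S \<alpha> \<beta> \<gamma>" .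
    have "(\<Sum>i\<in>I. \<Sum>j\<in>I. pair \<alpha> (br (c i) (c j)) * (pair \<beta> (d i) * pair \<gamma> (d j) - pair \<beta> (d j) * pair \<gamma> (d i))) =
        S \<alpha> \<beta> \<gamma> - (\<Sum>i\<in>I. \<Sum>j\<in>I. pair \<alpha> (br (c i) (c j)) * pair \<beta> (d j) * pair \<gamma> (d i))"
      unfolding S_def sum_subtractf[symmetric] by (intro sum.cong refl) (simp only: right_diff_distrib mult.assoc)
    then show ?thesis unfolding e by simp
  qed
  have "gerstenhaber A 2 2 \<pi> \<pi> p [\<alpha> p, \<beta> p, \<gamma> p] =
      (\<Sum>i\<in>I. \<Sum>j\<in>I.
        pair \<alpha> (br (c i) (c j)) * (pair \<beta> (d i) * pair \<gamma> (d j) - pair \<beta> (d j) * pair \<gamma> (d i)) +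
        pair \<beta> (br (c i) (c j)) * (pair \<gamma> (d i) * pair \<alpha> (d j) - pair \<gamma> (d j) * pair \<alpha> (d i)) +
        pair \<gamma> (br (c i) (c j)) * (pair \<alpha> (d i) * pair \<beta> (d j) - pair \<alpha> (d j) * pair \<beta> (d i))) p"
    unfolding gerstenhaber_bivector_bivector[OF b cosecD[OF assms(1)] cosecD[OF assms(2)] cosecD[OF assms(3)]] wedge_3_cyclic
    by (simp add: sum_fun_apply pair_def)
  also have "\<dots> = (S \<alpha> \<beta> \<gamma> + S \<alpha> \<beta> \<gamma> + (S \<beta> \<gamma> \<alpha> + S \<beta> \<gamma> \<alpha>) + (S \<gamma> \<alpha> \<beta> + S \<gamma> \<alpha> \<beta>)) p"
    unfolding sum.distrib using Sskew assms by (simp only:)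
  finally show ?thesis
    using assms by (simp add: loc1 loc2 brY derq)
qed

end

section \<open>The modular section\<close>

lemma alternating_on_Cons:
  assumes w: "alternating_on F (Suc q) w" and u: "u \<in> F"
  shows "alternating_on F q (\<lambda>us. w (u # us))"
  unfolding alternating_on_def
proof (intro conjI allI impI, goal_cases)
  case (1 xs ys a b)
  then show ?case using alternating_onD(1)[OF w, of "u # xs" ys a b] u by simp
next
  case (2 xs ys a c)
  then show ?case using alternating_onD(2)[OF w, of "u # xs" ys a c] u by simp
next
  case (3 xs ys zs a)
  then show ?case using alternating_onD(3)[OF w, of "u # xs" ys zs a] u by simp
qed

lemma alternating_on_plus:
  "alternating_on F q v \<Longrightarrow> alternating_on F q w \<Longrightarrow> alternating_on F q (\<lambda>us. v us + w us)"
  unfolding alternating_on_def by (simp add: algebra_simps)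

section \<open>Contraction with the bivector, and the section X\<close>

context bivector_bundle
begin

text \<open>Contraction of a 2-form with \<open>\<pi>\<close>, with the sign opposite to that of
  i_\<pi>, which inserts the second factor first.\<close>

definition tr :: "'m \<Rightarrow> ('v list \<Rightarrow> real) \<Rightarrow> real" where
  "tr p w = (\<Sum>us\<leftarrow>decomp A 2 p (\<pi> p). w [us ! 0, us ! 1])"

lemma decomp_bivector:
  assumes "us \<in> set (decomp A 2 p (\<pi> p))"
  shows "us = [us ! 0, us ! 1]" "us ! 0 \<in> fibre A p" "us ! 1 \<in> fibre A p"
proof -
  have "us \<in> tuples A 2 p" using decomp_2(1)[OF pi_alternating] assms by blast
  then have l: "length us = 2" "set us \<subseteq> fibre A p" by (auto simp: tuples_def)
  then show "us = [us ! 0, us ! 1]" "us ! 0 \<in> fibre A p" "us ! 1 \<in> fibre A p"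
    using length_2_conv by (auto simp: subset_iff)
qed

lemma interior_mv_bivector:
  "interior_mv A 2 \<pi> \<omega> p vs = (\<Sum>us\<leftarrow>decomp A 2 p (\<pi> p). \<omega> p (us ! 1 # us ! 0 # vs))"
  unfolding interior_mv_def
proof (rule arg_cong[where f = sum_list], rule map_cong[OF refl])
  fix us assume "us \<in> set (decomp A 2 p (\<pi> p))"
  from decomp_bivector(1)[OF this] obtain u v where "us = [u, v]" by metis
  then show "foldr (\<lambda>x \<theta> vs. \<theta> (x # vs)) us (\<omega> p) vs = \<omega> p (us ! 1 # us ! 0 # vs)" by simp
qed

lemma tr_frame:
  assumes fr: "local_frame p' W e \<epsilon>" and p: "p \<in> W" and w: "alternating_on (fibre A p) 2 w"
  shows "2 * tr p w = (\<Sum>j<N. \<Sum>k<N. \<pi> p [\<epsilon> j p, \<epsilon> k p] * w [e j p, e k p])"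
proof -
  define D where "D = decomp A 2 p (\<pi> p)"
  have Df: "us ! 0 \<in> fibre A p" "us ! 1 \<in> fibre A p" "us = [us ! 0, us ! 1]" if "us \<in> set D" for us
    using decomp_bivector that D_def by auto
  have cd: "dleft D i \<in> fibre A p" "dright D i \<in> fibre A p" if "i \<in> didx D" for i
    using that Df[of "D ! fst i"] by (auto simp: didx_def dleft_def dright_def)
  have eps: "\<epsilon> i p \<in> cofibre p" if "i < N" for i using local_frameD(4)[OF fr that] cosecD by blast
  have P: "(\<Sum>i\<in>didx D. \<xi> (dleft D i) * \<eta> (dright D i)) = \<pi> p [\<xi>, \<eta>]" if "\<xi> \<in> cofibre p" "\<eta> \<in> cofibre p" for \<xi> \<eta>
  proof -
    have "(\<Sum>i\<in>didx D. \<xi> (dleft D i) * \<eta> (dright D i)) = (\<Sum>us\<leftarrow>D. \<xi> (us ! 0) * \<eta> (us ! 1) + \<xi> (us ! 1) * \<eta> (- (us ! 0)))"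
      by (rule sum_didx)
    also have "\<dots> = (\<Sum>us\<leftarrow>D. wedge us [\<xi>, \<eta>])"
    proof (rule arg_cong[where f = sum_list], rule map_cong[OF refl])
      fix us assume us: "us \<in> set D"
      have "wedge us [\<xi>, \<eta>] = wedge [us ! 0, us ! 1] [\<xi>, \<eta>]" using Df(3)[OF us] by simp
      then show "\<xi> (us ! 0) * \<eta> (us ! 1) + \<xi> (us ! 1) * \<eta> (- (us ! 0)) = wedge us [\<xi>, \<eta>]"
        using cofibreD(5)[OF that(2) Df(1)[OF us]] by (simp add: wedge_2)
    qed
    also have "\<dots> = \<pi> p [\<xi>, \<eta>]" using decomp_2(2)[OF pi_alternating that] by (simp add: D_def)
    finally show ?thesis .
  qed
  have "(\<Sum>i\<in>didx D. w [dleft D i, dright D i]) = (\<Sum>us\<leftarrow>D. w [us ! 0, us ! 1] + w [us ! 1, - (us ! 0)])"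
    by (rule sum_didx)
  also have "\<dots> = (\<Sum>us\<leftarrow>D. 2 * w [us ! 0, us ! 1])"
  proof (rule arg_cong[where f = sum_list], rule map_cong[OF refl])
    fix us assume us: "us \<in> set D"
    have "w [us ! 1, - (us ! 0)] = - w [us ! 1, us ! 0]"
      using alternating_on_2(4)[OF w Df(2)[OF us] Df(1)[OF us], of "-1"] by simp
    also have "\<dots> = w [us ! 0, us ! 1]"
      using alternating_on_2_swap[OF w fibre_subspace Df(1)[OF us] Df(2)[OF us]] by simp
    finally show "w [us ! 0, us ! 1] + w [us ! 1, - (us ! 0)] = 2 * w [us ! 0, us ! 1]" by simp
  qed
  also have "\<dots> = 2 * tr p w" by (simp add: tr_def D_def sum_list_const_mult)
  finally have "2 * tr p w = (\<Sum>i\<in>didx D. w [dleft D i, dright D i])" by simp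
  also have "\<dots> = (\<Sum>j<N. \<Sum>k<N. (\<Sum>i\<in>didx D. \<epsilon> j p (dleft D i) * \<epsilon> k p (dright D i)) * w [e j p, e k p])"
    by (rule pairing_independent[OF fr p finite_didx cd w])
  also have "\<dots> = (\<Sum>j<N. \<Sum>k<N. \<pi> p [\<epsilon> j p, \<epsilon> k p] * w [e j p, e k p])"
    using P eps by simp
  finally show ?thesis .
qed

text \<open>\<open>interior_mv\<close> decomposes \<open>\<pi>\<close> at a point and
  \<open>gerstenhaber\<close> near it, by unrelated choices; both decompositions have the
  coefficients \<open>\<pi> x [\<epsilon> j x, \<epsilon> k x]\<close>, so their contractions agree.
  The factor 1 / 2 undoes the doubling in the tensor form.\<close>

lemma tr_bdec:
  assumes b: "bdec p c d I W" and x: "x \<in> W" and w: "alternating_on (fibre A x) 2 w"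
  shows "tr x w = 1 / 2 * (\<Sum>i\<in>I. w [c i x, d i x])"
proof -
  note B = bdecD[OF b]
  obtain V e \<epsilon> where fr: "local_frame x V e \<epsilon>" by (rule local_frame_exists)
  note f = local_frameD[OF fr]
  have "(\<Sum>i\<in>I. w [c i x, d i x]) =
      (\<Sum>j<N. \<Sum>k<N. (\<Sum>i\<in>I. \<epsilon> j x (c i x) * \<epsilon> k x (d i x)) * w [e j x, e k x])"
    by (rule pairing_independent[OF fr f(2) B(5) secD[OF B(3)] secD[OF B(4)] w])
  also have "\<dots> = (\<Sum>j<N. \<Sum>k<N. \<pi> x [\<epsilon> j x, \<epsilon> k x] * w [e j x, e k x])"
    using B(6)[OF x cosecD[OF f(4)] cosecD[OF f(4)]] by simp
  also have "\<dots> = 2 * tr x w" by (rule tr_frame[OF fr f(2) w, symmetric])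
  finally show ?thesis by simp
qed

lemma tr_add: "tr p (\<lambda>us. v us + w us) = tr p v + tr p w"
  by (simp add: tr_def sum_list_addf)

definition trd :: "('m \<Rightarrow> 'v \<Rightarrow> real) \<Rightarrow> 'm \<Rightarrow> real" where
  "trd \<alpha> p = tr p (la_diff A (form_of_section \<alpha>) p)"

lemma trd_bdec:
  assumes b: "bdec p c d I W" and x: "x \<in> W" and \<alpha>: "cosec \<alpha>"
  shows "trd \<alpha> x = ((\<lambda>_. 1 / 2) * (\<Sum>i\<in>I. dd \<alpha> (c i) (d i))) x"
  unfolding trd_def tr_bdec[OF b x la_diff_form_of_section_alternating[OF \<alpha>]]
  using la_diff_form_of_section[OF \<alpha> bdecD(3)[OF b] bdecD(4)[OF b], of _ _ x] by (simp add: sum_fun_apply)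

lemma trd_smooth: "cosec \<alpha> \<Longrightarrow> smooth (trd \<alpha>)"
proof (rule smooth_fun_local[OF manifold])
  fix p assume \<alpha>: "cosec \<alpha>"
  obtain c d I W where b: "bdec p c d I W" by (rule bdec_exists)
  note B = bdecD[OF b]
  have "smooth ((\<lambda>_. 1 / 2) * (\<Sum>i\<in>I. dd \<alpha> (c i) (d i)))" using B \<alpha> by simp
  then have "smooth_fun (atlas A) W ((\<lambda>_. 1 / 2) * (\<Sum>i\<in>I. dd \<alpha> (c i) (d i)))"
    by (rule smooth_fun_mono) simp
  then have "smooth_fun (atlas A) W (trd \<alpha>)"
    by (rule smooth_fun_cong[OF manifold B(1)]) (use trd_bdec[OF b _ \<alpha>] in simp)
  then show "\<exists>V. open V \<and> p \<in> V \<and> smooth_fun (atlas A) V (trd \<alpha>)" using B by blast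
qed

text \<open>d (f \<alpha>) = f d \<alpha> + df \<and> \<alpha>, and df \<and> \<alpha> contracts
  with \<open>\<pi>\<close> to minus the derivative of f along X \<alpha>. This is the defect of the
  divergence in \<open>dv_smul\<close> with the opposite sign, so that divergence and trace together
  are function-linear in \<alpha>.\<close>

lemma trd_linear:
  assumes \<alpha>: "cosec \<alpha>"
  shows "cosec \<beta> \<Longrightarrow> trd (\<alpha> + \<beta>) p = trd \<alpha> p + trd \<beta> p"
    "smooth f \<Longrightarrow> trd (f \<bullet>\<^sub>s \<alpha>) p = f p * trd \<alpha> p - der (X \<alpha>) f p"
proof -
  obtain c d I W where b: "bdec p c d I W" by (rule bdec_exists)
  note B = bdecD[OF b] and t = trd_bdec[OF b bdecD(2)[OF b]]
  show "trd (\<alpha> + \<beta>) p = trd \<alpha> p + trd \<beta> p" if \<beta>: "cosec \<beta>"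
  proof -
    have "dd (\<alpha> + \<beta>) (c i) (d i) = dd \<alpha> (c i) (d i) + dd \<beta> (c i) (d i)" if "i \<in> I" for i
      using B that \<alpha> \<beta> by (simp add: dd_def)
    then show ?thesis
      using t[OF cosec_closed(1)[OF \<alpha> \<beta>]] t[OF \<alpha>] t[OF \<beta>] by (simp add: sum_fun_apply sum.distrib algebra_simps)
  qed
  show "trd (f \<bullet>\<^sub>s \<alpha>) p = f p * trd \<alpha> p - der (X \<alpha>) f p" if f: "smooth f"
  proof -
    have "dd (f \<bullet>\<^sub>s \<alpha>) (c i) (d i) = f * dd \<alpha> (c i) (d i) + der (c i) f * pair \<alpha> (d i) - der (d i) f * pair \<alpha> (c i)"
      if "i \<in> I" for i
      using B that \<alpha> f by (simp add: dd_def algebra_simps)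
    then have "(\<Sum>i\<in>I. dd (f \<bullet>\<^sub>s \<alpha>) (c i) (d i)) =
        f * (\<Sum>i\<in>I. dd \<alpha> (c i) (d i)) + (\<Sum>i\<in>I. der (c i) f * pair \<alpha> (d i)) - (\<Sum>i\<in>I. der (d i) f * pair \<alpha> (c i))"
      by (simp add: sum.distrib sum_subtractf sum_distrib_left)
    also have "(\<Sum>i\<in>I. der (c i) f * pair \<alpha> (d i)) = - (\<Sum>i\<in>I. der (d i) f * pair \<alpha> (c i))"
      by (rule bdec_swap[OF b, of "\<lambda>x y. der x f * pair \<alpha> y"]) (use \<alpha> f in simp_all)
    finally have e: "(\<Sum>i\<in>I. dd (f \<bullet>\<^sub>s \<alpha>) (c i) (d i)) =
        f * (\<Sum>i\<in>I. dd \<alpha> (c i) (d i)) + - (\<Sum>i\<in>I. der (d i) f * pair \<alpha> (c i)) - (\<Sum>i\<in>I. der (d i) f * pair \<alpha> (c i))" .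
    have "der (X \<alpha>) f p = der (\<Sum>i\<in>I. pair \<alpha> (c i) \<bullet>\<^sub>s d i) f p"
      using bdec_X(2)[OF b \<alpha> B(2)] by (simp add: der_def)
    also have "\<dots> = (\<Sum>i\<in>I. der (d i) f * pair \<alpha> (c i)) p"
      using B f \<alpha> by (simp add: mult.commute)
    finally have d: "der (X \<alpha>) f p = (\<Sum>i\<in>I. der (d i) f * pair \<alpha> (c i)) p" .
    have e': "(\<Sum>i\<in>I. dd (f \<bullet>\<^sub>s \<alpha>) (c i) (d i)) p =
        f p * (\<Sum>i\<in>I. dd \<alpha> (c i) (d i)) p - 2 * (\<Sum>i\<in>I. der (d i) f * pair \<alpha> (c i)) p"
      using fun_cong[OF e, of p] by simp
    show ?thesis
      unfolding t[OF cosec_closed(2)[OF f \<alpha>]] t[OF \<alpha>] d times_fun_apply e' by (simp add: algebra_simps)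
  qed
qed

text \<open>Divergence plus trace is function-linear in \<alpha> and so comes from a section, which
  solves the definite description. The solution is unique because \<open>\<mu>\<close> is non-zero
  on some tuple at each point.\<close>

lemma modular_X:
  assumes \<mu>: "volume_form A \<mu>"
  shows "sec (modular_X A \<pi> \<mu>)" "cosec \<alpha> \<Longrightarrow> \<alpha> p (modular_X A \<pi> \<mu> p) = dv \<mu> (X \<alpha>) p + trd \<alpha> p"
proof -
  obtain M where M: "sec M" "\<And>\<xi> p. cosec \<xi> \<Longrightarrow> \<xi> p (M p) = (dv \<mu> (X \<xi>) + trd \<xi>) p"
  proof (rule tensor_section[of "\<lambda>\<xi>. dv \<mu> (X \<xi>) + trd \<xi>"])
    fix s t p assume s: "cosec s" "cosec t"
    have e: "(\<lambda>x. s x + t x) = s + t" by (simp add: fun_eq_iff)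
    show "(dv \<mu> (X (\<lambda>x. s x + t x)) + trd (\<lambda>x. s x + t x)) p = (dv \<mu> (X s) + trd s) p + (dv \<mu> (X t) + trd t) p"
      unfolding e using X_linear(1)[OF s] dv_add[OF \<mu> X_sec[OF s(1)] X_sec[OF s(2)]] trd_linear(1)[OF s] by simp
  next
    fix f s p assume f: "smooth f" "cosec s"
    have e: "(\<lambda>x. f x *\<^sub>R s x) = f \<bullet>\<^sub>s s" by (simp add: smul_def)
    show "(dv \<mu> (X (\<lambda>x. f x *\<^sub>R s x)) + trd (\<lambda>x. f x *\<^sub>R s x)) p = f p * (dv \<mu> (X s) + trd s) p"
      unfolding e using X_linear(2)[OF f(2,1)] dv_smul[OF \<mu> X_sec[OF f(2)] f(1)] trd_linear(2)[OF f(2,1)]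
      by (simp add: algebra_simps)
  next
    fix s assume "cosec s"
    then show "smooth (dv \<mu> (X s) + trd s)" using \<mu> trd_smooth by simp
  qed blast
  have key: "lie_derivative A (\<lambda>x. sharp A \<pi> x (\<alpha> x)) \<mu> p us
      - interior_mv A 2 \<pi> (la_diff A (form_of_section \<alpha>)) p [] * \<mu> p us = (dv \<mu> (X \<alpha>) p + trd \<alpha> p) * \<mu> p us"
    if \<alpha>: "cosec \<alpha>" and us: "us \<in> tuples A N p" for \<alpha> p us
  proof -
    have "(\<Sum>us\<leftarrow>decomp A 2 p (\<pi> p). la_diff A (form_of_section \<alpha>) p [us ! 1, us ! 0]) =
        (\<Sum>us\<leftarrow>decomp A 2 p (\<pi> p). - la_diff A (form_of_section \<alpha>) p [us ! 0, us ! 1])"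
      by (rule arg_cong[where f = sum_list], rule map_cong[OF refl],
          rule alternating_on_2_swap[OF la_diff_form_of_section_alternating[OF \<alpha>] fibre_subspace])
        (auto dest: decomp_bivector)
    also have "\<dots> = - trd \<alpha> p" by (simp add: trd_def tr_def uminus_sum_list_map o_def)
    finally show ?thesis
      using lie_derivative_dv[OF \<mu> X_sec[OF \<alpha>] us]
      by (simp add: interior_mv_bivector X_def[symmetric] algebra_simps)
  qed
  have "modular_X A \<pi> \<mu> = M"
    unfolding modular_X_def
  proof (rule the_equality)
    show "sec M \<and> (\<forall>\<alpha>. cosec \<alpha> \<longrightarrow> (\<forall>p. \<forall>us\<in>tuples A N p. \<alpha> p (M p) * \<mu> p us =
        lie_derivative A (\<lambda>x. sharp A \<pi> x (\<alpha> x)) \<mu> p us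
        - interior_mv A 2 \<pi> (la_diff A (form_of_section \<alpha>)) p [] * \<mu> p us))"
      using M key by simp
    fix M' assume M': "sec M' \<and> (\<forall>\<alpha>. cosec \<alpha> \<longrightarrow> (\<forall>p. \<forall>us\<in>tuples A N p. \<alpha> p (M' p) * \<mu> p us =
        lie_derivative A (\<lambda>x. sharp A \<pi> x (\<alpha> x)) \<mu> p us
        - interior_mv A 2 \<pi> (la_diff A (form_of_section \<alpha>)) p [] * \<mu> p us))"
    show "M' = M"
    proof
      fix p
      obtain us where us: "us \<in> tuples A N p" "\<mu> p us \<noteq> 0" using \<mu> unfolding volume_form_def by blast
      show "M' p = M p"
      proof (rule cofibre_separates)
        fix \<alpha> assume \<alpha>: "cosec \<alpha>"
        have "\<alpha> p (M' p) * \<mu> p us = (dv \<mu> (X \<alpha>) p + trd \<alpha> p) * \<mu> p us"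
          using M' \<alpha> us(1) key[OF \<alpha> us(1)] by simp
        then show "\<alpha> p (M' p) = \<alpha> p (M p)" using us(2) M(2)[OF \<alpha>] by simp
      qed (use M M' secD in auto)
    qed
  qed
  then show "sec (modular_X A \<pi> \<mu>)" "cosec \<alpha> \<Longrightarrow> \<alpha> p (modular_X A \<pi> \<mu> p) = dv \<mu> (X \<alpha>) p + trd \<alpha> p"
    using M by simp_all
qed

lemma sharp_linear:
  assumes "\<xi> \<in> cofibre p" "\<eta> \<in> cofibre p"
  shows "sharp A \<pi> p (\<xi> + \<eta>) = sharp A \<pi> p \<xi> + sharp A \<pi> p \<eta>" "sharp A \<pi> p (c *\<^sub>R \<xi>) = c *\<^sub>R sharp A \<pi> p \<xi>"
proof -
  have c: "\<xi> + \<eta> \<in> cofibre p" "c *\<^sub>R \<xi> \<in> cofibre p"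
    using assms subspace_add[OF cofibre_subspace] subspace_scale[OF cofibre_subspace] by auto
  note s = sharp[OF assms(1)] sharp[OF assms(2)] sharp[OF c(1)] sharp[OF c(2)]
  show "sharp A \<pi> p (\<xi> + \<eta>) = sharp A \<pi> p \<xi> + sharp A \<pi> p \<eta>"
  proof (rule cofibre_separates)
    fix \<zeta> assume "cosec \<zeta>"
    note z = cosecD[OF this, of p]
    show "\<zeta> p (sharp A \<pi> p (\<xi> + \<eta>)) = \<zeta> p (sharp A \<pi> p \<xi> + sharp A \<pi> p \<eta>)"
      using s(2)[OF z] s(4)[OF z] s(6)[OF z] cofibreD(1)[OF z s(1,3)] alternating_on_2(1)[OF pi_alternating assms z]
      by simp
  qed (use s in auto)
  show "sharp A \<pi> p (c *\<^sub>R \<xi>) = c *\<^sub>R sharp A \<pi> p \<xi>"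
  proof (rule cofibre_separates)
    fix \<zeta> assume "cosec \<zeta>"
    note z = cosecD[OF this, of p]
    show "\<zeta> p (sharp A \<pi> p (c *\<^sub>R \<xi>)) = \<zeta> p (c *\<^sub>R sharp A \<pi> p \<xi>)"
      using s(8)[OF z] s(2)[OF z] cofibreD(2)[OF z s(1)] alternating_on_2(3)[OF pi_alternating assms(1) z] by simp
  qed (use s in auto)
qed

end

section \<open>The twist: the section Y and the bracket on the dual\<close>

locale twisted_poisson_bundle = bivector_bundle A \<pi>
  for A :: "('m::{t2_space,second_countable_topology}, 'e::real_inner, 'v::real_vector) algebroid" and \<pi> +
  fixes \<psi> :: "'m \<Rightarrow> 'v list \<Rightarrow> real"
  assumes TP: "twisted_poisson A \<pi> \<psi>"
begin

lemma psi_form: "form A 3 \<psi>"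
  using TP by (simp add: twisted_poisson_def)

lemma psi_alternating: "alternating_on (fibre A p) 3 (\<psi> p)"
  by (rule alternating_on_form[OF psi_form])

lemma psi_contract: "u \<in> fibre A p \<Longrightarrow> alternating_on (fibre A p) 2 (\<lambda>us. \<psi> p (u # us))"
  using alternating_on_Cons[of "fibre A p" 2 "\<psi> p" u] psi_alternating[of p] by (simp add: numeral_3_eq_3 numeral_2_eq_2)

lemma psi_closed: "sec U \<Longrightarrow> sec V \<Longrightarrow> sec W \<Longrightarrow> sec Z \<Longrightarrow> dd3 \<psi> U V W Z = 0"
  using TP by (intro dd3_eq_zero[OF psi_form]) (auto simp: twisted_poisson_def)

text \<open>The form in which the condition on [\<pi>, \<pi>] is applied, once to the bracket of X
  \<alpha> and X \<beta> and once to the Lie derivative of \<open>\<pi>\<close>.\<close>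

lemma twisted_jacobi:
  assumes "cosec \<alpha>" "cosec \<beta>" "cosec \<gamma>"
  shows "pair \<alpha> (br (X \<beta>) (X \<gamma>)) + pair \<beta> (br (X \<gamma>) (X \<alpha>)) + pair \<gamma> (br (X \<alpha>) (X \<beta>))
     - der (X \<alpha>) (pp \<beta> \<gamma>) - der (X \<beta>) (pp \<gamma> \<alpha>) - der (X \<gamma>) (pp \<alpha> \<beta>) = ev \<psi> [X \<alpha>, X \<beta>, X \<gamma>]"
proof
  fix p
  have "[\<alpha> p, \<beta> p, \<gamma> p] \<in> tuples (dual_bundle A) 3 p" using assms cosecD by (auto simp: tuples_def)
  then have "1 / 2 * gerstenhaber A 2 2 \<pi> \<pi> p [\<alpha> p, \<beta> p, \<gamma> p] = sharp_form A \<pi> \<psi> p [\<alpha> p, \<beta> p, \<gamma> p]"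
    using TP unfolding twisted_poisson_def by blast
  then show "(pair \<alpha> (br (X \<beta>) (X \<gamma>)) + pair \<beta> (br (X \<gamma>) (X \<alpha>)) + pair \<gamma> (br (X \<alpha>) (X \<beta>))
     - der (X \<alpha>) (pp \<beta> \<gamma>) - der (X \<beta>) (pp \<gamma> \<alpha>) - der (X \<gamma>) (pp \<alpha> \<beta>)) p = ev \<psi> [X \<alpha>, X \<beta>, X \<gamma>] p"
    unfolding schouten_bracket[OF assms] by (simp add: sharp_form_def ev_def X_def)
qed

text \<open>Two signs cancel: i_\<pi> \<psi> is minus a trace, and skewness of \<open>\<pi>\<close>
  gives another minus when X passes from i_\<pi> \<psi> to \<alpha>. Smoothness of i_\<pi> \<psi>
  comes from contracting with a decomposition by sections near each point.\<close>

lemma modular_Y: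
  shows "sec (modular_Y A \<pi> \<psi>)"
    "cosec \<alpha> \<Longrightarrow> \<alpha> p (modular_Y A \<pi> \<psi> p) = tr p (\<lambda>us. \<psi> p (X \<alpha> p # us))"
proof -
  define \<kappa> where "\<kappa> p = section_of_form A (interior_mv A 2 \<pi> \<psi>) p" for p
  have k: "\<kappa> p u = - tr p (\<lambda>us. \<psi> p (u # us))" if u: "u \<in> fibre A p" for p u
  proof -
    have "(\<Sum>us\<leftarrow>decomp A 2 p (\<pi> p). \<psi> p [us ! 1, us ! 0, u]) = (\<Sum>us\<leftarrow>decomp A 2 p (\<pi> p). - \<psi> p [u, us ! 0, us ! 1])"
    proof (rule arg_cong[where f = sum_list], rule map_cong[OF refl])
      fix us assume "us \<in> set (decomp A 2 p (\<pi> p))"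
      note f = decomp_bivector(2,3)[OF this]
      note al = alternating_on_3(3,4)[OF psi_alternating fibre_subspace]
      show "\<psi> p [us ! 1, us ! 0, u] = - \<psi> p [u, us ! 0, us ! 1]"
        using al(2)[OF f(2,1) u] al(1)[OF f(2) u f(1)] al(2)[OF u f(2,1)] by simp
    qed
    also have "\<dots> = - tr p (\<lambda>us. \<psi> p (u # us))" by (simp add: tr_def uminus_sum_list_map o_def)
    finally show ?thesis using u by (simp add: \<kappa>_def section_of_form_def interior_mv_bivector)
  qed
  have kf: "\<kappa> p \<in> cofibre p" for p
    unfolding dual_fibre_iff
  proof (intro conjI allI ballI impI)
    note al = alternating_on_3(1,2)[OF psi_alternating fibre_subspace]
    fix u v assume uv: "u \<in> fibre A p" "v \<in> fibre A p"
    have "tr p (\<lambda>us. \<psi> p ((u + v) # us)) = tr p (\<lambda>us. \<psi> p (u # us) + \<psi> p (v # us))"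
      unfolding tr_def
      by (rule arg_cong[where f = sum_list], rule map_cong[OF refl], rule al(1)) (use uv in \<open>auto dest: decomp_bivector\<close>)
    also have "\<dots> = tr p (\<lambda>us. \<psi> p (u # us)) + tr p (\<lambda>us. \<psi> p (v # us))" by (rule tr_add)
    finally show "\<kappa> p (u + v) = \<kappa> p u + \<kappa> p v" using k uv by simp
  next
    note al = alternating_on_3(1,2)[OF psi_alternating fibre_subspace]
    fix c u assume u: "u \<in> fibre A p"
    have "tr p (\<lambda>us. \<psi> p ((c *\<^sub>R u) # us)) = c * tr p (\<lambda>us. \<psi> p (u # us))"
      unfolding tr_def sum_list_const_mult[symmetric]
      by (rule arg_cong[where f = sum_list], rule map_cong[OF refl], rule al(2)) (use u in \<open>auto dest: decomp_bivector\<close>)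
    then show "\<kappa> p (c *\<^sub>R u) = c * \<kappa> p u" using k u by simp
  qed (simp add: \<kappa>_def section_of_form_def)
  have ks: "cosec \<kappa>"
  proof (rule cosec_by_pairing[OF kf])
    fix U assume U: "sec U"
    show "smooth (\<lambda>p. \<kappa> p (U p))"
    proof (rule smooth_fun_local[OF manifold])
      fix p
      obtain c d I W where b: "bdec p c d I W" by (rule bdec_exists)
      note B = bdecD[OF b]
      have "smooth (\<Sum>i\<in>I. ev \<psi> [U, c i, d i])" using ev_3(4)[OF psi_form U B(3,4)] by simp
      then have "smooth ((\<lambda>_. - (1 / 2)) * (\<Sum>i\<in>I. ev \<psi> [U, c i, d i]))" by simp
      then have "smooth_fun (atlas A) W ((\<lambda>_. - (1 / 2)) * (\<Sum>i\<in>I. ev \<psi> [U, c i, d i]))"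
        by (rule smooth_fun_mono) simp
      then have "smooth_fun (atlas A) W (\<lambda>p. \<kappa> p (U p))"
      proof (rule smooth_fun_cong[OF manifold B(1)])
        fix x assume x: "x \<in> W"
        show "((\<lambda>_. - (1 / 2)) * (\<Sum>i\<in>I. ev \<psi> [U, c i, d i])) x = \<kappa> x (U x)"
          unfolding k[OF secD[OF U]] tr_bdec[OF b x psi_contract[OF secD[OF U]]]
          by (simp add: sum_fun_apply ev_def)
      qed
      then show "\<exists>V. open V \<and> p \<in> V \<and> smooth_fun (atlas A) V (\<lambda>p. \<kappa> p (U p))" using B by blast
    qed
  qed
  have Y: "modular_Y A \<pi> \<psi> = X \<kappa>" by (simp add: fun_eq_iff modular_Y_def X_def \<kappa>_def)
  show "sec (modular_Y A \<pi> \<psi>)" unfolding Y using ks by simp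
  show "\<alpha> p (modular_Y A \<pi> \<psi> p) = tr p (\<lambda>us. \<psi> p (X \<alpha> p # us))" if \<alpha>: "cosec \<alpha>"
  proof -
    have "\<alpha> p (X \<kappa> p) = pp \<kappa> \<alpha> p" using pair_X_pointwise[OF ks \<alpha>] by (simp add: pair_def)
    also have "\<dots> = - pp \<alpha> \<kappa> p" using pp_skew[OF ks \<alpha>] by simp
    also have "\<dots> = - \<kappa> p (X \<alpha> p)" using pair_X_pointwise[OF \<alpha> ks, of p] by (simp add: pair_def)
    finally show ?thesis unfolding Y using k[OF secD[OF X_sec[OF \<alpha>]]] by simp
  qed
qed

text \<open>The 2-form \<open>d \<alpha> + i\<^bsub>X \<alpha>\<^esub> \<psi>\<close>, on sections and pointwise.\<close>

definition FF :: "('m \<Rightarrow> 'v \<Rightarrow> real) \<Rightarrow> ('m \<Rightarrow> 'v) \<Rightarrow> ('m \<Rightarrow> 'v) \<Rightarrow> 'm \<Rightarrow> real" where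
  "FF \<alpha> U V = dd \<alpha> U V + ev \<psi> [X \<alpha>, U, V]"

definition Fw :: "('m \<Rightarrow> 'v \<Rightarrow> real) \<Rightarrow> 'm \<Rightarrow> 'v list \<Rightarrow> real" where
  "Fw \<alpha> p us = la_diff A (form_of_section \<alpha>) p us + \<psi> p (X \<alpha> p # us)"

lemma Fw_alternating: "cosec \<alpha> \<Longrightarrow> alternating_on (fibre A p) 2 (Fw \<alpha> p)"
  unfolding Fw_def
  by (intro alternating_on_plus la_diff_form_of_section_alternating psi_contract secD X_sec)

lemma Fw_sections: "cosec \<alpha> \<Longrightarrow> sec U \<Longrightarrow> sec V \<Longrightarrow> Fw \<alpha> p [U p, V p] = FF \<alpha> U V p"
  by (simp add: Fw_def FF_def la_diff_form_of_section ev_def)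

lemma ev_psi_linear:
  assumes "sec U" "sec V" "sec W"
  shows "sec U' \<Longrightarrow> ev \<psi> [U, V + U', W] = ev \<psi> [U, V, W] + ev \<psi> [U, U', W]"
    "sec U' \<Longrightarrow> ev \<psi> [U, V, W + U'] = ev \<psi> [U, V, W] + ev \<psi> [U, V, U']"
    "ev \<psi> [U, f \<bullet>\<^sub>s V, W] = f * ev \<psi> [U, V, W]"
    "ev \<psi> [U, V, f \<bullet>\<^sub>s W] = f * ev \<psi> [U, V, W]"
  using ev_linear(1)[OF psi_form, of "[U]" "[W]" V U'] ev_linear(1)[OF psi_form, of "[U, V]" "[]" W U']
    ev_linear(2)[OF psi_form, of "[U]" "[W]" V f] ev_linear(2)[OF psi_form, of "[U, V]" "[]" W f] assms
  by auto

lemma FF_linear: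
  assumes \<alpha>: "cosec \<alpha>" and s: "sec U" "sec V"
  shows "sec U' \<Longrightarrow> FF \<alpha> V (U + U') = FF \<alpha> V U + FF \<alpha> V U'"
    "smooth f \<Longrightarrow> FF \<alpha> V (f \<bullet>\<^sub>s U) = f * FF \<alpha> V U"
    "smooth (FF \<alpha> U V)" "FF \<alpha> U V = - FF \<alpha> V U"
proof -
  show "FF \<alpha> U V = - FF \<alpha> V U"
    using dd_linear(3)[OF \<alpha> s] ev_3(2)[OF psi_form X_sec[OF \<alpha>] s(2,1)] by (simp add: FF_def)
  show "smooth (FF \<alpha> U V)" using ev_3(4)[OF psi_form X_sec[OF \<alpha>] s] \<alpha> s by (simp add: FF_def)
  show "FF \<alpha> V (U + U') = FF \<alpha> V U + FF \<alpha> V U'" if u: "sec U'"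
    using ev_psi_linear(2)[OF X_sec[OF \<alpha>] s(2,1) u] \<alpha> s u by (simp add: FF_def dd_def)
  show "FF \<alpha> V (f \<bullet>\<^sub>s U) = f * FF \<alpha> V U" if f: "smooth f"
    using ev_psi_linear(4)[OF X_sec[OF \<alpha>] s(2,1), of f] \<alpha> s f
    by (simp add: FF_def dd_def fun_eq_iff algebra_simps)
qed

definition trF :: "('m \<Rightarrow> 'v \<Rightarrow> real) \<Rightarrow> 'm \<Rightarrow> real" where
  "trF \<alpha> p = tr p (Fw \<alpha> p)"

lemma trF_bdec:
  assumes b: "bdec p c d I W" and x: "x \<in> W" and \<alpha>: "cosec \<alpha>"
  shows "trF \<alpha> x = ((\<lambda>_. 1 / 2) * (\<Sum>i\<in>I. FF \<alpha> (c i) (d i))) x"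
  unfolding trF_def tr_bdec[OF b x Fw_alternating[OF \<alpha>]]
  using Fw_sections[OF \<alpha> bdecD(3)[OF b] bdecD(4)[OF b], of _ _ x] by (simp add: sum_fun_apply)

text \<open>Additivity of the trace merges the contribution of d \<alpha> to X and that of \<psi> to
  Y into the trace of a single 2-form.\<close>

lemma modular_Z:
  assumes \<mu>: "volume_form A \<mu>"
  shows "sec (modular_Z A \<pi> \<psi> \<mu>)" "cosec \<alpha> \<Longrightarrow> pair \<alpha> (modular_Z A \<pi> \<psi> \<mu>) = dv \<mu> (X \<alpha>) + trF \<alpha>"
proof -
  have Z: "modular_Z A \<pi> \<psi> \<mu> = modular_X A \<pi> \<mu> + modular_Y A \<pi> \<psi>" by (simp add: modular_Z_def fun_eq_iff)
  show "sec (modular_Z A \<pi> \<psi> \<mu>)" unfolding Z using modular_X(1)[OF \<mu>] modular_Y(1) by simp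
  show "pair \<alpha> (modular_Z A \<pi> \<psi> \<mu>) = dv \<mu> (X \<alpha>) + trF \<alpha>" if \<alpha>: "cosec \<alpha>"
    unfolding Z pair_linear(1)[OF \<alpha> modular_X(1)[OF \<mu>] modular_Y(1)]
    using modular_X(2)[OF \<mu> \<alpha>] modular_Y(2)[OF \<alpha>]
    by (simp add: fun_eq_iff pair_def trF_def trd_def Fw_def[abs_def] tr_add)
qed

lemma trF_smooth [simp]:
  assumes \<alpha>: "cosec \<alpha>"
  shows "smooth (trF \<alpha>)"
proof (rule smooth_fun_local[OF manifold])
  fix p
  obtain c d I W where b: "bdec p c d I W" by (rule bdec_exists)
  note B = bdecD[OF b]
  have "smooth ((\<lambda>_. 1 / 2) * (\<Sum>i\<in>I. FF \<alpha> (c i) (d i)))" using FF_linear(3)[OF \<alpha> B(3,4)] by simp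
  then have "smooth_fun (atlas A) W ((\<lambda>_. 1 / 2) * (\<Sum>i\<in>I. FF \<alpha> (c i) (d i)))"
    by (rule smooth_fun_mono) simp
  then have "smooth_fun (atlas A) W (trF \<alpha>)"
    by (rule smooth_fun_cong[OF manifold B(1)]) (use trF_bdec[OF b _ \<alpha>] in simp)
  then show "\<exists>V. open V \<and> p \<in> V \<and> smooth_fun (atlas A) V (trF \<alpha>)" using B by blast
qed

text \<open>The bracket of the Lie algebroid \<open>A\<^sup>*\<close>, written in the form
  \<open>[\<alpha>, \<beta>] = L\<^bsub>X \<alpha>\<^esub> \<beta> - i\<^bsub>X \<beta>\<^esub> (d \<alpha> + i\<^bsub>X \<alpha>\<^esub> \<psi>)\<close> of a Dorfman bracket.\<close>

lemma dual_bracket: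
  assumes a: "cosec \<alpha>" "cosec \<beta>"
  obtains \<gamma> where "cosec \<gamma>" "\<And>U. sec U \<Longrightarrow> pair \<gamma> U = der (X \<alpha>) (pair \<beta> U) - pair \<beta> (br (X \<alpha>) U) - FF \<alpha> (X \<beta>) U"
    "X \<gamma> = br (X \<alpha>) (X \<beta>)"
proof -
  let ?\<Phi> = "\<lambda>U. der (X \<alpha>) (pair \<beta> U) - pair \<beta> (br (X \<alpha>) U) - FF \<alpha> (X \<beta>) U"
  note F = FF_linear[OF a(1) _ X_sec[OF a(2)]]
  obtain \<gamma> where g: "cosec \<gamma>" "\<And>U p. sec U \<Longrightarrow> \<gamma> p (U p) = ?\<Phi> U p"
  proof (rule tensor_cosection[of ?\<Phi>])
    fix s t p assume s: "sec s" "sec t"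
    have e: "(\<lambda>x. s x + t x) = s + t" by (simp add: fun_eq_iff)
    show "?\<Phi> (\<lambda>x. s x + t x) p = ?\<Phi> s p + ?\<Phi> t p"
      unfolding e using F(1)[OF s] a s by simp
  next
    fix f s p assume f: "smooth f" "sec s"
    have e: "(\<lambda>x. f x *\<^sub>R s x) = f \<bullet>\<^sub>s s" by (simp add: smul_def)
    show "?\<Phi> (\<lambda>x. f x *\<^sub>R s x) p = f p * ?\<Phi> s p"
      unfolding e using F(2)[OF f(2,1)] a f by (simp add: algebra_simps)
  next
    fix s assume s: "sec s"
    show "smooth (?\<Phi> s)" using FF_linear(3)[OF a(1) X_sec[OF a(2)] s] a s by simp
  qed blast
  have gp: "pair \<gamma> U = ?\<Phi> U" if "sec U" for U
  proof
    fix x show "pair \<gamma> U x = ?\<Phi> U x" using g(2)[OF that, of x] by (simp only: pair_def)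
  qed
  \<comment> \<open>Paired with \<eta>, the left side is - \<gamma>(X \<eta>) by skewness of
    \<open>\<pi>\<close>; inserting the formula for \<gamma> leaves \<open>twisted_jacobi\<close>
    for \<alpha>, \<beta>, \<eta>.\<close>
  have "X \<gamma> = br (X \<alpha>) (X \<beta>)"
  proof (rule sec_eqI)
    fix \<eta> assume n: "cosec \<eta>"
    have "pair \<eta> (X \<gamma>) = - pp \<eta> \<gamma>" using pair_X[OF g(1) n] pp_skew[OF g(1) n] by simp
    also have "pp \<eta> \<gamma> = pair \<gamma> (X \<eta>)" using pair_X[OF n g(1)] by simp
    also have "\<dots> = der (X \<alpha>) (pp \<eta> \<beta>) - pair \<beta> (br (X \<alpha>) (X \<eta>)) -
        (der (X \<beta>) (pp \<eta> \<alpha>) - der (X \<eta>) (pp \<beta> \<alpha>) - pair \<alpha> (br (X \<beta>) (X \<eta>)) + ev \<psi> [X \<alpha>, X \<beta>, X \<eta>])"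
      unfolding gp[OF X_sec[OF n]] FF_def dd_def pair_X[OF n a(2)] pair_X[OF n a(1)] pair_X[OF a(2,1)] ..
    finally have e: "pair \<eta> (X \<gamma>) = - (der (X \<alpha>) (pp \<eta> \<beta>) - pair \<beta> (br (X \<alpha>) (X \<eta>)) -
        (der (X \<beta>) (pp \<eta> \<alpha>) - der (X \<eta>) (pp \<beta> \<alpha>) - pair \<alpha> (br (X \<beta>) (X \<eta>)) + ev \<psi> [X \<alpha>, X \<beta>, X \<eta>]))" .
    have s1: "der (X \<alpha>) (pp \<beta> \<eta>) = - der (X \<alpha>) (pp \<eta> \<beta>)"
      using pp_skew[OF a(2) n] a n by simp
    have s2: "der (X \<eta>) (pp \<beta> \<alpha>) = - der (X \<eta>) (pp \<alpha> \<beta>)"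
      using pp_skew[OF a(2) a(1)] a n by simp
    have s3: "pair \<beta> (br (X \<eta>) (X \<alpha>)) = - pair \<beta> (br (X \<alpha>) (X \<eta>))"
      using br_skew[OF X_sec[OF n] X_sec[OF a(1)]] a n by simp
    show "pair \<eta> (X \<gamma>) = pair \<eta> (br (X \<alpha>) (X \<beta>))"
    proof
      fix x
      from fun_cong[OF e, of x] fun_cong[OF twisted_jacobi[OF a n], of x]
        fun_cong[OF s1, of x] fun_cong[OF s2, of x] fun_cong[OF s3, of x]
      show "pair \<eta> (X \<gamma>) x = pair \<eta> (br (X \<alpha>) (X \<beta>)) x" by simp
    qed
  qed (use g(1) a in simp_all)
  then show thesis using g(1) gp by (intro that)
qed

text \<open>Derivatives along brackets are split by \<open>der_br\<close>, after which second
  derivatives cancel. The terms in \<psi> form d \<psi> on X \<alpha>, X \<beta>, U, V, and the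
  double brackets obey the Jacobi identity. What remains is linear arithmetic at a point.\<close>

lemma FF_dual_bracket:
  assumes a: "cosec \<alpha>" "cosec \<beta>" and g: "cosec \<gamma>"
    and gp: "\<And>U. sec U \<Longrightarrow> pair \<gamma> U = der (X \<alpha>) (pair \<beta> U) - pair \<beta> (br (X \<alpha>) U) - FF \<alpha> (X \<beta>) U"
    and Xg: "X \<gamma> = br (X \<alpha>) (X \<beta>)" and s: "sec U" "sec V"
  shows "FF \<gamma> U V = (der (X \<alpha>) (FF \<beta> U V) - FF \<beta> (br (X \<alpha>) U) V - FF \<beta> U (br (X \<alpha>) V))
    - (der (X \<beta>) (FF \<alpha> U V) - FF \<alpha> (br (X \<beta>) U) V - FF \<alpha> U (br (X \<beta>) V))"
proof -
  define a where "a = X \<alpha>"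
  define b where "b = X \<beta>"
  have ab: "sec a" "sec b" using assms(1,2) by (simp_all add: a_def b_def)
  note sm = ev_3(4)[OF psi_form]
  have cl: "dd3 \<psi> a b U V = 0" by (rule psi_closed[OF ab s])
  have j: "br a (br U V) = br (br a U) V + br U (br a V)" "br b (br U V) = br (br b U) V + br U (br b V)"
    by (rule jacobi[OF ab(1) s], rule jacobi[OF ab(2) s])
  \<comment> \<open>Brings the arguments of \<psi> as listed in \<open>dd3\<close> to the order in
    which \<open>FF\<close> and the formula for \<gamma> produce them.\<close>
  have p1: "ev \<psi> [br a U, b, V] = - ev \<psi> [b, br a U, V]" "ev \<psi> [br b U, a, V] = - ev \<psi> [a, br b U, V]"
    "ev \<psi> [br a V, b, U] = ev \<psi> [b, U, br a V]" "ev \<psi> [br b V, a, U] = ev \<psi> [a, U, br b V]"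
    "ev \<psi> [br U V, a, b] = ev \<psi> [a, b, br U V]"
  proof -
    show "ev \<psi> [br a U, b, V] = - ev \<psi> [b, br a U, V]" "ev \<psi> [br b U, a, V] = - ev \<psi> [a, br b U, V]"
      using ev_3(1)[OF psi_form, of b "br a U" V] ev_3(1)[OF psi_form, of a "br b U" V] ab s by simp_all
    show "ev \<psi> [br a V, b, U] = ev \<psi> [b, U, br a V]" "ev \<psi> [br b V, a, U] = ev \<psi> [a, U, br b V]"
      "ev \<psi> [br U V, a, b] = ev \<psi> [a, b, br U V]"
      using ev_3(1)[OF psi_form, of b "br a V" U] ev_3(2)[OF psi_form, of b "br a V" U]
        ev_3(1)[OF psi_form, of a "br b V" U] ev_3(2)[OF psi_form, of a "br b V" U]
        ev_3(1)[OF psi_form, of a "br U V" b] ev_3(2)[OF psi_form, of a "br U V" b] ab s by simp_all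
  qed
  have gp': "pair \<gamma> Z = der a (pair \<beta> Z) - pair \<beta> (br a Z)
      - (der b (pair \<alpha> Z) - der Z (pair \<alpha> b) - pair \<alpha> (br b Z) + ev \<psi> [a, b, Z])" if "sec Z" for Z
    using gp[OF that] by (simp only: FF_def dd_def a_def b_def)
  have j2: "pair \<beta> (br a (br U V)) = pair \<beta> (br (br a U) V) + pair \<beta> (br U (br a V))"
    "pair \<alpha> (br b (br U V)) = pair \<alpha> (br (br b U) V) + pair \<alpha> (br U (br b V))"
    unfolding j using assms(1,2) ab s by simp_all
  have ga: "cosec \<alpha>" "cosec \<beta>" by (fact assms)+
  have L: "der Z (pair \<gamma> T) = der Z (der a (pair \<beta> T)) - der Z (pair \<beta> (br a T))
      - (der Z (der b (pair \<alpha> T)) - der Z (der T (pair \<alpha> b)) - der Z (pair \<alpha> (br b T)) + der Z (ev \<psi> [a, b, T]))"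
    if "sec Z" "sec T" for Z T
    unfolding gp'[OF that(2)] using that ga ab sm[OF ab that(2)] by simp
  have L3: "pair \<gamma> (br U V) = der a (pair \<beta> (br U V)) - pair \<beta> (br a (br U V))
      - (der b (pair \<alpha> (br U V)) - (der U (der V (pair \<alpha> b)) - der V (der U (pair \<alpha> b)))
         - pair \<alpha> (br b (br U V)) + ev \<psi> [a, b, br U V])"
    unfolding gp'[OF br_sec[OF s]] using s ga ab by (simp only: der_br smooth_closed)
  have R1: "der z (FF \<delta> U V) = der z (der U (pair \<delta> V)) - der z (der V (pair \<delta> U)) - der z (pair \<delta> (br U V))
      + der z (ev \<psi> [X \<delta>, U, V])" if "sec z" "cosec \<delta>" for z \<delta>
    unfolding FF_def dd_def using that s sm[OF X_sec[OF that(2)] s] by simp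
  have R2: "FF \<delta> (br z U) V = (der z (der U (pair \<delta> V)) - der U (der z (pair \<delta> V))) - der V (pair \<delta> (br z U))
      - pair \<delta> (br (br z U) V) + ev \<psi> [X \<delta>, br z U, V]" if "sec z" "cosec \<delta>" for z \<delta>
    unfolding FF_def dd_def using that s by (simp only: der_br smooth_closed)
  have R3: "FF \<delta> U (br z V) = der U (pair \<delta> (br z V)) - (der z (der V (pair \<delta> U)) - der V (der z (pair \<delta> U)))
      - pair \<delta> (br U (br z V)) + ev \<psi> [X \<delta>, U, br z V]" if "sec z" "cosec \<delta>" for z \<delta>
    unfolding FF_def dd_def using that s by (simp only: der_br smooth_closed)
  have lhs: "FF \<gamma> U V = der U (pair \<gamma> V) - der V (pair \<gamma> U) - pair \<gamma> (br U V) + ev \<psi> [br a b, U, V]"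
    unfolding FF_def dd_def Xg a_def b_def ..
  show ?thesis
    unfolding a_def[symmetric] b_def[symmetric]
  proof
    fix x
    note r = R1[OF ab(1) ga(2)] R2[OF ab(1) ga(2)] R3[OF ab(1) ga(2)] R1[OF ab(2) ga(1)] R2[OF ab(2) ga(1)] R3[OF ab(2) ga(1)]
    show "FF \<gamma> U V x = ((der a (FF \<beta> U V) - FF \<beta> (br a U) V - FF \<beta> U (br a V))
      - (der b (FF \<alpha> U V) - FF \<alpha> (br b U) V - FF \<alpha> U (br b V))) x"
      using fun_cong[OF cl, of x] fun_cong[OF j2(1), of x] fun_cong[OF j2(2), of x]
      unfolding lhs L[OF s] L[OF s(2,1)] L3 r a_def[symmetric] b_def[symmetric] dd3_def p1
        plus_fun_apply minus_apply uminus_apply zero_fun_apply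
      by linarith
  qed
qed

end

section \<open>The cocycle property and the modular class\<close>

context twisted_poisson_bundle
begin

text \<open>\<open>L\<^bsub>X \<alpha>\<^esub> \<pi>\<close> is the image under \<open>\<and>\<^sup>2 \<pi>\<^sup>\<sharp>\<close> of \<open>d \<alpha> + i\<^bsub>X \<alpha>\<^esub> \<psi>\<close>.\<close>

lemma lie_derivative_bivector:
  assumes b: "bdec p c d I W" and a: "cosec \<alpha>" "cosec \<xi>" "cosec \<eta>"
  shows "(\<Sum>i\<in>I. pair \<xi> (br (X \<alpha>) (c i)) * pair \<eta> (d i) + pair \<xi> (c i) * pair \<eta> (br (X \<alpha>) (d i))) p =
    FF \<alpha> (X \<xi>) (X \<eta>) p"
proof -
  note B = bdecD[OF b]
  define z where "z = X \<alpha>"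
  have z: "sec z" using a by (simp add: z_def)
  define Y where "Y \<beta> = (\<Sum>i\<in>I. pair \<beta> (c i) \<bullet>\<^sub>s d i)" for \<beta>
  have Ys: "sec (Y \<beta>)" if "cosec \<beta>" for \<beta> unfolding Y_def by (rule bdec_X(1)[OF b that])
  define q where "q = (\<Sum>i\<in>I. pair \<xi> (c i) * pair \<eta> (d i))"
  have q: "smooth q" using B a by (simp add: q_def)
  have derq: "der z q = (\<Sum>i\<in>I. pair \<xi> (c i) * der z (pair \<eta> (d i))) + (\<Sum>i\<in>I. pair \<eta> (d i) * der z (pair \<xi> (c i)))"
    unfolding q_def sum.distrib[symmetric] using B a z by simp
  have brY: "pair \<theta> (br z (Y \<beta>)) = (\<Sum>i\<in>I. pair \<beta> (c i) * pair \<theta> (br z (d i))) + (\<Sum>i\<in>I. der z (pair \<beta> (c i)) * pair \<theta> (d i))"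
    if "cosec \<beta>" "cosec \<theta>" for \<beta> \<theta>
    unfolding Y_def sum.distrib[symmetric] using B that z by simp
  have w1: "(\<Sum>i\<in>I. pair \<eta> (c i) * pair \<xi> (br z (d i))) = - (\<Sum>i\<in>I. pair \<eta> (d i) * pair \<xi> (br z (c i)))"
    by (rule bdec_swap[OF b, of "\<lambda>x y. pair \<eta> x * pair \<xi> (br z y)"]) (use a z in simp_all)
  have w2: "(\<Sum>i\<in>I. der z (pair \<eta> (c i)) * pair \<xi> (d i)) = - (\<Sum>i\<in>I. der z (pair \<eta> (d i)) * pair \<xi> (c i))"
    by (rule bdec_swap[OF b, of "\<lambda>x y. der z (pair \<eta> x) * pair \<xi> y"]) (use a z in simp_all)
  have main: "(\<Sum>i\<in>I. pair \<xi> (br z (c i)) * pair \<eta> (d i) + pair \<xi> (c i) * pair \<eta> (br z (d i))) =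
      pair \<eta> (br z (Y \<xi>)) - pair \<xi> (br z (Y \<eta>)) - der z q"
  proof
    fix x
    have c1: "(\<Sum>i\<in>I. pair \<xi> (br z (c i)) * pair \<eta> (d i)) = (\<Sum>i\<in>I. pair \<eta> (d i) * pair \<xi> (br z (c i)))"
      "(\<Sum>i\<in>I. der z (pair \<eta> (d i)) * pair \<xi> (c i)) = (\<Sum>i\<in>I. pair \<xi> (c i) * der z (pair \<eta> (d i)))"
      "(\<Sum>i\<in>I. der z (pair \<xi> (c i)) * pair \<eta> (d i)) = (\<Sum>i\<in>I. pair \<eta> (d i) * der z (pair \<xi> (c i)))"
      by (rule sum.cong; simp add: mult.commute)+
    show "(\<Sum>i\<in>I. pair \<xi> (br z (c i)) * pair \<eta> (d i) + pair \<xi> (c i) * pair \<eta> (br z (d i))) x =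
        (pair \<eta> (br z (Y \<xi>)) - pair \<xi> (br z (Y \<eta>)) - der z q) x"
      unfolding brY[OF a(2,3)] brY[OF a(3,2)] derq sum.distrib w1 w2 c1
        plus_fun_apply minus_apply uminus_apply by simp
  qed
  have l1: "br z (X \<beta>) p = br z (Y \<beta>) p" if "cosec \<beta>" for \<beta>
    by (rule br_local(1)[OF z X_sec[OF that] Ys[OF that] B(1,2)]) (use bdec_X(2)[OF b that] Y_def in auto)
  have l2: "der z (pp \<xi> \<eta>) p = der z q p"
    by (rule der_local[OF z pp_smooth[OF a(2,3)] q B(1,2)]) (use bdec_X(3)[OF b a(2,3)] in \<open>auto simp: q_def\<close>)
  have FFe: "FF \<alpha> (X \<xi>) (X \<eta>) = der (X \<xi>) (pp \<eta> \<alpha>) - der (X \<eta>) (pp \<xi> \<alpha>) - pair \<alpha> (br (X \<xi>) (X \<eta>)) + ev \<psi> [X \<alpha>, X \<xi>, X \<eta>]"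
    unfolding FF_def dd_def pair_X[OF a(3,1)] pair_X[OF a(2,1)] ..
  have s1: "der (X \<eta>) (pp \<xi> \<alpha>) = - der (X \<eta>) (pp \<alpha> \<xi>)" using pp_skew[OF a(2,1)] a by simp
  have s2: "pair \<xi> (br (X \<eta>) z) = - pair \<xi> (br z (X \<eta>))" using br_skew[OF X_sec[OF a(3)] z] a z by simp
  \<comment> \<open>\<open>twisted_jacobi\<close> eliminates \<psi> and the bracket of X \<xi> and X
    \<eta>; what is left is the Lie derivative of \<open>\<pi>\<close> along X \<alpha>, evaluated
    on \<xi> and \<eta>.\<close>
  have "FF \<alpha> (X \<xi>) (X \<eta>) p = (pair \<eta> (br z (X \<xi>)) - pair \<xi> (br z (X \<eta>)) - der z (pp \<xi> \<eta>)) p"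
    using fun_cong[OF twisted_jacobi[OF a], of p] fun_cong[OF s1, of p] fun_cong[OF s2, of p]
    unfolding FFe z_def[symmetric] plus_fun_apply minus_apply uminus_apply by linarith
  also have "\<dots> = (pair \<eta> (br z (Y \<xi>)) - pair \<xi> (br z (Y \<eta>)) - der z q) p"
    using l1[OF a(2)] l1[OF a(3)] l2 by (simp add: pair_def)
  finally show ?thesis using main by (simp only: z_def[symmetric])
qed

text \<open>Up to a factor, the pairing of \<open>L\<^bsub>X \<alpha>\<^esub> \<pi>\<close> with the 2-form of \<open>\<beta>\<close>.\<close>

definition SS where
  "SS I c d \<alpha> \<beta> = (\<Sum>i\<in>I. FF \<beta> (br (X \<alpha>) (c i)) (d i) + FF \<beta> (c i) (br (X \<alpha>) (d i)))"

text \<open>In a frame both sides become sums of P_jl P_km G(l,m) G'(j,k), with P the coefficients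
  of \<open>\<pi>\<close> and G, G' those of the two 2-forms. Exchanging (j,k) with (l,m) costs two
  signs, one for each factor P.\<close>

lemma SS_symmetric:
  assumes b: "bdec p c d I W" and a: "cosec \<alpha>" "cosec \<beta>"
  shows "SS I c d \<alpha> \<beta> p = SS I c d \<beta> \<alpha> p"
proof -
  note B = bdecD[OF b]
  obtain V e \<epsilon> where fr: "local_frame p V e \<epsilon>" by (rule local_frame_exists)
  note f = local_frameD[OF fr]
  have ef: "e i p \<in> fibre A p" if "i < N" for i using f(3)[OF that] secD by blast
  define P where "P j k = \<pi> p [\<epsilon> j p, \<epsilon> k p]" for j k
  define G where "G \<alpha> j k = Fw \<alpha> p [e j p, e k p]" for \<alpha> j k
  have Psk: "P j k = - P k j" if "j < N" "k < N" for j k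
    unfolding P_def by (rule alternating_on_2_swap[OF pi_alternating cofibre_subspace]) (use f(4) that cosecD in auto)
  have Xe: "X (\<epsilon> j) p = (\<Sum>l<N. P j l *\<^sub>R e l p)" if j: "j < N" for j
  proof -
    have "X (\<epsilon> j) p = (\<Sum>l<N. \<epsilon> l p (X (\<epsilon> j) p) *\<^sub>R e l p)"
      by (rule f(6)[OF f(2)]) (use f(4)[OF j] secD X_sec in blast)
    also have "\<dots> = (\<Sum>l<N. P j l *\<^sub>R e l p)"
      by (rule sum.cong) (use pair_X_pointwise[OF f(4)[OF j] f(4), of _ p] in \<open>auto simp: pair_def pp_def P_def\<close>)
    finally show ?thesis .
  qed
  have FX: "FF \<alpha> (X (\<epsilon> j)) (X (\<epsilon> k)) p = (\<Sum>l<N. \<Sum>m<N. P j l * P k m * G \<alpha> l m)"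
    if \<alpha>: "cosec \<alpha>" and jk: "j < N" "k < N" for \<alpha> j k
  proof -
    note w = Fw_alternating[OF \<alpha>, of p]
    have fk: "(\<Sum>m<N. P k m *\<^sub>R e m p) \<in> fibre A p" by (rule fibre_sum) (use ef in auto)
    have "FF \<alpha> (X (\<epsilon> j)) (X (\<epsilon> k)) p = Fw \<alpha> p [X (\<epsilon> j) p, X (\<epsilon> k) p]"
      using Fw_sections[OF \<alpha> X_sec[OF f(4)[OF jk(1)]] X_sec[OF f(4)[OF jk(2)]]] by simp
    also have "\<dots> = (\<Sum>l<N. P j l * Fw \<alpha> p [e l p, \<Sum>m<N. P k m *\<^sub>R e m p])"
      unfolding Xe[OF jk(1)] Xe[OF jk(2)]
      by (rule alternating_on_2_sum(1)[OF w fibre_subspace fk]) (use ef in auto)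
    also have "\<dots> = (\<Sum>l<N. \<Sum>m<N. P j l * P k m * G \<alpha> l m)"
    proof (rule sum.cong[OF refl])
      fix l assume "l \<in> {..<N}"
      then have "Fw \<alpha> p [e l p, \<Sum>m<N. P k m *\<^sub>R e m p] = (\<Sum>m<N. P k m * Fw \<alpha> p [e l p, e m p])"
        by (intro alternating_on_2_sum(2)[OF w fibre_subspace]) (use ef in auto)
      then show "P j l * Fw \<alpha> p [e l p, \<Sum>m<N. P k m *\<^sub>R e m p] = (\<Sum>m<N. P j l * P k m * G \<alpha> l m)"
        by (simp add: sum_distrib_left G_def mult.assoc)
    qed
    finally show ?thesis .
  qed
  \<comment> \<open>Pairs of indices are treated as single indices, so that the symmetry becomes an
    exchange of two sums.\<close>
  let ?J = "{..<N} \<times> {..<N}"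
  have J: "(\<Sum>x\<in>?J. h x) = (\<Sum>j<N. \<Sum>k<N. h (j, k))" for h :: "nat \<times> nat \<Rightarrow> real"
    by (simp add: sum.cartesian_product)
  define T where "T x y = P (fst x) (fst y) * P (snd x) (snd y)" for x y
  have Ts: "T x y = T y x" if "x \<in> ?J" "y \<in> ?J" for x y
  proof -
    have "P (fst x) (fst y) = - P (fst y) (fst x)" by (rule Psk) (use that in auto)
    moreover have "P (snd x) (snd y) = - P (snd y) (snd x)" by (rule Psk) (use that in auto)
    ultimately show ?thesis by (simp add: T_def)
  qed
  define H where "H \<alpha> x = G \<alpha> (fst x) (snd x)" for \<alpha> x
  have S: "SS I c d \<alpha> \<beta> p = (\<Sum>x\<in>?J. \<Sum>y\<in>?J. T x y * H \<alpha> y * H \<beta> x)" if a: "cosec \<alpha>" "cosec \<beta>" for \<alpha> \<beta>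
  proof -
    note w = Fw_alternating[OF a(2), of p]
    have z: "sec (br (X \<alpha>) (c i))" "sec (br (X \<alpha>) (d i))" if "i \<in> I" for i using B that a by simp_all
    have "SS I c d \<alpha> \<beta> p = (\<Sum>i\<in>I. Fw \<beta> p [br (X \<alpha>) (c i) p, d i p]) + (\<Sum>i\<in>I. Fw \<beta> p [c i p, br (X \<alpha>) (d i) p])"
      using Fw_sections[OF a(2) z(1) B(4), of _ _ p] Fw_sections[OF a(2) B(3) z(2), of _ _ p]
      by (simp add: SS_def sum_fun_apply sum.distrib)
    also have "\<dots> = (\<Sum>j<N. \<Sum>k<N. (\<Sum>i\<in>I. \<epsilon> j p (br (X \<alpha>) (c i) p) * \<epsilon> k p (d i p)) * G \<beta> j k) +
        (\<Sum>j<N. \<Sum>k<N. (\<Sum>i\<in>I. \<epsilon> j p (c i p) * \<epsilon> k p (br (X \<alpha>) (d i) p)) * G \<beta> j k)"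
      unfolding G_def
      using pairing_independent[OF fr f(2) B(5) secD[OF z(1)] secD[OF B(4)] w]
        pairing_independent[OF fr f(2) B(5) secD[OF B(3)] secD[OF z(2)] w] by simp
    also have "\<dots> = (\<Sum>j<N. \<Sum>k<N. FF \<alpha> (X (\<epsilon> j)) (X (\<epsilon> k)) p * G \<beta> j k)"
      unfolding sum.distrib[symmetric]
    proof (intro sum.cong refl)
      fix j k assume "j \<in> {..<N}" "k \<in> {..<N}"
      then have jk: "j < N" "k < N" by auto
      show "(\<Sum>i\<in>I. \<epsilon> j p (br (X \<alpha>) (c i) p) * \<epsilon> k p (d i p)) * G \<beta> j k +
          (\<Sum>i\<in>I. \<epsilon> j p (c i p) * \<epsilon> k p (br (X \<alpha>) (d i) p)) * G \<beta> j k =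
          FF \<alpha> (X (\<epsilon> j)) (X (\<epsilon> k)) p * G \<beta> j k"
        using lie_derivative_bivector[OF b a(1) f(4)[OF jk(1)] f(4)[OF jk(2)]]
        by (simp add: sum_fun_apply sum.distrib pair_def distrib_right[symmetric])
    qed
    also have "\<dots> = (\<Sum>j<N. \<Sum>k<N. (\<Sum>l<N. \<Sum>m<N. P j l * P k m * G \<alpha> l m) * G \<beta> j k)"
      by (intro sum.cong refl) (use FX[OF a(1)] in auto)
    also have "\<dots> = (\<Sum>x\<in>?J. \<Sum>y\<in>?J. T x y * H \<alpha> y * H \<beta> x)"
      by (simp only: J T_def H_def fst_conv snd_conv sum_distrib_right)
    finally show ?thesis .
  qed
  have "SS I c d \<alpha> \<beta> p = (\<Sum>y\<in>?J. \<Sum>x\<in>?J. T x y * H \<alpha> y * H \<beta> x)"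
    unfolding S[OF a] by (rule sum.swap)
  also have "\<dots> = (\<Sum>y\<in>?J. \<Sum>x\<in>?J. T y x * H \<beta> x * H \<alpha> y)"
    by (intro sum.cong refl) (use Ts in \<open>simp add: mult.assoc mult.commute[of "H \<alpha> _"]\<close>)
  also have "\<dots> = SS I c d \<beta> \<alpha> p" unfolding S[OF a(2,1)] ..
  finally show ?thesis .
qed

section \<open>The twisted differential on vectors, and the cocycle property\<close>

lemma twist_diff_vector:
  assumes a: "cosec \<alpha>" "cosec \<beta>" and Z: "sec Z"
  shows "twist_diff A \<pi> \<psi> 1 (vector_of_section Z) p [\<alpha> p, \<beta> p] = ev \<psi> [X \<alpha>, X \<beta>, Z] p"
proof -
  define D where "D = decomp A 1 p (vector_of_section Z p)"
  have D: "\<And>us. us \<in> set D \<Longrightarrow> length us = 1 \<and> us ! 0 \<in> fibre A p" "(\<Sum>us\<leftarrow>D. us ! 0) = Z p"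
    unfolding D_def by (rule decomp_1[OF secD[OF Z]]; simp add: vector_of_section_def)+
  note al = alternating_on_3[OF psi_alternating fibre_subspace]
  have psi2: "alternating_on (cofibre p) 2 (psi2 A \<pi> \<psi> p u)" if u: "u \<in> fibre A p" for u
  proof (rule alternating_on_2I[OF _ _ _ cofibre_subspace])
    fix \<xi> \<xi>' \<eta> assume f: "\<xi> \<in> cofibre p" "\<xi>' \<in> cofibre p" "\<eta> \<in> cofibre p"
    note s = sharp(1)[OF f(1)] sharp(1)[OF f(2)] sharp(1)[OF f(3)]
    show "psi2 A \<pi> \<psi> p u [\<xi> + \<xi>', \<eta>] = psi2 A \<pi> \<psi> p u [\<xi>, \<eta>] + psi2 A \<pi> \<psi> p u [\<xi>', \<eta>]"
      using al(1)[OF s u] sharp_linear(1)[OF f(1,2)] by (simp add: psi2_def)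
  next
    fix \<xi> \<eta> c assume f: "\<xi> \<in> cofibre p" "\<eta> \<in> cofibre p"
    note s = sharp(1)[OF f(1)] sharp(1)[OF f(2)]
    show "psi2 A \<pi> \<psi> p u [c *\<^sub>R \<xi>, \<eta>] = c * psi2 A \<pi> \<psi> p u [\<xi>, \<eta>]"
      using al(2)[OF s u] sharp_linear(2)[OF f(1,1)] by (simp add: psi2_def)
  next
    fix \<xi> \<eta> assume f: "\<xi> \<in> cofibre p" "\<eta> \<in> cofibre p"
    note s = sharp(1)[OF f(1)] sharp(1)[OF f(2)]
    show "psi2 A \<pi> \<psi> p u [\<xi>, \<eta>] = - psi2 A \<pi> \<psi> p u [\<eta>, \<xi>]"
      using al(3)[OF s u] by (simp add: psi2_def)
  qed
  let ?g = "\<lambda>u. \<psi> p [X \<alpha> p, X \<beta> p, u]"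
  have Xf: "X \<alpha> p \<in> fibre A p" "X \<beta> p \<in> fibre A p" using a secD X_sec by blast+
  have "twist_diff A \<pi> \<psi> 1 (vector_of_section Z) p [\<alpha> p, \<beta> p] = (\<Sum>us\<leftarrow>D. ?g (us ! 0))"
    unfolding twist_diff_def D_def[symmetric] if_not_P[OF one_neq_zero]
  proof (rule arg_cong[where f = sum_list], rule map_cong[OF refl])
    fix us assume "us \<in> set D"
    note l = D(1)[OF this]
    then obtain u where u: "us = [u]" "u \<in> fibre A p" by (cases us) auto
    have "(\<Sum>bs\<leftarrow>decomp A 2 p (psi2 A \<pi> \<psi> p u). wedge bs [\<alpha> p, \<beta> p]) = psi2 A \<pi> \<psi> p u [\<alpha> p, \<beta> p]"
      by (rule decomp_2(2)[OF psi2[OF u(2)] cosecD[OF a(1)] cosecD[OF a(2)], symmetric])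
    then show "(\<Sum>k<1. (-1) ^ k * (\<Sum>bs\<leftarrow>decomp A 2 p (psi2 A \<pi> \<psi> p (us ! k)). wedge (bs @ remove_nth k us) [\<alpha> p, \<beta> p])) =
        ?g (us ! 0)"
      using u by (simp add: psi2_def X_def)
  qed
  \<comment> \<open>The list selected for Z may have several entries; \<psi> is additive in its last
    argument, and by \<open>decomp_1\<close> the entries sum to Z(p).\<close>
  also have "\<dots> = ?g (\<Sum>us\<leftarrow>D. us ! 0)"
  proof -
    have lin: "?g (u + v) = ?g u + ?g v" if "u \<in> fibre A p" "v \<in> fibre A p" for u v
      using alternating_onD(1)[OF psi_alternating[of p], of "[X \<alpha> p, X \<beta> p]" "[]" u v] Xf that by simp
    have z: "?g 0 = 0" using lin[of 0 0] by simp
    have "(\<Sum>us\<leftarrow>D. ?g (us ! 0)) = ?g (\<Sum>us\<leftarrow>D. us ! 0) \<and> (\<Sum>us\<leftarrow>D. us ! 0) \<in> fibre A p"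
      using D(1) by (induction D) (simp_all add: lin z)
    then show ?thesis ..
  qed
  finally show ?thesis unfolding D(2) by (simp add: ev_def)
qed

text \<open>As in \<open>schouten_bracket\<close>, X is replaced near p by its expansion; the
  derivative terms cancel, and an exchange of c_i and d_i settles the rest. The outcome involves
  only the bracket and anchor of A, ready for comparison with the bracket on the dual.\<close>

lemma twisted_diff_vector:
  assumes a: "cosec \<alpha>" "cosec \<beta>" and Z: "sec Z"
  shows "twisted_diff A \<pi> \<psi> 1 (vector_of_section Z) p [\<alpha> p, \<beta> p] =
    (pair \<beta> (br (X \<alpha>) Z) - pair \<alpha> (br (X \<beta>) Z) + der Z (pp \<alpha> \<beta>) + ev \<psi> [X \<alpha>, X \<beta>, Z]) p"
proof -
  obtain c d I W where b: "bdec p c d I W" by (rule bdec_exists)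
  note B = bdecD[OF b]
  define Y where "Y \<beta> = (\<Sum>i\<in>I. pair \<beta> (c i) \<bullet>\<^sub>s d i)" for \<beta>
  have Ys: "sec (Y \<beta>)" if "cosec \<beta>" for \<beta> unfolding Y_def by (rule bdec_X(1)[OF b that])
  define q where "q = (\<Sum>i\<in>I. pair \<alpha> (c i) * pair \<beta> (d i))"
  have q: "smooth q" using B a by (simp add: q_def)
  have derq: "der Z q = (\<Sum>i\<in>I. pair \<alpha> (c i) * der Z (pair \<beta> (d i))) + (\<Sum>i\<in>I. pair \<beta> (d i) * der Z (pair \<alpha> (c i)))"
    unfolding q_def sum.distrib[symmetric] using B a Z by simp
  have brY: "pair \<theta> (br (Y \<xi>) Z) = (\<Sum>i\<in>I. pair \<xi> (c i) * pair \<theta> (br (d i) Z)) - (\<Sum>i\<in>I. der Z (pair \<xi> (c i)) * pair \<theta> (d i))"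
    if "cosec \<xi>" "cosec \<theta>" for \<xi> \<theta>
    unfolding Y_def sum_subtractf[symmetric] using B that Z by simp
  have w: "(\<Sum>i\<in>I. pair \<xi> (c i) * pair \<theta> (br (d i) Z)) = - (\<Sum>i\<in>I. pair \<xi> (d i) * pair \<theta> (br (c i) Z))"
    if "cosec \<xi>" "cosec \<theta>" for \<xi> \<theta>
    by (rule bdec_swap[OF b, of "\<lambda>x y. pair \<xi> x * pair \<theta> (br y Z)"]) (use that Z in simp_all)
  have w2: "(\<Sum>i\<in>I. der Z (pair \<beta> (c i)) * pair \<alpha> (d i)) = - (\<Sum>i\<in>I. der Z (pair \<beta> (d i)) * pair \<alpha> (c i))"
    by (rule bdec_swap[OF b, of "\<lambda>x y. der Z (pair \<beta> x) * pair \<alpha> y"]) (use a Z in simp_all)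
  have c1: "(\<Sum>i\<in>I. der Z (pair \<beta> (d i)) * pair \<alpha> (c i)) = (\<Sum>i\<in>I. pair \<alpha> (c i) * der Z (pair \<beta> (d i)))"
    "(\<Sum>i\<in>I. der Z (pair \<alpha> (c i)) * pair \<beta> (d i)) = (\<Sum>i\<in>I. pair \<beta> (d i) * der Z (pair \<alpha> (c i)))"
    by (rule sum.cong; simp add: mult.commute)+
  have l1: "br (X \<xi>) Z p = br (Y \<xi>) Z p" if "cosec \<xi>" for \<xi>
    by (rule br_local(2)[OF Z X_sec[OF that] Ys[OF that] B(1,2)]) (use bdec_X(2)[OF b that] Y_def in auto)
  have l2: "der Z (pp \<alpha> \<beta>) p = der Z q p"
    by (rule der_local[OF Z pp_smooth[OF a] q B(1,2)]) (use bdec_X(3)[OF b a] in \<open>auto simp: q_def\<close>)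
  have g: "gerstenhaber A 2 1 \<pi> (vector_of_section Z) p [\<alpha> p, \<beta> p] =
      ((\<Sum>i\<in>I. pair \<beta> (d i) * pair \<alpha> (br (c i) Z)) - (\<Sum>i\<in>I. pair \<alpha> (d i) * pair \<beta> (br (c i) Z))) p"
    unfolding gerstenhaber_bivector_vector[OF b Z cosecD[OF a(1)] cosecD[OF a(2)]]
    by (simp add: sum_fun_apply pair_def sum_subtractf mult.commute)
  have l: "(pair \<beta> (br (X \<alpha>) Z) - pair \<alpha> (br (X \<beta>) Z) + der Z (pp \<alpha> \<beta>)) p =
      (pair \<beta> (br (Y \<alpha>) Z) - pair \<alpha> (br (Y \<beta>) Z) + der Z q) p"
    using l1[OF a(1)] l1[OF a(2)] l2 by (simp add: pair_def)
  have "\<dots> = gerstenhaber A 2 1 \<pi> (vector_of_section Z) p [\<alpha> p, \<beta> p]"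
    unfolding g brY[OF a] brY[OF a(2,1)] derq w[OF a] w[OF a(2,1)] w2 c1
      plus_fun_apply minus_apply uminus_apply by simp
  then show ?thesis
    unfolding twisted_diff_def twist_diff_vector[OF a Z] using l by simp
qed

lemma modular_Z_cocycle:
  assumes \<mu>: "volume_form A \<mu>" and a: "cosec \<alpha>" "cosec \<beta>"
  shows "twisted_diff A \<pi> \<psi> 1 (vector_of_section (modular_Z A \<pi> \<psi> \<mu>)) p [\<alpha> p, \<beta> p] = 0"
proof -
  define Z where "Z = modular_Z A \<pi> \<psi> \<mu>"
  have Z: "sec Z" "\<And>\<alpha>. cosec \<alpha> \<Longrightarrow> pair \<alpha> Z = dv \<mu> (X \<alpha>) + trF \<alpha>"
    unfolding Z_def using modular_Z[OF \<mu>] by auto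
  define x where "x = X \<alpha>"
  define y where "y = X \<beta>"
  have xy: "sec x" "sec y" using a by (simp_all add: x_def y_def)
  obtain \<gamma> where g: "cosec \<gamma>" and gp: "\<And>U. sec U \<Longrightarrow> pair \<gamma> U = der x (pair \<beta> U) - pair \<beta> (br x U) - FF \<alpha> y U"
    and Xg: "X \<gamma> = br x y"
    unfolding x_def y_def by (rule dual_bracket[OF a]) blast
  have FZ: "FF \<alpha> y Z = der y (pair \<alpha> Z) - der Z (pp \<beta> \<alpha>) - pair \<alpha> (br y Z) + ev \<psi> [x, y, Z]"
    unfolding FF_def dd_def y_def x_def pair_X[OF a(2,1)] ..
  have s1: "der Z (pp \<beta> \<alpha>) = - der Z (pp \<alpha> \<beta>)" using pp_skew[OF a(2,1)] a Z(1) by simp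
  \<comment> \<open>The usual formula for a Lie algebroid differential, on the dual: pairings with Z
    differentiated along x and y, minus the pairing of Z with the bracket \<gamma> of \<alpha> and
    \<beta>.\<close>
  have "twisted_diff A \<pi> \<psi> 1 (vector_of_section Z) p [\<alpha> p, \<beta> p] =
      (der x (pair \<beta> Z) - der y (pair \<alpha> Z) - pair \<gamma> Z) p"
    unfolding twisted_diff_vector[OF a Z(1)] gp[OF Z(1)] FZ x_def[symmetric] y_def[symmetric] s1
      plus_fun_apply minus_apply uminus_apply by simp
  also have "der x (pair \<beta> Z) = der x (dv \<mu> y) + der x (trF \<beta>)"
    unfolding Z(2)[OF a(2)] y_def[symmetric] using xy a \<mu> by simp
  also have "der y (pair \<alpha> Z) = der y (dv \<mu> x) + der y (trF \<alpha>)"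
    unfolding Z(2)[OF a(1)] x_def[symmetric] using xy a \<mu> by simp
  also have "pair \<gamma> Z = der x (dv \<mu> y) - der y (dv \<mu> x) + trF \<gamma>"
    unfolding Z(2)[OF g] Xg dv_br[OF \<mu> xy] ..
  \<comment> \<open>The divergences have cancelled by \<open>dv_br\<close>, since X \<gamma> is the
    bracket of x and y; only traces remain.\<close>
  finally have e: "twisted_diff A \<pi> \<psi> 1 (vector_of_section Z) p [\<alpha> p, \<beta> p] =
      der x (trF \<beta>) p - der y (trF \<alpha>) p - trF \<gamma> p" by simp
  obtain c d I W where b: "bdec p c d I W" by (rule bdec_exists)
  note B = bdecD[OF b]
  define h where "h = (\<lambda>_::'m. 1 / 2 :: real)"
  have h: "smooth h" "\<And>z. sec z \<Longrightarrow> der z h = 0" unfolding h_def by simp_all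
  \<comment> \<open>The sections c_i, d_i express the trace on a whole neighbourhood of p, so it can
    be differentiated term by term and \<open>der_local\<close> applies.\<close>
  have dtr: "der z (trF \<delta>) p = 1 / 2 * (\<Sum>i\<in>I. der z (FF \<delta> (c i) (d i)) p)" if z: "sec z" "cosec \<delta>" for z \<delta>
  proof -
    have sF: "smooth (FF \<delta> (c i) (d i))" if "i \<in> I" for i using FF_linear(3)[OF z(2)] B that by simp
    have "der z (trF \<delta>) p = der z (h * (\<Sum>i\<in>I. FF \<delta> (c i) (d i))) p"
      by (rule der_local[OF z(1) trF_smooth[OF z(2)] _ B(1,2)])
        (use trF_bdec[OF b _ z(2)] sF h in \<open>auto simp: h_def\<close>)
    also have "\<dots> = 1 / 2 * (\<Sum>i\<in>I. der z (FF \<delta> (c i) (d i)) p)"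
      using z sF h by (simp add: sum_fun_apply h_def)
    finally show ?thesis .
  qed
  have tg: "trF \<gamma> p = 1 / 2 * (\<Sum>i\<in>I. FF \<gamma> (c i) (d i) p)"
    using trF_bdec[OF b B(2) g] by (simp add: sum_fun_apply)
  have Fg: "FF \<gamma> (c i) (d i) p = (der x (FF \<beta> (c i) (d i)) p - FF \<beta> (br x (c i)) (d i) p - FF \<beta> (c i) (br x (d i)) p)
      - (der y (FF \<alpha> (c i) (d i)) p - FF \<alpha> (br y (c i)) (d i) p - FF \<alpha> (c i) (br y (d i)) p)" if i: "i \<in> I" for i
    using fun_cong[OF FF_dual_bracket[OF a g gp[unfolded x_def y_def] Xg[unfolded x_def y_def] B(3)[OF i] B(4)[OF i]], of p]
    unfolding x_def[symmetric] y_def[symmetric] by simp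
  \<comment> \<open>When \<open>FF_dual_bracket\<close> is summed over the decomposition, the terms
    with a bracket in an argument make up two values of \<open>SS\<close>, which are equal by
    \<open>SS_symmetric\<close>.\<close>
  have "(\<Sum>i\<in>I. FF \<gamma> (c i) (d i) p) = (\<Sum>i\<in>I. der x (FF \<beta> (c i) (d i)) p) - SS I c d \<alpha> \<beta> p
      - ((\<Sum>i\<in>I. der y (FF \<alpha> (c i) (d i)) p) - SS I c d \<beta> \<alpha> p)"
    by (simp add: Fg SS_def x_def y_def sum_fun_apply sum.distrib sum_subtractf)
  then have "trF \<gamma> p = der x (trF \<beta>) p - der y (trF \<alpha>) p"
    unfolding tg dtr[OF xy(1) a(2)] dtr[OF xy(2) a(1)] SS_symmetric[OF b a] by simp
  then show ?thesis using e by (simp add: Z_def)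
qed

section \<open>From sections to tuples of covectors and to cohomology classes\<close>

lemma form_vector_of_section: "sec Z \<Longrightarrow> form (dual_bundle A) 1 (vector_of_section Z)"
  unfolding form_def
proof (intro conjI allI ballI impI)
  fix p us i u v assume us: "us \<in> tuples (dual_bundle A) 1 p" and i: "i < (1::nat)"
  obtain x where x: "us = [x]" using us by (auto simp: tuples_def length_Suc_conv)
  show "vector_of_section Z p (us[i := u + v]) = vector_of_section Z p (us[i := u]) + vector_of_section Z p (us[i := v])"
    using i x by (simp add: vector_of_section_def)
next
  fix p us i c u assume us: "us \<in> tuples (dual_bundle A) 1 p" and i: "i < (1::nat)"
  obtain x where x: "us = [x]" using us by (auto simp: tuples_def length_Suc_conv)
  show "vector_of_section Z p (us[i := c *\<^sub>R u]) = c * vector_of_section Z p (us[i := u])"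
    using i x by (simp add: vector_of_section_def)
next
  fix p and us :: "('v \<Rightarrow> real) list" and i j :: nat assume "i < 1" "j < 1" "i \<noteq> j \<and> us ! i = us ! j"
  then show "vector_of_section Z p us = 0" by simp
next
  fix Ud assume Z: "sec Z" and Ud: "Ud \<in> frames (dual_bundle A)"
  obtain U d where e: "Ud = (U, d)" by (cases Ud)
  then obtain f where f: "(U, f) \<in> frames A" "d = coord f" using Ud by (auto simp del: dual_bundle_simps simp: frames_dual)
  have "smooth_fun (atlas A) U (\<lambda>p. vector_of_section Z p (map (\<lambda>i. d i p) is))"
    if l: "length is = 1" "set is \<subseteq> {..<N}" for "is"
  proof -
    obtain k where "is = [k]" using l(1) by (auto simp: length_Suc_conv)
    then show ?thesis using sec_coord_smooth[OF Z f(1), of k] l(2) f(2) by (simp add: vector_of_section_def)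
  qed
  then show "case Ud of (U, e) \<Rightarrow> \<forall>is. length is = 1 \<and> set is \<subseteq> {..<vrank (dual_bundle A)} \<longrightarrow>
      smooth_fun (atlas (dual_bundle A)) U (\<lambda>p. vector_of_section Z p (map (\<lambda>i. e i p) is))"
    by (simp add: e del: dual_bundle_simps(3))
qed

lemma form_0_iff: "form (dual_bundle A) 0 R \<longleftrightarrow> smooth (\<lambda>x. R x [])"
proof
  assume R: "form (dual_bundle A) 0 R"
  show "smooth (\<lambda>x. R x [])"
    using vbundle.form_smooth[OF vbundle_dual R, of "[]"] by simp
next
  assume s: "smooth (\<lambda>x. R x [])"
  have "case Ud of (U, e) \<Rightarrow> \<forall>is. length is = 0 \<and> set is \<subseteq> {..<vrank (dual_bundle A)} \<longrightarrow>
      smooth_fun (atlas (dual_bundle A)) U (\<lambda>p. R p (map (\<lambda>i. e i p) is))" for Ud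
    using smooth_fun_mono[OF s] by (cases Ud) (simp del: dual_bundle_simps(3))
  then show "form (dual_bundle A) 0 R" unfolding form_def by simp
qed

lemma twisted_diff_function:
  "form (dual_bundle A) 0 R \<Longrightarrow> cosec \<xi> \<Longrightarrow> twisted_diff A \<pi> \<psi> 0 R p [\<xi> p] = der (X \<xi>) (\<lambda>x. R x []) p"
  by (simp add: twisted_diff_def twist_diff_def gerstenhaber_fun_bivector form_0_iff)

text \<open>Each covector is the value of a section, so that identities proved for sections apply to
  the tuples over which cocycles and classes quantify.\<close>

lemma tuples_dual_sections:
  assumes "\<xi>s \<in> tuples (dual_bundle A) (Suc n) p"
  obtains \<alpha> \<eta>s where "cosec \<alpha>" "\<xi>s = \<alpha> p # \<eta>s" "\<eta>s \<in> tuples (dual_bundle A) n p"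
proof -
  obtain \<xi> \<eta>s where x: "\<xi>s = \<xi> # \<eta>s" using assms by (cases \<xi>s) (auto simp: tuples_def)
  then have "\<xi> \<in> cofibre p" using assms by (simp add: tuples_def)
  then obtain \<alpha> where "cosec \<alpha>" "\<alpha> p = \<xi>" by (rule vbundle.sec_extension_exists[OF vbundle_dual])
  then show thesis using that[of \<alpha> \<eta>s] x assms by (simp add: tuples_def)
qed

text \<open>One inclusion for arbitrary \<mu> and \<nu> is enough, by exchanging the two. The
  primitive ln |f| of the difference is globally defined and smooth because the ratio f of the
  volume forms has no zeros.\<close>

lemma modular_class_subset:
  assumes \<mu>: "volume_form A \<mu>" and \<nu>: "volume_form A \<nu>"
  shows "twisted_class A \<pi> \<psi> 0 (vector_of_section (modular_Z A \<pi> \<psi> \<nu>)) \<subseteq>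
    twisted_class A \<pi> \<psi> 0 (vector_of_section (modular_Z A \<pi> \<psi> \<mu>))"
proof
  obtain f where f: "smooth f" "\<And>x. f x \<noteq> 0" "\<And>p us. us \<in> tuples A N p \<Longrightarrow> \<nu> p us = f p * \<mu> p us"
    by (rule volume_form_ratio[OF \<mu> \<nu>]) blast
  define g where "g = (\<lambda>x. ln \<bar>f x\<bar>)"
  have g: "smooth g" unfolding g_def by (rule smooth_fun_ln_abs[OF manifold open_UNIV f(1)]) (rule f(2))
  have Z: "pair \<xi> (modular_Z A \<pi> \<psi> \<nu>) = pair \<xi> (modular_Z A \<pi> \<psi> \<mu>) + der (X \<xi>) g" if "cosec \<xi>" for \<xi>
  proof -
    have "dv \<nu> (X \<xi>) = dv \<mu> (X \<xi>) + der (X \<xi>) g"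
      unfolding g_def by (rule dv_change[OF \<mu> \<nu> f X_sec[OF that]])
    then show ?thesis
      unfolding modular_Z(2)[OF \<mu> that] modular_Z(2)[OF \<nu> that] by (simp add: algebra_simps)
  qed
  fix Q assume "Q \<in> twisted_class A \<pi> \<psi> 0 (vector_of_section (modular_Z A \<pi> \<psi> \<nu>))"
  then obtain R where Q: "form (dual_bundle A) (Suc 0) Q" and R: "form (dual_bundle A) 0 R"
    "\<And>p \<xi>s. \<xi>s \<in> tuples (dual_bundle A) (Suc 0) p \<Longrightarrow>
      Q p \<xi>s = vector_of_section (modular_Z A \<pi> \<psi> \<nu>) p \<xi>s + twisted_diff A \<pi> \<psi> 0 R p \<xi>s"
    unfolding twisted_class_def by blast
  \<comment> \<open>A 0-form counts only through its value on the empty list; adding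
    \<open>g\<close> to it adds the coboundary of ln |f|.\<close>
  define R' where "R' = (\<lambda>x us. R x us + g x)"
  have Rs: "smooth (\<lambda>x. R x [])" using R(1) form_0_iff by blast
  have R'e: "(\<lambda>x. R' x []) = (\<lambda>x. R x []) + g" by (simp add: R'_def fun_eq_iff)
  have R': "form (dual_bundle A) 0 R'" unfolding form_0_iff R'e using Rs g by simp
  have "Q p \<xi>s = vector_of_section (modular_Z A \<pi> \<psi> \<mu>) p \<xi>s + twisted_diff A \<pi> \<psi> 0 R' p \<xi>s"
    if x: "\<xi>s \<in> tuples (dual_bundle A) (Suc 0) p" for p \<xi>s
  proof -
    obtain \<alpha> \<eta>s where a: "cosec \<alpha>" "\<xi>s = \<alpha> p # \<eta>s" "\<eta>s \<in> tuples (dual_bundle A) 0 p"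
      by (rule tuples_dual_sections[OF x])
    then have e: "\<xi>s = [\<alpha> p]" by (simp add: tuples_def)
    have "der (X \<alpha>) (\<lambda>x. R' x []) p = der (X \<alpha>) (\<lambda>x. R x []) p + der (X \<alpha>) g p"
      unfolding R'e using der_linear(1)[OF X_sec[OF a(1)] Rs g] by simp
    then show ?thesis
      using R(2)[OF x] fun_cong[OF Z[OF a(1)], of p] twisted_diff_function[OF R(1) a(1), of p]
        twisted_diff_function[OF R' a(1), of p]
      by (simp add: e vector_of_section_def pair_def)
  qed
  then show "Q \<in> twisted_class A \<pi> \<psi> 0 (vector_of_section (modular_Z A \<pi> \<psi> \<mu>))"
    unfolding twisted_class_def using Q R' by blast
qed

end

theorem theorem6p1:
  fixes A :: "('m::{t2_space,second_countable_topology}, 'e::real_inner, 'v::real_vector) algebroid"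
    and \<pi> :: "'m \<Rightarrow> ('v \<Rightarrow> real) list \<Rightarrow> real"
    and \<psi> \<mu> :: "'m \<Rightarrow> 'v list \<Rightarrow> real"
  assumes "lie_algebroid A"
    and "twisted_poisson A \<pi> \<psi>"
    and "orientable A"
    and "volume_form A \<mu>"
  shows "smooth_section A (modular_Z A \<pi> \<psi> \<mu>) \<and>
    twisted_cocycle A \<pi> \<psi> 1 (vector_of_section (modular_Z A \<pi> \<psi> \<mu>)) \<and>
    (\<forall>\<nu>. volume_form A \<nu> \<longrightarrow>
      twisted_class A \<pi> \<psi> 0 (vector_of_section (modular_Z A \<pi> \<psi> \<nu>)) =
      twisted_class A \<pi> \<psi> 0 (vector_of_section (modular_Z A \<pi> \<psi> \<mu>)))"
proof -
  interpret twisted_poisson_bundle A \<pi> \<psi>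
    by unfold_locales (use assms(1,2) in \<open>simp_all add: twisted_poisson_def\<close>)
  note \<mu> = assms(4)
  have "twisted_diff A \<pi> \<psi> 1 (vector_of_section (modular_Z A \<pi> \<psi> \<mu>)) p \<xi>s = 0"
    if x: "\<xi>s \<in> tuples (dual_bundle A) (Suc 1) p" for p \<xi>s
  proof -
    obtain \<alpha> \<eta>s where a: "cosec \<alpha>" "\<xi>s = \<alpha> p # \<eta>s" "\<eta>s \<in> tuples (dual_bundle A) (Suc 0) p"
      using tuples_dual_sections[OF x] by (metis One_nat_def)
    obtain \<beta> \<zeta>s where b: "cosec \<beta>" "\<eta>s = \<beta> p # \<zeta>s" "\<zeta>s \<in> tuples (dual_bundle A) 0 p"
      by (rule tuples_dual_sections[OF a(3)])
    have "\<xi>s = [\<alpha> p, \<beta> p]" using a(2) b(2,3) by (simp add: tuples_def)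
    then show ?thesis using modular_Z_cocycle[OF \<mu> a(1) b(1)] by simp
  qed
  then have "twisted_cocycle A \<pi> \<psi> 1 (vector_of_section (modular_Z A \<pi> \<psi> \<mu>))"
    unfolding twisted_cocycle_def using form_vector_of_section[OF modular_Z(1)[OF \<mu>]] by blast
  then show ?thesis
    using modular_Z(1)[OF \<mu>] modular_class_subset[OF \<mu>] modular_class_subset[OF _ \<mu>] by blast
qed

end
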